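(* Let $R$ be a commutative ring, $H$ a Hopf algebra over $R$, and $A$ a right $H$-comodule algebra with $B=A^{co\,H}$ such that $A/B$ is $H$-Galois. Assume that $A$ and $H$ are flat Mittag--Leffler $R$-modules and that $A$ is a faithfully flat left $B$-module. Then a subalgebra $S\in\mathrm{Sub}_{Alg}(A/B)$ is a closed element of the Galois connection $(\phi,\psi)$ between $\mathrm{Sub}_{Alg}(A/B)$ and $\mathrm{Quot}_{gen}(H)$ if and only if the canonical map $$\mathrm{can}_S:S\otimes_BA\to A\,\square_{\psi(S)}H,\qquad \mathrm{can}_S(a\otimes b)=ab_{(0)}\otimes b_{(1)}$$ is an isomorphism.
   Context: Algebras are associative and unital; unadorned $\otimes$ is over $R$. A right $H$-comodule algebra is an algebra $A$ with a counital coassociative coaction $\delta_A:A\to A\otimes H$, $\delta_A(a)=a_{(0)}\otimes a_{(1)}$, that is an algebra homomorphism; $A^{co\,H}=\{a:\delta_A(a)=a\otimes1_H\}$. $A/B$ is $H$-Galois if $\mathrm{can}:A\otimes_BA\to A\otimes H$, $a\otimes b\mapsto ab_{(0)}\otimes b_{(1)}$, is bijective. An $R$-module $M$ is Mittag--Leffler if $M\otimes\prod_\lambda M_\lambda\to\prod_\lambda(M\otimes M_\lambda)$ is injective for every family of $R$-modules $(M_\lambda)$. $\mathrm{Sub}_{Alg}(A/B)$ is the poset (under inclusion) of subalgebras $S$ with $B\subseteq S\subseteq A$. $\mathrm{Quot}_{gen}(H)$ is the complete lattice of quotients $H/I$ by right ideal coideals, ordered by $H/I\succcurlyeq H/J\Leftrightarrow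 I\subseteq J$. For $Q$ in it with projection $\pi:H\to Q$, $A^{co\,Q}=\{a\in A:a_{(0)}\otimes\pi(a_{(1)})=a\otimes\pi(1_H)\}$. The Galois connection consists of the order-reversing maps $\phi(Q)=A^{co\,Q}$ and $\psi(S)=\bigvee\{Q\in\mathrm{Quot}_{gen}(H):S\subseteq A^{co\,Q}\}$ (these satisfy $S\subseteq\phi\psi(S)$ and $Q\preccurlyeq\psi\phi(Q)$); $S$ is closed if $\phi\psi(S)=S$. For a generalised quotient $\pi:H\to Q$, $A$ is a right $Q$-comodule via $(\mathrm{id}\otimes\pi)\delta_A$ and $H$ is a left $Q$-comodule via $(\pi\otimes\mathrm{id})\Delta$; $A\,\square_QH$ is the cotensor product, i.e. the equaliser of the two maps $A\otimes H\rightrightarrows A\otimes Q\otimes H$ induced by these coactions. *)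

theory Defs
  imports "HOL-Algebra.Module" "HOL-Algebra.Subrings" "HOL-Algebra.AbelCoset"
    "HOL-Algebra.Lattice" "HOL-Algebra.Free_Abelian_Groups"
begin

section \<open>Modules and algebras\<close>

text \<open>
  All modules are \<open>module\<close> records. A right module over a noncommutative ring is stored with its
  scalar on the left as well: \<open>b \<odot> x\<close> stands for \<open>x \<cdot> b\<close>, whence the reversed associativity law.
  The ring multiplication and unit fields of a record are only used if the record is an algebra.
\<close>

locale left_module = R?: ring R + M?: abelian_group M
  for R :: "('b, 'c) ring_scheme" (structure) and M :: "('b, 'm, 'd) module_scheme" (structure) +
  assumes smult_closed: "\<lbrakk>a \<in> carrier R; x \<in> carrier M\<rbrakk> \<Longrightarrow> a \<odot>\<^bsub>M\<^esub> x \<in> carrier M"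
    and smult_add_left: "\<lbrakk>a \<in> carrier R; b \<in> carrier R; x \<in> carrier M\<rbrakk>
      \<Longrightarrow> (a \<oplus>\<^bsub>R\<^esub> b) \<odot>\<^bsub>M\<^esub> x = a \<odot>\<^bsub>M\<^esub> x \<oplus>\<^bsub>M\<^esub> b \<odot>\<^bsub>M\<^esub> x"
    and smult_add_right: "\<lbrakk>a \<in> carrier R; x \<in> carrier M; y \<in> carrier M\<rbrakk>
      \<Longrightarrow> a \<odot>\<^bsub>M\<^esub> (x \<oplus>\<^bsub>M\<^esub> y) = a \<odot>\<^bsub>M\<^esub> x \<oplus>\<^bsub>M\<^esub> a \<odot>\<^bsub>M\<^esub> y"
    and smult_mult: "\<lbrakk>a \<in> carrier R; b \<in> carrier R; x \<in> carrier M\<rbrakk>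
      \<Longrightarrow> (a \<otimes>\<^bsub>R\<^esub> b) \<odot>\<^bsub>M\<^esub> x = a \<odot>\<^bsub>M\<^esub> (b \<odot>\<^bsub>M\<^esub> x)"
    and smult_unit: "x \<in> carrier M \<Longrightarrow> \<one>\<^bsub>R\<^esub> \<odot>\<^bsub>M\<^esub> x = x"

locale right_module = R?: ring R + M?: abelian_group M
  for R :: "('b, 'c) ring_scheme" (structure) and M :: "('b, 'm, 'd) module_scheme" (structure) +
  assumes smult_closed: "\<lbrakk>a \<in> carrier R; x \<in> carrier M\<rbrakk> \<Longrightarrow> a \<odot>\<^bsub>M\<^esub> x \<in> carrier M"
    and smult_add_left: "\<lbrakk>a \<in> carrier R; b \<in> carrier R; x \<in> carrier M\<rbrakk>
      \<Longrightarrow> (a \<oplus>\<^bsub>R\<^esub> b) \<odot>\<^bsub>M\<^esub> x = a \<odot>\<^bsub>M\<^esub> x \<oplus>\<^bsub>M\<^esub> b \<odot>\<^bsub>M\<^esub> x"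
    and smult_add_right: "\<lbrakk>a \<in> carrier R; x \<in> carrier M; y \<in> carrier M\<rbrakk>
      \<Longrightarrow> a \<odot>\<^bsub>M\<^esub> (x \<oplus>\<^bsub>M\<^esub> y) = a \<odot>\<^bsub>M\<^esub> x \<oplus>\<^bsub>M\<^esub> a \<odot>\<^bsub>M\<^esub> y"
    and smult_mult: "\<lbrakk>a \<in> carrier R; b \<in> carrier R; x \<in> carrier M\<rbrakk>
      \<Longrightarrow> (a \<otimes>\<^bsub>R\<^esub> b) \<odot>\<^bsub>M\<^esub> x = b \<odot>\<^bsub>M\<^esub> (a \<odot>\<^bsub>M\<^esub> x)"
    and smult_unit: "x \<in> carrier M \<Longrightarrow> \<one>\<^bsub>R\<^esub> \<odot>\<^bsub>M\<^esub> x = x"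

definition module_hom ::
  "('b, 'c) ring_scheme \<Rightarrow> ('b, 'm, 'd) module_scheme \<Rightarrow> ('b, 'n, 'e) module_scheme \<Rightarrow> ('m \<Rightarrow> 'n) set"
  where "module_hom R M N =
    {f \<in> carrier M \<rightarrow> carrier N.
       (\<forall>x\<in>carrier M. \<forall>y\<in>carrier M. f (x \<oplus>\<^bsub>M\<^esub> y) = f x \<oplus>\<^bsub>N\<^esub> f y) \<and>
       (\<forall>r\<in>carrier R. \<forall>x\<in>carrier M. f (r \<odot>\<^bsub>M\<^esub> x) = r \<odot>\<^bsub>N\<^esub> f x)}"

text \<open>The locale \<open>algebra\<close> of the library is restricted to commutative algebras.\<close>

locale assoc_algebra = module R A + ring A
  for R :: "('r, 'c) ring_scheme" (structure) and A :: "('r, 'a, 'd) module_scheme" (structure) +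
  assumes smult_mult_left: "\<lbrakk>r \<in> carrier R; x \<in> carrier A; y \<in> carrier A\<rbrakk>
      \<Longrightarrow> (r \<odot>\<^bsub>A\<^esub> x) \<otimes>\<^bsub>A\<^esub> y = r \<odot>\<^bsub>A\<^esub> (x \<otimes>\<^bsub>A\<^esub> y)"
    and smult_mult_right: "\<lbrakk>r \<in> carrier R; x \<in> carrier A; y \<in> carrier A\<rbrakk>
      \<Longrightarrow> x \<otimes>\<^bsub>A\<^esub> (r \<odot>\<^bsub>A\<^esub> y) = r \<odot>\<^bsub>A\<^esub> (x \<otimes>\<^bsub>A\<^esub> y)"

definition alg_hom ::
  "('r, 'c) ring_scheme \<Rightarrow> ('r, 'a, 'd) module_scheme \<Rightarrow> ('r, 'b, 'e) module_scheme \<Rightarrow> ('a \<Rightarrow> 'b) set"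
  where "alg_hom R A B = ring_hom A B \<inter> module_hom R A B"

text \<open>A subset \<open>X\<close> of a ring \<open>A\<close> as a module over a subring, by left or right multiplication.\<close>

definition left_regular :: "('a, 'c) ring_scheme \<Rightarrow> 'a set \<Rightarrow> ('a, 'a) module"
  where "left_regular A X =
    \<lparr>carrier = X, monoid.mult = (\<otimes>\<^bsub>A\<^esub>), one = \<one>\<^bsub>A\<^esub>, ring.zero = \<zero>\<^bsub>A\<^esub>, add = (\<oplus>\<^bsub>A\<^esub>),
     smult = (\<lambda>b x. b \<otimes>\<^bsub>A\<^esub> x)\<rparr>"

definition right_regular :: "('a, 'c) ring_scheme \<Rightarrow> 'a set \<Rightarrow> ('a, 'a) module"
  where "right_regular A X =
    \<lparr>carrier = X, monoid.mult = (\<otimes>\<^bsub>A\<^esub>), one = \<one>\<^bsub>A\<^esub>, ring.zero = \<zero>\<^bsub>A\<^esub>, add = (\<oplus>\<^bsub>A\<^esub>),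
     smult = (\<lambda>b x. x \<otimes>\<^bsub>A\<^esub> b)\<rparr>"

definition quot_module :: "('r, 'h, 'd) module_scheme \<Rightarrow> 'h set \<Rightarrow> ('r, 'h set) module"
  where "quot_module H I =
    \<lparr>carrier = a_rcosets\<^bsub>H\<^esub> I, monoid.mult = undefined, one = undefined, ring.zero = I,
     add = (\<lambda>X Y. X <+>\<^bsub>H\<^esub> Y), smult = (\<lambda>r X. \<Union>x\<in>X. I +>\<^bsub>H\<^esub> (r \<odot>\<^bsub>H\<^esub> x))\<rparr>"

definition prod_module :: "'i set \<Rightarrow> ('i \<Rightarrow> ('r, 'm) module) \<Rightarrow> ('r, 'i \<Rightarrow> 'm) module"
  where "prod_module L M =
    \<lparr>carrier = (\<Pi>\<^sub>E i\<in>L. carrier (M i)), monoid.mult = undefined, one = undefined,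
     ring.zero = (\<lambda>i\<in>L. \<zero>\<^bsub>M i\<^esub>), add = (\<lambda>x y. \<lambda>i\<in>L. x i \<oplus>\<^bsub>M i\<^esub> y i),
     smult = (\<lambda>r x. \<lambda>i\<in>L. r \<odot>\<^bsub>M i\<^esub> x i)\<rparr>"


section \<open>Tensor products\<close>

text \<open>
  For a right \<open>B\<close>-module \<open>M\<close> and a left \<open>B\<close>-module \<open>N\<close>, the tensor product over \<open>B\<close> is the free abelian
  group on \<open>M \<times> N\<close> modulo the biadditivity and balancing relations. Its elements are cosets.
\<close>

type_synonym ('m, 'n) tens = "('m \<times> 'n \<Rightarrow>\<^sub>0 int) set"

definition tensor_relators ::
  "('b, 'c) ring_scheme \<Rightarrow> ('b, 'm, 'd) module_scheme \<Rightarrow> ('b, 'n, 'e) module_scheme \<Rightarrow> ('m, 'n) tens"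
  where "tensor_relators B M N =
    {frag_of (m \<oplus>\<^bsub>M\<^esub> m', n) - frag_of (m, n) - frag_of (m', n) | m m' n.
       m \<in> carrier M \<and> m' \<in> carrier M \<and> n \<in> carrier N} \<union>
    {frag_of (m, n \<oplus>\<^bsub>N\<^esub> n') - frag_of (m, n) - frag_of (m, n') | m n n'.
       m \<in> carrier M \<and> n \<in> carrier N \<and> n' \<in> carrier N} \<union>
    {frag_of (b \<odot>\<^bsub>M\<^esub> m, n) - frag_of (m, b \<odot>\<^bsub>N\<^esub> n) | b m n.
       b \<in> carrier B \<and> m \<in> carrier M \<and> n \<in> carrier N}"

definition tensor_kernel ::
  "('b, 'c) ring_scheme \<Rightarrow> ('b, 'm, 'd) module_scheme \<Rightarrow> ('b, 'n, 'e) module_scheme \<Rightarrow> ('m, 'n) tens"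
  where "tensor_kernel B M N =
    generate (free_Abelian_group (carrier M \<times> carrier N)) (tensor_relators B M N)"

definition tensor_group ::
  "('b, 'c) ring_scheme \<Rightarrow> ('b, 'm, 'd) module_scheme \<Rightarrow> ('b, 'n, 'e) module_scheme
    \<Rightarrow> ('m, 'n) tens monoid"
  where "tensor_group B M N =
    free_Abelian_group (carrier M \<times> carrier N) Mod tensor_kernel B M N"

definition pure_tensor ::
  "('b, 'c) ring_scheme \<Rightarrow> ('b, 'm, 'd) module_scheme \<Rightarrow> ('b, 'n, 'e) module_scheme
    \<Rightarrow> 'm \<Rightarrow> 'n \<Rightarrow> ('m, 'n) tens"
  where "pure_tensor B M N m n =
    tensor_kernel B M N #>\<^bsub>free_Abelian_group (carrier M \<times> carrier N)\<^esub> frag_of (m, n)"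

text \<open>
  The homomorphism from a tensor product to an abelian group \<open>G\<close> (written multiplicatively)
  induced by a balanced biadditive map \<open>f\<close>. It is evaluated on an arbitrary representative, the
  choice of which is irrelevant because \<open>f\<close> is balanced.
\<close>

definition tensor_lift :: "('g, 'c) monoid_scheme \<Rightarrow> ('m \<Rightarrow> 'n \<Rightarrow> 'g) \<Rightarrow> ('m, 'n) tens \<Rightarrow> 'g"
  where "tensor_lift G f X =
    (let c = (SOME c. c \<in> X)
     in \<Otimes>\<^bsub>G\<^esub>p\<in>Poly_Mapping.keys c. f (fst p) (snd p) [^]\<^bsub>G\<^esub> Poly_Mapping.lookup c p)"

text \<open>
  The tensor product as a record. The scalar action (by \<open>b \<cdot> (m \<otimes> n) = b m \<otimes> n\<close>) is meaningful for
  commutative \<open>B\<close>, and the multiplication and unit if moreover \<open>M\<close> and \<open>N\<close> are \<open>B\<close>-algebras.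
\<close>

definition tensor ::
  "('b, 'c) ring_scheme \<Rightarrow> ('b, 'm, 'd) module_scheme \<Rightarrow> ('b, 'n, 'e) module_scheme
    \<Rightarrow> ('b, ('m, 'n) tens) module"
  where "tensor B M N =
    (let G = tensor_group B M N in
     \<lparr>carrier = carrier G,
      monoid.mult = (\<lambda>x y. tensor_lift G (\<lambda>m n. tensor_lift G (\<lambda>m' n'.
        pure_tensor B M N (m \<otimes>\<^bsub>M\<^esub> m') (n \<otimes>\<^bsub>N\<^esub> n')) y) x),
      one = pure_tensor B M N \<one>\<^bsub>M\<^esub> \<one>\<^bsub>N\<^esub>,
      ring.zero = \<one>\<^bsub>G\<^esub>,
      add = monoid.mult G,
      smult = (\<lambda>b. tensor_lift G (\<lambda>m n. pure_tensor B M N (b \<odot>\<^bsub>M\<^esub> m) n))\<rparr>)"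

text \<open>\<open>f \<otimes> g\<close>, where \<open>M'\<close> and \<open>N'\<close> are the codomains of \<open>f\<close> and \<open>g\<close>.\<close>

definition tensor_map ::
  "('b, 'c) ring_scheme \<Rightarrow> ('b, 'm', 'd) module_scheme \<Rightarrow> ('b, 'n', 'e) module_scheme
    \<Rightarrow> ('m \<Rightarrow> 'm') \<Rightarrow> ('n \<Rightarrow> 'n') \<Rightarrow> ('m, 'n) tens \<Rightarrow> ('m', 'n') tens"
  where "tensor_map B M' N' f g =
    tensor_lift (tensor_group B M' N') (\<lambda>m n. pure_tensor B M' N' (f m) (g n))"

definition tensor_assoc ::
  "('b, 'c) ring_scheme \<Rightarrow> ('b, 'm, 'd) module_scheme \<Rightarrow> ('b, 'n, 'e) module_scheme
    \<Rightarrow> ('b, 'p, 'f) module_scheme \<Rightarrow> (('m, 'n) tens, 'p) tens \<Rightarrow> ('m, ('n, 'p) tens) tens"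
  where "tensor_assoc R M N P =
    (let T = tensor R N P; G = tensor_group R M T in
     tensor_lift G (\<lambda>t p. tensor_lift G (\<lambda>m n. pure_tensor R M T m (pure_tensor R N P n p)) t))"


section \<open>Flatness and the Mittag-Leffler condition\<close>

text \<open>
  HOL does not quantify over types inside a formula, so the test modules range over a fixed type:
  a module over a ring of type \<open>'b\<close> is tested against modules with elements in \<open>'b list set\<close>. Up to
  isomorphism these include all finitely generated modules, since the elements of \<open>B\<^sup>m / K\<close> are sets
  of lists of length \<open>m\<close>. This gives the same notions as unrestricted test modules:
  the vanishing of an element of a tensor product is witnessed by finitely many elements, so a
  counterexample to preservation of injectivity can be cut down to finitely generated modules;
  and \<open>N \<otimes> M = 0\<close> passes, for \<open>M\<close> flat, to the cyclic submodules of \<open>N\<close>.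
\<close>

definition exact_at ::
  "('m, 'c) ring_scheme \<Rightarrow> ('n, 'd) ring_scheme \<Rightarrow> ('p, 'e) ring_scheme
    \<Rightarrow> ('m \<Rightarrow> 'n) \<Rightarrow> ('n \<Rightarrow> 'p) \<Rightarrow> bool"
  where "exact_at N1 N2 N3 f g \<longleftrightarrow> f ` carrier N1 = a_kernel N2 N3 g"

definition flat_left_module :: "('b, 'c) ring_scheme \<Rightarrow> ('b, 'm, 'd) module_scheme \<Rightarrow> bool"
  where "flat_left_module B M \<longleftrightarrow> left_module B M \<and>
    (\<forall>(N1 :: ('b, 'b list set) module) (N2 :: ('b, 'b list set) module)
      (N3 :: ('b, 'b list set) module).
     \<forall>f \<in> module_hom B N1 N2. \<forall>g \<in> module_hom B N2 N3.
       right_module B N1 \<and> right_module B N2 \<and> right_module B N3 \<longrightarrow>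
       exact_at N1 N2 N3 f g \<longrightarrow>
       exact_at (tensor B N1 M) (tensor B N2 M) (tensor B N3 M)
         (tensor_map B N2 M f id) (tensor_map B N3 M g id))"

definition faithfully_flat_left_module ::
  "('b, 'c) ring_scheme \<Rightarrow> ('b, 'm, 'd) module_scheme \<Rightarrow> bool"
  where "faithfully_flat_left_module B M \<longleftrightarrow> left_module B M \<and>
    (\<forall>(N1 :: ('b, 'b list set) module) (N2 :: ('b, 'b list set) module)
      (N3 :: ('b, 'b list set) module).
     \<forall>f \<in> module_hom B N1 N2. \<forall>g \<in> module_hom B N2 N3.
       right_module B N1 \<and> right_module B N2 \<and> right_module B N3 \<longrightarrow>
       (exact_at N1 N2 N3 f g \<longleftrightarrow>
        exact_at (tensor B N1 M) (tensor B N2 M) (tensor B N3 M)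
          (tensor_map B N2 M f id) (tensor_map B N3 M g id)))"

text \<open>
  The type of the indices is fixed as well. Given an element \<open>x = \<Sum>i<n. m\<^sub>i \<otimes> q\<^sub>i\<close> of the kernel for
  an arbitrary family, each \<open>M\<^sub>\<lambda>\<close> has a finitely generated submodule \<open>N\<^sub>\<lambda>\<close> which contains the
  components of the \<open>q\<^sub>i\<close> and in whose tensor product with \<open>M\<close> the image of \<open>x\<close> vanishes. Present it
  as \<open>R\<^sup>k / K\<^sub>\<lambda>\<close> with the components of the \<open>q\<^sub>i\<close> as the first \<open>n\<close> generators. Then \<open>x\<close> comes from the
  family of the \<open>R\<^sup>k / K\<close> indexed by the set of all these \<open>K :: 'r list set\<close>.
\<close>

definition mittag_leffler :: "('r, 'c) ring_scheme \<Rightarrow> ('r, 'm, 'd) module_scheme \<Rightarrow> bool"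
  where "mittag_leffler R M \<longleftrightarrow> module R M \<and>
    (\<forall>(L :: 'r list set set) (N :: 'r list set \<Rightarrow> ('r, 'r list set) module).
      (\<forall>i\<in>L. module R (N i)) \<longrightarrow>
      inj_on (\<lambda>x. \<lambda>i\<in>L. tensor_map R M (N i) id (\<lambda>y. y i) x)
        (carrier (tensor R M (prod_module L N))))"


section \<open>Hopf algebras and comodule algebras\<close>

locale hopf_algebra = assoc_algebra R H
  for R :: "('r, 'c) ring_scheme" (structure) and H :: "('r, 'h, 'd) module_scheme" (structure) +
  fixes comult :: "'h \<Rightarrow> ('h, 'h) tens" and counit :: "'h \<Rightarrow> 'r" and antipode :: "'h \<Rightarrow> 'h"
  assumes comult_hom: "comult \<in> alg_hom R H (tensor R H H)"
    and counit_hom: "counit \<in> alg_hom R H (left_regular R (carrier R))"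
    and antipode_hom: "antipode \<in> module_hom R H H"
    and comult_coassoc: "h \<in> carrier H \<Longrightarrow>
      tensor_assoc R H H H (tensor_map R (tensor R H H) H comult id (comult h)) =
      tensor_map R H (tensor R H H) id comult (comult h)"
    and counit_left: "h \<in> carrier H \<Longrightarrow>
      tensor_lift (add_monoid H) (\<lambda>x y. counit x \<odot>\<^bsub>H\<^esub> y) (comult h) = h"
    and counit_right: "h \<in> carrier H \<Longrightarrow>
      tensor_lift (add_monoid H) (\<lambda>x y. counit y \<odot>\<^bsub>H\<^esub> x) (comult h) = h"
    and antipode_left: "h \<in> carrier H \<Longrightarrow>
      tensor_lift (add_monoid H) (\<lambda>x y. antipode x \<otimes>\<^bsub>H\<^esub> y) (comult h) = counit h \<odot>\<^bsub>H\<^esub> \<one>\<^bsub>H\<^esub>"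
    and antipode_right: "h \<in> carrier H \<Longrightarrow>
      tensor_lift (add_monoid H) (\<lambda>x y. x \<otimes>\<^bsub>H\<^esub> antipode y) (comult h) = counit h \<odot>\<^bsub>H\<^esub> \<one>\<^bsub>H\<^esub>"

locale comodule_algebra = hopf_algebra R H comult counit antipode + A?: assoc_algebra R A
  for R :: "('r, 'c) ring_scheme" (structure) and H :: "('r, 'h, 'd) module_scheme" (structure)
    and comult :: "'h \<Rightarrow> ('h, 'h) tens" and counit :: "'h \<Rightarrow> 'r" and antipode :: "'h \<Rightarrow> 'h"
    and A :: "('r, 'a, 'e) module_scheme" (structure) +
  fixes coact :: "'a \<Rightarrow> ('a, 'h) tens"
  assumes coact_hom: "coact \<in> alg_hom R A (tensor R A H)"
    and coact_coassoc: "a \<in> carrier A \<Longrightarrow>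
      tensor_assoc R A H H (tensor_map R (tensor R A H) H coact id (coact a)) =
      tensor_map R A (tensor R H H) id comult (coact a)"
    and coact_counit: "a \<in> carrier A \<Longrightarrow>
      tensor_lift (add_monoid A) (\<lambda>x h. counit h \<odot>\<^bsub>A\<^esub> x) (coact a) = a"

definition coinvariants ::
  "('r, 'c) ring_scheme \<Rightarrow> ('r, 'h, 'd) module_scheme \<Rightarrow> ('r, 'a, 'e) module_scheme
    \<Rightarrow> ('a \<Rightarrow> ('a, 'h) tens) \<Rightarrow> 'a set"
  where "coinvariants R H A coact = {a \<in> carrier A. coact a = pure_tensor R A H a \<one>\<^bsub>H\<^esub>}"

text \<open>
  The map \<open>a \<otimes> b \<mapsto> a b\<^sub>0 \<otimes> b\<^sub>1\<close>. On \<open>S \<otimes>\<^sub>B A\<close> it is given by the same formula, so one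
  constant serves for every subalgebra \<open>S\<close>.
\<close>

definition canonical_map ::
  "('r, 'c) ring_scheme \<Rightarrow> ('r, 'h, 'd) module_scheme \<Rightarrow> ('r, 'a, 'e) module_scheme
    \<Rightarrow> ('a \<Rightarrow> ('a, 'h) tens) \<Rightarrow> ('a, 'a) tens \<Rightarrow> ('a, 'h) tens"
  where "canonical_map R H A coact =
    tensor_lift (tensor_group R A H) (\<lambda>a b. tensor_map R A H (\<lambda>c. a \<otimes>\<^bsub>A\<^esub> c) id (coact b))"

definition tensor_over_sub ::
  "('r, 'a, 'e) module_scheme \<Rightarrow> 'a set \<Rightarrow> 'a set \<Rightarrow> ('a, ('a, 'a) tens) module"
  where "tensor_over_sub A B S =
    tensor (A\<lparr>carrier := B\<rparr>) (right_regular A S) (left_regular A (carrier A))"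

definition hopf_galois ::
  "('r, 'c) ring_scheme \<Rightarrow> ('r, 'h, 'd) module_scheme \<Rightarrow> ('r, 'a, 'e) module_scheme
    \<Rightarrow> ('a \<Rightarrow> ('a, 'h) tens) \<Rightarrow> bool"
  where "hopf_galois R H A coact \<longleftrightarrow>
    bij_betw (canonical_map R H A coact)
      (carrier (tensor_over_sub A (coinvariants R H A coact) (carrier A))) (carrier (tensor R A H))"


section \<open>Generalised quotients and the Galois connection\<close>

text \<open>
  The coideal condition \<open>\<Delta>(I) \<subseteq> I \<otimes> H + H \<otimes> I\<close> is read with the images of \<open>I \<otimes> H\<close> and \<open>H \<otimes> I\<close> in
  \<open>H \<otimes> H\<close>, as these maps need not be injective over a ring. Together with \<open>\<epsilon>(I) = 0\<close> it says that
  \<open>H / I\<close> is a quotient coalgebra.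
\<close>

definition right_ideal_coideal ::
  "('r, 'c) ring_scheme \<Rightarrow> ('r, 'h, 'd) module_scheme \<Rightarrow> ('h \<Rightarrow> ('h, 'h) tens) \<Rightarrow> ('h \<Rightarrow> 'r)
    \<Rightarrow> 'h set \<Rightarrow> bool"
  where "right_ideal_coideal R H comult counit I \<longleftrightarrow>
    submodule I R H \<and>
    (\<forall>x\<in>I. \<forall>h\<in>carrier H. x \<otimes>\<^bsub>H\<^esub> h \<in> I) \<and>
    (\<forall>x\<in>I. counit x = \<zero>\<^bsub>R\<^esub>) \<and>
    (\<forall>x\<in>I. comult x \<in> generate (tensor_group R H H)
       ({pure_tensor R H H i h | i h. i \<in> I \<and> h \<in> carrier H} \<union>
        {pure_tensor R H H h i | i h. i \<in> I \<and> h \<in> carrier H}))"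

text \<open>A generalised quotient \<open>H / I\<close> is represented by \<open>I\<close>; hence the order is reversed inclusion.\<close>

definition Quot_gen ::
  "('r, 'c) ring_scheme \<Rightarrow> ('r, 'h, 'd) module_scheme \<Rightarrow> ('h \<Rightarrow> ('h, 'h) tens) \<Rightarrow> ('h \<Rightarrow> 'r)
    \<Rightarrow> 'h set gorder"
  where "Quot_gen R H comult counit =
    \<lparr>carrier = {I. right_ideal_coideal R H comult counit I}, eq = (=), le = (\<lambda>I J. J \<subseteq> I)\<rparr>"

definition Sub_Alg ::
  "('r, 'c) ring_scheme \<Rightarrow> ('r, 'a, 'e) module_scheme \<Rightarrow> 'a set \<Rightarrow> 'a set set"
  where "Sub_Alg R A B = {S. subring S A \<and> submodule S R A \<and> B \<subseteq> S}"

text \<open>\<open>A\<^bsup>co Q\<^esup>\<close> for \<open>Q = H / I\<close>; the projection onto \<open>Q\<close> is \<open>\<lambda>h. I +> h\<close>.\<close>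

definition galois_phi ::
  "('r, 'c) ring_scheme \<Rightarrow> ('r, 'h, 'd) module_scheme \<Rightarrow> ('r, 'a, 'e) module_scheme
    \<Rightarrow> ('a \<Rightarrow> ('a, 'h) tens) \<Rightarrow> 'h set \<Rightarrow> 'a set"
  where "galois_phi R H A coact I =
    {a \<in> carrier A. tensor_map R A (quot_module H I) id (\<lambda>h. I +>\<^bsub>H\<^esub> h) (coact a) =
       pure_tensor R A (quot_module H I) a (I +>\<^bsub>H\<^esub> \<one>\<^bsub>H\<^esub>)}"

definition galois_psi ::
  "('r, 'c) ring_scheme \<Rightarrow> ('r, 'h, 'd) module_scheme \<Rightarrow> ('h \<Rightarrow> ('h, 'h) tens) \<Rightarrow> ('h \<Rightarrow> 'r)
    \<Rightarrow> ('r, 'a, 'e) module_scheme \<Rightarrow> ('a \<Rightarrow> ('a, 'h) tens) \<Rightarrow> 'a set \<Rightarrow> 'h set"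
  where "galois_psi R H comult counit A coact S =
    \<Squnion>\<^bsub>Quot_gen R H comult counit\<^esub>
      {I \<in> carrier (Quot_gen R H comult counit). S \<subseteq> galois_phi R H A coact I}"

definition galois_closed ::
  "('r, 'c) ring_scheme \<Rightarrow> ('r, 'h, 'd) module_scheme \<Rightarrow> ('h \<Rightarrow> ('h, 'h) tens) \<Rightarrow> ('h \<Rightarrow> 'r)
    \<Rightarrow> ('r, 'a, 'e) module_scheme \<Rightarrow> ('a \<Rightarrow> ('a, 'h) tens) \<Rightarrow> 'a set \<Rightarrow> bool"
  where "galois_closed R H comult counit A coact S \<longleftrightarrow>
    galois_phi R H A coact (galois_psi R H comult counit A coact S) = S"

text \<open>
  \<open>A \<box>\<^sub>Q H\<close> for \<open>Q = H / I\<close>, where the two maps from \<open>A \<otimes> H\<close> are compared in \<open>A \<otimes> (Q \<otimes> H)\<close>.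
\<close>

definition cotensor ::
  "('r, 'c) ring_scheme \<Rightarrow> ('r, 'h, 'd) module_scheme \<Rightarrow> ('h \<Rightarrow> ('h, 'h) tens)
    \<Rightarrow> ('r, 'a, 'e) module_scheme \<Rightarrow> ('a \<Rightarrow> ('a, 'h) tens) \<Rightarrow> 'h set \<Rightarrow> ('r, ('a, 'h) tens) module"
  where "cotensor R H comult A coact I =
    (let Q = quot_module H I; proj = (\<lambda>h. I +>\<^bsub>H\<^esub> h) in
     (tensor R A H)\<lparr>carrier := {x \<in> carrier (tensor R A H).
        tensor_assoc R A Q H
          (tensor_map R (tensor R A Q) H (\<lambda>a. tensor_map R A Q id proj (coact a)) id x) =
        tensor_map R A (tensor R Q H) id (\<lambda>h. tensor_map R Q H proj id (comult h)) x}\<rparr>)"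

end

theory Submission
  imports Defs
begin

text \<open>
  Write \<open>\<delta>\<close> for the coaction of \<open>H\<close> on \<open>A\<close>, and \<open>Q = H / I\<close> with projection \<open>\<pi>\<close>. Three arguments
  make up the proof.

  Existence of \<open>\<psi>(S)\<close>. The inclusion \<open>S \<subseteq> A\<^bsup>co Q\<^esup>\<close> says that \<open>\<delta>(a) - a \<otimes> 1\<close> vanishes in \<open>A \<otimes> H / I\<close>
  for every \<open>a \<in> S\<close>. Because \<open>A\<close> is flat and Mittag-Leffler, this condition is inherited by the
  intersection \<open>N\<close> of all right ideals \<open>I\<close> that satisfy it (\<open>vanishes_mod_Inter\<close>). Minimality makes \<open>N\<close>
  a coideal: by the counit law \<open>ker \<epsilon>\<close> satisfies the condition, by coassociativity so does the
  preimage of \<open>N \<otimes> H + H \<otimes> N\<close> under \<open>\<Delta>\<close>, and \<open>N\<close> is contained in both. Hence \<open>\<psi>(S)\<close> is \<open>H / N\<close>, and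
  \<open>S \<subseteq> \<phi>(\<psi>(S))\<close> (\<open>galois_psi_eq\<close>).

  The cotensor product. The map \<open>v \<otimes> q \<otimes> a \<mapsto> v a\<^sub>0 \<otimes> q a\<^sub>1 \<otimes> a\<^sub>2\<close> carries \<open>(A \<otimes> Q) \<otimes>\<^sub>B A\<close> to
  \<open>A \<otimes> Q \<otimes> H\<close>; the antipode and the inverse of \<open>can\<close> undo it. If \<open>A \<otimes> H\<close> is replaced by \<open>A \<otimes>\<^sub>B A\<close>
  by means of \<open>can\<close>, then this map relates the two arrows that define \<open>A \<box>\<^sub>Q H\<close> to
  \<open>u \<otimes> a \<mapsto> \<delta>\<^sub>Q(u) \<otimes> a\<close> and \<open>u \<otimes> a \<mapsto> (u \<otimes> \<pi>(1)) \<otimes> a\<close>. Since \<open>A\<close> is flat over \<open>B\<close>, these agree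
  exactly on \<open>A\<^bsup>co Q\<^esup> \<otimes>\<^sub>B A\<close>. So \<open>can\<close> maps \<open>A\<^bsup>co Q\<^esup> \<otimes>\<^sub>B A\<close> onto \<open>A \<box>\<^sub>Q H\<close> (\<open>cotensor_rep\<close>).

  Comparison of \<open>S\<close> with \<open>A\<^bsup>co Q\<^esup>\<close> for \<open>Q = \<psi>(S)\<close>. By flatness \<open>S \<otimes>\<^sub>B A\<close> embeds into \<open>A \<otimes>\<^sub>B A\<close>, so
  \<open>can\<^sub>S\<close> is always injective, and it is onto if and only if \<open>S \<otimes>\<^sub>B A\<close> is all of \<open>A\<^bsup>co Q\<^esup> \<otimes>\<^sub>B A\<close>. By
  faithful flatness this forces \<open>S = A\<^bsup>co Q\<^esup>\<close>: for \<open>t \<in> A\<^bsup>co Q\<^esup>\<close> the right ideal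
  \<open>J = {b \<in> B. t b \<in> S}\<close> satisfies \<open>J A = A\<close>, hence \<open>1 \<in> J\<close> (\<open>mem_if_tensor_one_in_image\<close>,
  \<open>galois_phi_eq_iff_iso\<close>).

  Apart from the final inference \<open>1 \<in> J\<close>, flatness is used through the equational criterion for the
  vanishing of an element of a tensor product (\<open>flat_vanishing\<close>). It holds for modules with elements of
  any type, although flatness is defined by test modules of one type, because its proof tests only
  free modules of finite rank and their submodules.
\<close>

section \<open>Additive maps and finite sums\<close>

abbreviation add_hom :: "('m, 'c) ring_scheme \<Rightarrow> ('n, 'd) ring_scheme \<Rightarrow> ('m \<Rightarrow> 'n) set"
  where "add_hom M N \<equiv> hom (add_monoid M) (add_monoid N)"

lemma add_homI:
  assumes "\<And>x. x \<in> carrier M \<Longrightarrow> f x \<in> carrier N"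
    and "\<And>x y. \<lbrakk>x \<in> carrier M; y \<in> carrier M\<rbrakk> \<Longrightarrow> f (x \<oplus>\<^bsub>M\<^esub> y) = f x \<oplus>\<^bsub>N\<^esub> f y"
  shows "f \<in> add_hom M N"
  using assms by (auto simp: hom_def)

lemma add_hom_closed: "\<lbrakk>f \<in> add_hom M N; x \<in> carrier M\<rbrakk> \<Longrightarrow> f x \<in> carrier N"
  by (auto simp: hom_def)

lemma add_hom_add:
  "\<lbrakk>f \<in> add_hom M N; x \<in> carrier M; y \<in> carrier M\<rbrakk> \<Longrightarrow> f (x \<oplus>\<^bsub>M\<^esub> y) = f x \<oplus>\<^bsub>N\<^esub> f y"
  by (auto simp: hom_def)

lemma add_hom_compose:
  "\<lbrakk>f \<in> add_hom M N; g \<in> add_hom N P\<rbrakk> \<Longrightarrow> (\<lambda>x. g (f x)) \<in> add_hom M P"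
  by (auto simp: hom_def Pi_iff)

lemma abelian_add_closed:
  "\<lbrakk>abelian_group M; x \<in> carrier M; y \<in> carrier M\<rbrakk> \<Longrightarrow> x \<oplus>\<^bsub>M\<^esub> y \<in> carrier M"
  by (rule abelian_monoid.a_closed[OF abelian_group.axioms(1)])

lemma add_hom_plus:
  assumes N: "abelian_group N" and f: "f \<in> add_hom M N" and g: "g \<in> add_hom M N"
  shows "(\<lambda>x. f x \<oplus>\<^bsub>N\<^esub> g x) \<in> add_hom M N"
proof -
  interpret abelian_group N by (rule N)
  show ?thesis
    using add_hom_closed[OF f] add_hom_closed[OF g]
    by (intro add_homI) (auto simp: add_hom_add[OF f] add_hom_add[OF g] a_ac)
qed

lemma add_hom_group_hom:
  assumes "abelian_group M" "abelian_group N" "f \<in> add_hom M N"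
  shows "group_hom (add_monoid M) (add_monoid N) f"
  using assms by (intro group_hom.intro group_hom_axioms.intro abelian_group.a_group) auto

lemma add_hom_zero:
  assumes "abelian_group M" "abelian_group N" "f \<in> add_hom M N"
  shows "f \<zero>\<^bsub>M\<^esub> = \<zero>\<^bsub>N\<^esub>"
  using group_hom.hom_one[OF add_hom_group_hom[OF assms]] by simp

lemma add_hom_minus:
  assumes "abelian_group M" "abelian_group N" "f \<in> add_hom M N" "x \<in> carrier M"
  shows "f (\<ominus>\<^bsub>M\<^esub> x) = \<ominus>\<^bsub>N\<^esub> f x"
  using group_hom.hom_inv[OF add_hom_group_hom[OF assms(1-3)], of x] assms(4)
  by (simp add: a_inv_def)

lemma add_hom_diff:
  assumes "abelian_group M" "abelian_group N" "f \<in> add_hom M N" "x \<in> carrier M" "y \<in> carrier M"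
  shows "f (x \<ominus>\<^bsub>M\<^esub> y) = f x \<ominus>\<^bsub>N\<^esub> f y"
  using assms
  by (simp add: a_minus_def add_hom_minus add_hom_add abelian_group.a_inv_closed)

lemma add_hom_finsum:
  assumes "abelian_group M" "abelian_group N" "f \<in> add_hom M N" "g \<in> I \<rightarrow> carrier M"
  shows "f (\<Oplus>\<^bsub>M\<^esub>i\<in>I. g i) = (\<Oplus>\<^bsub>N\<^esub>i\<in>I. f (g i))"
proof -
  interpret M: abelian_group M by fact
  interpret N: abelian_group N by fact
  show ?thesis
    using assms(4)
  proof (induction I rule: infinite_finite_induct)
    case (infinite I)
    then show ?case by (simp add: add_hom_zero[OF assms(1-3)])
  next
    case empty
    then show ?case by (simp add: add_hom_zero[OF assms(1-3)])
  next
    case (insert i I)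
    then have g: "g \<in> I \<rightarrow> carrier M" "g i \<in> carrier M" by auto
    then have "(\<lambda>i. f (g i)) \<in> I \<rightarrow> carrier N" "f (g i) \<in> carrier N"
      using add_hom_closed[OF assms(3)] by (auto simp: Pi_iff)
    with insert g show ?case
      by (simp add: add_hom_add[OF assms(3)])
  qed
qed

lemma (in abelian_group) finsum_swap:
  assumes "finite I" "finite J" "\<And>i j. \<lbrakk>i \<in> I; j \<in> J\<rbrakk> \<Longrightarrow> f i j \<in> carrier G"
  shows "(\<Oplus>i\<in>I. \<Oplus>j\<in>J. f i j) = (\<Oplus>j\<in>J. \<Oplus>i\<in>I. f i j)"
  using assms(1,3)
proof (induction I)
  case empty
  then show ?case by (simp add: finsum_zero)
next
  case (insert i I)
  have "(\<Oplus>j\<in>J. \<Oplus>i\<in>insert i I. f i j) = (\<Oplus>j\<in>J. f i j \<oplus> (\<Oplus>i\<in>I. f i j))"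
    using insert by (intro finsum_cong') (auto intro!: finsum_insert)
  also have "\<dots> = (\<Oplus>j\<in>J. f i j) \<oplus> (\<Oplus>j\<in>J. \<Oplus>i\<in>I. f i j)"
    using insert by (intro finsum_addf) auto
  finally show ?case
    using insert by (subst finsum_insert) auto
qed

lemma (in abelian_group) diff_zero_iff:
  "\<lbrakk>x \<in> carrier G; y \<in> carrier G\<rbrakk> \<Longrightarrow> x \<ominus> y = \<zero> \<longleftrightarrow> x = y"
  by (metis a_minus_def add.inv_closed add.inv_solve_right' l_zero r_neg zero_closed minus_equality)

lemma (in abelian_group) diff_add_cancel:
  "\<lbrakk>x \<in> carrier G; y \<in> carrier G\<rbrakk> \<Longrightarrow> (x \<ominus> y) \<oplus> y = x"
  by (simp add: a_minus_def a_assoc l_neg)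

lemma (in abelian_group) add_minus_minus:
  "\<lbrakk>x \<in> carrier G; y \<in> carrier G\<rbrakk> \<Longrightarrow> x \<oplus> y \<ominus> x \<ominus> y = \<zero>"
  by (metis a_comm add.inv_closed add.inv_solve_right' add.m_closed a_minus_def r_neg)

lemma free_hom_diff:
  assumes M: "abelian_group M" and h: "h \<in> hom (free_Abelian_group X) (add_monoid M)"
    and c: "c \<in> carrier (free_Abelian_group X)" and d: "d \<in> carrier (free_Abelian_group X)"
  shows "h (c - d) = h c \<ominus>\<^bsub>M\<^esub> h d"
proof -
  interpret h: group_hom "free_Abelian_group X" "add_monoid M" h
    using h by (intro group_hom.intro group_hom_axioms.intro abelian_group.a_group[OF M]) simp_all
  have "h (c - d) = h (c \<otimes>\<^bsub>free_Abelian_group X\<^esub> inv\<^bsub>free_Abelian_group X\<^esub> d)" using d by simp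
  also have "\<dots> = h c \<otimes>\<^bsub>add_monoid M\<^esub> h (inv\<^bsub>free_Abelian_group X\<^esub> d)"
    by (rule h.hom_mult[OF c]) (use d in simp)
  also have "h (inv\<^bsub>free_Abelian_group X\<^esub> d) = inv\<^bsub>add_monoid M\<^esub> h d"
    by (rule h.hom_inv[OF d])
  finally show ?thesis by (simp only: a_minus_def a_inv_def monoid.simps)
qed

lemma subgroup_eqI:
  fixes G :: "('g, 'c) monoid_scheme" and H :: "('g, 'd) monoid_scheme"
  assumes "carrier H = carrier G" "monoid.mult H = monoid.mult G" "one H = one G"
  shows "subgroup X H = subgroup X G"
proof -
  have "m_inv H = m_inv G" using assms by (simp add: m_inv_def fun_eq_iff)
  then show ?thesis using assms by (simp add: subgroup_def)
qed

lemma generate_eqI: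
  fixes G :: "('g, 'c) monoid_scheme" and H :: "('g, 'd) monoid_scheme"
  assumes "carrier H = carrier G" "monoid.mult H = monoid.mult G" "one H = one G"
  shows "generate H X = generate G X"
proof -
  have inv: "m_inv H = m_inv G" using assms by (simp add: m_inv_def fun_eq_iff)
  have "x \<in> generate G X" if "x \<in> generate H X" for x
    using that by induction
      (use generate.one[of G X] generate.incl[of _ X G] generate.inv[of _ X G] generate.eng[of _ G X] in
        \<open>simp_all add: assms inv\<close>)
  moreover have "x \<in> generate H X" if "x \<in> generate G X" for x
    using that by induction
      (use generate.one[of H X] generate.incl[of _ X H] generate.inv[of _ X H] generate.eng[of _ H X] in
        \<open>simp_all add: assms inv\<close>)
  ultimately show ?thesis by blast
qed

lemma add_hom_generate:
  assumes M: "abelian_group M" and N: "abelian_group N" and f: "f \<in> add_hom M N"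
    and X: "X \<subseteq> carrier M" and W: "subgroup W (add_monoid N)" and fX: "\<And>x. x \<in> X \<Longrightarrow> f x \<in> W"
    and x: "x \<in> generate (add_monoid M) X"
  shows "f x \<in> W"
proof -
  interpret M: abelian_group M by (rule M)
  interpret N: abelian_group N by (rule N)
  have "generate (add_monoid M) X \<subseteq> {x \<in> carrier M. f x \<in> W}"
  proof (rule group.generate_subgroup_incl[OF M.a_group])
    show "X \<subseteq> {x \<in> carrier M. f x \<in> W}" using X fX by blast
    show "subgroup {x \<in> carrier M. f x \<in> W} (add_monoid M)"
    proof (rule group.subgroupI[OF M.a_group])
      show "{x \<in> carrier M. f x \<in> W} \<noteq> {}"
        using subgroup.one_closed[OF W] add_hom_zero[OF M N f] M.zero_closed by force
      fix x assume "x \<in> {x \<in> carrier M. f x \<in> W}"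
      then show "inv\<^bsub>add_monoid M\<^esub> x \<in> {x \<in> carrier M. f x \<in> W}"
        using subgroup.m_inv_closed[OF W, of "f x"] add_hom_minus[OF M N f, of x] M.a_inv_closed[of x]
        by (simp add: a_inv_def)
    next
      fix x y assume "x \<in> {x \<in> carrier M. f x \<in> W}" "y \<in> {x \<in> carrier M. f x \<in> W}"
      then show "x \<otimes>\<^bsub>add_monoid M\<^esub> y \<in> {x \<in> carrier M. f x \<in> W}"
        using subgroup.m_closed[OF W, of "f x" "f y"] by (simp add: add_hom_add[OF f])
    qed auto
  qed
  then show ?thesis using x by blast
qed

section \<open>The tensor product\<close>

definition balanced ::
  "('b, 'c) ring_scheme \<Rightarrow> ('b, 'm, 'd) module_scheme \<Rightarrow> ('b, 'n, 'e) module_scheme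
    \<Rightarrow> ('g, 'f) ring_scheme \<Rightarrow> ('m \<Rightarrow> 'n \<Rightarrow> 'g) \<Rightarrow> bool"
  where "balanced B M N G f \<longleftrightarrow>
    (\<forall>n\<in>carrier N. (\<lambda>m. f m n) \<in> add_hom M G) \<and> (\<forall>m\<in>carrier M. f m \<in> add_hom N G) \<and>
    (\<forall>b\<in>carrier B. \<forall>m\<in>carrier M. \<forall>n\<in>carrier N. f (b \<odot>\<^bsub>M\<^esub> m) n = f m (b \<odot>\<^bsub>N\<^esub> n))"

lemma balancedI:
  assumes "\<And>n. n \<in> carrier N \<Longrightarrow> (\<lambda>m. f m n) \<in> add_hom M G"
    and "\<And>m. m \<in> carrier M \<Longrightarrow> f m \<in> add_hom N G"
    and "\<And>b m n. \<lbrakk>b \<in> carrier B; m \<in> carrier M; n \<in> carrier N\<rbrakk>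
      \<Longrightarrow> f (b \<odot>\<^bsub>M\<^esub> m) n = f m (b \<odot>\<^bsub>N\<^esub> n)"
  shows "balanced B M N G f"
  using assms by (simp add: balanced_def)

text \<open>
  Evaluation of a formal sum, the formula behind \<open>tensor_lift\<close>. It is a homomorphism since the product
  may be taken over any finite set that contains the support.
\<close>

lemma free_eval_hom:
  assumes "comm_group G" "\<And>p. p \<in> X \<Longrightarrow> g p \<in> carrier G"
  defines "ev \<equiv> \<lambda>c. \<Otimes>\<^bsub>G\<^esub>p\<in>Poly_Mapping.keys c. g p [^]\<^bsub>G\<^esub> Poly_Mapping.lookup c p"
  shows "ev \<in> hom (free_Abelian_group X) G" and "p \<in> X \<Longrightarrow> ev (frag_of p) = g p"
proof -
  interpret G: comm_group G by fact
  let ?t = "\<lambda>(c :: _ \<Rightarrow>\<^sub>0 int) p. g p [^]\<^bsub>G\<^esub> Poly_Mapping.lookup c p"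
  have clo: "?t c p \<in> carrier G" if "p \<in> X" for c p
    using G.int_pow_closed[OF assms(2)[OF that]] .
  have ev: "ev c = (\<Otimes>\<^bsub>G\<^esub>p\<in>K. ?t c p)"
    if "finite K" "Poly_Mapping.keys c \<subseteq> K" "K \<subseteq> X" for c K
    unfolding ev_def
    by (rule G.finprod_mono_neutral_cong_left)
      (use that clo in \<open>auto simp: not_in_keys_iff_lookup_eq_zero\<close>)
  show "ev \<in> hom (free_Abelian_group X) G"
  proof (rule homI)
    fix c assume "c \<in> carrier (free_Abelian_group X)"
    then show "ev c \<in> carrier G"
      unfolding ev_def using clo by (intro G.finprod_closed) auto
  next
    fix c d assume "c \<in> carrier (free_Abelian_group X)" "d \<in> carrier (free_Abelian_group X)"
    then have cd: "Poly_Mapping.keys c \<subseteq> X" "Poly_Mapping.keys d \<subseteq> X" by auto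
    define K where "K = Poly_Mapping.keys c \<union> Poly_Mapping.keys d"
    have K: "finite K" "K \<subseteq> X" using cd by (auto simp: K_def)
    have "ev (c + d) = (\<Otimes>\<^bsub>G\<^esub>p\<in>K. ?t (c + d) p)"
      using K keys_add[of c d] by (intro ev) (auto simp: K_def)
    also have "\<dots> = (\<Otimes>\<^bsub>G\<^esub>p\<in>K. ?t c p \<otimes>\<^bsub>G\<^esub> ?t d p)"
      using K clo assms(2)
      by (intro G.finprod_cong') (auto simp: lookup_add G.int_pow_mult)
    also have "\<dots> = (\<Otimes>\<^bsub>G\<^esub>p\<in>K. ?t c p) \<otimes>\<^bsub>G\<^esub> (\<Otimes>\<^bsub>G\<^esub>p\<in>K. ?t d p)"
      using K clo by (intro G.finprod_multf) auto
    also have "\<dots> = ev c \<otimes>\<^bsub>G\<^esub> ev d"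
      using ev[of K c] ev[of K d] K by (simp add: K_def)
    finally show "ev (c \<otimes>\<^bsub>free_Abelian_group X\<^esub> d) = ev c \<otimes>\<^bsub>G\<^esub> ev d" by simp
  qed
  show "ev (frag_of p) = g p" if "p \<in> X"
    using ev[of "{p}" "frag_of p"] that assms(2) by simp
qed

text \<open>A group record and the additive part of a ring record differ in their extension fields only.\<close>

lemma comm_group_eqI:
  fixes G :: "('g, 'c) monoid_scheme" and H :: "('g, 'd) monoid_scheme"
  assumes "comm_group G" "carrier H = carrier G" "monoid.mult H = monoid.mult G" "one H = one G"
  shows "comm_group H"
proof -
  interpret G: comm_group G by fact
  show ?thesis
    by (rule comm_groupI) (use assms in \<open>auto simp: G.m_assoc intro: G.l_inv_ex G.m_comm\<close>)
qed

lemma tensor_lift_eq: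
  fixes G :: "('g, 'c) monoid_scheme" and H :: "('g, 'd) monoid_scheme"
  assumes "carrier H = carrier G" "monoid.mult H = monoid.mult G" "one H = one G"
  shows "tensor_lift H = (tensor_lift G :: ('m \<Rightarrow> 'n \<Rightarrow> 'g) \<Rightarrow> _)"
proof -
  have inv: "m_inv H = m_inv G" using assms by (simp add: m_inv_def fun_eq_iff)
  have pow: "x [^]\<^bsub>H\<^esub> (n :: nat) = x [^]\<^bsub>G\<^esub> n" for x n
    using assms by (simp add: nat_pow_def)
  have "x [^]\<^bsub>H\<^esub> (n :: int) = x [^]\<^bsub>G\<^esub> n" for x n
    using assms inv by (simp add: int_pow_def nat_pow_def Let_def)
  moreover have "finprod H = (finprod G :: ('m \<times> 'n \<Rightarrow> 'g) \<Rightarrow> _)"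
    by (intro ext) (simp add: finprod_def assms)
  ultimately show ?thesis by (intro ext) (simp add: tensor_lift_def)
qed

lemma tensor_lift_group: "tensor_lift (tensor_group B M N) = tensor_lift (add_monoid (tensor B M N))"
  by (rule tensor_lift_eq) (simp_all add: tensor_def Let_def)

text \<open>In what follows, every tensor product is taken of a right module and a left module.\<close>

locale tensor_pair = M: right_module B M + N: left_module B N
  for B :: "('b, 'c) ring_scheme" and M :: "('b, 'm, 'd) module_scheme"
    and N :: "('b, 'n, 'e) module_scheme"
begin

abbreviation T where "T \<equiv> tensor B M N"
abbreviation F where "F \<equiv> free_Abelian_group (carrier M \<times> carrier N)"
abbreviation K where "K \<equiv> tensor_kernel B M N"
abbreviation pure (infix "\<boxtimes>" 72) where "m \<boxtimes> n \<equiv> pure_tensor B M N m n"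

lemma relators_carrier: "tensor_relators B M N \<subseteq> carrier F"
proof -
  have **: "a - b \<in> carrier F" if "a \<in> carrier F" "b \<in> carrier F" for a b
  proof -
    have "Poly_Mapping.keys (a - b) \<subseteq> Poly_Mapping.keys a \<union> Poly_Mapping.keys b" by (rule keys_diff)
    also have "\<dots> \<subseteq> carrier M \<times> carrier N" using that by simp
    finally show ?thesis by simp
  qed
  then have *: "a - b - c \<in> carrier F" if "a \<in> carrier F" "b \<in> carrier F" "c \<in> carrier F" for a b c
    using that by blast
  show ?thesis
    unfolding tensor_relators_def
    by (auto intro!: * ** simp: M.smult_closed N.smult_closed simp del: carrier_free_Abelian_group_iff)
qed

lemma frag_diff_closed:
  "\<lbrakk>m \<in> carrier M; n \<in> carrier N; m' \<in> carrier M; n' \<in> carrier N\<rbrakk> \<Longrightarrow>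
    Poly_Mapping.keys (frag_of (m, n) - frag_of (m', n')) \<subseteq> carrier M \<times> carrier N"
  using keys_diff[of "frag_of (m, n)" "frag_of (m', n')"] by auto

lemma K_subgroup: "subgroup K F"
  unfolding tensor_kernel_def by (rule group.generate_is_subgroup) (auto simp: relators_carrier[simplified subset_iff] intro: subsetD[OF relators_carrier])

lemma K_normal: "normal K F"
  by (rule comm_group.subgroup_imp_normal[OF abelian_free_Abelian_group K_subgroup])

lemma T_comm_group: "comm_group (add_monoid T)"
proof (rule comm_group_eqI)
  show "comm_group (tensor_group B M N)"
    unfolding tensor_group_def
    by (rule comm_group.abelian_FactGroup[OF abelian_free_Abelian_group K_subgroup])
qed (simp_all add: tensor_def Let_def)

lemma T_abelian: "abelian_group T"
  using T_comm_group
  by (intro abelian_group.intro abelian_monoid.intro abelian_group_axioms.intro)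
     (auto simp: comm_group_def)

lemma carrier_T: "carrier T = (\<lambda>c. K #>\<^bsub>F\<^esub> c) ` carrier F"
  by (auto simp: tensor_def Let_def tensor_group_def FactGroup_def RCOSETS_def)

lemma coset_add:
  assumes "c \<in> carrier F" "d \<in> carrier F"
  shows "(K #>\<^bsub>F\<^esub> c) \<oplus>\<^bsub>T\<^esub> (K #>\<^bsub>F\<^esub> d) = K #>\<^bsub>F\<^esub> (c + d)"
  using normal.rcos_sum[OF K_normal assms] by (simp add: tensor_def Let_def tensor_group_def FactGroup_def)

lemma zero_T: "\<zero>\<^bsub>T\<^esub> = K"
  by (simp add: tensor_def Let_def tensor_group_def FactGroup_def)

lemma coset_eq_zero_iff: "c \<in> carrier F \<Longrightarrow> K #>\<^bsub>F\<^esub> c = \<zero>\<^bsub>T\<^esub> \<longleftrightarrow> c \<in> K"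
  using group.coset_join1[OF group_free_Abelian_group _ _ K_subgroup]
    group.coset_join2[OF group_free_Abelian_group _ K_subgroup] subgroup.subset[OF K_subgroup]
  by (auto simp: zero_T)

lemma coset_eq:
  assumes "c \<in> carrier F" "d \<in> carrier F" "c - d \<in> K"
  shows "K #>\<^bsub>F\<^esub> c = K #>\<^bsub>F\<^esub> d"
proof -
  interpret T: abelian_group T by (rule T_abelian)
  have cd: "c - d \<in> carrier F" using assms keys_diff[of c d] by auto
  have "K #>\<^bsub>F\<^esub> c = K #>\<^bsub>F\<^esub> ((c - d) + d)" by simp
  also have "\<dots> = (K #>\<^bsub>F\<^esub> (c - d)) \<oplus>\<^bsub>T\<^esub> (K #>\<^bsub>F\<^esub> d)"
    by (rule coset_add[symmetric]) (use cd assms in auto)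
  also have "\<dots> = K #>\<^bsub>F\<^esub> d"
    using assms(3) cd coset_eq_zero_iff[OF cd] assms(2) by (auto simp: carrier_T)
  finally show ?thesis .
qed

lemma pure_closed [simp]: "\<lbrakk>m \<in> carrier M; n \<in> carrier N\<rbrakk> \<Longrightarrow> m \<boxtimes> n \<in> carrier T"
  by (auto simp: pure_tensor_def carrier_T)

lemma relator_in_K: "c \<in> tensor_relators B M N \<Longrightarrow> c \<in> K"
  unfolding tensor_kernel_def by (rule generate.incl)

lemma pure_add_left:
  assumes "m \<in> carrier M" "m' \<in> carrier M" "n \<in> carrier N"
  shows "(m \<oplus>\<^bsub>M\<^esub> m') \<boxtimes> n = m \<boxtimes> n \<oplus>\<^bsub>T\<^esub> m' \<boxtimes> n"
proof -
  have "frag_of (m \<oplus>\<^bsub>M\<^esub> m', n) - frag_of (m, n) - frag_of (m', n) \<in> K"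
    using assms by (intro relator_in_K) (auto simp: tensor_relators_def)
  then have "frag_of (m \<oplus>\<^bsub>M\<^esub> m', n) - (frag_of (m, n) + frag_of (m', n)) \<in> K"
    by (simp add: algebra_simps)
  moreover have F: "frag_of (m, n) + frag_of (m', n) \<in> carrier F"
    using assms keys_add[of "frag_of (m, n)" "frag_of (m', n)"] by auto
  ultimately have "K #>\<^bsub>F\<^esub> frag_of (m \<oplus>\<^bsub>M\<^esub> m', n) = K #>\<^bsub>F\<^esub> (frag_of (m, n) + frag_of (m', n))"
    using assms by (intro coset_eq) simp_all
  then show ?thesis
    using assms by (simp add: pure_tensor_def coset_add)
qed

lemma pure_add_right:
  assumes "m \<in> carrier M" "n \<in> carrier N" "n' \<in> carrier N"
  shows "m \<boxtimes> (n \<oplus>\<^bsub>N\<^esub> n') = m \<boxtimes> n \<oplus>\<^bsub>T\<^esub> m \<boxtimes> n'"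
proof -
  have "frag_of (m, n \<oplus>\<^bsub>N\<^esub> n') - frag_of (m, n) - frag_of (m, n') \<in> K"
    using assms by (intro relator_in_K) (auto simp: tensor_relators_def)
  then have "frag_of (m, n \<oplus>\<^bsub>N\<^esub> n') - (frag_of (m, n) + frag_of (m, n')) \<in> K"
    by (simp add: algebra_simps)
  moreover have F: "frag_of (m, n) + frag_of (m, n') \<in> carrier F"
    using assms keys_add[of "frag_of (m, n)" "frag_of (m, n')"] by auto
  ultimately have "K #>\<^bsub>F\<^esub> frag_of (m, n \<oplus>\<^bsub>N\<^esub> n') = K #>\<^bsub>F\<^esub> (frag_of (m, n) + frag_of (m, n'))"
    using assms by (intro coset_eq) simp_all
  then show ?thesis
    using assms by (simp add: pure_tensor_def coset_add)
qed

lemma pure_smult: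
  assumes "b \<in> carrier B" "m \<in> carrier M" "n \<in> carrier N"
  shows "(b \<odot>\<^bsub>M\<^esub> m) \<boxtimes> n = m \<boxtimes> (b \<odot>\<^bsub>N\<^esub> n)"
proof -
  have "frag_of (b \<odot>\<^bsub>M\<^esub> m, n) - frag_of (m, b \<odot>\<^bsub>N\<^esub> n) \<in> K"
    using assms by (intro relator_in_K) (auto simp: tensor_relators_def)
  then show ?thesis
    unfolding pure_tensor_def using assms M.smult_closed N.smult_closed
    by (intro coset_eq) auto
qed

lemma pure_hom_left: "n \<in> carrier N \<Longrightarrow> (\<lambda>m. m \<boxtimes> n) \<in> add_hom M T"
  by (rule add_homI) (auto simp: pure_add_left)

lemma pure_hom_right: "m \<in> carrier M \<Longrightarrow> (\<lambda>n. m \<boxtimes> n) \<in> add_hom N T"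
  by (rule add_homI) (auto simp: pure_add_right)

lemma pure_zero_left: "n \<in> carrier N \<Longrightarrow> \<zero>\<^bsub>M\<^esub> \<boxtimes> n = \<zero>\<^bsub>T\<^esub>"
  by (rule add_hom_zero[OF _ T_abelian pure_hom_left]) (unfold_locales)

lemma pure_zero_right: "m \<in> carrier M \<Longrightarrow> m \<boxtimes> \<zero>\<^bsub>N\<^esub> = \<zero>\<^bsub>T\<^esub>"
  by (rule add_hom_zero[OF _ T_abelian pure_hom_right]) (unfold_locales)

text \<open>
  Evaluation of a balanced map kills the relators, hence the whole kernel; therefore it has the same
  value at \<open>c\<close> and at the representative of the coset of \<open>c\<close> that \<open>tensor_lift\<close> picks.
\<close>

lemma lift_aux:
  assumes G: "abelian_group G" and f: "balanced B M N G f"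
  defines "ev \<equiv> \<lambda>c. \<Otimes>\<^bsub>add_monoid G\<^esub>p\<in>Poly_Mapping.keys c.
      f (fst p) (snd p) [^]\<^bsub>add_monoid G\<^esub> Poly_Mapping.lookup c p"
  shows "ev \<in> hom F (add_monoid G)"
    and "c \<in> carrier F \<Longrightarrow> tensor_lift (add_monoid G) f (K #>\<^bsub>F\<^esub> c) = ev c"
proof -
  interpret G: abelian_group G by fact
  have fc: "f m n \<in> carrier G" if "m \<in> carrier M" "n \<in> carrier N" for m n
    using f that by (auto simp: balanced_def add_hom_closed)
  have ev: "ev \<in> hom F (add_monoid G)"
    unfolding ev_def by (rule free_eval_hom(1)) (auto intro: fc G.a_comm_group)
  have ev_of: "ev (frag_of (m, n)) = f m n" if "m \<in> carrier M" "n \<in> carrier N" for m n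
    unfolding ev_def
    by (subst free_eval_hom(2)[where X = "carrier M \<times> carrier N"])
      (use that in \<open>auto intro: fc G.a_comm_group\<close>)
  show "ev \<in> hom F (add_monoid G)" by (fact ev)
  interpret ev: group_hom F "add_monoid G" ev
    by (intro group_hom.intro group_hom_axioms.intro ev G.a_group) simp
  note ev_diff = free_hom_diff[OF G ev]
  have "K \<subseteq> kernel F (add_monoid G) ev"
    unfolding tensor_kernel_def
  proof (rule group.generate_subgroup_incl)
    show "tensor_relators B M N \<subseteq> kernel F (add_monoid G) ev"
    proof
      fix c assume c: "c \<in> tensor_relators B M N"
      have [simp]: "\<lbrakk>m \<in> carrier M; m' \<in> carrier M\<rbrakk> \<Longrightarrow> m \<oplus>\<^bsub>M\<^esub> m' \<in> carrier M"
        "\<lbrakk>n \<in> carrier N; n' \<in> carrier N\<rbrakk> \<Longrightarrow> n \<oplus>\<^bsub>N\<^esub> n' \<in> carrier N"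
        "\<lbrakk>b \<in> carrier B; m \<in> carrier M\<rbrakk> \<Longrightarrow> b \<odot>\<^bsub>M\<^esub> m \<in> carrier M"
        "\<lbrakk>b \<in> carrier B; n \<in> carrier N\<rbrakk> \<Longrightarrow> b \<odot>\<^bsub>N\<^esub> n \<in> carrier N" for b m m' n n'
        by (auto intro: M.smult_closed N.smult_closed)
      from c have "ev c = \<zero>\<^bsub>G\<^esub>"
        unfolding tensor_relators_def
      proof (elim UnE CollectE exE conjE)
        fix m m' n assume "c = frag_of (m \<oplus>\<^bsub>M\<^esub> m', n) - frag_of (m, n) - frag_of (m', n)"
          and A: "m \<in> carrier M" "m' \<in> carrier M" "n \<in> carrier N"
        then have "ev c = f (m \<oplus>\<^bsub>M\<^esub> m') n \<ominus>\<^bsub>G\<^esub> f m n \<ominus>\<^bsub>G\<^esub> f m' n"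
          using frag_diff_closed by (simp add: ev_diff ev_of)
        moreover have "f (m \<oplus>\<^bsub>M\<^esub> m') n = f m n \<oplus>\<^bsub>G\<^esub> f m' n"
          using f A by (auto simp: balanced_def hom_def)
        ultimately show ?thesis using A fc by (simp add: G.add_minus_minus)
      next
        fix m n n' assume "c = frag_of (m, n \<oplus>\<^bsub>N\<^esub> n') - frag_of (m, n) - frag_of (m, n')"
          and A: "m \<in> carrier M" "n \<in> carrier N" "n' \<in> carrier N"
        then have "ev c = f m (n \<oplus>\<^bsub>N\<^esub> n') \<ominus>\<^bsub>G\<^esub> f m n \<ominus>\<^bsub>G\<^esub> f m n'"
          using frag_diff_closed by (simp add: ev_diff ev_of)
        moreover have "f m (n \<oplus>\<^bsub>N\<^esub> n') = f m n \<oplus>\<^bsub>G\<^esub> f m n'"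
          using f A by (auto simp: balanced_def hom_def)
        ultimately show ?thesis using A fc by (simp add: G.add_minus_minus)
      next
        fix b m n assume "c = frag_of (b \<odot>\<^bsub>M\<^esub> m, n) - frag_of (m, b \<odot>\<^bsub>N\<^esub> n)"
          and A: "b \<in> carrier B" "m \<in> carrier M" "n \<in> carrier N"
        then have "ev c = f (b \<odot>\<^bsub>M\<^esub> m) n \<ominus>\<^bsub>G\<^esub> f m (b \<odot>\<^bsub>N\<^esub> n)"
          using frag_diff_closed by (simp add: ev_diff ev_of)
        moreover have "f (b \<odot>\<^bsub>M\<^esub> m) n = f m (b \<odot>\<^bsub>N\<^esub> n)"
          using f A by (auto simp: balanced_def)
        ultimately show ?thesis using A fc by (simp add: G.r_neg a_minus_def)
      qed
      moreover have "c \<in> carrier F" using relators_carrier c by blast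
      ultimately show "c \<in> kernel F (add_monoid G) ev" by (simp add: kernel_def)
    qed
    show "subgroup (kernel F (add_monoid G) ev) F" by (rule ev.subgroup_kernel)
  qed simp
  then have evK: "ev k = \<zero>\<^bsub>G\<^esub>" if "k \<in> K" for k using that by (auto simp: kernel_def)
  show "tensor_lift (add_monoid G) f (K #>\<^bsub>F\<^esub> c) = ev c" if c: "c \<in> carrier F"
  proof -
    have "c \<in> K #>\<^bsub>F\<^esub> c"
      by (rule group.rcos_self[OF group_free_Abelian_group c K_subgroup])
    then have "(SOME d. d \<in> K #>\<^bsub>F\<^esub> c) \<in> K #>\<^bsub>F\<^esub> c" by (rule someI)
    then obtain k where k: "k \<in> K" "(SOME d. d \<in> K #>\<^bsub>F\<^esub> c) = k + c"
      by (auto simp: r_coset_def)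
    have "k \<in> carrier F" using subgroup.subset[OF K_subgroup] k by blast
    then have "ev (k + c) = ev k \<oplus>\<^bsub>G\<^esub> ev c"
      using ev.hom_mult[of k c] c by simp
    also have "\<dots> = ev c" using evK[OF k(1)] ev.hom_closed[OF c] by simp
    finally show ?thesis
      by (simp add: tensor_lift_def Let_def k(2) ev_def)
  qed
qed

lemma lift_hom:
  assumes "abelian_group G" "balanced B M N G f"
  shows "tensor_lift (add_monoid G) f \<in> add_hom T G"
proof (rule add_homI)
  note ev = lift_aux[OF assms]
  fix x assume "x \<in> carrier T"
  then show "tensor_lift (add_monoid G) f x \<in> carrier G"
    using ev(2) hom_in_carrier[OF ev(1)] by (auto simp: carrier_T)
next
  note ev = lift_aux[OF assms]
  fix x y assume "x \<in> carrier T" "y \<in> carrier T"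
  then obtain c d where *: "c \<in> carrier F" "d \<in> carrier F" "x = K #>\<^bsub>F\<^esub> c" "y = K #>\<^bsub>F\<^esub> d"
    by (auto simp: carrier_T)
  have cd: "c + d \<in> carrier F" using * keys_add[of c d] by auto
  show "tensor_lift (add_monoid G) f (x \<oplus>\<^bsub>T\<^esub> y)
    = tensor_lift (add_monoid G) f x \<oplus>\<^bsub>G\<^esub> tensor_lift (add_monoid G) f y"
    using hom_mult[OF ev(1) *(1,2)] by (simp add: * coset_add ev(2) cd *[simplified] cd[simplified])
qed

lemma lift_pure:
  assumes G: "abelian_group G" "balanced B M N G f" and "m \<in> carrier M" "n \<in> carrier N"
  shows "tensor_lift (add_monoid G) f (m \<boxtimes> n) = f m n"
proof -
  have fc: "f m n \<in> carrier G" if "m \<in> carrier M" "n \<in> carrier N" for m n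
    using G that by (auto simp: balanced_def add_hom_closed)
  show ?thesis
    unfolding pure_tensor_def
    by (subst lift_aux(2)[OF G], use assms in simp,
        subst free_eval_hom(2)[where X = "carrier M \<times> carrier N"])
      (use assms fc in \<open>auto intro: abelian_group.a_comm_group\<close>)
qed

text \<open>
  Negatives need no case of their own because \<open>-(m \<otimes> n) = (-m) \<otimes> n\<close>.
\<close>

lemma T_induct [consumes 1, case_names zero pure add]:
  assumes x: "x \<in> carrier T" and zero: "P \<zero>\<^bsub>T\<^esub>"
    and pure: "\<And>m n. \<lbrakk>m \<in> carrier M; n \<in> carrier N\<rbrakk> \<Longrightarrow> P (m \<boxtimes> n)"
    and add: "\<And>x y. \<lbrakk>x \<in> carrier T; y \<in> carrier T; P x; P y\<rbrakk> \<Longrightarrow> P (x \<oplus>\<^bsub>T\<^esub> y)"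
  shows "P x"
proof -
  interpret T: abelian_group T by (rule T_abelian)
  have neg: "\<ominus>\<^bsub>T\<^esub> (m \<boxtimes> n) = (\<ominus>\<^bsub>M\<^esub> m) \<boxtimes> n" if "m \<in> carrier M" "n \<in> carrier N" for m n
    using add_hom_minus[OF _ T_abelian pure_hom_left[OF that(2)] that(1)] M.abelian_group_axioms by simp
  have "P (K #>\<^bsub>F\<^esub> c) \<and> P (\<ominus>\<^bsub>T\<^esub> (K #>\<^bsub>F\<^esub> c))" if "Poly_Mapping.keys c \<subseteq> carrier M \<times> carrier N" for c
  proof (rule free_Abelian_group_induct[OF that], goal_cases)
    case 1
    have "K #>\<^bsub>F\<^esub> 0 = \<zero>\<^bsub>T\<^esub>"
      using subgroup.one_closed[OF K_subgroup] by (subst coset_eq_zero_iff) auto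
    moreover have "\<ominus>\<^bsub>T\<^esub> \<zero>\<^bsub>T\<^esub> = \<zero>\<^bsub>T\<^esub>" by (rule T.minus_equality) auto
    ultimately show ?case using zero by metis
  next
    case (2 c d)
    then have cd: "c \<in> carrier F" "d \<in> carrier F" "c - d \<in> carrier F"
      using keys_diff[of c d] by auto
    have cT: "K #>\<^bsub>F\<^esub> c \<in> carrier T" "K #>\<^bsub>F\<^esub> d \<in> carrier T" "K #>\<^bsub>F\<^esub> (c - d) \<in> carrier T"
      using cd unfolding carrier_T by blast+
    have "(K #>\<^bsub>F\<^esub> (c - d)) \<oplus>\<^bsub>T\<^esub> (K #>\<^bsub>F\<^esub> d) = (K #>\<^bsub>F\<^esub> c)"
      using coset_add[OF cd(3,2)] by simp
    then have eq: "(K #>\<^bsub>F\<^esub> (c - d)) = (K #>\<^bsub>F\<^esub> c) \<oplus>\<^bsub>T\<^esub> \<ominus>\<^bsub>T\<^esub> (K #>\<^bsub>F\<^esub> d)"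
      using cT by (simp add: T.add.inv_solve_right)
    moreover have "\<ominus>\<^bsub>T\<^esub> (K #>\<^bsub>F\<^esub> (c - d)) = \<ominus>\<^bsub>T\<^esub> (K #>\<^bsub>F\<^esub> c) \<oplus>\<^bsub>T\<^esub> (K #>\<^bsub>F\<^esub> d)"
      using cT by (simp add: eq T.minus_add T.minus_minus)
    ultimately show ?case using 2 cT by (auto intro!: add)
  next
    case (3 p)
    then obtain m n where p: "p = (m, n)" "m \<in> carrier M" "n \<in> carrier N" by auto
    have "K #>\<^bsub>F\<^esub> frag_of p = m \<boxtimes> n" by (simp add: p pure_tensor_def)
    then show ?case using p neg by (simp add: pure)
  qed
  then show ?thesis using x by (auto simp: carrier_T)
qed

lemma T_hom_eqI:
  assumes "abelian_group G" "f \<in> add_hom T G" "g \<in> add_hom T G"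
    and "\<And>m n. \<lbrakk>m \<in> carrier M; n \<in> carrier N\<rbrakk> \<Longrightarrow> f (m \<boxtimes> n) = g (m \<boxtimes> n)"
    and "x \<in> carrier T"
  shows "f x = g x"
  using assms(5)
proof (induction x rule: T_induct)
  case zero
  show ?case using add_hom_zero[OF T_abelian assms(1)] assms(2,3) by metis
next
  case (add x y)
  then show ?case by (simp add: add_hom_add[OF assms(2)] add_hom_add[OF assms(3)])
qed (rule assms(4))

lemma T_finsumE:
  assumes "x \<in> carrier T"
  obtains k :: nat and m n where "m \<in> {..<k} \<rightarrow> carrier M" "n \<in> {..<k} \<rightarrow> carrier N"
    "x = (\<Oplus>\<^bsub>T\<^esub>i\<in>{..<k}. m i \<boxtimes> n i)"
proof -
  interpret T: abelian_group T by (rule T_abelian)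
  have "\<exists>(k::nat) m n. m \<in> {..<k} \<rightarrow> carrier M \<and> n \<in> {..<k} \<rightarrow> carrier N \<and>
    x = (\<Oplus>\<^bsub>T\<^esub>i\<in>{..<k}. m i \<boxtimes> n i)"
    using assms
  proof (induction x rule: T_induct)
    case zero
    show ?case by (rule exI[of _ 0]) auto
  next
    case (pure m n)
    then show ?case
      by (intro exI[of _ 1] exI[of _ "\<lambda>_. m"] exI[of _ "\<lambda>_. n"]) (auto simp: lessThan_Suc)
  next
    case (add x y)
    then obtain k m n l m' n' where
      x: "m \<in> {..<k::nat} \<rightarrow> carrier M" "n \<in> {..<k} \<rightarrow> carrier N" "x = (\<Oplus>\<^bsub>T\<^esub>i\<in>{..<k}. m i \<boxtimes> n i)"
      and y: "m' \<in> {..<l::nat} \<rightarrow> carrier M" "n' \<in> {..<l} \<rightarrow> carrier N"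
        "y = (\<Oplus>\<^bsub>T\<^esub>i\<in>{..<l}. m' i \<boxtimes> n' i)" by blast
    define M' where "M' = (\<lambda>i. if i < k then m i else m' (i - k))"
    define N' where "N' = (\<lambda>i. if i < k then n i else n' (i - k))"
    have c: "M' \<in> {..<k + l} \<rightarrow> carrier M" "N' \<in> {..<k + l} \<rightarrow> carrier N"
      using x y by (auto simp: M'_def N'_def Pi_iff)
    have "(\<Oplus>\<^bsub>T\<^esub>i\<in>{..<k + l}. M' i \<boxtimes> N' i)
      = (\<Oplus>\<^bsub>T\<^esub>i\<in>{..<k}. M' i \<boxtimes> N' i) \<oplus>\<^bsub>T\<^esub> (\<Oplus>\<^bsub>T\<^esub>i\<in>(\<lambda>i. i + k) ` {..<l}. M' i \<boxtimes> N' i)"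
    proof -
      have "{..<k + l} = {..<k} \<union> (\<lambda>i. i + k) ` {..<l}"
      proof (intro equalityI subsetI)
        fix i assume "i \<in> {..<k + l}"
        then show "i \<in> {..<k} \<union> (\<lambda>i. i + k) ` {..<l}"
          by (cases "i < k") (auto intro!: image_eqI[of _ _ "i - k"])
      qed auto
      moreover have "{..<k} \<inter> (\<lambda>i. i + k) ` {..<l} = {}" by auto
      moreover have "(\<lambda>i. M' i \<boxtimes> N' i) \<in> {..<k} \<rightarrow> carrier T"
        "(\<lambda>i. M' i \<boxtimes> N' i) \<in> (\<lambda>i. i + k) ` {..<l} \<rightarrow> carrier T"
        using c by (auto simp: Pi_iff)
      ultimately show ?thesis by (simp only: T.finsum_Un_disjoint finite_lessThan finite_imageI)
    qed
    also have "(\<Oplus>\<^bsub>T\<^esub>i\<in>{..<k}. M' i \<boxtimes> N' i) = x"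
      unfolding x(3)
    proof (rule T.finsum_cong'[OF refl])
      show "(\<lambda>i. m i \<boxtimes> n i) \<in> {..<k} \<rightarrow> carrier T" using x(1,2) by (auto simp: Pi_iff)
    qed (simp add: M'_def N'_def)
    also have "(\<Oplus>\<^bsub>T\<^esub>i\<in>(\<lambda>i. i + k) ` {..<l}. M' i \<boxtimes> N' i) = (\<Oplus>\<^bsub>T\<^esub>i\<in>{..<l}. M' (i + k) \<boxtimes> N' (i + k))"
    proof (rule T.finsum_reindex)
      show "(\<lambda>i. M' i \<boxtimes> N' i) \<in> (\<lambda>i. i + k) ` {..<l} \<rightarrow> carrier T"
        using c by (auto simp: Pi_iff)
    qed simp
    also have "\<dots> = y"
      unfolding y(3)
    proof (rule T.finsum_cong'[OF refl])
      show "(\<lambda>i. m' i \<boxtimes> n' i) \<in> {..<l} \<rightarrow> carrier T" using y(1,2) by (auto simp: Pi_iff)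
    qed (simp add: M'_def N'_def)
    finally have "x \<oplus>\<^bsub>T\<^esub> y = (\<Oplus>\<^bsub>T\<^esub>i\<in>{..<k + l}. M' i \<boxtimes> N' i)" by (rule sym)
    with c show ?case by blast
  qed
  then show ?thesis using that by blast
qed

end

section \<open>Linear maps\<close>

lemma module_homI:
  assumes "f \<in> add_hom M N"
    and "\<And>r x. \<lbrakk>r \<in> carrier R; x \<in> carrier M\<rbrakk> \<Longrightarrow> f (r \<odot>\<^bsub>M\<^esub> x) = r \<odot>\<^bsub>N\<^esub> f x"
  shows "f \<in> module_hom R M N"
  using assms by (auto simp: module_hom_def hom_def)

lemma module_hom_add_hom: "f \<in> module_hom R M N \<Longrightarrow> f \<in> add_hom M N"
  by (auto simp: module_hom_def hom_def)

lemma module_hom_closed: "\<lbrakk>f \<in> module_hom R M N; x \<in> carrier M\<rbrakk> \<Longrightarrow> f x \<in> carrier N"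
  by (auto simp: module_hom_def)

lemma module_hom_smult:
  "\<lbrakk>f \<in> module_hom R M N; r \<in> carrier R; x \<in> carrier M\<rbrakk> \<Longrightarrow> f (r \<odot>\<^bsub>M\<^esub> x) = r \<odot>\<^bsub>N\<^esub> f x"
  by (auto simp: module_hom_def)

lemma module_hom_id: "id \<in> module_hom R M M"
  by (auto simp: module_hom_def)

lemma module_hom_compose:
  "\<lbrakk>f \<in> module_hom R M N; g \<in> module_hom R N P\<rbrakk> \<Longrightarrow> (\<lambda>x. g (f x)) \<in> module_hom R M P"
  by (auto simp: module_hom_def Pi_iff)

lemma (in right_module) smult_hom: "b \<in> carrier R \<Longrightarrow> (\<lambda>x. b \<odot>\<^bsub>M\<^esub> x) \<in> add_hom M M"
  by (rule add_homI) (auto simp: smult_closed smult_add_right)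

lemma (in right_module) smult_hom_scalar:
  "x \<in> carrier M \<Longrightarrow> (\<lambda>b. b \<odot>\<^bsub>M\<^esub> x) \<in> add_hom R M"
  by (rule add_homI) (auto simp: smult_closed smult_add_left)

lemma (in left_module) smult_hom: "b \<in> carrier R \<Longrightarrow> (\<lambda>x. b \<odot>\<^bsub>M\<^esub> x) \<in> add_hom M M"
  by (rule add_homI) (auto simp: smult_closed smult_add_right)

lemma (in left_module) smult_hom_scalar:
  "x \<in> carrier M \<Longrightarrow> (\<lambda>b. b \<odot>\<^bsub>M\<^esub> x) \<in> add_hom R M"
  by (rule add_homI) (auto simp: smult_closed smult_add_left)

lemma (in module) right_module: "right_module R M"
  by (intro right_module.intro right_module_axioms.intro R.ring_axioms abelian_group_axioms)
    (auto simp: smult_l_distr smult_r_distr smult_assoc1[symmetric] R.m_comm)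

lemma (in module) left_module: "left_module R M"
  by (intro left_module.intro left_module_axioms.intro R.ring_axioms abelian_group_axioms)
    (auto simp: smult_l_distr smult_r_distr smult_assoc1)

lemma module_if_right_module:
  assumes "cring R" "right_module R M"
  shows "module R M"
proof -
  interpret cring R by fact
  interpret right_module R M by fact
  show ?thesis
    by (rule moduleI)
      (auto simp: smult_closed smult_add_left smult_add_right smult_unit smult_mult[symmetric] m_comm
        cring_axioms intro: M.abelian_group_axioms)
qed

lemma module_tensor_pair: "\<lbrakk>module R M; module R N\<rbrakk> \<Longrightarrow> tensor_pair R M N"
  by (intro tensor_pair.intro module.right_module module.left_module)

lemma tensor_map_balanced:
  assumes "tensor_pair B M N" "tensor_pair B M' N'" "f \<in> module_hom B M M'" "g \<in> module_hom B N N'"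
  shows "balanced B M N (tensor B M' N') (\<lambda>m n. pure_tensor B M' N' (f m) (g n))"
proof -
  interpret T: tensor_pair B M N by fact
  interpret T': tensor_pair B M' N' by fact
  note f = module_hom_add_hom[OF assms(3)] and g = module_hom_add_hom[OF assms(4)]
  show ?thesis
  proof (rule balancedI)
    show "(\<lambda>m. pure_tensor B M' N' (f m) (g n)) \<in> add_hom M (tensor B M' N')" if "n \<in> carrier N" for n
      by (rule add_hom_compose[OF f T'.pure_hom_left]) (rule module_hom_closed[OF assms(4) that])
    show "(\<lambda>n. pure_tensor B M' N' (f m) (g n)) \<in> add_hom N (tensor B M' N')" if "m \<in> carrier M" for m
      by (rule add_hom_compose[OF g T'.pure_hom_right]) (rule module_hom_closed[OF assms(3) that])
  qed (use assms(3,4) in \<open>auto simp: module_hom_smult module_hom_closed T'.pure_smult\<close>)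
qed

lemma tensor_map_hom:
  assumes "tensor_pair B M N" "tensor_pair B M' N'" "f \<in> module_hom B M M'" "g \<in> module_hom B N N'"
  shows "tensor_map B M' N' f g \<in> add_hom (tensor B M N) (tensor B M' N')"
  unfolding tensor_map_def tensor_lift_group
  by (rule tensor_pair.lift_hom[OF assms(1) tensor_pair.T_abelian[OF assms(2)] tensor_map_balanced[OF assms]])

lemma tensor_map_pure:
  assumes "tensor_pair B M N" "tensor_pair B M' N'" "f \<in> module_hom B M M'" "g \<in> module_hom B N N'"
    and "m \<in> carrier M" "n \<in> carrier N"
  shows "tensor_map B M' N' f g (pure_tensor B M N m n) = pure_tensor B M' N' (f m) (g n)"
  unfolding tensor_map_def tensor_lift_group
  by (rule tensor_pair.lift_pure[OF assms(1) tensor_pair.T_abelian[OF assms(2)] tensor_map_balanced[OF assms(1-4)] assms(5,6)])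

lemma tensor_map_compose:
  assumes T: "tensor_pair B M N" "tensor_pair B M' N'" "tensor_pair B M'' N''"
    and f: "f \<in> module_hom B M M'" "f' \<in> module_hom B M' M''"
    and g: "g \<in> module_hom B N N'" "g' \<in> module_hom B N' N''"
    and h: "\<And>m. m \<in> carrier M \<Longrightarrow> h m = f' (f m)" "\<And>n. n \<in> carrier N \<Longrightarrow> k n = g' (g n)"
    and x: "x \<in> carrier (tensor B M N)"
  shows "tensor_map B M'' N'' f' g' (tensor_map B M' N' f g x) = tensor_map B M'' N'' h k x"
proof -
  interpret M: right_module B M by (rule tensor_pair.axioms(1)[OF T(1)])
  interpret N: left_module B N by (rule tensor_pair.axioms(2)[OF T(1)])
  have hk: "h \<in> module_hom B M M''" "k \<in> module_hom B N N''"
    using module_hom_compose[OF f] module_hom_compose[OF g]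
    by (auto simp: module_hom_def h M.smult_closed N.smult_closed)
  show ?thesis
    by (rule tensor_pair.T_hom_eqI[OF T(1) tensor_pair.T_abelian[OF T(3)] _ tensor_map_hom[OF T(1,3) hk] _ x])
      (use f g in \<open>auto simp: tensor_map_pure[OF T(1,2) f(1) g(1)] tensor_map_pure[OF T(2,3) f(2) g(2)]
        tensor_map_pure[OF T(1,3) hk] h module_hom_closed
        intro: add_hom_compose[OF tensor_map_hom[OF T(1,2) f(1) g(1)] tensor_map_hom[OF T(2,3) f(2) g(2)]]\<close>)
qed

lemma tensor_map_id:
  assumes T: "tensor_pair B M N" and h: "\<And>m. m \<in> carrier M \<Longrightarrow> h m = m"
    and x: "x \<in> carrier (tensor B M N)"
  shows "tensor_map B M N h id x = x"
proof -
  interpret M: right_module B M by (rule tensor_pair.axioms(1)[OF T])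
  have hm: "h \<in> module_hom B M M"
    by (auto simp: module_hom_def h M.smult_closed)
  have "tensor_map B M N h id x = id x"
    by (rule tensor_pair.T_hom_eqI[OF T tensor_pair.T_abelian[OF T] tensor_map_hom[OF T T hm module_hom_id] _ _ x])
      (auto simp: tensor_map_pure[OF T T hm module_hom_id] h hom_def)
  then show ?thesis by simp
qed

section \<open>Tensor products as modules\<close>

text \<open>
  A second action on the left factor that commutes with the scalars passes to the tensor product.
  Its ring may differ from the one over which the tensor product is taken.
\<close>

lemma tensor_right_module:
  fixes P :: "('s, ('m, 'n) tens, 'x) module_scheme" and M' :: "('s, 'm, 'y) module_scheme"
  assumes pair: "tensor_pair R M N" and M': "right_module S M'"
    and M'_eq: "carrier M' = carrier M" "add M' = add M"
    and act: "\<And>s. s \<in> carrier S \<Longrightarrow> (\<lambda>m. s \<odot>\<^bsub>M'\<^esub> m) \<in> module_hom R M M"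
    and P: "carrier P = carrier (tensor R M N)" "add P = add (tensor R M N)" "\<zero>\<^bsub>P\<^esub> = \<zero>\<^bsub>tensor R M N\<^esub>"
    and P_smult: "\<And>s x. \<lbrakk>s \<in> carrier S; x \<in> carrier (tensor R M N)\<rbrakk>
      \<Longrightarrow> s \<odot>\<^bsub>P\<^esub> x = tensor_map R M N (\<lambda>m. s \<odot>\<^bsub>M'\<^esub> m) id x"
  shows "right_module S P"
proof -
  interpret T: tensor_pair R M N by fact
  interpret M': right_module S M' by fact
  interpret TT: abelian_group T.T by (rule T.T_abelian)
  define \<rho> where "\<rho> s = tensor_map R M N (\<lambda>m. s \<odot>\<^bsub>M'\<^esub> m) id" for s
  have hom: "\<rho> s \<in> add_hom T.T T.T" if "s \<in> carrier S" for s
    unfolding \<rho>_def by (rule tensor_map_hom[OF pair pair act[OF that] module_hom_id])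
  have pure: "\<rho> s (T.pure m n) = T.pure (s \<odot>\<^bsub>M'\<^esub> m) n"
    if "s \<in> carrier S" "m \<in> carrier M" "n \<in> carrier N" for s m n
    unfolding \<rho>_def using tensor_map_pure[OF pair pair act[OF that(1)] module_hom_id that(2,3)] by simp
  have clo [simp]: "s \<odot>\<^bsub>M'\<^esub> m \<in> carrier M" if "s \<in> carrier S" "m \<in> carrier M" for s m
    using M'.smult_closed that M'_eq by auto
  have PT: "x \<oplus>\<^bsub>P\<^esub> y = x \<oplus>\<^bsub>T.T\<^esub> y" "\<zero>\<^bsub>P\<^esub> = \<zero>\<^bsub>T.T\<^esub>" for x y
    using P by simp_all
  have abP: "abelian_group P"
  proof -
    have "comm_group (add_monoid P)"
      by (rule comm_group_eqI[OF T.T_comm_group]) (simp_all add: P)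
    then show ?thesis
      by (intro abelian_group.intro abelian_monoid.intro abelian_group_axioms.intro)
        (auto simp: comm_group_def)
  qed
  have sm: "s \<odot>\<^bsub>P\<^esub> x = \<rho> s x" if "s \<in> carrier S" "x \<in> carrier T.T" for s x
    using P_smult[OF that] by (simp add: \<rho>_def)
  show ?thesis
  proof (intro right_module.intro right_module_axioms.intro M'.ring_axioms abP, unfold PT P)
    fix s t x assume s: "s \<in> carrier S" and t: "t \<in> carrier S" and x: "x \<in> carrier T.T"
    have st: "s \<oplus>\<^bsub>S\<^esub> t \<in> carrier S" "s \<otimes>\<^bsub>S\<^esub> t \<in> carrier S" using s t by auto
    have "\<rho> (s \<oplus>\<^bsub>S\<^esub> t) x = \<rho> s x \<oplus>\<^bsub>T.T\<^esub> \<rho> t x"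
    proof (rule T.T_hom_eqI[OF T.T_abelian hom[OF st(1)] add_hom_plus[OF T.T_abelian hom[OF s] hom[OF t]] _ x])
      fix m n assume mn: "m \<in> carrier M" "n \<in> carrier N"
      have "(s \<oplus>\<^bsub>S\<^esub> t) \<odot>\<^bsub>M'\<^esub> m = s \<odot>\<^bsub>M'\<^esub> m \<oplus>\<^bsub>M\<^esub> t \<odot>\<^bsub>M'\<^esub> m"
        using M'.smult_add_left[OF s t, of m] mn M'_eq by simp
      then show "\<rho> (s \<oplus>\<^bsub>S\<^esub> t) (T.pure m n) = \<rho> s (T.pure m n) \<oplus>\<^bsub>T.T\<^esub> \<rho> t (T.pure m n)"
        using mn s t st by (simp add: pure T.pure_add_left)
    qed
    then show "(s \<oplus>\<^bsub>S\<^esub> t) \<odot>\<^bsub>P\<^esub> x = s \<odot>\<^bsub>P\<^esub> x \<oplus>\<^bsub>T.T\<^esub> t \<odot>\<^bsub>P\<^esub> x"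
      using s t st x by (simp add: sm)
    have "\<rho> (s \<otimes>\<^bsub>S\<^esub> t) x = \<rho> t (\<rho> s x)"
    proof (rule T.T_hom_eqI[OF T.T_abelian hom[OF st(2)] add_hom_compose[OF hom[OF s] hom[OF t]] _ x])
      fix m n assume mn: "m \<in> carrier M" "n \<in> carrier N"
      then show "\<rho> (s \<otimes>\<^bsub>S\<^esub> t) (T.pure m n) = \<rho> t (\<rho> s (T.pure m n))"
        using s t st M'.smult_mult[OF s t, of m] M'_eq by (simp add: pure)
    qed
    then show "(s \<otimes>\<^bsub>S\<^esub> t) \<odot>\<^bsub>P\<^esub> x = t \<odot>\<^bsub>P\<^esub> (s \<odot>\<^bsub>P\<^esub> x)"
      using s t st x add_hom_closed[OF hom[OF s]] by (simp add: sm)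
  next
    fix s x assume s: "s \<in> carrier S" and x: "x \<in> carrier T.T"
    show "s \<odot>\<^bsub>P\<^esub> x \<in> carrier T.T" using s x add_hom_closed[OF hom[OF s]] by (simp add: sm)
  next
    fix s x y assume s: "s \<in> carrier S" and x: "x \<in> carrier T.T" "y \<in> carrier T.T"
    then show "s \<odot>\<^bsub>P\<^esub> (x \<oplus>\<^bsub>T.T\<^esub> y) = s \<odot>\<^bsub>P\<^esub> x \<oplus>\<^bsub>T.T\<^esub> s \<odot>\<^bsub>P\<^esub> y"
      by (simp add: sm add_hom_add[OF hom])
  next
    fix x assume x: "x \<in> carrier T.T"
    have "\<rho> \<one>\<^bsub>S\<^esub> x = id x"
    proof (rule T.T_hom_eqI[OF T.T_abelian hom _ _ x])
      fix m n assume mn: "m \<in> carrier M" "n \<in> carrier N"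
      then show "\<rho> \<one>\<^bsub>S\<^esub> (T.pure m n) = id (T.pure m n)"
        using M'.smult_unit[of m] M'_eq by (simp add: pure)
    qed (auto simp: hom_def)
    then show "\<one>\<^bsub>S\<^esub> \<odot>\<^bsub>P\<^esub> x = x" using x by (simp add: sm)
  qed
qed

lemma tensor_smult: "b \<odot>\<^bsub>tensor B M N\<^esub> x = tensor_map B M N (\<lambda>m. b \<odot>\<^bsub>M\<^esub> m) id x"
  by (simp add: tensor_def tensor_map_def Let_def)

lemma (in module) smult_module_hom: "r \<in> carrier R \<Longrightarrow> (\<lambda>m. r \<odot>\<^bsub>M\<^esub> m) \<in> module_hom R M M"
  by (intro module_homI add_homI) (auto simp: smult_r_distr smult_assoc1[symmetric] R.m_comm)

lemma tensor_module:
  assumes M: "module R M" and N: "module R N"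
  shows "module R (tensor R M N)"
proof (rule module_if_right_module)
  show "cring R" using M by (rule module.axioms(1))
  show "right_module R (tensor R M N)"
  proof (rule tensor_right_module[OF module_tensor_pair[OF M N] module.right_module[OF M]])
    show "(\<lambda>m. r \<odot>\<^bsub>M\<^esub> m) \<in> module_hom R M M" if "r \<in> carrier R" for r
      using that by (rule module.smult_module_hom[OF M])
    show "r \<odot>\<^bsub>tensor R M N\<^esub> x = tensor_map R M N (\<lambda>m. r \<odot>\<^bsub>M\<^esub> m) id x" for r x
      by (rule tensor_smult)
  qed (rule refl)+
qed

lemma tensor_smult_pure:
  assumes M: "module R M" and N: "module R N" and "r \<in> carrier R" "m \<in> carrier M" "n \<in> carrier N"
  shows "r \<odot>\<^bsub>tensor R M N\<^esub> pure_tensor R M N m n = pure_tensor R M N (r \<odot>\<^bsub>M\<^esub> m) n"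
  unfolding tensor_smult
  using tensor_map_pure[OF module_tensor_pair[OF M N] module_tensor_pair[OF M N]
      module.smult_module_hom[OF M assms(3)] module_hom_id assms(4,5)] by simp

lemma tensor_module_hom_if_pure:
  assumes M: "module R M" and N: "module R N" and G: "module R G"
    and f: "f \<in> add_hom (tensor R M N) G"
    and pure: "\<And>r m n. \<lbrakk>r \<in> carrier R; m \<in> carrier M; n \<in> carrier N\<rbrakk> \<Longrightarrow>
      f (pure_tensor R M N (r \<odot>\<^bsub>M\<^esub> m) n) = r \<odot>\<^bsub>G\<^esub> f (pure_tensor R M N m n)"
  shows "f \<in> module_hom R (tensor R M N) G"
proof (rule module_homI[OF f])
  interpret T: tensor_pair R M N by (rule module_tensor_pair[OF M N])
  interpret TM: module R "tensor R M N" by (rule tensor_module[OF M N])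
  interpret G: module R G by (rule G)
  fix r x assume r: "r \<in> carrier R" and x: "x \<in> carrier T.T"
  have l: "(\<lambda>x. f (r \<odot>\<^bsub>T.T\<^esub> x)) \<in> add_hom T.T G"
    by (rule add_hom_compose[OF module_hom_add_hom[OF TM.smult_module_hom[OF r]] f])
  have r': "(\<lambda>x. r \<odot>\<^bsub>G\<^esub> f x) \<in> add_hom T.T G"
    by (rule add_hom_compose[OF f module_hom_add_hom[OF G.smult_module_hom[OF r]]])
  show "f (r \<odot>\<^bsub>T.T\<^esub> x) = r \<odot>\<^bsub>G\<^esub> f x"
    by (rule T.T_hom_eqI[OF G.abelian_group_axioms l r' _ x])
      (simp add: tensor_smult_pure[OF M N] r pure)
qed

lemma tensor_map_module_hom:
  assumes M: "module R M" and N: "module R N" and M': "module R M'" and N': "module R N'"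
    and f: "f \<in> module_hom R M M'" and g: "g \<in> module_hom R N N'"
  shows "tensor_map R M' N' f g \<in> module_hom R (tensor R M N) (tensor R M' N')"
proof -
  note p = module_tensor_pair[OF M N] and p' = module_tensor_pair[OF M' N']
  show ?thesis
    using module.smult_closed[OF M]
    by (intro tensor_module_hom_if_pure[OF M N tensor_module[OF M' N'] tensor_map_hom[OF p p' f g]])
      (auto simp: tensor_map_pure[OF p p' f g] tensor_smult_pure[OF M' N'] module_hom_closed[OF f]
        module_hom_closed[OF g] module_hom_smult[OF f])
qed

lemma lift_module_hom:
  assumes M: "module R M" and N: "module R N" and G: "module R G"
    and bal: "balanced R M N G f"
    and lin: "\<And>r m n. \<lbrakk>r \<in> carrier R; m \<in> carrier M; n \<in> carrier N\<rbrakk> \<Longrightarrow> f (r \<odot>\<^bsub>M\<^esub> m) n = r \<odot>\<^bsub>G\<^esub> f m n"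
  shows "tensor_lift (add_monoid G) f \<in> module_hom R (tensor R M N) G"
proof -
  interpret T: tensor_pair R M N by (rule module_tensor_pair[OF M N])
  interpret G: module R G by (rule G)
  show ?thesis
    using module.smult_closed[OF M]
    by (intro tensor_module_hom_if_pure[OF M N G T.lift_hom[OF _ bal]])
      (auto simp: T.lift_pure[OF G.abelian_group_axioms bal] lin intro: G.abelian_group_axioms)
qed

section \<open>Reassociation\<close>

lemma
  assumes M: "module R M" and N: "module R N" and P: "module R P"
  shows tensor_assoc_module_hom:
      "tensor_assoc R M N P \<in> module_hom R (tensor R (tensor R M N) P) (tensor R M (tensor R N P))"
    and tensor_assoc_pure: "\<lbrakk>m \<in> carrier M; n \<in> carrier N; p \<in> carrier P\<rbrakk> \<Longrightarrow>
      tensor_assoc R M N P (pure_tensor R (tensor R M N) P (pure_tensor R M N m n) p)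
      = pure_tensor R M (tensor R N P) m (pure_tensor R N P n p)"
proof -
  interpret M: module R M by (rule M)
  interpret N: module R N by (rule N)
  interpret P: module R P by (rule P)
  note MN = tensor_module[OF M N] and NP = tensor_module[OF N P]
  interpret pMN: tensor_pair R M N by (rule module_tensor_pair[OF M N])
  interpret pNP: tensor_pair R N P by (rule module_tensor_pair[OF N P])
  interpret pMN_P: tensor_pair R "tensor R M N" P by (rule module_tensor_pair[OF MN P])
  interpret pM_NP: tensor_pair R M "tensor R N P" by (rule module_tensor_pair[OF M NP])
  interpret G: module R "tensor R M (tensor R N P)" by (rule tensor_module[OF M NP])
  let ?G = "tensor R M (tensor R N P)"
  define f where "f p = tensor_lift (add_monoid ?G) (\<lambda>m n. pM_NP.pure m (pNP.pure n p))" for p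
  have bal: "balanced R M N ?G (\<lambda>m n. pM_NP.pure m (pNP.pure n p))" if p: "p \<in> carrier P" for p
  proof (rule balancedI)
    show "(\<lambda>m. pM_NP.pure m (pNP.pure n p)) \<in> add_hom M ?G" if "n \<in> carrier N" for n
      using that p by (intro pM_NP.pure_hom_left pNP.pure_closed)
    show "(\<lambda>n. pM_NP.pure m (pNP.pure n p)) \<in> add_hom N ?G" if "m \<in> carrier M" for m
      by (rule add_hom_compose[OF pNP.pure_hom_left[OF p] pM_NP.pure_hom_right[OF that]])
  qed (use p in \<open>simp add: pM_NP.pure_smult tensor_smult_pure[OF N P]\<close>)
  have f_hom: "f p \<in> module_hom R (tensor R M N) ?G" if p: "p \<in> carrier P" for p
    unfolding f_def by (rule lift_module_hom[OF M N G.module_axioms bal[OF p]])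
      (use p in \<open>simp add: tensor_smult_pure[OF M NP]\<close>)
  have f_pure: "f p (pMN.pure m n) = pM_NP.pure m (pNP.pure n p)"
    if "m \<in> carrier M" "n \<in> carrier N" "p \<in> carrier P" for m n p
    unfolding f_def by (rule pMN.lift_pure[OF G.abelian_group_axioms bal[OF that(3)] that(1,2)])
  have f_add: "f (p \<oplus>\<^bsub>P\<^esub> q) t = f p t \<oplus>\<^bsub>?G\<^esub> f q t"
    if t: "t \<in> carrier (tensor R M N)" and p: "p \<in> carrier P" and q: "q \<in> carrier P" for p q t
  proof (rule pMN.T_hom_eqI[OF G.abelian_group_axioms module_hom_add_hom[OF f_hom] _ _ t])
    show "(\<lambda>t. f p t \<oplus>\<^bsub>?G\<^esub> f q t) \<in> add_hom (tensor R M N) ?G"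
      by (rule add_hom_plus[OF G.abelian_group_axioms module_hom_add_hom[OF f_hom[OF p]] module_hom_add_hom[OF f_hom[OF q]]])
  qed (use p q in \<open>auto simp: f_pure pNP.pure_add_right pM_NP.pure_add_right\<close>)
  have f_smult: "f (r \<odot>\<^bsub>P\<^esub> p) t = r \<odot>\<^bsub>?G\<^esub> f p t"
    if t: "t \<in> carrier (tensor R M N)" and p: "p \<in> carrier P" and r: "r \<in> carrier R" for p r t
  proof (rule pMN.T_hom_eqI[OF G.abelian_group_axioms module_hom_add_hom[OF f_hom] _ _ t])
    show "(\<lambda>t. r \<odot>\<^bsub>?G\<^esub> f p t) \<in> add_hom (tensor R M N) ?G"
      by (rule add_hom_compose[OF module_hom_add_hom[OF f_hom[OF p]]
            module_hom_add_hom[OF G.smult_module_hom[OF r]]])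
    show "f (r \<odot>\<^bsub>P\<^esub> p) (pMN.pure m n) = r \<odot>\<^bsub>?G\<^esub> f p (pMN.pure m n)"
      if "m \<in> carrier M" "n \<in> carrier N" for m n
      using that p r by (simp add: f_pure tensor_smult_pure[OF M NP] pNP.pure_smult[symmetric]
          pM_NP.pure_smult tensor_smult_pure[OF N P])
  qed (use p r in auto)
  have bal2: "balanced R (tensor R M N) P ?G (\<lambda>t p. f p t)"
  proof (rule balancedI)
    show "f p \<in> add_hom (tensor R M N) ?G" if "p \<in> carrier P" for p
      by (rule module_hom_add_hom[OF f_hom[OF that]])
    show "(\<lambda>p. f p t) \<in> add_hom P ?G" if "t \<in> carrier (tensor R M N)" for t
      by (rule add_homI) (use that f_add module_hom_closed[OF f_hom] in auto)
  qed (simp add: f_smult module_hom_smult[OF f_hom])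
  have eq: "tensor_assoc R M N P = tensor_lift (add_monoid ?G) (\<lambda>t p. f p t)"
    by (simp add: tensor_assoc_def Let_def tensor_lift_group f_def)
  show "tensor_assoc R M N P \<in> module_hom R (tensor R (tensor R M N) P) ?G"
    unfolding eq by (rule lift_module_hom[OF MN P G.module_axioms bal2])
      (simp add: module_hom_smult[OF f_hom])
  show "tensor_assoc R M N P (pMN_P.pure (pMN.pure m n) p) = pM_NP.pure m (pNP.pure n p)"
    if "m \<in> carrier M" "n \<in> carrier N" "p \<in> carrier P"
    unfolding eq using that
    by (subst pMN_P.lift_pure[OF G.abelian_group_axioms bal2]) (auto simp: f_pure)
qed

section \<open>Quotient modules\<close>

locale right_submodule = right_module R M
  for R :: "('b, 'c) ring_scheme" and M :: "('b, 'm, 'd) module_scheme" and I :: "'m set" +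
  assumes sub: "subgroup I (add_monoid M)"
    and sub_smult: "\<lbrakk>b \<in> carrier R; x \<in> I\<rbrakk> \<Longrightarrow> b \<odot>\<^bsub>M\<^esub> x \<in> I"
begin

abbreviation Q where "Q \<equiv> quot_module M I"
abbreviation proj where "proj x \<equiv> I +>\<^bsub>M\<^esub> x"

sublocale ab: abelian_subgroup I M
  by (rule abelian_subgroupI3) (auto simp: additive_subgroup_def sub intro: M.abelian_group_axioms)

lemma carrier_Q: "carrier Q = proj ` carrier M"
  by (auto simp: quot_module_def A_RCOSETS_def' )

lemma proj_closed [simp]: "x \<in> carrier M \<Longrightarrow> proj x \<in> carrier Q"
  by (simp add: carrier_Q)

lemma add_Q: "\<lbrakk>x \<in> carrier M; y \<in> carrier M\<rbrakk> \<Longrightarrow> proj x \<oplus>\<^bsub>Q\<^esub> proj y = proj (x \<oplus>\<^bsub>M\<^esub> y)"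
  by (simp add: quot_module_def ab.a_rcos_sum)

lemma zero_Q: "\<zero>\<^bsub>Q\<^esub> = I"
  by (simp add: quot_module_def)

lemma proj_zero_iff: "x \<in> carrier M \<Longrightarrow> proj x = \<zero>\<^bsub>Q\<^esub> \<longleftrightarrow> x \<in> I"
  unfolding zero_Q using ab.a_rcos_const[of x] ab.a_rcos_self[of x] by blast

lemma mem_proj_iff: "\<lbrakk>x \<in> carrier M; y \<in> carrier M\<rbrakk> \<Longrightarrow> x \<in> proj y \<longleftrightarrow> x \<ominus>\<^bsub>M\<^esub> y \<in> I"
  using ab.a_rcos_module[of y x] by (simp add: a_minus_def)

lemma proj_eq: "\<lbrakk>x \<in> carrier M; y \<in> carrier M; x \<ominus>\<^bsub>M\<^esub> y \<in> I\<rbrakk> \<Longrightarrow> proj x = proj y"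
  using ab.a_repr_independence'[of x y] mem_proj_iff[of x y] by auto

lemma smult_Q: 
  assumes "b \<in> carrier R" "x \<in> carrier M"
  shows "b \<odot>\<^bsub>Q\<^esub> proj x = proj (b \<odot>\<^bsub>M\<^esub> x)"
proof -
  have "proj (b \<odot>\<^bsub>M\<^esub> y) = proj (b \<odot>\<^bsub>M\<^esub> x)" if "y \<in> proj x" for y
  proof -
    have y: "y \<in> carrier M" using that assms by (meson ab.a_elemrcos_carrier)
    then have "y \<ominus>\<^bsub>M\<^esub> x \<in> I" using that assms
      by (simp add: mem_proj_iff)
    then have "b \<odot>\<^bsub>M\<^esub> (y \<ominus>\<^bsub>M\<^esub> x) \<in> I" by (intro sub_smult assms)
    then have "b \<odot>\<^bsub>M\<^esub> y \<ominus>\<^bsub>M\<^esub> b \<odot>\<^bsub>M\<^esub> x \<in> I"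
      using add_hom_diff[OF M.abelian_group_axioms M.abelian_group_axioms smult_hom[OF assms(1)] y assms(2)] by simp
    then show ?thesis using y assms by (intro proj_eq) (simp_all add: smult_closed)
  qed
  then have "(\<Union>y\<in>proj x. proj (b \<odot>\<^bsub>M\<^esub> y)) = (\<Union>y\<in>proj x. proj (b \<odot>\<^bsub>M\<^esub> x))"
    by (rule SUP_cong[OF refl])
  moreover have "proj x \<noteq> {}" using ab.a_rcos_self[OF assms(2)] by blast
  ultimately show ?thesis by (simp add: quot_module_def)
qed

lemma Q_abelian: "abelian_group Q"
proof -
  have "comm_group (add_monoid Q)"
    by (rule comm_group_eqI[OF ab.a_factorgroup_is_comm_group])
      (auto simp: quot_module_def A_FactGroup_def FactGroup_def A_RCOSETS_def set_add_def)
  then show ?thesis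
    by (intro abelian_group.intro abelian_monoid.intro abelian_group_axioms.intro)
      (auto simp: comm_group_def)
qed

lemma Q_right_module: "right_module R Q"
  by (intro right_module.intro right_module_axioms.intro R.ring_axioms Q_abelian)
    (auto simp: carrier_Q smult_Q add_Q smult_closed smult_add_left smult_add_right smult_mult smult_unit)

lemma proj_hom: "proj \<in> module_hom R M Q"
  by (intro module_homI add_homI) (auto simp: add_Q smult_Q)

lemma sub_right_module: "right_module R (M\<lparr>carrier := I\<rparr>)"
proof -
  have "comm_group (add_monoid M\<lparr>carrier := I\<rparr>)"
    using subgroup.subgroup_is_group[OF sub M.a_group] subgroup.subset[OF sub] M.a_comm
    by (intro group.group_comm_groupI) auto
  then have "comm_group (add_monoid (M\<lparr>carrier := I\<rparr>))"
    by (rule comm_group_eqI) simp_all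
  then have "abelian_group (M\<lparr>carrier := I\<rparr>)"
    by (intro abelian_group.intro abelian_monoid.intro abelian_group_axioms.intro)
      (auto simp: comm_group_def)
  moreover have "x \<in> carrier M" if "x \<in> I" for x
    using that subgroup.subset[OF sub] by auto
  ultimately show ?thesis
    by (intro right_module.intro right_module_axioms.intro R.ring_axioms)
      (auto simp: sub_smult smult_add_left smult_add_right smult_mult smult_unit)
qed

end

lemma right_submodule_if_submodule:
  assumes "module R M" "submodule I R M"
  shows "right_submodule R M I"
proof -
  interpret I: submodule I R M by fact
  show ?thesis
    by (intro right_submodule.intro right_submodule_axioms.intro module.right_module assms)
      (auto intro: I.subgroup_axioms)
qed

lemma quot_is_module: "\<lbrakk>module R M; submodule I R M\<rbrakk> \<Longrightarrow> module R (quot_module M I)"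
  by (rule module_if_right_module[OF module.axioms(1) right_submodule.Q_right_module[OF right_submodule_if_submodule]])

section \<open>Flatness\<close>

text \<open>
  The free right module of rank \<open>n\<close>, with lists as elements.
\<close>

definition list_module :: "('b, 'c) ring_scheme \<Rightarrow> nat \<Rightarrow> ('b, 'b list) module"
  where "list_module B n =
    \<lparr>carrier = {l. length l = n \<and> set l \<subseteq> carrier B}, monoid.mult = undefined, one = undefined,
     ring.zero = replicate n \<zero>\<^bsub>B\<^esub>, add = (\<lambda>l l'. map2 (\<oplus>\<^bsub>B\<^esub>) l l'),
     smult = (\<lambda>b l. map (\<lambda>x. x \<otimes>\<^bsub>B\<^esub> b) l)\<rparr>"

lemma (in ring) list_module_right_module: "right_module R (list_module R n)"
proof -
  let ?M = "list_module R n"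
  have nth: "l ! i \<in> carrier R" if "l \<in> carrier ?M" "i < n" for l i
    using that by (auto simp: list_module_def)
  have ab: "abelian_group ?M"
  proof (rule abelian_groupI)
    show "x \<oplus>\<^bsub>?M\<^esub> y \<in> carrier ?M" if "x \<in> carrier ?M" "y \<in> carrier ?M" for x y
      using nth[OF that(1)] nth[OF that(2)] that by (auto simp: list_module_def set_zip)
    show "\<exists>y\<in>carrier ?M. y \<oplus>\<^bsub>?M\<^esub> x = \<zero>\<^bsub>?M\<^esub>" if x: "x \<in> carrier ?M" for x
    proof (rule bexI)
      show "map (\<lambda>a. \<ominus> a) x \<in> carrier ?M" using x by (auto simp: list_module_def)
      show "map (\<lambda>a. \<ominus> a) x \<oplus>\<^bsub>?M\<^esub> x = \<zero>\<^bsub>?M\<^esub>"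
        using x nth[OF x] by (auto simp: list_module_def l_neg intro!: nth_equalityI)
    qed
  next
    show "\<zero>\<^bsub>?M\<^esub> \<in> carrier ?M" by (auto simp: list_module_def)
    show "x \<oplus>\<^bsub>?M\<^esub> y \<oplus>\<^bsub>?M\<^esub> z = x \<oplus>\<^bsub>?M\<^esub> (y \<oplus>\<^bsub>?M\<^esub> z)"
      if "x \<in> carrier ?M" "y \<in> carrier ?M" "z \<in> carrier ?M" for x y z
      using nth[OF that(1)] nth[OF that(2)] nth[OF that(3)] that
      by (auto simp: list_module_def a_assoc intro!: nth_equalityI)
    show "x \<oplus>\<^bsub>?M\<^esub> y = y \<oplus>\<^bsub>?M\<^esub> x" if "x \<in> carrier ?M" "y \<in> carrier ?M" for x y
      using nth[OF that(1)] nth[OF that(2)] that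
      by (auto simp: list_module_def intro!: nth_equalityI a_comm)
    show "\<zero>\<^bsub>?M\<^esub> \<oplus>\<^bsub>?M\<^esub> x = x" if "x \<in> carrier ?M" for x
      using nth[OF that] that by (auto simp: list_module_def intro!: nth_equalityI)
  qed
  show ?thesis
  proof (intro right_module.intro right_module_axioms.intro ring_axioms ab)
    fix a b x assume a: "a \<in> carrier R" and b: "b \<in> carrier R" and x: "x \<in> carrier ?M"
    note nx = nth[OF x] and len = x[unfolded list_module_def, simplified]
    show "a \<odot>\<^bsub>?M\<^esub> x \<in> carrier ?M"
      using a len by (auto simp: list_module_def)
    show "(a \<oplus> b) \<odot>\<^bsub>?M\<^esub> x = a \<odot>\<^bsub>?M\<^esub> x \<oplus>\<^bsub>?M\<^esub> b \<odot>\<^bsub>?M\<^esub> x"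
      using a b nx len by (auto simp: list_module_def r_distr intro!: nth_equalityI)
    show "(a \<otimes> b) \<odot>\<^bsub>?M\<^esub> x = b \<odot>\<^bsub>?M\<^esub> (a \<odot>\<^bsub>?M\<^esub> x)"
      using a b nx len by (auto simp: list_module_def m_assoc intro!: nth_equalityI)
  next
    fix a x y assume a: "a \<in> carrier R" and x: "x \<in> carrier ?M" and y: "y \<in> carrier ?M"
    note nx = nth[OF x] nth[OF y] and len = x[unfolded list_module_def, simplified] y[unfolded list_module_def, simplified]
    show "a \<odot>\<^bsub>?M\<^esub> (x \<oplus>\<^bsub>?M\<^esub> y) = a \<odot>\<^bsub>?M\<^esub> x \<oplus>\<^bsub>?M\<^esub> a \<odot>\<^bsub>?M\<^esub> y"
      using a nx len by (auto simp: list_module_def l_distr intro!: nth_equalityI)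
  next
    fix x assume x: "x \<in> carrier ?M"
    show "\<one> \<odot>\<^bsub>?M\<^esub> x = x"
      using nth[OF x] x[unfolded list_module_def, simplified]
      by (auto simp: list_module_def intro!: nth_equalityI)
  qed
qed

lemma list_module_nth:
  "\<lbrakk>l \<in> carrier (list_module B n); i < n\<rbrakk> \<Longrightarrow> l ! i \<in> carrier B"
  by (auto simp: list_module_def)

lemma list_module_nth_hom: "i < n \<Longrightarrow> (\<lambda>l. l ! i) \<in> add_hom (list_module B n) B"
  by (rule add_homI) (auto simp: list_module_def)

lemma list_module_eqI:
  "\<lbrakk>l \<in> carrier (list_module B n); l' \<in> carrier (list_module B n); \<And>i. i < n \<Longrightarrow> l ! i = l' ! i\<rbrakk> \<Longrightarrow> l = l'"
  by (auto simp: list_module_def intro!: nth_equalityI)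

definition unit_list :: "('b, 'c) ring_scheme \<Rightarrow> nat \<Rightarrow> nat \<Rightarrow> 'b list"
  where "unit_list B n i = map (\<lambda>j. if j = i then \<one>\<^bsub>B\<^esub> else \<zero>\<^bsub>B\<^esub>) [0..<n]"

lemma (in ring) unit_list_closed: "unit_list R n i \<in> carrier (list_module R n)"
  by (auto simp: unit_list_def list_module_def)

lemma unit_list_nth: "j < n \<Longrightarrow> unit_list B n i ! j = (if j = i then \<one>\<^bsub>B\<^esub> else \<zero>\<^bsub>B\<^esub>)"
  by (simp add: unit_list_def)

lemma (in ring) list_module_expand:
  assumes "l \<in> carrier (list_module R n)"
  shows "l = (\<Oplus>\<^bsub>list_module R n\<^esub>i\<in>{..<n}. l ! i \<odot>\<^bsub>list_module R n\<^esub> unit_list R n i)"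
proof (rule list_module_eqI[OF assms])
  interpret L: right_module R "list_module R n" by (rule list_module_right_module)
  have t: "l ! i \<odot>\<^bsub>list_module R n\<^esub> unit_list R n i \<in> carrier (list_module R n)" if "i < n" for i
    using that assms by (intro L.smult_closed unit_list_closed list_module_nth)
  then show "(\<Oplus>\<^bsub>list_module R n\<^esub>i\<in>{..<n}. l ! i \<odot>\<^bsub>list_module R n\<^esub> unit_list R n i) \<in> carrier (list_module R n)"
    by (intro L.finsum_closed) auto
  fix j assume j: "j < n"
  have "(\<Oplus>\<^bsub>list_module R n\<^esub>i\<in>{..<n}. l ! i \<odot>\<^bsub>list_module R n\<^esub> unit_list R n i) ! j
    = (\<Oplus>i\<in>{..<n}. (l ! i \<odot>\<^bsub>list_module R n\<^esub> unit_list R n i) ! j)"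
    using t by (intro add_hom_finsum[OF L.M.abelian_group_axioms abelian_group_axioms list_module_nth_hom[OF j]]) auto
  also have "\<dots> = (\<Oplus>i\<in>{..<n}. if j = i then l ! i else \<zero>)"
    using j assms
    by (intro finsum_cong') (auto simp: list_module_def unit_list_def set_conv_nth)
  also have "\<dots> = l ! j"
    using j assms by (intro finsum_singleton) (auto simp: list_module_def)
  finally show "l ! j = (\<Oplus>\<^bsub>list_module R n\<^esub>i\<in>{..<n}. l ! i \<odot>\<^bsub>list_module R n\<^esub> unit_list R n i) ! j" by simp
qed

text \<open>
  Cosets of the zero submodule copy a module with elements in \<open>'b list\<close> to one with elements in
  \<open>'b list set\<close>, the type of the test modules.
\<close>

abbreviation copy :: "('b, 'm, 'd) module_scheme \<Rightarrow> ('b, 'm set) module"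
  where "copy M \<equiv> quot_module M {\<zero>\<^bsub>M\<^esub>}"

lemma (in right_module)
  shows copy_right_module: "right_module R (copy M)"
    and copy_in: "(\<lambda>x. {x}) \<in> module_hom R M (copy M)"
    and copy_out: "the_elem \<in> module_hom R (copy M) M"
    and copy_carrier: "carrier (copy M) = (\<lambda>x. {x}) ` carrier M"
proof -
  have z: "b \<odot>\<^bsub>M\<^esub> \<zero>\<^bsub>M\<^esub> = \<zero>\<^bsub>M\<^esub>" if "b \<in> carrier R" for b
    by (rule add_hom_zero[OF M.abelian_group_axioms M.abelian_group_axioms smult_hom[OF that]])
  interpret S: right_submodule R M "{\<zero>\<^bsub>M\<^esub>}"
    by (intro right_submodule.intro right_submodule_axioms.intro right_module_axioms)
      (auto simp: z M.add.triv_subgroup[simplified])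
  have proj: "S.proj x = {x}" if "x \<in> carrier M" for x
    using that by (auto simp: a_r_coset_def')
  show "right_module R (copy M)" by (rule S.Q_right_module)
  show car: "carrier (copy M) = (\<lambda>x. {x}) ` carrier M" by (auto simp: S.carrier_Q proj)
  have add: "{x} \<oplus>\<^bsub>copy M\<^esub> {y} = {x \<oplus>\<^bsub>M\<^esub> y}" if "x \<in> carrier M" "y \<in> carrier M" for x y
    using S.add_Q[OF that] that by (simp add: proj)
  have sm: "b \<odot>\<^bsub>copy M\<^esub> {x} = {b \<odot>\<^bsub>M\<^esub> x}" if "b \<in> carrier R" "x \<in> carrier M" for b x
    using S.smult_Q[OF that] that by (simp add: proj smult_closed)
  show "(\<lambda>x. {x}) \<in> module_hom R M (copy M)"
    by (intro module_homI add_homI) (auto simp: car add sm)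
  show "the_elem \<in> module_hom R (copy M) M"
    by (intro module_homI add_homI) (auto simp: car add sm smult_closed)
qed

text \<open>
  Flatness in the form in which it is applied: exactness at the middle module of a sequence of modules
  of lists, which the copies turn into test modules.
\<close>

lemma flat_list_exact:
  fixes N1 N2 N3 :: "('b, 'b list) module" and M :: "('b, 'm, 'd) module_scheme"
  assumes flat: "flat_left_module B M"
    and N: "right_module B N1" "right_module B N2" "right_module B N3"
    and f: "f \<in> module_hom B N1 N2" and g: "g \<in> module_hom B N2 N3"
    and exact: "exact_at N1 N2 N3 f g"
    and t: "t \<in> carrier (tensor B N2 M)" "tensor_map B N3 M g id t = \<zero>\<^bsub>tensor B N3 M\<^esub>"
  obtains s where "s \<in> carrier (tensor B N1 M)" "tensor_map B N2 M f id s = t"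
proof -
  have M: "left_module B M" using flat by (simp add: flat_left_module_def)
  note cp = right_module.copy_right_module[OF N(1)] right_module.copy_right_module[OF N(2)]
    right_module.copy_right_module[OF N(3)]
  note ins = right_module.copy_in[OF N(1)] right_module.copy_in[OF N(2)] right_module.copy_in[OF N(3)]
  note out = right_module.copy_out[OF N(1)] right_module.copy_out[OF N(2)] right_module.copy_out[OF N(3)]
  note car = right_module.copy_carrier[OF N(1)] right_module.copy_carrier[OF N(2)] right_module.copy_carrier[OF N(3)]
  have p: "tensor_pair B N1 M" "tensor_pair B N2 M" "tensor_pair B N3 M"
    "tensor_pair B (copy N1) M" "tensor_pair B (copy N2) M" "tensor_pair B (copy N3) M"
    using N cp M by (auto intro: tensor_pair.intro)
  define f' where "f' X = {f (the_elem X)}" for X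
  define g' where "g' X = {g (the_elem X)}" for X
  have f': "f' \<in> module_hom B (copy N1) (copy N2)"
    unfolding f'_def by (rule module_hom_compose[OF module_hom_compose[OF out(1) f] ins(2)])
  have g': "g' \<in> module_hom B (copy N2) (copy N3)"
    unfolding g'_def by (rule module_hom_compose[OF module_hom_compose[OF out(2) g] ins(3)])
  have zero: "\<zero>\<^bsub>copy N3\<^esub> = {\<zero>\<^bsub>N3\<^esub>}" by (simp add: quot_module_def)
  have im: "f ` carrier N1 = {x \<in> carrier N2. g x = \<zero>\<^bsub>N3\<^esub>}"
    using exact by (simp add: exact_at_def a_kernel_def kernel_def)
  have "exact_at (copy N1) (copy N2) (copy N3) f' g'"
  proof -
    have "f' ` carrier (copy N1) = (\<lambda>x. {x}) ` (f ` carrier N1)"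
      by (simp add: car image_image f'_def)
    also have "\<dots> = {X \<in> carrier (copy N2). g' X = \<zero>\<^bsub>copy N3\<^esub>}"
      unfolding im by (auto simp: car g'_def zero)
    finally show ?thesis by (simp add: exact_at_def a_kernel_def kernel_def)
  qed
  then have ex: "exact_at (tensor B (copy N1) M) (tensor B (copy N2) M) (tensor B (copy N3) M)
         (tensor_map B (copy N2) M f' id) (tensor_map B (copy N3) M g' id)"
    using flat f' g' cp unfolding flat_left_module_def by blast
  define t' where "t' = tensor_map B (copy N2) M (\<lambda>x. {x}) id t"
  have t': "t' \<in> carrier (tensor B (copy N2) M)"
    unfolding t'_def by (rule add_hom_closed[OF tensor_map_hom[OF p(2,5) ins(2) module_hom_id] t(1)])
  have "tensor_map B (copy N3) M g' id t' = tensor_map B (copy N3) M (\<lambda>x. {g x}) id t"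
    unfolding t'_def
    by (rule tensor_map_compose[OF p(2,5,6) ins(2) g' module_hom_id module_hom_id _ _ t(1)]) (auto simp: g'_def)
  also have "\<dots> = tensor_map B (copy N3) M (\<lambda>x. {x}) id (tensor_map B N3 M g id t)"
    by (rule tensor_map_compose[OF p(2,3,6) g ins(3) module_hom_id module_hom_id _ _ t(1), symmetric]) auto
  also have "\<dots> = \<zero>\<^bsub>tensor B (copy N3) M\<^esub>"
    unfolding t(2)
    by (rule add_hom_zero[OF _ _ tensor_map_hom[OF p(3,6) ins(3) module_hom_id]])
      (auto intro: tensor_pair.T_abelian p)
  finally have "t' \<in> a_kernel (tensor B (copy N2) M) (tensor B (copy N3) M) (tensor_map B (copy N3) M g' id)"
    using t' by (simp add: a_kernel_def kernel_def)
  then have "t' \<in> tensor_map B (copy N2) M f' id ` carrier (tensor B (copy N1) M)"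
    using ex by (simp add: exact_at_def)
  then obtain s' where s': "s' \<in> carrier (tensor B (copy N1) M)" "tensor_map B (copy N2) M f' id s' = t'"
    by blast
  define s where "s = tensor_map B N1 M the_elem id s'"
  have "s \<in> carrier (tensor B N1 M)"
    unfolding s_def by (rule add_hom_closed[OF tensor_map_hom[OF p(4,1) out(1) module_hom_id] s'(1)])
  moreover have "tensor_map B N2 M f id s = t"
  proof -
    have "tensor_map B N2 M f id s = tensor_map B N2 M (\<lambda>X. f (the_elem X)) id s'"
      unfolding s_def
      by (rule tensor_map_compose[OF p(4,1,2) out(1) f module_hom_id module_hom_id _ _ s'(1)]) auto
    also have "\<dots> = tensor_map B N2 M the_elem id (tensor_map B (copy N2) M f' id s')"
      by (rule tensor_map_compose[OF p(4,5,2) f' out(2) module_hom_id module_hom_id _ _ s'(1), symmetric])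
        (auto simp: f'_def)
    also have "\<dots> = tensor_map B N2 M (\<lambda>x. x) id t"
      unfolding s'(2) t'_def
      by (rule tensor_map_compose[OF p(2,5,2) ins(2) out(2) module_hom_id module_hom_id _ _ t(1)]) auto
    also have "\<dots> = t" by (rule tensor_map_id[OF p(2) _ t(1)]) simp
    finally show ?thesis .
  qed
  ultimately show ?thesis by (rule that)
qed

text \<open>
  A triple \<open>(b, m, m')\<close> in \<open>F\<close> is a request for linearity at \<open>b m + m'\<close>. A flat module may have too few
  functionals that are linear everywhere, but it has enough that are linear at finitely many places.
\<close>

definition locally_linear ::
  "('b, 'c) ring_scheme \<Rightarrow> ('b, 'n, 'd) module_scheme \<Rightarrow> ('b \<times> 'n \<times> 'n) set \<Rightarrow> ('n \<Rightarrow> 'b) \<Rightarrow> bool"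
  where "locally_linear B N F \<gamma> \<longleftrightarrow> (\<forall>b m m'. (b, m, m') \<in> F \<longrightarrow>
    \<gamma> (b \<odot>\<^bsub>N\<^esub> m \<oplus>\<^bsub>N\<^esub> m') = b \<otimes>\<^bsub>B\<^esub> \<gamma> m \<oplus>\<^bsub>B\<^esub> \<gamma> m')"

text \<open>
  Let \<open>X\<close> be the finite set of elements of \<open>N\<close> that occur in \<open>X0\<close> or in \<open>F\<close>. Functions on \<open>X\<close> with
  values in \<open>B\<close> form the free module \<open>B\<^sup>n\<close>, and those that respect \<open>F\<close> form the kernel \<open>K\<close> of a map
  \<open>B\<^sup>n \<rightarrow> B\<^sup>p\<close>. The identity of \<open>X\<close> is the element \<open>t = \<Sum>\<^sub>i u\<^sub>i \<otimes> e\<^sub>i\<close> of \<open>B\<^sup>n \<otimes> N\<close>, where \<open>u\<^sub>i\<close> are the unit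
  vectors and \<open>e\<^sub>i\<close> the elements of \<open>X\<close>. It vanishes in \<open>B\<^sup>p \<otimes> N\<close>, as \<open>N\<close> itself satisfies the relations
  in \<open>F\<close>. Flatness puts \<open>t\<close> into the image of \<open>K \<otimes> N\<close>, and writing it as \<open>\<Sum>\<^sub>j l\<^sub>j \<otimes> y\<^sub>j\<close> with \<open>l\<^sub>j \<in> K\<close>
  gives the claim.
\<close>

lemma flat_local_dual_basis:
  fixes N :: "('b, 'n, 'd) module_scheme"
  assumes flat: "flat_left_module B N"
    and X0: "finite X0" "X0 \<subseteq> carrier N"
    and F: "finite F" "F \<subseteq> carrier B \<times> carrier N \<times> carrier N"
  shows "\<exists>(k :: nat) y \<gamma>. y \<in> {..<k} \<rightarrow> carrier N \<and> (\<forall>j<k. \<forall>a. \<gamma> j a \<in> carrier B) \<and>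
    (\<forall>j<k. locally_linear B N F (\<gamma> j)) \<and>
    (\<forall>a\<in>X0. a = (\<Oplus>\<^bsub>N\<^esub>j\<in>{..<k}. \<gamma> j a \<odot>\<^bsub>N\<^esub> y j))"
proof -
  interpret N: left_module B N using flat by (simp add: flat_left_module_def)
  define X where "X = X0 \<union> (\<lambda>(b, m, m'). m) ` F \<union> (\<lambda>(b, m, m'). m') ` F
    \<union> (\<lambda>(b, m, m'). b \<odot>\<^bsub>N\<^esub> m \<oplus>\<^bsub>N\<^esub> m') ` F"
  have X: "finite X" "X \<subseteq> carrier N"
    using X0 F by (auto simp: X_def intro!: N.smult_closed)
  have FX: "b \<in> carrier B" "m \<in> X" "m' \<in> X" "b \<odot>\<^bsub>N\<^esub> m \<oplus>\<^bsub>N\<^esub> m' \<in> X" if "(b, m, m') \<in> F" for b m m'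
    using that F by (auto simp: X_def image_iff intro: bexI[OF _ that])
  define n where "n = card X"
  obtain e where e: "bij_betw e {0..<n} X"
    using ex_bij_betw_nat_finite[OF X(1)] by (auto simp: n_def)
  define idx where "idx = the_inv_into {0..<n} e"
  have idx: "idx a < n" "e (idx a) = a" if "a \<in> X" for a
    using that e the_inv_into_into[of e "{0..<n}" a "{0..<n}"] f_the_inv_into_f_bij_betw[OF e, of a]
    by (auto simp: idx_def bij_betw_def)
  have eX: "e i \<in> X" if "i < n" for i using e that by (auto simp: bij_betw_def)
  (* The function on X given by the list l, extended by 0 to a function on all of N. *)
  define \<gamma> where "\<gamma> l a = (if a \<in> X then l ! idx a else \<zero>\<^bsub>B\<^esub>)" for l a
  let ?L = "list_module B n"
  interpret L: right_module B ?L by (rule N.R.list_module_right_module)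
  have \<gamma>_hom: "(\<lambda>l. \<gamma> l a) \<in> add_hom ?L B" for a
    using list_module_nth_hom[of "idx a" n B] idx
    by (cases "a \<in> X") (auto simp: \<gamma>_def hom_def)
  have \<gamma>_closed: "\<gamma> l a \<in> carrier B" if "l \<in> carrier ?L" for l a
    by (rule add_hom_closed[OF \<gamma>_hom that])
  have \<gamma>_smult: "\<gamma> (b \<odot>\<^bsub>?L\<^esub> l) a = \<gamma> l a \<otimes>\<^bsub>B\<^esub> b" if "l \<in> carrier ?L" "b \<in> carrier B" for l a b
    using that idx by (auto simp: \<gamma>_def list_module_def)
  obtain fs where fs: "set fs = F" using finite_list[OF F(1)] by blast
  define p where "p = length fs"
  let ?P = "list_module B p"
  interpret P: right_module B ?P by (rule N.R.list_module_right_module)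
  (* The defect of linearity of this function at a triple. *)
  define \<rho> where "\<rho> = (\<lambda>l (b, m, m'). \<gamma> l (b \<odot>\<^bsub>N\<^esub> m \<oplus>\<^bsub>N\<^esub> m') \<ominus>\<^bsub>B\<^esub> (b \<otimes>\<^bsub>B\<^esub> \<gamma> l m \<oplus>\<^bsub>B\<^esub> \<gamma> l m'))"
  have \<rho>_hom: "(\<lambda>l. \<rho> l q) \<in> add_hom ?L B" if "q \<in> F" for q
  proof -
    obtain b m m' where q: "q = (b, m, m')" by (cases q) auto
    then have b: "b \<in> carrier B" using FX that by blast
    show ?thesis
    proof (rule add_homI)
      fix l l' assume l: "l \<in> carrier ?L" and l': "l' \<in> carrier ?L"
      show "\<rho> (l \<oplus>\<^bsub>?L\<^esub> l') q = \<rho> l q \<oplus>\<^bsub>B\<^esub> \<rho> l' q"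
        using \<gamma>_closed[OF l] \<gamma>_closed[OF l'] b
        by (simp add: q \<rho>_def add_hom_add[OF \<gamma>_hom l l'] N.R.r_distr N.R.minus_add a_minus_def N.R.a_ac)
    qed (use \<gamma>_closed b in \<open>simp add: q \<rho>_def\<close>)
  qed
  have \<rho>_smult: "\<rho> (b \<odot>\<^bsub>?L\<^esub> l) q = \<rho> l q \<otimes>\<^bsub>B\<^esub> b" if "l \<in> carrier ?L" "b \<in> carrier B" "q \<in> F" for l b q
    using that \<gamma>_closed[OF that(1)] FX
    by (cases q) (auto simp: \<rho>_def \<gamma>_smult a_minus_def N.R.l_distr N.R.l_minus N.R.m_assoc)
  define g where "g l = map (\<rho> l) fs" for l
  have g: "g \<in> module_hom B ?L ?P"
  proof (intro module_homI add_homI)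
    fix l assume l: "l \<in> carrier ?L"
    show "g l \<in> carrier ?P"
      using add_hom_closed[OF \<rho>_hom l] by (auto simp: g_def list_module_def p_def fs)
    show "g (b \<odot>\<^bsub>?L\<^esub> l) = b \<odot>\<^bsub>?P\<^esub> g l" if "b \<in> carrier B" for b
      using \<rho>_smult[OF l that] by (auto simp: g_def list_module_def[of B p] fs)
    show "g (l \<oplus>\<^bsub>?L\<^esub> l') = g l \<oplus>\<^bsub>?P\<^esub> g l'" if "l' \<in> carrier ?L" for l'
      using add_hom_add[OF \<rho>_hom l that]
      by (auto simp: g_def list_module_def[of B p] fs map_zip_map map_zip_map2 zip_map_map
          zip_same_conv_map)
  qed
  define K where "K = {l \<in> carrier ?L. g l = \<zero>\<^bsub>?P\<^esub>}"
  have KD: "l \<in> carrier ?L" "g l = \<zero>\<^bsub>?P\<^esub>" if "l \<in> K" for l using that unfolding K_def by blast+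
  interpret K: right_submodule B ?L K
  proof (intro right_submodule.intro right_submodule_axioms.intro L.right_module_axioms)
    have "K = kernel (add_monoid ?L) (add_monoid ?P) g" by (simp add: K_def kernel_def)
    then show "subgroup K (add_monoid ?L)"
      using group_hom.subgroup_kernel[OF add_hom_group_hom[OF L.M.abelian_group_axioms
            P.M.abelian_group_axioms module_hom_add_hom[OF g]]] by simp
    fix b l assume "b \<in> carrier B" "l \<in> K"
    then show "b \<odot>\<^bsub>?L\<^esub> l \<in> K"
      using add_hom_zero[OF P.M.abelian_group_axioms P.M.abelian_group_axioms P.smult_hom]
      by (simp add: K_def L.smult_closed module_hom_smult[OF g])
  qed
  let ?K = "?L\<lparr>carrier := K\<rparr>"
  have K: "right_module B ?K" by (rule K.sub_right_module)
  have id_K: "id \<in> module_hom B ?K ?L"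
  proof (intro module_homI add_homI)
    show "id x \<in> carrier ?L" if "x \<in> carrier ?K" for x
      using that unfolding K_def by simp
  qed simp_all
  interpret pL: tensor_pair B ?L N by (intro tensor_pair.intro L.right_module_axioms N.left_module_axioms)
  interpret pP: tensor_pair B ?P N by (intro tensor_pair.intro P.right_module_axioms N.left_module_axioms)
  interpret pK: tensor_pair B ?K N by (intro tensor_pair.intro K N.left_module_axioms)
  interpret TL: abelian_group pL.T by (rule pL.T_abelian)
  interpret TP: abelian_group pP.T by (rule pP.T_abelian)
  let ?u = "unit_list B n"
  have u: "?u i \<in> carrier ?L" for i by (rule N.R.unit_list_closed)
  have eN: "e i \<in> carrier N" if "i < n" for i using eX that X by auto
  have dual: "(\<Oplus>\<^bsub>N\<^esub>i\<in>{..<n}. \<gamma> (?u i) a \<odot>\<^bsub>N\<^esub> e i) = a" if a: "a \<in> X" for a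
  proof -
    have "(\<Oplus>\<^bsub>N\<^esub>i\<in>{..<n}. \<gamma> (?u i) a \<odot>\<^bsub>N\<^esub> e i) = (\<Oplus>\<^bsub>N\<^esub>i\<in>{..<n}. if idx a = i then e i else \<zero>\<^bsub>N\<^esub>)"
      using a idx[OF a] eN add_hom_zero[OF N.R.abelian_group_axioms N.M.abelian_group_axioms N.smult_hom_scalar]
      by (intro N.finsum_cong') (auto simp: \<gamma>_def unit_list_nth N.smult_unit)
    also have "\<dots> = e (idx a)"
      using idx[OF a] eN by (intro N.finsum_singleton) auto
    finally show ?thesis using idx[OF a] by simp
  qed
  have rel: "(\<Oplus>\<^bsub>N\<^esub>i\<in>{..<n}. \<rho> (?u i) q \<odot>\<^bsub>N\<^esub> e i) = \<zero>\<^bsub>N\<^esub>" if "q \<in> F" for q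
  proof -
    obtain b m m' where q: "q = (b, m, m')" by (cases q) auto
    note bm = FX[OF that[unfolded q]]
    let ?s = "\<lambda>a i. \<gamma> (?u i) a \<odot>\<^bsub>N\<^esub> e i"
    have s: "?s a i \<in> carrier N" if "i < n" for a i
      using that eN \<gamma>_closed[OF u] by (intro N.smult_closed) auto
    have "(\<Oplus>\<^bsub>N\<^esub>i\<in>{..<n}. \<rho> (?u i) q \<odot>\<^bsub>N\<^esub> e i)
      = (\<Oplus>\<^bsub>N\<^esub>i\<in>{..<n}. ?s (b \<odot>\<^bsub>N\<^esub> m \<oplus>\<^bsub>N\<^esub> m') i \<oplus>\<^bsub>N\<^esub> \<ominus>\<^bsub>N\<^esub> (b \<odot>\<^bsub>N\<^esub> ?s m i \<oplus>\<^bsub>N\<^esub> ?s m' i))"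
    proof (rule N.finsum_cong'[OF refl])
      fix i assume i: "i \<in> {..<n}"
      note c = \<gamma>_closed[OF u, of i] and ei = eN[of i]
      show "\<rho> (?u i) q \<odot>\<^bsub>N\<^esub> e i
        = ?s (b \<odot>\<^bsub>N\<^esub> m \<oplus>\<^bsub>N\<^esub> m') i \<oplus>\<^bsub>N\<^esub> \<ominus>\<^bsub>N\<^esub> (b \<odot>\<^bsub>N\<^esub> ?s m i \<oplus>\<^bsub>N\<^esub> ?s m' i)"
        using c ei i bm(1)
          add_hom_minus[OF N.R.abelian_group_axioms N.M.abelian_group_axioms N.smult_hom_scalar[OF ei]]
        by (simp add: q \<rho>_def a_minus_def N.smult_add_left N.smult_mult)
    qed (use s bm in \<open>auto intro!: N.smult_closed N.add.m_closed N.a_inv_closed \<gamma>_closed[OF u] eN\<close>)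
    also have "\<dots> = (\<Oplus>\<^bsub>N\<^esub>i\<in>{..<n}. ?s (b \<odot>\<^bsub>N\<^esub> m \<oplus>\<^bsub>N\<^esub> m') i) \<oplus>\<^bsub>N\<^esub>
        (\<Oplus>\<^bsub>N\<^esub>i\<in>{..<n}. \<ominus>\<^bsub>N\<^esub> (b \<odot>\<^bsub>N\<^esub> ?s m i \<oplus>\<^bsub>N\<^esub> ?s m' i))"
      using s bm by (intro N.finsum_addf)
        (auto intro!: N.a_inv_closed N.add.m_closed N.smult_closed \<gamma>_closed[OF u] eN)
    also have "(\<Oplus>\<^bsub>N\<^esub>i\<in>{..<n}. \<ominus>\<^bsub>N\<^esub> (b \<odot>\<^bsub>N\<^esub> ?s m i \<oplus>\<^bsub>N\<^esub> ?s m' i))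
      = \<ominus>\<^bsub>N\<^esub> (\<Oplus>\<^bsub>N\<^esub>i\<in>{..<n}. b \<odot>\<^bsub>N\<^esub> ?s m i \<oplus>\<^bsub>N\<^esub> ?s m' i)"
    proof (rule add_hom_finsum[OF N.M.abelian_group_axioms N.M.abelian_group_axioms, symmetric])
      show "(\<lambda>x. \<ominus>\<^bsub>N\<^esub> x) \<in> add_hom N N" by (rule add_homI) (auto simp: N.minus_add)
    qed (use s bm in \<open>auto intro!: N.add.m_closed N.smult_closed \<gamma>_closed[OF u] eN\<close>)
    also have "(\<Oplus>\<^bsub>N\<^esub>i\<in>{..<n}. b \<odot>\<^bsub>N\<^esub> ?s m i \<oplus>\<^bsub>N\<^esub> ?s m' i)
      = (\<Oplus>\<^bsub>N\<^esub>i\<in>{..<n}. b \<odot>\<^bsub>N\<^esub> ?s m i) \<oplus>\<^bsub>N\<^esub> (\<Oplus>\<^bsub>N\<^esub>i\<in>{..<n}. ?s m' i)"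
      using s bm by (intro N.finsum_addf)
        (auto intro!: N.a_inv_closed N.add.m_closed N.smult_closed \<gamma>_closed[OF u] eN)
    also have "(\<Oplus>\<^bsub>N\<^esub>i\<in>{..<n}. b \<odot>\<^bsub>N\<^esub> ?s m i) = b \<odot>\<^bsub>N\<^esub> (\<Oplus>\<^bsub>N\<^esub>i\<in>{..<n}. ?s m i)"
      using s by (intro add_hom_finsum[OF N.M.abelian_group_axioms N.M.abelian_group_axioms
            N.smult_hom[OF bm(1)], symmetric]) auto
    also have "(\<Oplus>\<^bsub>N\<^esub>i\<in>{..<n}. ?s (b \<odot>\<^bsub>N\<^esub> m \<oplus>\<^bsub>N\<^esub> m') i) \<oplus>\<^bsub>N\<^esub>
      \<ominus>\<^bsub>N\<^esub> (b \<odot>\<^bsub>N\<^esub> (\<Oplus>\<^bsub>N\<^esub>i\<in>{..<n}. ?s m i) \<oplus>\<^bsub>N\<^esub> (\<Oplus>\<^bsub>N\<^esub>i\<in>{..<n}. ?s m' i)) = \<zero>\<^bsub>N\<^esub>"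
      unfolding dual[OF bm(2)] dual[OF bm(3)] dual[OF bm(4)]
      using bm X by (intro N.r_neg) (auto intro!: N.smult_closed)
    finally show ?thesis .
  qed
  define t where "t = (\<Oplus>\<^bsub>pL.T\<^esub>i\<in>{..<n}. pL.pure (?u i) (e i))"
  have tc: "(\<lambda>i. pL.pure (?u i) (e i)) \<in> {..<n} \<rightarrow> carrier pL.T" using u eN by auto
  have t: "t \<in> carrier pL.T" unfolding t_def by (rule TL.finsum_closed[OF tc])
  have \<rho>N: "\<rho> (?u i) (fs ! q) \<in> carrier B" if "q < p" for i q
    using add_hom_closed[OF \<rho>_hom u, of "fs ! q"] that fs by (auto simp: p_def)
  have "tensor_map B ?P N g id t = (\<Oplus>\<^bsub>pP.T\<^esub>i\<in>{..<n}. pP.pure (g (?u i)) (e i))"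
    unfolding t_def
    by (subst add_hom_finsum[OF pL.T_abelian pP.T_abelian tensor_map_hom[OF pL.tensor_pair_axioms
            pP.tensor_pair_axioms g module_hom_id] tc], rule TP.finsum_cong'[OF refl])
      (use u eN module_hom_closed[OF g] in \<open>auto simp: tensor_map_pure[OF pL.tensor_pair_axioms
        pP.tensor_pair_axioms g module_hom_id]\<close>)
  also have "\<dots> = (\<Oplus>\<^bsub>pP.T\<^esub>i\<in>{..<n}. \<Oplus>\<^bsub>pP.T\<^esub>q\<in>{..<p}. pP.pure (unit_list B p q) (\<rho> (?u i) (fs ! q) \<odot>\<^bsub>N\<^esub> e i))"
  proof (rule TP.finsum_cong'[OF refl])
    have gc: "g (?u i) ! q \<in> carrier B" if "q < p" for i q
      using list_module_nth[OF module_hom_closed[OF g u] that] .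
    have gq: "g (?u i) ! q = \<rho> (?u i) (fs ! q)" if "q < p" for i q using that by (simp add: g_def p_def)
    show "(\<lambda>i. \<Oplus>\<^bsub>pP.T\<^esub>q\<in>{..<p}. pP.pure (unit_list B p q) (\<rho> (?u i) (fs ! q) \<odot>\<^bsub>N\<^esub> e i)) \<in> {..<n} \<rightarrow> carrier pP.T"
      using \<rho>N eN by (auto intro!: TP.finsum_closed pP.pure_closed N.smult_closed N.R.unit_list_closed)
    fix i assume i: "i \<in> {..<n}"
    then have ei: "e i \<in> carrier N" using eN by simp
    have sc: "g (?u i) ! q \<odot>\<^bsub>?P\<^esub> unit_list B p q \<in> carrier ?P" if "q < p" for q
      using that gc by (intro P.smult_closed N.R.unit_list_closed)
    have "pP.pure (g (?u i)) (e i)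
      = pP.pure (\<Oplus>\<^bsub>?P\<^esub>q\<in>{..<p}. g (?u i) ! q \<odot>\<^bsub>?P\<^esub> unit_list B p q) (e i)"
      using N.R.list_module_expand[OF module_hom_closed[OF g u]] by simp
    also have "\<dots> = (\<Oplus>\<^bsub>pP.T\<^esub>q\<in>{..<p}. pP.pure (g (?u i) ! q \<odot>\<^bsub>?P\<^esub> unit_list B p q) (e i))"
      using sc by (intro add_hom_finsum[OF P.M.abelian_group_axioms pP.T_abelian pP.pure_hom_left[OF ei]]) auto
    also have "\<dots> = (\<Oplus>\<^bsub>pP.T\<^esub>q\<in>{..<p}. pP.pure (unit_list B p q) (\<rho> (?u i) (fs ! q) \<odot>\<^bsub>N\<^esub> e i))"
    proof (rule TP.finsum_cong'[OF refl])
      show "(\<lambda>q. pP.pure (unit_list B p q) (\<rho> (?u i) (fs ! q) \<odot>\<^bsub>N\<^esub> e i)) \<in> {..<p} \<rightarrow> carrier pP.T"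
        using \<rho>N ei by (auto intro!: pP.pure_closed N.smult_closed N.R.unit_list_closed)
    qed (use gc gq ei in \<open>auto simp: pP.pure_smult N.R.unit_list_closed\<close>)
    finally show "pP.pure (g (?u i)) (e i)
      = (\<Oplus>\<^bsub>pP.T\<^esub>q\<in>{..<p}. pP.pure (unit_list B p q) (\<rho> (?u i) (fs ! q) \<odot>\<^bsub>N\<^esub> e i))" .
  qed
  also have "\<dots> = (\<Oplus>\<^bsub>pP.T\<^esub>q\<in>{..<p}. \<Oplus>\<^bsub>pP.T\<^esub>i\<in>{..<n}. pP.pure (unit_list B p q) (\<rho> (?u i) (fs ! q) \<odot>\<^bsub>N\<^esub> e i))"
  proof (rule TP.finsum_swap)
    fix i q assume "i \<in> {..<n}" "q \<in> {..<p}"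
    then show "pP.pure (unit_list B p q) (\<rho> (?u i) (fs ! q) \<odot>\<^bsub>N\<^esub> e i) \<in> carrier pP.T"
      using add_hom_closed[OF \<rho>_hom u, of "fs ! q"] fs eN
      by (intro pP.pure_closed N.smult_closed N.R.unit_list_closed) (auto simp: p_def)
  qed auto
  also have "\<dots> = (\<Oplus>\<^bsub>pP.T\<^esub>q\<in>{..<p}. \<zero>\<^bsub>pP.T\<^esub>)"
  proof (rule TP.finsum_cong'[OF refl])
    fix q assume "q \<in> {..<p}"
    then have q: "fs ! q \<in> F" using fs by (auto simp: p_def)
    have c: "\<rho> (?u i) (fs ! q) \<odot>\<^bsub>N\<^esub> e i \<in> carrier N" if "i < n" for i
      using add_hom_closed[OF \<rho>_hom[OF q] u] eN[OF that] by (rule N.smult_closed)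
    have "(\<Oplus>\<^bsub>pP.T\<^esub>i\<in>{..<n}. pP.pure (unit_list B p q) (\<rho> (?u i) (fs ! q) \<odot>\<^bsub>N\<^esub> e i))
      = pP.pure (unit_list B p q) (\<Oplus>\<^bsub>N\<^esub>i\<in>{..<n}. \<rho> (?u i) (fs ! q) \<odot>\<^bsub>N\<^esub> e i)"
      using c by (intro add_hom_finsum[OF N.M.abelian_group_axioms pP.T_abelian
            pP.pure_hom_right[OF N.R.unit_list_closed], symmetric]) auto
    then show "(\<Oplus>\<^bsub>pP.T\<^esub>i\<in>{..<n}. pP.pure (unit_list B p q) (\<rho> (?u i) (fs ! q) \<odot>\<^bsub>N\<^esub> e i)) = \<zero>\<^bsub>pP.T\<^esub>"
      by (simp add: rel[OF q] pP.pure_zero_right N.R.unit_list_closed)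
  qed simp
  also have "\<dots> = \<zero>\<^bsub>pP.T\<^esub>" by (rule TP.finsum_zero)
  finally have gt: "tensor_map B ?P N g id t = \<zero>\<^bsub>pP.T\<^esub>" .
  have "{l \<in> carrier ?L. g l = \<zero>\<^bsub>?P\<^esub>} = K" by (simp only: K_def)
  then have "exact_at ?K ?L ?P id g"
    by (simp add: exact_at_def a_kernel_def kernel_def)
  from flat_list_exact[OF flat K L.right_module_axioms P.right_module_axioms id_K g this t gt]
  obtain s where s: "s \<in> carrier pK.T" "tensor_map B ?L N id id s = t" .
  obtain k :: nat and l y where l: "l \<in> {..<k} \<rightarrow> K" and y: "y \<in> {..<k} \<rightarrow> carrier N"
    and s_eq: "s = (\<Oplus>\<^bsub>pK.T\<^esub>j\<in>{..<k}. pK.pure (l j) (y j))"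
    using pK.T_finsumE[OF s(1), simplified] by blast
  have lL: "l j \<in> carrier ?L" if "j < k" for j
    by (rule KD(1), rule funcset_mem[OF l]) (use that in simp)
  have t_eq: "t = (\<Oplus>\<^bsub>pL.T\<^esub>j\<in>{..<k}. pL.pure (l j) (y j))"
  proof -
    have c: "(\<lambda>j. pK.pure (l j) (y j)) \<in> {..<k} \<rightarrow> carrier pK.T"
      by (intro funcsetI pK.pure_closed) (simp_all add: funcset_mem[OF l] funcset_mem[OF y])
    show ?thesis
      unfolding s(2)[symmetric] s_eq
      by (subst add_hom_finsum[OF pK.T_abelian pL.T_abelian tensor_map_hom[OF pK.tensor_pair_axioms
            pL.tensor_pair_axioms id_K module_hom_id] c], rule TL.finsum_cong'[OF refl])
        (use lL in \<open>simp_all add: Pi_iff funcset_mem[OF l] funcset_mem[OF y]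
          tensor_map_pure[OF pK.tensor_pair_axioms pL.tensor_pair_axioms id_K module_hom_id]\<close>)
  qed
  have eval: "a = (\<Oplus>\<^bsub>N\<^esub>j\<in>{..<k}. \<gamma> (l j) a \<odot>\<^bsub>N\<^esub> y j)" if a: "a \<in> X" for a
  proof -
    have bal: "balanced B ?L N N (\<lambda>l y. \<gamma> l a \<odot>\<^bsub>N\<^esub> y)"
    proof (rule balancedI)
      show "(\<lambda>l. \<gamma> l a \<odot>\<^bsub>N\<^esub> y) \<in> add_hom ?L N" if "y \<in> carrier N" for y
        by (rule add_hom_compose[OF \<gamma>_hom N.smult_hom_scalar[OF that]])
      show "(\<lambda>y. \<gamma> l a \<odot>\<^bsub>N\<^esub> y) \<in> add_hom N N" if "l \<in> carrier ?L" for l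
        by (rule N.smult_hom[OF \<gamma>_closed[OF that]])
    qed (simp add: \<gamma>_smult N.smult_mult \<gamma>_closed)
    let ?ev = "tensor_lift (add_monoid N) (\<lambda>l y. \<gamma> l a \<odot>\<^bsub>N\<^esub> y)"
    note ev = pL.lift_hom[OF N.M.abelian_group_axioms bal] and ev_pure = pL.lift_pure[OF N.M.abelian_group_axioms bal]
    have "?ev t = (\<Oplus>\<^bsub>N\<^esub>i\<in>{..<n}. \<gamma> (?u i) a \<odot>\<^bsub>N\<^esub> e i)"
      unfolding t_def
      by (subst add_hom_finsum[OF pL.T_abelian N.M.abelian_group_axioms ev tc], rule N.finsum_cong'[OF refl])
        (use u eN \<gamma>_closed in \<open>auto simp: ev_pure intro!: N.smult_closed\<close>)
    moreover have "?ev t = (\<Oplus>\<^bsub>N\<^esub>j\<in>{..<k}. \<gamma> (l j) a \<odot>\<^bsub>N\<^esub> y j)"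
    proof -
      have c: "(\<lambda>j. pL.pure (l j) (y j)) \<in> {..<k} \<rightarrow> carrier pL.T"
        by (intro funcsetI pL.pure_closed) (simp_all add: lL funcset_mem[OF y])
      show ?thesis
        unfolding t_eq
        by (subst add_hom_finsum[OF pL.T_abelian N.M.abelian_group_axioms ev c], rule N.finsum_cong'[OF refl])
          (use lL \<gamma>_closed in \<open>auto simp: ev_pure funcset_mem[OF y] intro!: N.smult_closed\<close>)
    qed
    ultimately show ?thesis using dual[OF a] by simp
  qed
  show ?thesis
  proof (intro exI[of _ k] exI[of _ y] exI[of _ "\<lambda>j. \<gamma> (l j)"] conjI allI impI ballI)
    show "y \<in> {..<k} \<rightarrow> carrier N" by (rule y)
    show "\<gamma> (l j) a \<in> carrier B" if "j < k" for j a using \<gamma>_closed lL that by blast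
    have "\<gamma> (l j) (b \<odot>\<^bsub>N\<^esub> m \<oplus>\<^bsub>N\<^esub> m') = b \<otimes>\<^bsub>B\<^esub> \<gamma> (l j) m \<oplus>\<^bsub>B\<^esub> \<gamma> (l j) m'"
      if "j < k" "(b, m, m') \<in> F" for j b m m'
    proof -
      have "g (l j) = \<zero>\<^bsub>?P\<^esub>" by (rule KD(2), rule funcset_mem[OF l]) (use that in simp)
      then have "\<rho> (l j) (b, m, m') = \<zero>\<^bsub>B\<^esub>"
        using that(2) fs unfolding g_def list_module_def
        by (auto simp: in_set_conv_nth list_eq_iff_nth_eq) (metis)
      then show ?thesis
        using \<gamma>_closed[OF lL[OF that(1)]] FX[OF that(2)] by (simp add: \<rho>_def N.R.diff_zero_iff)
    qed
    then show "locally_linear B N F (\<gamma> (l j))" if "j < k" for j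
      using that unfolding locally_linear_def by blast
    show "a = (\<Oplus>\<^bsub>N\<^esub>j\<in>{..<k}. \<gamma> (l j) a \<odot>\<^bsub>N\<^esub> y j)" if "a \<in> X0" for a
      by (rule eval) (use that in \<open>simp add: X_def\<close>)
  qed
qed

section \<open>The equational criterion\<close>

text \<open>
  Moving coefficients across the tensor sign; with \<open>flat_vanishing\<close> it shows that the vanishing of
  \<open>\<Sum>\<^sub>i c\<^sub>i\<^sub>j m\<^sub>i\<close> for all \<open>j\<close> is the reason for \<open>\<Sum>\<^sub>i m\<^sub>i \<otimes> a\<^sub>i = 0\<close>.
\<close>

lemma (in tensor_pair) finsum_exchange:
  fixes k :: nat
  assumes I: "finite I" "m \<in> I \<rightarrow> carrier M" and y: "y \<in> {..<k} \<rightarrow> carrier N"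
    and c: "\<And>i j. \<lbrakk>i \<in> I; j < k\<rbrakk> \<Longrightarrow> c i j \<in> carrier B"
    and a: "\<And>i. i \<in> I \<Longrightarrow> a i = (\<Oplus>\<^bsub>N\<^esub>j\<in>{..<k}. c i j \<odot>\<^bsub>N\<^esub> y j)"
  shows "(\<Oplus>\<^bsub>T\<^esub>i\<in>I. m i \<boxtimes> a i) = (\<Oplus>\<^bsub>T\<^esub>j\<in>{..<k}. (\<Oplus>\<^bsub>M\<^esub>i\<in>I. c i j \<odot>\<^bsub>M\<^esub> m i) \<boxtimes> y j)"
proof -
  interpret T: abelian_group T by (rule T_abelian)
  have m: "m i \<in> carrier M" if "i \<in> I" for i using I that by auto
  have y': "y j \<in> carrier N" if "j < k" for j using y that by auto
  have "(\<Oplus>\<^bsub>T\<^esub>i\<in>I. m i \<boxtimes> a i) = (\<Oplus>\<^bsub>T\<^esub>i\<in>I. \<Oplus>\<^bsub>T\<^esub>j\<in>{..<k}. (c i j \<odot>\<^bsub>M\<^esub> m i) \<boxtimes> y j)"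
  proof (rule T.finsum_cong'[OF refl])
    show "(\<lambda>i. \<Oplus>\<^bsub>T\<^esub>j\<in>{..<k}. (c i j \<odot>\<^bsub>M\<^esub> m i) \<boxtimes> y j) \<in> I \<rightarrow> carrier T"
      using m y' c by (auto intro!: T.finsum_closed pure_closed M.smult_closed)
    fix i assume i: "i \<in> I"
    have "m i \<boxtimes> a i = (\<Oplus>\<^bsub>T\<^esub>j\<in>{..<k}. m i \<boxtimes> (c i j \<odot>\<^bsub>N\<^esub> y j))"
      unfolding a[OF i] using i c y'
      by (intro add_hom_finsum[OF N.M.abelian_group_axioms T_abelian pure_hom_right[OF m[OF i]]])
        (auto intro!: N.smult_closed)
    also have "\<dots> = (\<Oplus>\<^bsub>T\<^esub>j\<in>{..<k}. (c i j \<odot>\<^bsub>M\<^esub> m i) \<boxtimes> y j)"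
    proof (rule T.finsum_cong'[OF refl])
      show "(\<lambda>j. (c i j \<odot>\<^bsub>M\<^esub> m i) \<boxtimes> y j) \<in> {..<k} \<rightarrow> carrier T"
        using i m y' c by (auto intro!: pure_closed M.smult_closed)
    qed (use i m y' c in \<open>simp add: pure_smult\<close>)
    finally show "m i \<boxtimes> a i = (\<Oplus>\<^bsub>T\<^esub>j\<in>{..<k}. (c i j \<odot>\<^bsub>M\<^esub> m i) \<boxtimes> y j)" .
  qed
  also have "\<dots> = (\<Oplus>\<^bsub>T\<^esub>j\<in>{..<k}. \<Oplus>\<^bsub>T\<^esub>i\<in>I. (c i j \<odot>\<^bsub>M\<^esub> m i) \<boxtimes> y j)"
    using I m y' c by (intro T.finsum_swap) (auto intro!: pure_closed M.smult_closed)
  also have "\<dots> = (\<Oplus>\<^bsub>T\<^esub>j\<in>{..<k}. (\<Oplus>\<^bsub>M\<^esub>i\<in>I. c i j \<odot>\<^bsub>M\<^esub> m i) \<boxtimes> y j)"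
  proof (rule T.finsum_cong'[OF refl])
    show "(\<lambda>j. (\<Oplus>\<^bsub>M\<^esub>i\<in>I. c i j \<odot>\<^bsub>M\<^esub> m i) \<boxtimes> y j) \<in> {..<k} \<rightarrow> carrier T"
      using m y' c by (auto intro!: pure_closed M.finsum_closed M.smult_closed)
    fix j assume j: "j \<in> {..<k}"
    show "(\<Oplus>\<^bsub>T\<^esub>i\<in>I. (c i j \<odot>\<^bsub>M\<^esub> m i) \<boxtimes> y j) = (\<Oplus>\<^bsub>M\<^esub>i\<in>I. c i j \<odot>\<^bsub>M\<^esub> m i) \<boxtimes> y j"
      using j c m y'
      by (intro add_hom_finsum[OF M.M.abelian_group_axioms T_abelian pure_hom_left, symmetric])
        (auto intro!: M.smult_closed)
  qed
  finally show ?thesis .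
qed

text \<open>
  A linear functional \<open>\<gamma>\<close> on \<open>N\<close> induces a map \<open>M \<otimes> N \<rightarrow> M\<close>, \<open>m \<otimes> n \<mapsto> m \<gamma>(n)\<close>. For a fixed element of
  the kernel only finitely many relators matter, so it is sent to 0 as soon as \<open>\<gamma>\<close> is linear at
  finitely many places \<open>E\<close>. These do not depend on \<open>\<gamma>\<close>, which is what allows \<open>\<gamma>\<close> to be chosen after \<open>E\<close>.
\<close>

lemma (in tensor_pair) kernel_vanishing:
  assumes c: "c \<in> K"
  shows "\<exists>E. finite E \<and> E \<subseteq> carrier B \<times> carrier N \<times> carrier N \<and>
    (\<forall>\<gamma> h. (\<forall>n. \<gamma> n \<in> carrier B) \<longrightarrow> locally_linear B N E \<gamma> \<longrightarrow>
    h \<in> hom F (add_monoid M) \<longrightarrow>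
    (\<forall>m\<in>carrier M. \<forall>n\<in>carrier N. h (frag_of (m, n)) = \<gamma> n \<odot>\<^bsub>M\<^esub> m) \<longrightarrow> h c = \<zero>\<^bsub>M\<^esub>)"
    (is "\<exists>E. _ \<and> _ \<and> ?good E c")
proof -
  let ?P = "\<lambda>c. \<exists>E. finite E \<and> E \<subseteq> carrier B \<times> carrier N \<times> carrier N \<and> ?good E c"
  have hom: "group_hom F (add_monoid M) h"
    if "h \<in> hom F (add_monoid M)" for h
    using that by (intro group_hom.intro group_hom_axioms.intro M.a_group) simp_all
  have rel: "?P c" if r: "c \<in> tensor_relators B M N" for c
  proof -
    note h_diff = free_hom_diff[OF M.abelian_group_axioms]
    from r show ?thesis
      unfolding tensor_relators_def
    proof (elim UnE CollectE exE conjE)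
      fix m m' n assume c: "c = frag_of (m \<oplus>\<^bsub>M\<^esub> m', n) - frag_of (m, n) - frag_of (m', n)"
        and A: "m \<in> carrier M" "m' \<in> carrier M" "n \<in> carrier N"
      have "?good {} c"
      proof (intro allI impI)
        fix \<gamma> h assume g: "\<forall>n. \<gamma> n \<in> carrier B"
          and h: "h \<in> hom F (add_monoid M)"
          and hv: "\<forall>m\<in>carrier M. \<forall>n\<in>carrier N. h (frag_of (m, n)) = \<gamma> n \<odot>\<^bsub>M\<^esub> m"
        have "h c = \<gamma> n \<odot>\<^bsub>M\<^esub> (m \<oplus>\<^bsub>M\<^esub> m') \<ominus>\<^bsub>M\<^esub> \<gamma> n \<odot>\<^bsub>M\<^esub> m \<ominus>\<^bsub>M\<^esub> \<gamma> n \<odot>\<^bsub>M\<^esub> m'"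
          using A frag_diff_closed by (simp add: c h_diff[OF h] hv)
        then show "h c = \<zero>\<^bsub>M\<^esub>" using A g by (simp add: M.smult_add_right M.add_minus_minus M.smult_closed)
      qed
      then show ?thesis by blast
    next
      fix m n n' assume c: "c = frag_of (m, n \<oplus>\<^bsub>N\<^esub> n') - frag_of (m, n) - frag_of (m, n')"
        and A: "m \<in> carrier M" "n \<in> carrier N" "n' \<in> carrier N"
      have "?good {(\<one>\<^bsub>B\<^esub>, n, n')} c"
      proof (intro allI impI)
        fix \<gamma> h assume g: "\<forall>n. \<gamma> n \<in> carrier B" and res: "locally_linear B N {(\<one>\<^bsub>B\<^esub>, n, n')} \<gamma>"
          and h: "h \<in> hom F (add_monoid M)"
          and hv: "\<forall>m\<in>carrier M. \<forall>n\<in>carrier N. h (frag_of (m, n)) = \<gamma> n \<odot>\<^bsub>M\<^esub> m"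
        have "h c = \<gamma> (n \<oplus>\<^bsub>N\<^esub> n') \<odot>\<^bsub>M\<^esub> m \<ominus>\<^bsub>M\<^esub> \<gamma> n \<odot>\<^bsub>M\<^esub> m \<ominus>\<^bsub>M\<^esub> \<gamma> n' \<odot>\<^bsub>M\<^esub> m"
          using A frag_diff_closed by (simp add: c h_diff[OF h] hv)
        moreover have "\<gamma> (n \<oplus>\<^bsub>N\<^esub> n') = \<gamma> n \<oplus>\<^bsub>B\<^esub> \<gamma> n'"
          using res A g by (simp add: locally_linear_def N.smult_unit)
        ultimately show "h c = \<zero>\<^bsub>M\<^esub>" using A g by (simp add: M.smult_add_left M.add_minus_minus M.smult_closed)
      qed
      then show ?thesis using A by (intro exI[of _ "{(\<one>\<^bsub>B\<^esub>, n, n')}"]) simp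
    next
      fix b m n assume c: "c = frag_of (b \<odot>\<^bsub>M\<^esub> m, n) - frag_of (m, b \<odot>\<^bsub>N\<^esub> n)"
        and A: "b \<in> carrier B" "m \<in> carrier M" "n \<in> carrier N"
      have bn: "b \<odot>\<^bsub>N\<^esub> n \<in> carrier N" "b \<odot>\<^bsub>M\<^esub> m \<in> carrier M"
        using A by (auto intro: N.smult_closed M.smult_closed)
      let ?F = "{(b, n, \<zero>\<^bsub>N\<^esub>), (\<one>\<^bsub>B\<^esub>, \<zero>\<^bsub>N\<^esub>, \<zero>\<^bsub>N\<^esub>)}"
      have "?good ?F c"
      proof (intro allI impI)
        fix \<gamma> h assume g: "\<forall>n. \<gamma> n \<in> carrier B" and res: "locally_linear B N ?F \<gamma>"
          and h: "h \<in> hom F (add_monoid M)"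
          and hv: "\<forall>m\<in>carrier M. \<forall>n\<in>carrier N. h (frag_of (m, n)) = \<gamma> n \<odot>\<^bsub>M\<^esub> m"
        have "h c = \<gamma> n \<odot>\<^bsub>M\<^esub> (b \<odot>\<^bsub>M\<^esub> m) \<ominus>\<^bsub>M\<^esub> \<gamma> (b \<odot>\<^bsub>N\<^esub> n) \<odot>\<^bsub>M\<^esub> m"
          using A bn by (simp add: c h_diff[OF h] hv)
        moreover have "\<gamma> (b \<odot>\<^bsub>N\<^esub> n) = b \<otimes>\<^bsub>B\<^esub> \<gamma> n"
        proof -
          (* The triple (1, 0, 0) forces the value at 0 to be 0. *)
          have "\<gamma> \<zero>\<^bsub>N\<^esub> = \<gamma> \<zero>\<^bsub>N\<^esub> \<oplus>\<^bsub>B\<^esub> \<gamma> \<zero>\<^bsub>N\<^esub>"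
            using res g by (simp add: locally_linear_def N.smult_unit)
          then have "\<gamma> \<zero>\<^bsub>N\<^esub> = \<zero>\<^bsub>B\<^esub>" using g by (metis M.R.add.l_cancel_one')
          then show ?thesis using res A bn g by (simp add: locally_linear_def)
        qed
        ultimately show "h c = \<zero>\<^bsub>M\<^esub>"
          using A bn g by (simp add: M.smult_mult M.smult_closed M.r_neg a_minus_def)
      qed
      then show ?thesis using A by (intro exI[of _ ?F]) simp
    qed
  qed
  show "?P c"
    using c unfolding tensor_kernel_def
  proof (induction rule: generate.induct)
    case one
    have "?good {} 0"
      using group_hom.hom_one[OF hom] by auto
    then show ?case by (intro exI[of _ "{}"]) simp
  next
    case (incl c)
    then show ?case by (rule rel)
  next
    case (inv c)
    obtain E where E: "finite E" "E \<subseteq> carrier B \<times> carrier N \<times> carrier N" "?good E c"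
      using rel[OF inv] by blast
    have "c \<in> carrier F"
      using relators_carrier inv by blast
    then have h_inv: "h (inv\<^bsub>F\<^esub> c) = inv\<^bsub>add_monoid M\<^esub> h c"
      if "h \<in> hom F (add_monoid M)" for h
      using group_hom.hom_inv[OF hom[OF that]] by blast
    then have "?good E (inv\<^bsub>F\<^esub> c)"
    proof (intro allI impI)
      fix \<gamma> h assume g: "\<forall>n. \<gamma> n \<in> carrier B" and res: "locally_linear B N E \<gamma>"
        and h: "h \<in> hom F (add_monoid M)"
        and hv: "\<forall>m\<in>carrier M. \<forall>n\<in>carrier N. h (frag_of (m, n)) = \<gamma> n \<odot>\<^bsub>M\<^esub> m"
      have "h c = \<zero>\<^bsub>M\<^esub>" using E(3) g res h hv by blast
      moreover have "\<ominus>\<^bsub>M\<^esub> \<zero>\<^bsub>M\<^esub> = \<zero>\<^bsub>M\<^esub>" by (rule M.minus_equality) auto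
      ultimately show "h (inv\<^bsub>F\<^esub> c) = \<zero>\<^bsub>M\<^esub>"
        using h_inv[OF h]
        by (simp only: a_inv_def)
    qed
    with E show ?case by blast
  next
    case (eng c d)
    obtain E where E: "finite E" "E \<subseteq> carrier B \<times> carrier N \<times> carrier N" "?good E c"
      using eng.IH(1) by blast
    obtain E' where E': "finite E'" "E' \<subseteq> carrier B \<times> carrier N \<times> carrier N" "?good E' d"
      using eng.IH(2) by blast
    have cd: "c \<in> carrier F"
      "d \<in> carrier F"
      using eng.hyps subgroup.subset[OF K_subgroup] unfolding tensor_kernel_def by blast+
    have "?good (E \<union> E') (c \<otimes>\<^bsub>F\<^esub> d)"
    proof (intro allI impI)
      fix \<gamma> h assume g: "\<forall>n. \<gamma> n \<in> carrier B" and res: "locally_linear B N (E \<union> E') \<gamma>"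
        and h: "h \<in> hom F (add_monoid M)"
        and hv: "\<forall>m\<in>carrier M. \<forall>n\<in>carrier N. h (frag_of (m, n)) = \<gamma> n \<odot>\<^bsub>M\<^esub> m"
      have "locally_linear B N E \<gamma>" "locally_linear B N E' \<gamma>" using res by (auto simp: locally_linear_def)
      then have "h c = \<zero>\<^bsub>M\<^esub>" "h d = \<zero>\<^bsub>M\<^esub>" using E(3) E'(3) g h hv by blast+
      then show "h (c \<otimes>\<^bsub>F\<^esub> d) = \<zero>\<^bsub>M\<^esub>"
        using hom_mult[OF h cd] by simp
    qed
    with E(1,2) E'(1,2) show ?case by (intro exI[of _ "E \<union> E'"]) simp
  qed
qed

text \<open>
  The equational criterion. The functionals \<open>\<gamma>\<^sub>j\<close> of a local dual basis for the \<open>a\<^sub>i\<close> can be chosen to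
  be linear at the finitely many places that witness the vanishing of the sum; then the coefficients
  \<open>c\<^sub>i\<^sub>j = \<gamma>\<^sub>j(a\<^sub>i)\<close> do what is required.
\<close>

lemma flat_vanishing:
  fixes M :: "('b, 'm, 'e) module_scheme" and N :: "('b, 'n, 'd) module_scheme"
  assumes flat: "flat_left_module B N" and M: "right_module B M"
    and I: "finite I" "m \<in> I \<rightarrow> carrier M" "a \<in> I \<rightarrow> carrier N"
    and zero: "(\<Oplus>\<^bsub>tensor B M N\<^esub>i\<in>I. pure_tensor B M N (m i) (a i)) = \<zero>\<^bsub>tensor B M N\<^esub>"
  shows "\<exists>(k :: nat) y c. y \<in> {..<k} \<rightarrow> carrier N \<and> (\<forall>i\<in>I. \<forall>j<k. c i j \<in> carrier B) \<and>
    (\<forall>i\<in>I. a i = (\<Oplus>\<^bsub>N\<^esub>j\<in>{..<k}. c i j \<odot>\<^bsub>N\<^esub> y j)) \<and>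
    (\<forall>j<k. (\<Oplus>\<^bsub>M\<^esub>i\<in>I. c i j \<odot>\<^bsub>M\<^esub> m i) = \<zero>\<^bsub>M\<^esub>)"
proof -
  interpret M: right_module B M by (rule M)
  interpret N: left_module B N using flat by (simp add: flat_left_module_def)
  interpret T: tensor_pair B M N by (intro tensor_pair.intro M N.left_module_axioms)
  interpret TT: abelian_group T.T by (rule T.T_abelian)
  let ?F = "free_Abelian_group (carrier M \<times> carrier N)"
  let ?c = "\<lambda>I. \<Sum>i\<in>I. frag_of (m i, a i)"
  have c: "?c J \<in> carrier ?F \<and> T.K #>\<^bsub>?F\<^esub> ?c J = (\<Oplus>\<^bsub>T.T\<^esub>i\<in>J. T.pure (m i) (a i))" if "J \<subseteq> I" for J
    using finite_subset[OF that I(1)] that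
  proof (induction J)
    case empty
    have "T.K #>\<^bsub>?F\<^esub> 0 = \<zero>\<^bsub>T.T\<^esub>"
      using subgroup.one_closed[OF T.K_subgroup] by (subst T.coset_eq_zero_iff) auto
    then show ?case by (simp add: TT.finsum_empty)
  next
    case (insert i J)
    then have *: "frag_of (m i, a i) \<in> carrier ?F" "?c J \<in> carrier ?F"
      "(\<lambda>i. T.pure (m i) (a i)) \<in> J \<rightarrow> carrier T.T" "T.pure (m i) (a i) \<in> carrier T.T"
      using I by (auto simp: Pi_iff)
    have "frag_of (m i, a i) + ?c J \<in> carrier ?F"
      using *(1,2) keys_add[of "frag_of (m i, a i)" "?c J"] by auto
    moreover have "T.K #>\<^bsub>?F\<^esub> (frag_of (m i, a i) + ?c J) = T.pure (m i) (a i) \<oplus>\<^bsub>T.T\<^esub> (\<Oplus>\<^bsub>T.T\<^esub>i\<in>J. T.pure (m i) (a i))"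
      using insert by (subst T.coset_add[OF *(1,2), symmetric]) (simp add: pure_tensor_def)
    ultimately show ?case
      using insert(1,2) *(3,4) by (simp add: TT.finsum_insert)
  qed
  then have "?c I \<in> T.K"
    using zero T.coset_eq_zero_iff[of "?c I"] by auto
  from T.kernel_vanishing[OF this] obtain F where F: "finite F" "F \<subseteq> carrier B \<times> carrier N \<times> carrier N"
    and van: "\<forall>\<gamma> h. (\<forall>n. \<gamma> n \<in> carrier B) \<longrightarrow> locally_linear B N F \<gamma> \<longrightarrow> h \<in> hom ?F (add_monoid M) \<longrightarrow>
      (\<forall>m\<in>carrier M. \<forall>n\<in>carrier N. h (frag_of (m, n)) = \<gamma> n \<odot>\<^bsub>M\<^esub> m) \<longrightarrow> h (?c I) = \<zero>\<^bsub>M\<^esub>"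
    by (elim exE conjE) (rule that)
  have aI: "finite (a ` I)" "a ` I \<subseteq> carrier N" using I by auto
  obtain k :: nat and y \<gamma> where y: "y \<in> {..<k} \<rightarrow> carrier N"
    and "\<forall>j<k. \<forall>a. \<gamma> j a \<in> carrier B" and res: "\<forall>j<k. locally_linear B N F (\<gamma> j)"
    and dual: "\<forall>x\<in>a ` I. x = (\<Oplus>\<^bsub>N\<^esub>j\<in>{..<k}. \<gamma> j x \<odot>\<^bsub>N\<^esub> y j)"
    using flat_local_dual_basis[OF flat aI F] by blast
  then have \<gamma>: "\<gamma> j a \<in> carrier B" if "j < k" for j a using that by blast
  show ?thesis
  proof (intro exI[of _ k] exI[of _ y] exI[of _ "\<lambda>i j. \<gamma> j (a i)"] conjI allI impI)
    fix j assume j: "j < k"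
    let ?g = "\<lambda>p. \<gamma> j (snd p) \<odot>\<^bsub>M\<^esub> fst p"
    have "?g ` (carrier M \<times> carrier N) \<subseteq> carrier (add_monoid M)"
      using \<gamma>[OF j] by (auto intro!: M.smult_closed)
    from comm_group.free_Abelian_group_universal[OF M.a_comm_group this]
    obtain h where h: "h \<in> hom ?F (add_monoid M)"
      and hv: "\<And>p. p \<in> carrier M \<times> carrier N \<Longrightarrow> h (frag_of p) = ?g p" by metis
    have "h (?c J) = (\<Oplus>\<^bsub>M\<^esub>i\<in>J. \<gamma> j (a i) \<odot>\<^bsub>M\<^esub> m i)" if "J \<subseteq> I" for J
      using finite_subset[OF that I(1)] that
    proof (induction J)
      case empty
      interpret h: group_hom ?F "add_monoid M" h
        using h by (intro group_hom.intro group_hom_axioms.intro M.a_group) simp_all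
      show ?case using h.hom_one by simp
    next
      case (insert i J)
      then have *: "frag_of (m i, a i) \<in> carrier ?F" "?c J \<in> carrier ?F"
        "(\<lambda>i. \<gamma> j (a i) \<odot>\<^bsub>M\<^esub> m i) \<in> J \<rightarrow> carrier M" "\<gamma> j (a i) \<odot>\<^bsub>M\<^esub> m i \<in> carrier M"
        and mem: "(m i, a i) \<in> carrier M \<times> carrier N"
        using I c[of J] \<gamma>[OF j] by (auto simp: Pi_iff intro!: M.smult_closed)
      show ?case
        using hom_mult[OF h *(1,2)] hv[OF mem] insert *(3,4) by (simp add: M.finsum_insert)
    qed
    from this[of I] show "(\<Oplus>\<^bsub>M\<^esub>i\<in>I. \<gamma> j (a i) \<odot>\<^bsub>M\<^esub> m i) = \<zero>\<^bsub>M\<^esub>"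
      using van[rule_format, of "\<gamma> j" h] \<gamma>[OF j] res j h hv by auto
  qed (use y \<gamma> dual in auto)
qed

section \<open>Elements of a tensor product that vanish modulo a submodule\<close>

lemma tensor_swap:
  assumes M: "module R M" and N: "module R N"
  obtains \<sigma> where "\<sigma> \<in> add_hom (tensor R M N) (tensor R N M)"
    "\<And>m n. \<lbrakk>m \<in> carrier M; n \<in> carrier N\<rbrakk> \<Longrightarrow> \<sigma> (pure_tensor R M N m n) = pure_tensor R N M n m"
proof -
  interpret T: tensor_pair R M N by (rule module_tensor_pair[OF M N])
  interpret T': tensor_pair R N M by (rule module_tensor_pair[OF N M])
  have bal: "balanced R M N T'.T (\<lambda>m n. T'.pure n m)"
    by (intro balancedI T'.pure_hom_left T'.pure_hom_right) (simp_all add: T'.pure_smult)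
  show ?thesis
    using that[OF T.lift_hom[OF T'.T_abelian bal] T.lift_pure[OF T'.T_abelian bal]] .
qed

lemma tensor_map_finsum:
  assumes T: "tensor_pair B M N" "tensor_pair B M' N'" and f: "f \<in> module_hom B M M'" and g: "g \<in> module_hom B N N'"
    and m: "m \<in> I \<rightarrow> carrier M" and n: "n \<in> I \<rightarrow> carrier N"
  shows "tensor_map B M' N' f g (\<Oplus>\<^bsub>tensor B M N\<^esub>i\<in>I. pure_tensor B M N (m i) (n i))
    = (\<Oplus>\<^bsub>tensor B M' N'\<^esub>i\<in>I. pure_tensor B M' N' (f (m i)) (g (n i)))"
proof -
  interpret T: tensor_pair B M N by (rule T)
  interpret T': tensor_pair B M' N' by (rule T)
  interpret TT: abelian_group T'.T by (rule T'.T_abelian)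
  have "(\<lambda>i. T.pure (m i) (n i)) \<in> I \<rightarrow> carrier T.T"
    using m n by (auto simp: Pi_iff)
  then have "tensor_map B M' N' f g (\<Oplus>\<^bsub>T.T\<^esub>i\<in>I. T.pure (m i) (n i))
    = (\<Oplus>\<^bsub>T'.T\<^esub>i\<in>I. tensor_map B M' N' f g (T.pure (m i) (n i)))"
    by (rule add_hom_finsum[OF T.T_abelian T'.T_abelian tensor_map_hom[OF T f g]])
  also have "\<dots> = (\<Oplus>\<^bsub>T'.T\<^esub>i\<in>I. T'.pure (f (m i)) (g (n i)))"
  proof (rule TT.finsum_cong'[OF refl])
    show "(\<lambda>i. T'.pure (f (m i)) (g (n i))) \<in> I \<rightarrow> carrier T'.T"
      using m n f g by (auto simp: Pi_iff module_hom_closed)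
  qed (use m n in \<open>auto simp: Pi_iff tensor_map_pure[OF T f g]\<close>)
  finally show ?thesis .
qed

lemma tensor_swap_finsum:
  assumes M: "module R M" and N: "module R N"
    and \<sigma>: "\<sigma> \<in> add_hom (tensor R M N) (tensor R N M)"
    and \<sigma>_pure: "\<And>m n. \<lbrakk>m \<in> carrier M; n \<in> carrier N\<rbrakk>
      \<Longrightarrow> \<sigma> (pure_tensor R M N m n) = pure_tensor R N M n m"
    and m: "m \<in> I \<rightarrow> carrier M" and n: "n \<in> I \<rightarrow> carrier N"
  shows "\<sigma> (\<Oplus>\<^bsub>tensor R M N\<^esub>i\<in>I. pure_tensor R M N (m i) (n i))
    = (\<Oplus>\<^bsub>tensor R N M\<^esub>i\<in>I. pure_tensor R N M (n i) (m i))"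
proof -
  interpret T: tensor_pair R M N by (rule module_tensor_pair[OF M N])
  interpret T': tensor_pair R N M by (rule module_tensor_pair[OF N M])
  interpret TT: abelian_group T'.T by (rule T'.T_abelian)
  have "(\<lambda>i. T.pure (m i) (n i)) \<in> I \<rightarrow> carrier T.T" using m n by (auto simp: Pi_iff)
  then have "\<sigma> (\<Oplus>\<^bsub>T.T\<^esub>i\<in>I. T.pure (m i) (n i)) = (\<Oplus>\<^bsub>T'.T\<^esub>i\<in>I. \<sigma> (T.pure (m i) (n i)))"
    by (rule add_hom_finsum[OF T.T_abelian T'.T_abelian \<sigma>])
  also have "\<dots> = (\<Oplus>\<^bsub>T'.T\<^esub>i\<in>I. T'.pure (n i) (m i))"
  proof (rule TT.finsum_cong'[OF refl])
    show "(\<lambda>i. T'.pure (n i) (m i)) \<in> I \<rightarrow> carrier T'.T" using m n by (auto simp: Pi_iff)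
  qed (use m n in \<open>auto simp: Pi_iff \<sigma>_pure\<close>)
  finally show ?thesis .
qed

lemma finsum_exchange_left:
  fixes k :: nat
  assumes M: "module R M" and N: "module R N"
    and I: "finite I" "m \<in> I \<rightarrow> carrier M" "n \<in> I \<rightarrow> carrier N" and y: "y \<in> {..<k} \<rightarrow> carrier M"
    and c: "\<And>i j. \<lbrakk>i \<in> I; j < k\<rbrakk> \<Longrightarrow> c i j \<in> carrier R"
    and m: "\<And>i. i \<in> I \<Longrightarrow> m i = (\<Oplus>\<^bsub>M\<^esub>j\<in>{..<k}. c i j \<odot>\<^bsub>M\<^esub> y j)"
  shows "(\<Oplus>\<^bsub>tensor R M N\<^esub>i\<in>I. pure_tensor R M N (m i) (n i))
    = (\<Oplus>\<^bsub>tensor R M N\<^esub>j\<in>{..<k}. pure_tensor R M N (y j) (\<Oplus>\<^bsub>N\<^esub>i\<in>I. c i j \<odot>\<^bsub>N\<^esub> n i))"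
proof -
  interpret N: module R N by (rule N)
  interpret T': tensor_pair R N M by (rule module_tensor_pair[OF N M])
  obtain \<sigma> where \<sigma>: "\<sigma> \<in> add_hom T'.T (tensor R M N)"
    "\<And>n m. \<lbrakk>n \<in> carrier N; m \<in> carrier M\<rbrakk> \<Longrightarrow> \<sigma> (T'.pure n m) = pure_tensor R M N m n"
    using tensor_swap[OF N M] by blast
  have n': "(\<lambda>j. \<Oplus>\<^bsub>N\<^esub>i\<in>I. c i j \<odot>\<^bsub>N\<^esub> n i) \<in> {..<k} \<rightarrow> carrier N"
    using I c by (auto intro!: N.finsum_closed simp: Pi_iff)
  have "(\<Oplus>\<^bsub>T'.T\<^esub>i\<in>I. T'.pure (n i) (m i))
    = (\<Oplus>\<^bsub>T'.T\<^esub>j\<in>{..<k}. T'.pure (\<Oplus>\<^bsub>N\<^esub>i\<in>I. c i j \<odot>\<^bsub>N\<^esub> n i) (y j))"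
    by (rule T'.finsum_exchange[OF I(1,3) y c m])
  from trans[OF trans[OF tensor_swap_finsum[OF N M \<sigma> I(3,2), symmetric] arg_cong[OF this, of \<sigma>]]
      tensor_swap_finsum[OF N M \<sigma> n' y]]
  show ?thesis .
qed

text \<open>
  Over a commutative ring the flat factor may as well stand on the left, as it does in \<open>A \<otimes> H\<close>.
\<close>

lemma flat_vanishing_left:
  assumes flat: "flat_left_module R A" and A: "module R A" and M: "module R M"
    and I: "finite I" "a \<in> I \<rightarrow> carrier A" "m \<in> I \<rightarrow> carrier M"
    and zero: "(\<Oplus>\<^bsub>tensor R A M\<^esub>i\<in>I. pure_tensor R A M (a i) (m i)) = \<zero>\<^bsub>tensor R A M\<^esub>"
  shows "\<exists>(k :: nat) y c. y \<in> {..<k} \<rightarrow> carrier A \<and> (\<forall>i\<in>I. \<forall>j<k. c i j \<in> carrier R) \<and>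
    (\<forall>i\<in>I. a i = (\<Oplus>\<^bsub>A\<^esub>j\<in>{..<k}. c i j \<odot>\<^bsub>A\<^esub> y j)) \<and>
    (\<forall>j<k. (\<Oplus>\<^bsub>M\<^esub>i\<in>I. c i j \<odot>\<^bsub>M\<^esub> m i) = \<zero>\<^bsub>M\<^esub>)"
proof -
  obtain \<sigma> where \<sigma>: "\<sigma> \<in> add_hom (tensor R A M) (tensor R M A)"
    "\<And>a m. \<lbrakk>a \<in> carrier A; m \<in> carrier M\<rbrakk> \<Longrightarrow> \<sigma> (pure_tensor R A M a m) = pure_tensor R M A m a"
    using tensor_swap[OF A M] by blast
  have "\<sigma> \<zero>\<^bsub>tensor R A M\<^esub> = \<zero>\<^bsub>tensor R M A\<^esub>"
    by (rule add_hom_zero[OF _ _ \<sigma>(1)]) (intro tensor_pair.T_abelian module_tensor_pair A M)+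
  then have "(\<Oplus>\<^bsub>tensor R M A\<^esub>i\<in>I. pure_tensor R M A (m i) (a i)) = \<zero>\<^bsub>tensor R M A\<^esub>"
    using tensor_swap_finsum[OF A M \<sigma> I(2,3)] zero by simp
  then show ?thesis
    by (rule flat_vanishing[OF flat module.right_module[OF M] I(1,3,2)])
qed

text \<open>
  Membership in the image of \<open>A \<otimes> W\<close>, put in the form in which it occurs in the definition of
  \<open>A\<^bsup>co Q\<^esup>\<close>, where \<open>W\<close> is the kernel of the projection onto \<open>Q\<close>.
\<close>

definition vanishes_mod ::
  "('r, 'c) ring_scheme \<Rightarrow> ('r, 'a, 'd) module_scheme \<Rightarrow> ('r, 'm, 'e) module_scheme \<Rightarrow> 'm set
    \<Rightarrow> ('a, 'm) tens \<Rightarrow> bool"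
  where "vanishes_mod R A M W t \<longleftrightarrow>
    tensor_map R A (quot_module M W) id (\<lambda>m. W +>\<^bsub>M\<^esub> m) t = \<zero>\<^bsub>tensor R A (quot_module M W)\<^esub>"

text \<open>
  Only the last line of the criterion mentions \<open>W\<close>, and it speaks of elements of \<open>M\<close> rather than of
  tensors. This is what makes preimages and intersections of submodules tractable.
\<close>

lemma vanishes_mod_iff:
  assumes flat: "flat_left_module R A" and A: "module R A" and M: "module R M" and W: "submodule W R M"
    and I: "finite I" "a \<in> I \<rightarrow> carrier A" "m \<in> I \<rightarrow> carrier M"
  shows "vanishes_mod R A M W (\<Oplus>\<^bsub>tensor R A M\<^esub>i\<in>I. pure_tensor R A M (a i) (m i)) \<longleftrightarrow>
    (\<exists>(k :: nat) y c. y \<in> {..<k} \<rightarrow> carrier A \<and> (\<forall>i\<in>I. \<forall>j<k. c i j \<in> carrier R) \<and>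
      (\<forall>i\<in>I. a i = (\<Oplus>\<^bsub>A\<^esub>j\<in>{..<k}. c i j \<odot>\<^bsub>A\<^esub> y j)) \<and>
      (\<forall>j<k. (\<Oplus>\<^bsub>M\<^esub>i\<in>I. c i j \<odot>\<^bsub>M\<^esub> m i) \<in> W))" (is "?L \<longleftrightarrow> ?R")
proof -
  interpret M: module R M by (rule M)
  interpret W: right_submodule R M W by (rule right_submodule_if_submodule[OF M W])
  note Q = quot_is_module[OF M W]
  interpret Q: module R W.Q by (rule Q)
  note p = module_tensor_pair[OF A M] and p' = module_tensor_pair[OF A Q]
  interpret T: tensor_pair R A M by (rule p)
  interpret T': tensor_pair R A W.Q by (rule p')
  interpret TT: abelian_group T'.T by (rule T'.T_abelian)
  have map: "tensor_map R A W.Q id W.proj (\<Oplus>\<^bsub>T.T\<^esub>i\<in>J. T.pure (x i) (n i))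
      = (\<Oplus>\<^bsub>T'.T\<^esub>i\<in>J. T'.pure (x i) (W.proj (n i)))"
    if "x \<in> J \<rightarrow> carrier A" "n \<in> J \<rightarrow> carrier M" for J :: "'x set" and x n
    using tensor_map_finsum[OF p p' module_hom_id W.proj_hom that] by simp
  have proj_sum: "(\<Oplus>\<^bsub>W.Q\<^esub>i\<in>I. c i \<odot>\<^bsub>W.Q\<^esub> W.proj (m i)) = W.proj (\<Oplus>\<^bsub>M\<^esub>i\<in>I. c i \<odot>\<^bsub>M\<^esub> m i)"
    if c: "\<And>i. i \<in> I \<Longrightarrow> c i \<in> carrier R" for c
  proof -
    have cm: "(\<lambda>i. c i \<odot>\<^bsub>M\<^esub> m i) \<in> I \<rightarrow> carrier M" using c I by (auto simp: Pi_iff)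
    have "W.proj (\<Oplus>\<^bsub>M\<^esub>i\<in>I. c i \<odot>\<^bsub>M\<^esub> m i) = (\<Oplus>\<^bsub>W.Q\<^esub>i\<in>I. W.proj (c i \<odot>\<^bsub>M\<^esub> m i))"
      by (rule add_hom_finsum[OF M.abelian_group_axioms Q.abelian_group_axioms module_hom_add_hom[OF W.proj_hom] cm])
    also have "\<dots> = (\<Oplus>\<^bsub>W.Q\<^esub>i\<in>I. c i \<odot>\<^bsub>W.Q\<^esub> W.proj (m i))"
      using c I by (intro Q.finsum_cong') (auto simp: W.smult_Q Pi_iff)
    finally show ?thesis by simp
  qed
  show ?thesis
  proof
    assume ?L
    then have zero: "(\<Oplus>\<^bsub>T'.T\<^esub>i\<in>I. T'.pure (a i) (W.proj (m i))) = \<zero>\<^bsub>T'.T\<^esub>"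
      using map[OF I(2,3)] by (simp add: vanishes_mod_def)
    have "(\<lambda>i. W.proj (m i)) \<in> I \<rightarrow> carrier W.Q" using I by (auto simp: Pi_iff)
    from flat_vanishing_left[OF flat A Q I(1,2) this zero]
    obtain k :: nat and y c where *: "y \<in> {..<k} \<rightarrow> carrier A" "\<forall>i\<in>I. \<forall>j<k. c i j \<in> carrier R"
      "\<forall>i\<in>I. a i = (\<Oplus>\<^bsub>A\<^esub>j\<in>{..<k}. c i j \<odot>\<^bsub>A\<^esub> y j)"
      and z: "\<forall>j<k. (\<Oplus>\<^bsub>W.Q\<^esub>i\<in>I. c i j \<odot>\<^bsub>W.Q\<^esub> W.proj (m i)) = \<zero>\<^bsub>W.Q\<^esub>" by blast
    have "(\<Oplus>\<^bsub>M\<^esub>i\<in>I. c i j \<odot>\<^bsub>M\<^esub> m i) \<in> W" if j: "j < k" for j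
    proof -
      have cm: "(\<lambda>i. c i j \<odot>\<^bsub>M\<^esub> m i) \<in> I \<rightarrow> carrier M" using *(2) j I by (auto simp: Pi_iff)
      have "W.proj (\<Oplus>\<^bsub>M\<^esub>i\<in>I. c i j \<odot>\<^bsub>M\<^esub> m i) = \<zero>\<^bsub>W.Q\<^esub>"
        using proj_sum[of "\<lambda>i. c i j"] *(2) z j by simp
      then show ?thesis using W.proj_zero_iff[OF M.finsum_closed[OF cm]] by simp
    qed
    with * show ?R by blast
  next
    assume ?R
    then obtain k :: nat and y c where y: "y \<in> {..<k} \<rightarrow> carrier A" and c: "\<forall>i\<in>I. \<forall>j<k. c i j \<in> carrier R"
      and a: "\<forall>i\<in>I. a i = (\<Oplus>\<^bsub>A\<^esub>j\<in>{..<k}. c i j \<odot>\<^bsub>A\<^esub> y j)"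
      and n: "\<forall>j<k. (\<Oplus>\<^bsub>M\<^esub>i\<in>I. c i j \<odot>\<^bsub>M\<^esub> m i) \<in> W" by blast
    have pm: "(\<lambda>i. W.proj (m i)) \<in> I \<rightarrow> carrier W.Q" using I by (auto simp: Pi_iff)
    have "(\<Oplus>\<^bsub>T'.T\<^esub>i\<in>I. T'.pure (a i) (W.proj (m i)))
      = (\<Oplus>\<^bsub>T'.T\<^esub>j\<in>{..<k}. T'.pure (y j) (\<Oplus>\<^bsub>W.Q\<^esub>i\<in>I. c i j \<odot>\<^bsub>W.Q\<^esub> W.proj (m i)))"
      by (rule finsum_exchange_left[OF A Q I(1,2) pm y]) (use c a in blast)+
    also have "\<dots> = (\<Oplus>\<^bsub>T'.T\<^esub>j\<in>{..<k}. \<zero>\<^bsub>T'.T\<^esub>)"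
    proof (rule TT.finsum_cong'[OF refl])
      fix j assume j: "j \<in> {..<k}"
      have cm: "(\<lambda>i. c i j \<odot>\<^bsub>M\<^esub> m i) \<in> I \<rightarrow> carrier M" using c j I by (auto simp: Pi_iff)
      have "(\<Oplus>\<^bsub>W.Q\<^esub>i\<in>I. c i j \<odot>\<^bsub>W.Q\<^esub> W.proj (m i)) = \<zero>\<^bsub>W.Q\<^esub>"
        using proj_sum[of "\<lambda>i. c i j"] c j n W.proj_zero_iff[OF M.finsum_closed[OF cm]] by simp
      then show "T'.pure (y j) (\<Oplus>\<^bsub>W.Q\<^esub>i\<in>I. c i j \<odot>\<^bsub>W.Q\<^esub> W.proj (m i)) = \<zero>\<^bsub>T'.T\<^esub>"
        using y j by (simp add: T'.pure_zero_right Pi_iff)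
    qed simp
    also have "\<dots> = \<zero>\<^bsub>T'.T\<^esub>" by (rule TT.finsum_zero)
    finally show ?L using map[OF I(2,3)] by (simp add: vanishes_mod_def)
  qed
qed

lemma vanishes_mod_rep:
  assumes flat: "flat_left_module R A" and A: "module R A" and M: "module R M" and W: "submodule W R M"
    and t: "t \<in> carrier (tensor R A M)" "vanishes_mod R A M W t"
  shows "\<exists>(k :: nat) y n. y \<in> {..<k} \<rightarrow> carrier A \<and> n \<in> {..<k} \<rightarrow> W \<and>
    t = (\<Oplus>\<^bsub>tensor R A M\<^esub>j\<in>{..<k}. pure_tensor R A M (y j) (n j))"
proof -
  interpret T: tensor_pair R A M by (rule module_tensor_pair[OF A M])
  obtain l :: nat and a m where I: "a \<in> {..<l} \<rightarrow> carrier A" "m \<in> {..<l} \<rightarrow> carrier M"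
    and t_eq: "t = (\<Oplus>\<^bsub>T.T\<^esub>i\<in>{..<l}. T.pure (a i) (m i))"
    using T.T_finsumE[OF t(1)] by blast
  have "\<exists>(k :: nat) y c. y \<in> {..<k} \<rightarrow> carrier A \<and> (\<forall>i\<in>{..<l}. \<forall>j<k. c i j \<in> carrier R) \<and>
      (\<forall>i\<in>{..<l}. a i = (\<Oplus>\<^bsub>A\<^esub>j\<in>{..<k}. c i j \<odot>\<^bsub>A\<^esub> y j)) \<and>
      (\<forall>j<k. (\<Oplus>\<^bsub>M\<^esub>i\<in>{..<l}. c i j \<odot>\<^bsub>M\<^esub> m i) \<in> W)"
    using t(2) unfolding t_eq vanishes_mod_iff[OF flat A M W finite_lessThan I] .
  then obtain k :: nat and y c where y: "y \<in> {..<k} \<rightarrow> carrier A" and c: "\<forall>i\<in>{..<l}. \<forall>j<k. c i j \<in> carrier R"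
      and a: "\<forall>i\<in>{..<l}. a i = (\<Oplus>\<^bsub>A\<^esub>j\<in>{..<k}. c i j \<odot>\<^bsub>A\<^esub> y j)"
      and n: "\<forall>j<k. (\<Oplus>\<^bsub>M\<^esub>i\<in>{..<l}. c i j \<odot>\<^bsub>M\<^esub> m i) \<in> W" by blast
  have "t = (\<Oplus>\<^bsub>T.T\<^esub>j\<in>{..<k}. T.pure (y j) (\<Oplus>\<^bsub>M\<^esub>i\<in>{..<l}. c i j \<odot>\<^bsub>M\<^esub> m i))"
    unfolding t_eq by (rule finsum_exchange_left[OF A M finite_lessThan I y]) (use c a in blast)+
  then show ?thesis
    using y n by (intro exI[of _ k] exI[of _ y] exI[of _ "\<lambda>j. \<Oplus>\<^bsub>M\<^esub>i\<in>{..<l}. c i j \<odot>\<^bsub>M\<^esub> m i"]) auto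
qed

lemma submodule_vimage:
  assumes M: "module R M" and M': "module R M'" and f: "f \<in> module_hom R M M'" and W: "submodule W R M'"
  shows "submodule {m \<in> carrier M. f m \<in> W} R M"
proof -
  interpret M: module R M by (rule M)
  interpret M': module R M' by (rule M')
  note E = M'.submoduleE[OF W]
  have z: "\<zero>\<^bsub>M'\<^esub> \<in> W" using subgroup.one_closed[OF submodule.axioms(1)[OF W]] by simp
  show ?thesis
    by (rule M.submoduleI)
      (use E z in \<open>auto simp: add_hom_zero[OF M.abelian_group_axioms M'.abelian_group_axioms module_hom_add_hom[OF f]]
        add_hom_minus[OF M.abelian_group_axioms M'.abelian_group_axioms module_hom_add_hom[OF f]]
        add_hom_add[OF module_hom_add_hom[OF f]] module_hom_smult[OF f]\<close>)
qed

text \<open>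
  The coefficients that express the vanishing of the image of \<open>t\<close> modulo \<open>W\<close> serve for \<open>t\<close> itself.
\<close>

lemma vanishes_mod_vimage:
  assumes flat: "flat_left_module R A" and A: "module R A" and M: "module R M" and M': "module R M'"
    and f: "f \<in> module_hom R M M'" and W: "submodule W R M'"
    and t: "t \<in> carrier (tensor R A M)" and van: "vanishes_mod R A M' W (tensor_map R A M' id f t)"
  shows "vanishes_mod R A M {m \<in> carrier M. f m \<in> W} t"
proof -
  interpret M: module R M by (rule M)
  interpret M': module R M' by (rule M')
  interpret T: tensor_pair R A M by (rule module_tensor_pair[OF A M])
  obtain l :: nat and a m where I: "a \<in> {..<l} \<rightarrow> carrier A" "m \<in> {..<l} \<rightarrow> carrier M"
    and t_eq: "t = (\<Oplus>\<^bsub>T.T\<^esub>i\<in>{..<l}. T.pure (a i) (m i))"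
    using T.T_finsumE[OF t] by blast
  have fm: "(\<lambda>i. f (m i)) \<in> {..<l} \<rightarrow> carrier M'" using I f by (auto simp: Pi_iff module_hom_closed)
  have map: "tensor_map R A M' id f t = (\<Oplus>\<^bsub>tensor R A M'\<^esub>i\<in>{..<l}. pure_tensor R A M' (a i) (f (m i)))"
    unfolding t_eq
    using tensor_map_finsum[OF module_tensor_pair[OF A M] module_tensor_pair[OF A M'] module_hom_id f I] by simp
  have "\<exists>(k :: nat) y c. y \<in> {..<k} \<rightarrow> carrier A \<and> (\<forall>i\<in>{..<l}. \<forall>j<k. c i j \<in> carrier R) \<and>
      (\<forall>i\<in>{..<l}. a i = (\<Oplus>\<^bsub>A\<^esub>j\<in>{..<k}. c i j \<odot>\<^bsub>A\<^esub> y j)) \<and>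
      (\<forall>j<k. (\<Oplus>\<^bsub>M'\<^esub>i\<in>{..<l}. c i j \<odot>\<^bsub>M'\<^esub> f (m i)) \<in> W)"
    using van unfolding map vanishes_mod_iff[OF flat A M' W finite_lessThan I(1) fm] .
  then obtain k :: nat and y c where y: "y \<in> {..<k} \<rightarrow> carrier A" and c: "\<forall>i\<in>{..<l}. \<forall>j<k. c i j \<in> carrier R"
      and a: "\<forall>i\<in>{..<l}. a i = (\<Oplus>\<^bsub>A\<^esub>j\<in>{..<k}. c i j \<odot>\<^bsub>A\<^esub> y j)"
      and n: "\<forall>j<k. (\<Oplus>\<^bsub>M'\<^esub>i\<in>{..<l}. c i j \<odot>\<^bsub>M'\<^esub> f (m i)) \<in> W" by blast
  have "(\<Oplus>\<^bsub>M\<^esub>i\<in>{..<l}. c i j \<odot>\<^bsub>M\<^esub> m i) \<in> {m \<in> carrier M. f m \<in> W}" if j: "j < k" for j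
  proof -
    have cm: "(\<lambda>i. c i j \<odot>\<^bsub>M\<^esub> m i) \<in> {..<l} \<rightarrow> carrier M" using c j I by (auto simp: Pi_iff)
    have "f (\<Oplus>\<^bsub>M\<^esub>i\<in>{..<l}. c i j \<odot>\<^bsub>M\<^esub> m i) = (\<Oplus>\<^bsub>M'\<^esub>i\<in>{..<l}. f (c i j \<odot>\<^bsub>M\<^esub> m i))"
      by (rule add_hom_finsum[OF M.abelian_group_axioms M'.abelian_group_axioms module_hom_add_hom[OF f] cm])
    also have "\<dots> = (\<Oplus>\<^bsub>M'\<^esub>i\<in>{..<l}. c i j \<odot>\<^bsub>M'\<^esub> f (m i))"
      using c j I fm by (intro M'.finsum_cong') (auto simp: module_hom_smult[OF f] Pi_iff)
    finally show ?thesis using n j M.finsum_closed[OF cm] by simp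
  qed
  then show ?thesis
    unfolding t_eq vanishes_mod_iff[OF flat A M submodule_vimage[OF M M' f W] finite_lessThan I]
    using y c a by blast
qed

lemma prod_module_module:
  assumes R: "cring R" and N: "\<And>i. i \<in> L \<Longrightarrow> module R (N i)"
  shows "module R (prod_module L N)"
proof -
  interpret R: cring R by (rule R)
  let ?P = "prod_module L N"
  note ab = module.axioms(2)[OF N] and sm = module.smult_closed[OF N]
  have mem: "x i \<in> carrier (N i)" if "x \<in> carrier ?P" "i \<in> L" for x i
    using that by (auto simp: prod_module_def)
  have ext: "x \<in> extensional L" if "x \<in> carrier ?P" for x
    using that by (auto simp: prod_module_def PiE_def)
  have addP: "x \<oplus>\<^bsub>?P\<^esub> y = (\<lambda>i\<in>L. x i \<oplus>\<^bsub>N i\<^esub> y i)" for x y by (simp add: prod_module_def)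
  have zeroP: "\<zero>\<^bsub>?P\<^esub> = (\<lambda>i\<in>L. \<zero>\<^bsub>N i\<^esub>)" by (simp add: prod_module_def)
  have smP: "r \<odot>\<^bsub>?P\<^esub> x = (\<lambda>i\<in>L. r \<odot>\<^bsub>N i\<^esub> x i)" for r x by (simp add: prod_module_def)
  have memI: "(\<lambda>i\<in>L. f i) \<in> carrier ?P" if "\<And>i. i \<in> L \<Longrightarrow> f i \<in> carrier (N i)" for f
    using that by (auto simp: prod_module_def)
  note eqI = extensionalityI[of _ L]
  note cl = abelian_add_closed[OF ab]
  show ?thesis
  proof (rule moduleI[OF R])
    show "abelian_group ?P"
    proof (rule abelian_groupI)
      fix x y z assume x: "x \<in> carrier ?P" and y: "y \<in> carrier ?P" and z: "z \<in> carrier ?P"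
      show "x \<oplus>\<^bsub>?P\<^esub> y \<in> carrier ?P"
        unfolding addP by (rule memI) (rule cl[OF _ mem[OF x] mem[OF y]])
      show "x \<oplus>\<^bsub>?P\<^esub> y \<oplus>\<^bsub>?P\<^esub> z = x \<oplus>\<^bsub>?P\<^esub> (y \<oplus>\<^bsub>?P\<^esub> z)"
        unfolding addP
        by (rule eqI) (auto simp: abelian_monoid.a_assoc[OF abelian_group.axioms(1)[OF ab] mem[OF x] mem[OF y] mem[OF z]])
      show "x \<oplus>\<^bsub>?P\<^esub> y = y \<oplus>\<^bsub>?P\<^esub> x"
        unfolding addP
        by (rule eqI) (auto intro!: abelian_monoid.a_comm[OF abelian_group.axioms(1)[OF ab] mem[OF x] mem[OF y]])
    next
      show "\<zero>\<^bsub>?P\<^esub> \<in> carrier ?P"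
        unfolding zeroP by (rule memI) (rule abelian_monoid.zero_closed[OF abelian_group.axioms(1)[OF ab]])
    next
      fix x assume x: "x \<in> carrier ?P"
      show "\<zero>\<^bsub>?P\<^esub> \<oplus>\<^bsub>?P\<^esub> x = x"
        unfolding addP zeroP using ext[OF x]
        by (intro eqI) (auto simp: abelian_monoid.l_zero[OF abelian_group.axioms(1)[OF ab] mem[OF x]])
      show "\<exists>y\<in>carrier ?P. y \<oplus>\<^bsub>?P\<^esub> x = \<zero>\<^bsub>?P\<^esub>"
      proof (rule bexI)
        show "(\<lambda>i\<in>L. \<ominus>\<^bsub>N i\<^esub> x i) \<in> carrier ?P"
          by (rule memI) (rule abelian_group.a_inv_closed[OF ab mem[OF x]])
        show "(\<lambda>i\<in>L. \<ominus>\<^bsub>N i\<^esub> x i) \<oplus>\<^bsub>?P\<^esub> x = \<zero>\<^bsub>?P\<^esub>"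
          unfolding addP zeroP by (rule eqI) (auto simp: abelian_group.l_neg[OF ab mem[OF x]])
      qed
    qed
  next
    fix a x assume a: "a \<in> carrier R" and x: "x \<in> carrier ?P"
    show "a \<odot>\<^bsub>?P\<^esub> x \<in> carrier ?P"
      unfolding smP by (rule memI) (rule sm[OF _ a mem[OF x]])
  next
    fix a b x assume a: "a \<in> carrier R" and b: "b \<in> carrier R" and x: "x \<in> carrier ?P"
    show "(a \<oplus>\<^bsub>R\<^esub> b) \<odot>\<^bsub>?P\<^esub> x = a \<odot>\<^bsub>?P\<^esub> x \<oplus>\<^bsub>?P\<^esub> b \<odot>\<^bsub>?P\<^esub> x"
      unfolding smP addP by (rule eqI) (auto simp: module.smult_l_distr[OF N a b mem[OF x]])
    show "(a \<otimes>\<^bsub>R\<^esub> b) \<odot>\<^bsub>?P\<^esub> x = a \<odot>\<^bsub>?P\<^esub> (b \<odot>\<^bsub>?P\<^esub> x)"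
      unfolding smP by (rule eqI) (auto simp: module.smult_assoc1[OF N a b mem[OF x]])
  next
    fix a x y assume a: "a \<in> carrier R" and x: "x \<in> carrier ?P" and y: "y \<in> carrier ?P"
    show "a \<odot>\<^bsub>?P\<^esub> (x \<oplus>\<^bsub>?P\<^esub> y) = a \<odot>\<^bsub>?P\<^esub> x \<oplus>\<^bsub>?P\<^esub> a \<odot>\<^bsub>?P\<^esub> y"
      unfolding smP addP by (rule eqI) (auto simp: module.smult_r_distr[OF N a mem[OF x] mem[OF y]])
  next
    fix x assume x: "x \<in> carrier ?P"
    show "\<one>\<^bsub>R\<^esub> \<odot>\<^bsub>?P\<^esub> x = x"
      unfolding smP using ext[OF x] by (intro eqI) (auto simp: module.smult_one[OF N mem[OF x]])
  qed
qed

lemma prod_module_component_hom: "i \<in> L \<Longrightarrow> (\<lambda>x. x i) \<in> module_hom R (prod_module L N) (N i)"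
  by (intro module_homI add_homI) (auto simp: prod_module_def)

text \<open>
  Let \<open>t = \<Sum>\<^sub>i a\<^sub>i \<otimes> m\<^sub>i\<close> with \<open>i < n\<close>, let \<open>s = \<Sum>\<^sub>i a\<^sub>i \<otimes> u\<^sub>i\<close> be its lift to \<open>A \<otimes> R\<^sup>n\<close>, and let \<open>K W\<close> be the
  preimage of \<open>W\<close> in \<open>R\<^sup>n\<close>. Then \<open>s\<close> vanishes in \<open>A \<otimes> R\<^sup>n / K W\<close> for every \<open>W\<close>, so by the Mittag-Leffler
  condition its image in \<open>A \<otimes> \<Prod>\<^sub>W R\<^sup>n / K W\<close> vanishes. The equational criterion, applied to this one
  element, yields coefficients that are good for all \<open>W\<close> at the same time. The detour through \<open>R\<^sup>n\<close>
  replaces the modules \<open>M / W\<close> by test modules.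
\<close>

lemma vanishes_mod_Inter:
  fixes A :: "('r, 'a, 'd) module_scheme"
  assumes flat: "flat_left_module R A" and mittag: "mittag_leffler R A" and M: "module R M"
    and F: "\<F> \<noteq> {}" "\<And>W. W \<in> \<F> \<Longrightarrow> submodule W R M"
    and t: "t \<in> carrier (tensor R A M)" and van: "\<And>W. W \<in> \<F> \<Longrightarrow> vanishes_mod R A M W t"
  shows "submodule (\<Inter>\<F>) R M" and "vanishes_mod R A M (\<Inter>\<F>) t"
proof -
  have A: "module R A" using mittag by (simp add: mittag_leffler_def)
  interpret M: module R M by (rule M)
  interpret A: module R A by (rule A)
  show sub: "submodule (\<Inter>\<F>) R M"
  proof (rule M.submoduleI)
    show "\<Inter>\<F> \<subseteq> carrier M" using F M.submoduleE(1) by blast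
    show "\<zero>\<^bsub>M\<^esub> \<in> \<Inter>\<F>" using subgroup.one_closed[OF submodule.axioms(1)[OF F(2)]] by simp
  qed (use M.submoduleE(3-5)[OF F(2)] in auto)
  interpret T: tensor_pair R A M by (rule module_tensor_pair[OF A M])
  obtain n :: nat and a m where I: "a \<in> {..<n} \<rightarrow> carrier A" "m \<in> {..<n} \<rightarrow> carrier M"
    and t_eq: "t = (\<Oplus>\<^bsub>T.T\<^esub>i\<in>{..<n}. T.pure (a i) (m i))"
    using T.T_finsumE[OF t] by blast
  let ?L = "list_module R n" and ?u = "unit_list R n"
  have L: "module R ?L"
    by (rule module_if_right_module[OF M.R.is_cring M.R.list_module_right_module])
  interpret L: module R ?L by (rule L)
  have u: "?u i \<in> carrier ?L" for i by (rule M.R.unit_list_closed)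
  define ev where "ev l = (\<Oplus>\<^bsub>M\<^esub>i\<in>{..<n}. l ! i \<odot>\<^bsub>M\<^esub> m i)" for l
  have lm: "l ! i \<odot>\<^bsub>M\<^esub> m i \<in> carrier M" if "l \<in> carrier ?L" "i < n" for l i
    using list_module_nth[OF that] I that by (auto simp: Pi_iff)
  have ev: "ev \<in> module_hom R ?L M"
  proof (intro module_homI add_homI)
    fix l assume l: "l \<in> carrier ?L"
    show "ev l \<in> carrier M" unfolding ev_def using lm[OF l] by (intro M.finsum_closed) auto
    show "ev (l \<oplus>\<^bsub>?L\<^esub> l') = ev l \<oplus>\<^bsub>M\<^esub> ev l'" if l': "l' \<in> carrier ?L" for l'
    proof -
      have "ev (l \<oplus>\<^bsub>?L\<^esub> l') = (\<Oplus>\<^bsub>M\<^esub>i\<in>{..<n}. l ! i \<odot>\<^bsub>M\<^esub> m i \<oplus>\<^bsub>M\<^esub> l' ! i \<odot>\<^bsub>M\<^esub> m i)"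
        unfolding ev_def
      proof (rule M.finsum_cong'[OF refl])
        fix i assume i: "i \<in> {..<n}"
        then show "(l \<oplus>\<^bsub>?L\<^esub> l') ! i \<odot>\<^bsub>M\<^esub> m i = l ! i \<odot>\<^bsub>M\<^esub> m i \<oplus>\<^bsub>M\<^esub> l' ! i \<odot>\<^bsub>M\<^esub> m i"
          using add_hom_add[OF list_module_nth_hom[of i n R] l l'] list_module_nth[OF l] list_module_nth[OF l'] I
          by (simp add: M.smult_l_distr Pi_iff)
      qed (use lm[OF l] lm[OF l'] in auto)
      also have "\<dots> = ev l \<oplus>\<^bsub>M\<^esub> ev l'"
        unfolding ev_def using lm[OF l] lm[OF l'] by (intro M.finsum_addf) auto
      finally show ?thesis .
    qed
    show "ev (r \<odot>\<^bsub>?L\<^esub> l) = r \<odot>\<^bsub>M\<^esub> ev l" if r: "r \<in> carrier R" for r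
    proof -
      have "r \<odot>\<^bsub>M\<^esub> ev l = (\<Oplus>\<^bsub>M\<^esub>i\<in>{..<n}. r \<odot>\<^bsub>M\<^esub> (l ! i \<odot>\<^bsub>M\<^esub> m i))"
        unfolding ev_def using lm[OF l]
        by (intro add_hom_finsum[OF M.abelian_group_axioms M.abelian_group_axioms
              module_hom_add_hom[OF M.smult_module_hom[OF r]]]) auto
      also have "\<dots> = (\<Oplus>\<^bsub>M\<^esub>i\<in>{..<n}. (r \<odot>\<^bsub>?L\<^esub> l) ! i \<odot>\<^bsub>M\<^esub> m i)"
      proof (rule M.finsum_cong'[OF refl])
        fix i assume i: "i \<in> {..<n}"
        then have "(r \<odot>\<^bsub>?L\<^esub> l) ! i = r \<otimes>\<^bsub>R\<^esub> l ! i"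
          using l list_module_nth[OF l] r by (simp add: list_module_def M.R.m_comm)
        then show "r \<odot>\<^bsub>M\<^esub> (l ! i \<odot>\<^bsub>M\<^esub> m i) = (r \<odot>\<^bsub>?L\<^esub> l) ! i \<odot>\<^bsub>M\<^esub> m i"
          using i list_module_nth[OF l] r I by (simp add: M.smult_assoc1 Pi_iff)
      qed (use lm[OF L.smult_closed[OF r l]] in auto)
      finally show ?thesis by (simp add: ev_def)
    qed
  qed
  have ev_u: "ev (?u i) = m i" if i: "i < n" for i
  proof -
    have "ev (?u i) = (\<Oplus>\<^bsub>M\<^esub>j\<in>{..<n}. if i = j then m j else \<zero>\<^bsub>M\<^esub>)"
      unfolding ev_def using I by (intro M.finsum_cong') (auto simp: unit_list_nth Pi_iff)
    also have "\<dots> = m i" using I i by (intro M.add.finprod_singleton) auto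
    finally show ?thesis .
  qed
  define K where "K W = {l \<in> carrier ?L. ev l \<in> W}" for W
  have K: "submodule (K W) R ?L" if "W \<in> \<F>" for W
    unfolding K_def by (rule submodule_vimage[OF L M ev F(2)[OF that]])
  let ?I = "K ` \<F>" and ?N = "\<lambda>X. quot_module ?L X" 
  let ?P = "prod_module ?I ?N"
  have N: "module R (?N X)" if "X \<in> ?I" for X using that K by (auto intro: quot_is_module[OF L])
  have P: "module R ?P" by (rule prod_module_module[OF M.R.is_cring N])
  interpret P: module R ?P by (rule P)
  define e where "e i = (\<lambda>X\<in>?I. X +>\<^bsub>?L\<^esub> ?u i)" for i
  have e: "e \<in> {..<n} \<rightarrow> carrier ?P"
    using right_submodule.proj_closed[OF right_submodule_if_submodule[OF L K] u]
    by (auto simp: e_def prod_module_def)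
  interpret TL: tensor_pair R A ?L by (rule module_tensor_pair[OF A L])
  interpret TP: tensor_pair R A ?P by (rule module_tensor_pair[OF A P])
  define s where "s = (\<Oplus>\<^bsub>TL.T\<^esub>i\<in>{..<n}. TL.pure (a i) (?u i))"
  define t' where "t' = (\<Oplus>\<^bsub>TP.T\<^esub>i\<in>{..<n}. TP.pure (a i) (e i))"
  have sT: "s \<in> carrier TL.T" and t'T: "t' \<in> carrier TP.T"
  proof -
    interpret a: abelian_group TL.T by (rule TL.T_abelian)
    interpret b: abelian_group TP.T by (rule TP.T_abelian)
    show "s \<in> carrier TL.T" unfolding s_def using I u by (intro a.finsum_closed) (auto simp: Pi_iff)
    show "t' \<in> carrier TP.T" unfolding t'_def using I e by (intro b.finsum_closed) (auto simp: Pi_iff)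
  qed
  have "tensor_map R A M id ev s = t"
  proof -
    have "tensor_map R A M id ev s = (\<Oplus>\<^bsub>T.T\<^esub>i\<in>{..<n}. T.pure (id (a i)) (ev (?u i)))"
      unfolding s_def
      by (rule tensor_map_finsum[OF TL.tensor_pair_axioms T.tensor_pair_axioms module_hom_id ev I(1)]) (use u in simp)
    also have "\<dots> = t"
    proof -
      interpret a: abelian_group T.T by (rule T.T_abelian)
      show ?thesis unfolding t_eq using I by (intro a.finsum_cong') (auto simp: ev_u Pi_iff)
    qed
    finally show ?thesis .
  qed
  then have s: "vanishes_mod R A ?L (K W) s" if "W \<in> \<F>" for W
    unfolding K_def using vanishes_mod_vimage[OF flat A L M ev F(2)[OF that] sT] van[OF that] by simp
  have component: "tensor_map R A (?N X) id (\<lambda>y. y X) t' = \<zero>\<^bsub>tensor R A (?N X)\<^esub>" if X: "X \<in> ?I" for X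
  proof -
    interpret TX: tensor_pair R A "?N X" by (rule module_tensor_pair[OF A N[OF X]])
    obtain W where W: "W \<in> \<F>" "X = K W" using X by blast
    note pr = right_submodule.proj_hom[OF right_submodule_if_submodule[OF L K[OF W(1)]], folded W(2)]
    have "tensor_map R A (?N X) id (\<lambda>y. y X) t' = (\<Oplus>\<^bsub>TX.T\<^esub>i\<in>{..<n}. TX.pure (id (a i)) (e i X))"
      unfolding t'_def
      by (rule tensor_map_finsum[OF TP.tensor_pair_axioms TX.tensor_pair_axioms module_hom_id
            prod_module_component_hom[OF X] I(1) e])
    also have "\<dots> = (\<Oplus>\<^bsub>TX.T\<^esub>i\<in>{..<n}. TX.pure (id (a i)) (X +>\<^bsub>?L\<^esub> ?u i))"
      using X by (simp add: e_def)
    also have "\<dots> = tensor_map R A (?N X) id (\<lambda>l. X +>\<^bsub>?L\<^esub> l) s"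
      unfolding s_def
      by (rule tensor_map_finsum[OF TL.tensor_pair_axioms TX.tensor_pair_axioms module_hom_id pr I(1), symmetric])
        (use u in simp)
    also have "\<dots> = \<zero>\<^bsub>TX.T\<^esub>" using s[OF W(1)] by (simp add: vanishes_mod_def W(2))
    finally show ?thesis .
  qed
  have "t' = \<zero>\<^bsub>TP.T\<^esub>"
  proof -
    interpret b: abelian_group TP.T by (rule TP.T_abelian)
    have inj: "inj_on (\<lambda>x. \<lambda>X\<in>?I. tensor_map R A (?N X) id (\<lambda>y. y X) x) (carrier TP.T)"
      using mittag N unfolding mittag_leffler_def by blast
    have "tensor_map R A (?N X) id (\<lambda>y. y X) \<zero>\<^bsub>TP.T\<^esub> = \<zero>\<^bsub>tensor R A (?N X)\<^esub>" if X: "X \<in> ?I" for X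
      using add_hom_zero[OF TP.T_abelian tensor_pair.T_abelian[OF module_tensor_pair[OF A N[OF X]]]
          tensor_map_hom[OF TP.tensor_pair_axioms module_tensor_pair[OF A N[OF X]] module_hom_id
            prod_module_component_hom[OF X]]] .
    then show ?thesis
      by (intro inj_onD[OF inj _ t'T b.zero_closed] restrict_ext) (simp add: component)
  qed
  from flat_vanishing_left[OF flat A P finite_lessThan I(1) e this[unfolded t'_def]]
  obtain k :: nat and y c where y: "y \<in> {..<k} \<rightarrow> carrier A" and c: "\<forall>i\<in>{..<n}. \<forall>j<k. c i j \<in> carrier R"
    and a: "\<forall>i\<in>{..<n}. a i = (\<Oplus>\<^bsub>A\<^esub>j\<in>{..<k}. c i j \<odot>\<^bsub>A\<^esub> y j)"
    and z: "\<forall>j<k. (\<Oplus>\<^bsub>?P\<^esub>i\<in>{..<n}. c i j \<odot>\<^bsub>?P\<^esub> e i) = \<zero>\<^bsub>?P\<^esub>" by blast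
  have "(\<Oplus>\<^bsub>M\<^esub>i\<in>{..<n}. c i j \<odot>\<^bsub>M\<^esub> m i) \<in> \<Inter>\<F>" if j: "j < k" for j
  proof
    fix W assume W: "W \<in> \<F>"
    have X: "K W \<in> ?I" using W by blast
    interpret X: right_submodule R ?L "K W" by (rule right_submodule_if_submodule[OF L K[OF W]])
    interpret N: module R "?N (K W)" by (rule N[OF X])
    have ce: "(\<lambda>i. c i j \<odot>\<^bsub>?P\<^esub> e i) \<in> {..<n} \<rightarrow> carrier ?P" using c j e by (auto simp: Pi_iff)
    have cu: "(\<lambda>i. c i j \<odot>\<^bsub>?L\<^esub> ?u i) \<in> {..<n} \<rightarrow> carrier ?L" using c j u by (auto simp: Pi_iff)
    note comp = prod_module_component_hom[OF X, of R ?N]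
    have "X.proj (\<Oplus>\<^bsub>?L\<^esub>i\<in>{..<n}. c i j \<odot>\<^bsub>?L\<^esub> ?u i) = (\<Oplus>\<^bsub>X.Q\<^esub>i\<in>{..<n}. X.proj (c i j \<odot>\<^bsub>?L\<^esub> ?u i))"
      by (rule add_hom_finsum[OF L.abelian_group_axioms N.abelian_group_axioms module_hom_add_hom[OF X.proj_hom] cu])
    also have "\<dots> = (\<Oplus>\<^bsub>X.Q\<^esub>i\<in>{..<n}. (c i j \<odot>\<^bsub>?P\<^esub> e i) (K W))"
    proof (rule N.finsum_cong'[OF refl])
      show "(\<lambda>i. (c i j \<odot>\<^bsub>?P\<^esub> e i) (K W)) \<in> {..<n} \<rightarrow> carrier X.Q"
        using module_hom_closed[OF comp] ce by (auto simp: Pi_iff)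
    qed (use c j u e X in \<open>simp add: module_hom_smult[OF comp] Pi_iff X.smult_Q e_def\<close>)
    also have "\<dots> = (\<Oplus>\<^bsub>?P\<^esub>i\<in>{..<n}. c i j \<odot>\<^bsub>?P\<^esub> e i) (K W)"
      by (rule add_hom_finsum[OF P.abelian_group_axioms N.abelian_group_axioms module_hom_add_hom[OF comp] ce, symmetric])
    also have "\<dots> = \<zero>\<^bsub>X.Q\<^esub>"
      using z j X by (simp add: prod_module_def)
    finally have "(\<Oplus>\<^bsub>?L\<^esub>i\<in>{..<n}. c i j \<odot>\<^bsub>?L\<^esub> ?u i) \<in> K W"
      using X.proj_zero_iff[OF L.finsum_closed[OF cu]] by simp
    then have "ev (\<Oplus>\<^bsub>?L\<^esub>i\<in>{..<n}. c i j \<odot>\<^bsub>?L\<^esub> ?u i) \<in> W" unfolding K_def by blast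
    also have "ev (\<Oplus>\<^bsub>?L\<^esub>i\<in>{..<n}. c i j \<odot>\<^bsub>?L\<^esub> ?u i) = (\<Oplus>\<^bsub>M\<^esub>i\<in>{..<n}. ev (c i j \<odot>\<^bsub>?L\<^esub> ?u i))"
      by (rule add_hom_finsum[OF L.abelian_group_axioms M.abelian_group_axioms module_hom_add_hom[OF ev] cu])
    also have "\<dots> = (\<Oplus>\<^bsub>M\<^esub>i\<in>{..<n}. c i j \<odot>\<^bsub>M\<^esub> m i)"
      using c j u I by (intro M.finsum_cong') (auto simp: module_hom_smult[OF ev] ev_u Pi_iff)
    finally show "(\<Oplus>\<^bsub>M\<^esub>i\<in>{..<n}. c i j \<odot>\<^bsub>M\<^esub> m i) \<in> W" .
  qed
  then show "vanishes_mod R A M (\<Inter>\<F>) t"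
    unfolding t_eq vanishes_mod_iff[OF flat A M sub finite_lessThan I]
    using y c a by blast
qed

text \<open>
  A map that is 0 on pure tensors from \<open>A \<times> W\<close> is 0 on all of \<open>A \<otimes> W\<close>, by \<open>vanishes_mod_rep\<close>.
\<close>

lemma vanishes_mod_kills:
  assumes flat: "flat_left_module R A" and A: "module R A" and M: "module R M" and W: "submodule W R M"
    and G: "abelian_group G" and f: "f \<in> add_hom (tensor R A M) G"
    and z: "\<And>a n. \<lbrakk>a \<in> carrier A; n \<in> W\<rbrakk> \<Longrightarrow> f (pure_tensor R A M a n) = \<zero>\<^bsub>G\<^esub>"
    and t: "t \<in> carrier (tensor R A M)" "vanishes_mod R A M W t"
  shows "f t = \<zero>\<^bsub>G\<^esub>"
proof -
  interpret T: tensor_pair R A M by (rule module_tensor_pair[OF A M])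
  interpret G: abelian_group G by (rule G)
  obtain k :: nat and y n where y: "y \<in> {..<k} \<rightarrow> carrier A" and n: "n \<in> {..<k} \<rightarrow> W"
    and t_eq: "t = (\<Oplus>\<^bsub>T.T\<^esub>j\<in>{..<k}. T.pure (y j) (n j))"
    using vanishes_mod_rep[OF flat A M W t] by blast
  have "W \<subseteq> carrier M" using module.submoduleE(1)[OF M W] .
  then have "(\<lambda>j. T.pure (y j) (n j)) \<in> {..<k} \<rightarrow> carrier T.T"
    using y n by (auto simp: Pi_iff)
  then have "f t = (\<Oplus>\<^bsub>G\<^esub>j\<in>{..<k}. f (T.pure (y j) (n j)))"
    unfolding t_eq by (rule add_hom_finsum[OF T.T_abelian G f])
  also have "\<dots> = (\<Oplus>\<^bsub>G\<^esub>j\<in>{..<k}. \<zero>\<^bsub>G\<^esub>)"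
    using y n z by (intro G.finsum_cong') (auto simp: Pi_iff)
  also have "\<dots> = \<zero>\<^bsub>G\<^esub>" by (rule G.finsum_zero)
  finally show ?thesis .
qed

lemma vanishes_mod_diff_iff:
  assumes A: "module R A" and M: "module R M" and W: "submodule W R M"
    and s: "s \<in> carrier (tensor R A M)" and t: "t \<in> carrier (tensor R A M)"
  shows "vanishes_mod R A M W (s \<ominus>\<^bsub>tensor R A M\<^esub> t) \<longleftrightarrow>
    tensor_map R A (quot_module M W) id (\<lambda>m. W +>\<^bsub>M\<^esub> m) s
    = tensor_map R A (quot_module M W) id (\<lambda>m. W +>\<^bsub>M\<^esub> m) t"
proof -
  interpret W: right_submodule R M W by (rule right_submodule_if_submodule[OF M W])
  note p = module_tensor_pair[OF A M] and p' = module_tensor_pair[OF A quot_is_module[OF M W]]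
  interpret T': abelian_group "tensor R A W.Q" by (rule tensor_pair.T_abelian[OF p'])
  note h = tensor_map_hom[OF p p' module_hom_id W.proj_hom]
  show ?thesis
    unfolding vanishes_mod_def add_hom_diff[OF tensor_pair.T_abelian[OF p] T'.abelian_group_axioms h s t]
    by (rule T'.diff_zero_iff) (rule add_hom_closed[OF h s] add_hom_closed[OF h t])+
qed

section \<open>Multiplication in a tensor product of algebras\<close>

lemma assoc_algebra_module: "assoc_algebra R A \<Longrightarrow> module R A"
  by (rule assoc_algebra.axioms(1))

lemma assoc_algebra_ring: "assoc_algebra R A \<Longrightarrow> ring A"
  by (rule assoc_algebra.axioms(2))

lemma left_mult_hom:
  assumes A: "assoc_algebra R A" and a: "a \<in> carrier A"
  shows "(\<lambda>x. a \<otimes>\<^bsub>A\<^esub> x) \<in> module_hom R A A"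
proof -
  interpret A: ring A by (rule assoc_algebra_ring[OF A])
  show ?thesis
    using a by (intro module_homI add_homI) (auto simp: A.r_distr assoc_algebra.smult_mult_right[OF A])
qed

lemma right_mult_hom:
  assumes A: "assoc_algebra R A" and a: "a \<in> carrier A"
  shows "(\<lambda>x. x \<otimes>\<^bsub>A\<^esub> a) \<in> module_hom R A A"
proof -
  interpret A: ring A by (rule assoc_algebra_ring[OF A])
  show ?thesis
    using a by (intro module_homI add_homI) (auto simp: A.l_distr assoc_algebra.smult_mult_left[OF A])
qed

text \<open>
  The product is defined by one lift inside another. The computations below only ever need the outer
  lift evaluated, on a pure tensor.
\<close>

lemma tensor_mult:
  assumes A: "assoc_algebra R A" and H: "assoc_algebra R H"
  shows tensor_mult_hom_left: "y \<in> carrier (tensor R A H) \<Longrightarrow>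
      (\<lambda>x. x \<otimes>\<^bsub>tensor R A H\<^esub> y) \<in> add_hom (tensor R A H) (tensor R A H)"
    and tensor_mult_pure_left: "\<lbrakk>a \<in> carrier A; h \<in> carrier H; y \<in> carrier (tensor R A H)\<rbrakk> \<Longrightarrow>
      pure_tensor R A H a h \<otimes>\<^bsub>tensor R A H\<^esub> y = tensor_map R A H (\<lambda>c. a \<otimes>\<^bsub>A\<^esub> c) (\<lambda>k. h \<otimes>\<^bsub>H\<^esub> k) y"
proof -
  note mA = assoc_algebra_module[OF A] and mH = assoc_algebra_module[OF H]
  interpret A: ring A by (rule assoc_algebra_ring[OF A])
  interpret H: ring H by (rule assoc_algebra_ring[OF H])
  interpret mA: module R A by (rule mA)
  interpret mH: module R H by (rule mH)
  note p = module_tensor_pair[OF mA mH]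
  interpret T: tensor_pair R A H by (rule p)
  let ?f = "\<lambda>y a h. tensor_map R A H (\<lambda>c. a \<otimes>\<^bsub>A\<^esub> c) (\<lambda>k. h \<otimes>\<^bsub>H\<^esub> k) y"
  have hom: "(\<lambda>y. ?f y a h) \<in> add_hom T.T T.T" if "a \<in> carrier A" "h \<in> carrier H" for a h
    using tensor_map_hom[OF p p left_mult_hom[OF A that(1)] left_mult_hom[OF H that(2)]] .
  have pure: "?f (T.pure c k) a h = T.pure (a \<otimes>\<^bsub>A\<^esub> c) (h \<otimes>\<^bsub>H\<^esub> k)"
    if "a \<in> carrier A" "h \<in> carrier H" "c \<in> carrier A" "k \<in> carrier H" for a h c k
    using tensor_map_pure[OF p p left_mult_hom[OF A that(1)] left_mult_hom[OF H that(2)] that(3,4)] .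
  have bal: "balanced R A H T.T (?f y)" if y: "y \<in> carrier T.T" for y
  proof (rule balancedI)
    fix h assume h: "h \<in> carrier H"
    show "(\<lambda>a. ?f y a h) \<in> add_hom A T.T"
    proof (rule add_homI)
      fix a b assume a: "a \<in> carrier A" and b: "b \<in> carrier A"
      show "?f y (a \<oplus>\<^bsub>A\<^esub> b) h = ?f y a h \<oplus>\<^bsub>T.T\<^esub> ?f y b h"
        by (rule T.T_hom_eqI[OF T.T_abelian hom[OF A.a_closed[OF a b] h] add_hom_plus[OF T.T_abelian hom[OF a h] hom[OF b h]] _ y])
          (use a b h in \<open>simp add: pure A.l_distr T.pure_add_left\<close>)
    qed (use add_hom_closed[OF hom y] h in auto)
  next
    fix a assume a: "a \<in> carrier A"
    show "?f y a \<in> add_hom H T.T"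
    proof (rule add_homI)
      fix h k assume h: "h \<in> carrier H" and k: "k \<in> carrier H"
      show "?f y a (h \<oplus>\<^bsub>H\<^esub> k) = ?f y a h \<oplus>\<^bsub>T.T\<^esub> ?f y a k"
        by (rule T.T_hom_eqI[OF T.T_abelian hom[OF a H.a_closed[OF h k]] add_hom_plus[OF T.T_abelian hom[OF a h] hom[OF a k]] _ y])
          (use a h k in \<open>simp add: pure H.l_distr T.pure_add_right\<close>)
    qed (use add_hom_closed[OF hom y] a in auto)
  next
    fix r a h assume r: "r \<in> carrier R" and a: "a \<in> carrier A" and h: "h \<in> carrier H"
    show "?f y (r \<odot>\<^bsub>A\<^esub> a) h = ?f y a (r \<odot>\<^bsub>H\<^esub> h)"
      by (rule T.T_hom_eqI[OF T.T_abelian hom[OF mA.smult_closed[OF r a] h] hom[OF a mH.smult_closed[OF r h]] _ y])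
        (use r a h in \<open>simp add: pure assoc_algebra.smult_mult_left[OF A] assoc_algebra.smult_mult_left[OF H] T.pure_smult\<close>)
  qed
  have eq: "x \<otimes>\<^bsub>T.T\<^esub> y = tensor_lift (add_monoid T.T) (?f y) x" for x y
  proof -
    have "x \<otimes>\<^bsub>T.T\<^esub> y = tensor_lift (tensor_group R A H) (?f y) x"
      by (simp add: tensor_def tensor_map_def Let_def)
    then show ?thesis by (simp only: tensor_lift_group)
  qed
  show "(\<lambda>x. x \<otimes>\<^bsub>T.T\<^esub> y) \<in> add_hom T.T T.T" if y: "y \<in> carrier T.T"
    unfolding eq by (rule T.lift_hom[OF T.T_abelian bal[OF y]])
  show "T.pure a h \<otimes>\<^bsub>T.T\<^esub> y = ?f y a h" if "a \<in> carrier A" "h \<in> carrier H" "y \<in> carrier T.T"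
    unfolding eq by (rule T.lift_pure[OF T.T_abelian bal[OF that(3)] that(1,2)])
qed

lemma tensor_mult_hom_right:
  assumes A: "assoc_algebra R A" and H: "assoc_algebra R H" and x: "x \<in> carrier (tensor R A H)"
  shows "(\<lambda>y. x \<otimes>\<^bsub>tensor R A H\<^esub> y) \<in> add_hom (tensor R A H) (tensor R A H)"
proof -
  note p = module_tensor_pair[OF assoc_algebra_module[OF A] assoc_algebra_module[OF H]]
  interpret T: tensor_pair R A H by (rule p)
  interpret TT: abelian_group T.T by (rule T.T_abelian)
  note l = tensor_mult_hom_left[OF A H]
  have pure: "(\<lambda>y. T.pure a h \<otimes>\<^bsub>T.T\<^esub> y) \<in> add_hom T.T T.T" if "a \<in> carrier A" "h \<in> carrier H" for a h
  proof -
    note f = tensor_map_hom[OF p p left_mult_hom[OF A that(1)] left_mult_hom[OF H that(2)]]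
    show ?thesis
      using add_hom_closed[OF f] add_hom_add[OF f]
      by (intro add_homI) (simp_all add: tensor_mult_pure_left[OF A H that])
  qed
  show ?thesis
  proof (rule add_homI)
    show "x \<otimes>\<^bsub>T.T\<^esub> y \<in> carrier T.T" if "y \<in> carrier T.T" for y by (rule add_hom_closed[OF l[OF that] x])
    fix y z assume y: "y \<in> carrier T.T" and z: "z \<in> carrier T.T"
    show "x \<otimes>\<^bsub>T.T\<^esub> (y \<oplus>\<^bsub>T.T\<^esub> z) = x \<otimes>\<^bsub>T.T\<^esub> y \<oplus>\<^bsub>T.T\<^esub> x \<otimes>\<^bsub>T.T\<^esub> z"
      by (rule T.T_hom_eqI[OF T.T_abelian l[OF TT.a_closed[OF y z]]
            add_hom_plus[OF T.T_abelian l[OF y] l[OF z]] _ x]) (rule add_hom_add[OF pure y z])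
  qed
qed

section \<open>Comodule algebras\<close>

context comodule_algebra
begin

abbreviation (input) AH where "AH \<equiv> tensor R A H"
abbreviation (input) HH where "HH \<equiv> tensor R H H"
abbreviation (input) AHH where "AHH \<equiv> tensor R A (tensor R H H)"

lemma algH: "assoc_algebra R H" by (rule hopf_algebra.axioms(1)[OF hopf_algebra_axioms])
lemma algA: "assoc_algebra R A" by (rule A.assoc_algebra_axioms)
lemma mH: "module R H" by (rule assoc_algebra_module[OF algH])
lemma mA: "module R A" by (rule assoc_algebra_module[OF algA])
lemma ringH: "ring H" by (rule assoc_algebra_ring[OF algH])
lemma ringA: "ring A" by (rule assoc_algebra_ring[OF algA])
lemma mAH: "module R AH" by (rule tensor_module[OF mA mH])
lemma mHH: "module R HH" by (rule tensor_module[OF mH mH])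
lemmas pAH = module_tensor_pair[OF mA mH]
lemmas pHH = module_tensor_pair[OF mH mH]
lemmas pA_HH = module_tensor_pair[OF mA mHH]
lemmas pAH_H = module_tensor_pair[OF mAH mH]

lemma abH: "abelian_group H" by (rule module.axioms(2)[OF mH])
lemma abA: "abelian_group A" by (rule module.axioms(2)[OF mA])

lemma abR: "abelian_group R" using ring.is_abelian_group cring.axioms(1) module.axioms(1)[OF mH] by blast

lemma R_comm: "\<lbrakk>r \<in> carrier R; s \<in> carrier R\<rbrakk> \<Longrightarrow> r \<otimes>\<^bsub>R\<^esub> s = s \<otimes>\<^bsub>R\<^esub> r"
  using comm_monoid.m_comm[OF cring.axioms(2)[OF module.axioms(1)[OF mH]]] .

lemma oneH: "\<one>\<^bsub>H\<^esub> \<in> carrier H" using ring.ring_simprules(6)[OF ringH] .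
lemma oneA: "\<one>\<^bsub>A\<^esub> \<in> carrier A" using ring.ring_simprules(6)[OF ringA] .

lemma monoidH: "monoid H" by (rule ring.is_monoid[OF ringH])
lemma monoidA: "monoid A" by (rule ring.is_monoid[OF ringA])
lemmas multH = monoid.m_closed[OF monoidH]
lemmas multA = monoid.m_closed[OF monoidA]

lemma coact_mhom: "coact \<in> module_hom R A AH" using coact_hom by (simp add: alg_hom_def)
lemma comult_mhom: "comult \<in> module_hom R H HH" using comult_hom by (simp add: alg_hom_def)
lemma coact_closed: "a \<in> carrier A \<Longrightarrow> coact a \<in> carrier AH" by (rule module_hom_closed[OF coact_mhom])
lemma comult_closed: "h \<in> carrier H \<Longrightarrow> comult h \<in> carrier HH" by (rule module_hom_closed[OF comult_mhom])

lemma coact_mult: "\<lbrakk>a \<in> carrier A; b \<in> carrier A\<rbrakk> \<Longrightarrow> coact (a \<otimes>\<^bsub>A\<^esub> b) = coact a \<otimes>\<^bsub>AH\<^esub> coact b"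
  using coact_hom by (simp add: alg_hom_def ring_hom_def)

lemma comult_mult: "\<lbrakk>h \<in> carrier H; k \<in> carrier H\<rbrakk> \<Longrightarrow> comult (h \<otimes>\<^bsub>H\<^esub> k) = comult h \<otimes>\<^bsub>HH\<^esub> comult k"
  using comult_hom by (simp add: alg_hom_def ring_hom_def)

lemma comult_one: "comult \<one>\<^bsub>H\<^esub> = pure_tensor R H H \<one>\<^bsub>H\<^esub> \<one>\<^bsub>H\<^esub>"
  using comult_hom by (simp add: alg_hom_def ring_hom_def tensor_def Let_def)

lemma counit_closed: "h \<in> carrier H \<Longrightarrow> counit h \<in> carrier R"
  using counit_hom by (auto simp: alg_hom_def module_hom_def left_regular_def)

lemma counit_add: "\<lbrakk>h \<in> carrier H; k \<in> carrier H\<rbrakk> \<Longrightarrow> counit (h \<oplus>\<^bsub>H\<^esub> k) = counit h \<oplus>\<^bsub>R\<^esub> counit k"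
  using counit_hom by (auto simp: alg_hom_def module_hom_def left_regular_def)

lemma counit_add_hom: "counit \<in> add_hom H R"
  by (rule add_homI) (auto simp: counit_closed counit_add)

lemma counit_smult: "\<lbrakk>r \<in> carrier R; h \<in> carrier H\<rbrakk> \<Longrightarrow> counit (r \<odot>\<^bsub>H\<^esub> h) = r \<otimes>\<^bsub>R\<^esub> counit h"
  using counit_hom by (auto simp: alg_hom_def module_hom_def left_regular_def)

lemma counit_mult: "\<lbrakk>h \<in> carrier H; k \<in> carrier H\<rbrakk> \<Longrightarrow> counit (h \<otimes>\<^bsub>H\<^esub> k) = counit h \<otimes>\<^bsub>R\<^esub> counit k"
  using counit_hom by (auto simp: alg_hom_def ring_hom_def left_regular_def)

lemma counit_one: "counit \<one>\<^bsub>H\<^esub> = \<one>\<^bsub>R\<^esub>"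
  using counit_hom by (auto simp: alg_hom_def ring_hom_def left_regular_def)

section \<open>The Galois connection\<close>

lemma galois_phi_iff:
  assumes I: "submodule I R H"
  shows "a \<in> galois_phi R H A coact I \<longleftrightarrow> a \<in> carrier A \<and>
    vanishes_mod R A H I (coact a \<ominus>\<^bsub>AH\<^esub> pure_tensor R A H a \<one>\<^bsub>H\<^esub>)"
proof (cases "a \<in> carrier A")
  case a: True
  interpret I: right_submodule R H I by (rule right_submodule_if_submodule[OF mH I])
  have "tensor_map R A I.Q id I.proj (pure_tensor R A H a \<one>\<^bsub>H\<^esub>) = pure_tensor R A I.Q a (I.proj \<one>\<^bsub>H\<^esub>)"
    using tensor_map_pure[OF pAH module_tensor_pair[OF mA quot_is_module[OF mH I]] module_hom_id I.proj_hom a oneH]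
    by simp
  then show ?thesis
    using a vanishes_mod_diff_iff[OF mA mH I coact_closed[OF a] tensor_pair.pure_closed[OF pAH a oneH]]
    by (simp add: galois_phi_def)
qed (simp add: galois_phi_def)

text \<open>
  The condition \<open>S \<subseteq> A\<^bsup>co H/I\<^esup>\<close>, imposed on right ideals that need not be coideals: an intersection of
  coideals is in general not a coideal, whereas an intersection of right ideals is a right ideal.
\<close>

definition right_ideals_for :: "'a set \<Rightarrow> 'h set set"
  where "right_ideals_for S = {I. submodule I R H \<and> (\<forall>x\<in>I. \<forall>h\<in>carrier H. x \<otimes>\<^bsub>H\<^esub> h \<in> I) \<and>
    (\<forall>a\<in>S. vanishes_mod R A H I (coact a \<ominus>\<^bsub>AH\<^esub> pure_tensor R A H a \<one>\<^bsub>H\<^esub>))}"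

text \<open>
  Modulo \<open>ker \<epsilon>\<close> every \<open>h\<close> equals \<open>\<epsilon>(h) 1\<close>, so \<open>a\<^sub>0 \<otimes> a\<^sub>1\<close> becomes \<open>a\<^sub>0 \<epsilon>(a\<^sub>1) \<otimes> 1 = a \<otimes> 1\<close>.
\<close>

lemma counit_kernel_right_ideals_for:
  assumes S: "S \<subseteq> carrier A"
  shows "{h \<in> carrier H. counit h = \<zero>\<^bsub>R\<^esub>} \<in> right_ideals_for S"
proof -
  define I where "I = {h \<in> carrier H. counit h = \<zero>\<^bsub>R\<^esub>}"
  have sub: "submodule I R H"
    unfolding I_def by (rule module.submoduleI[OF mH])
      (auto simp: counit_add counit_smult add_hom_zero[OF abH abR counit_add_hom]
        add_hom_minus[OF abH abR counit_add_hom])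
  interpret I: right_submodule R H I by (rule right_submodule_if_submodule[OF mH sub])
  note p' = module_tensor_pair[OF mA quot_is_module[OF mH sub]]
  interpret T: tensor_pair R A H by (rule pAH)
  interpret T': tensor_pair R A I.Q by (rule p')
  have bal: "balanced R A H A (\<lambda>x h. counit h \<odot>\<^bsub>A\<^esub> x)"
  proof (rule balancedI)
    show "(\<lambda>m. counit h \<odot>\<^bsub>A\<^esub> m) \<in> add_hom A A" if "h \<in> carrier H" for h
      by (rule module_hom_add_hom[OF module.smult_module_hom[OF mA counit_closed[OF that]]])
    show "(\<lambda>h. counit h \<odot>\<^bsub>A\<^esub> a) \<in> add_hom H A" if "a \<in> carrier A" for a
      by (rule add_hom_compose[OF counit_add_hom left_module.smult_hom_scalar[OF module.left_module[OF mA] that]])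
    show "counit h \<odot>\<^bsub>A\<^esub> (r \<odot>\<^bsub>A\<^esub> a) = counit (r \<odot>\<^bsub>H\<^esub> h) \<odot>\<^bsub>A\<^esub> a"
      if "r \<in> carrier R" "a \<in> carrier A" "h \<in> carrier H" for r a h
    proof -
      have "counit h \<odot>\<^bsub>A\<^esub> (r \<odot>\<^bsub>A\<^esub> a) = (counit h \<otimes>\<^bsub>R\<^esub> r) \<odot>\<^bsub>A\<^esub> a"
        by (rule module.smult_assoc1[OF mA counit_closed[OF that(3)] that(1,2), symmetric])
      then show ?thesis using counit_smult[OF that(1,3)] R_comm[OF that(1) counit_closed[OF that(3)]] by simp
    qed
  qed
  let ?e = "tensor_lift (add_monoid A) (\<lambda>x h. counit h \<odot>\<^bsub>A\<^esub> x)"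
  note e_hom = T.lift_hom[OF abA bal] and e_pure = T.lift_pure[OF abA bal]
  have eq: "tensor_map R A I.Q id I.proj s = T'.pure (?e s) (I.proj \<one>\<^bsub>H\<^esub>)" if s: "s \<in> carrier AH" for s
  proof (rule T.T_hom_eqI[OF T'.T_abelian tensor_map_hom[OF pAH p' module_hom_id I.proj_hom]
        add_hom_compose[OF e_hom T'.pure_hom_left[OF I.proj_closed[OF oneH]]] _ s])
    fix a h assume a: "a \<in> carrier A" and h: "h \<in> carrier H"
    note c = counit_closed[OF h]
    have e: "counit h \<odot>\<^bsub>H\<^esub> \<one>\<^bsub>H\<^esub> \<in> carrier H" by (rule module.smult_closed[OF mH c oneH])
    have "counit (counit h \<odot>\<^bsub>H\<^esub> \<one>\<^bsub>H\<^esub>) = counit h"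
      using monoid.r_one[OF ring.is_monoid[OF cring.axioms(1)[OF module.axioms(1)[OF mH]]] c]
      by (simp only: counit_smult[OF c oneH] counit_one)
    then have "counit (h \<ominus>\<^bsub>H\<^esub> counit h \<odot>\<^bsub>H\<^esub> \<one>\<^bsub>H\<^esub>) = \<zero>\<^bsub>R\<^esub>"
      using abelian_group.diff_zero_iff[OF abR c c] by (simp only: add_hom_diff[OF abH abR counit_add_hom h e])
    then have "h \<ominus>\<^bsub>H\<^esub> counit h \<odot>\<^bsub>H\<^esub> \<one>\<^bsub>H\<^esub> \<in> I"
      unfolding I_def using abelian_group.minus_closed[OF abH h e] by blast
    then have "I.proj h = I.proj (counit h \<odot>\<^bsub>H\<^esub> \<one>\<^bsub>H\<^esub>)"
      by (rule I.proj_eq[OF h e])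
    then have "T'.pure a (I.proj h) = T'.pure (counit h \<odot>\<^bsub>A\<^esub> a) (I.proj \<one>\<^bsub>H\<^esub>)"
      by (simp only: I.smult_Q[OF c oneH, symmetric] T'.pure_smult[OF c a I.proj_closed[OF oneH]])
    then show "tensor_map R A I.Q id I.proj (T.pure a h) = T'.pure (?e (T.pure a h)) (I.proj \<one>\<^bsub>H\<^esub>)"
      using tensor_map_pure[OF pAH p' module_hom_id I.proj_hom a h] e_pure[OF a h] by simp
  qed
  have "vanishes_mod R A H I (coact a \<ominus>\<^bsub>AH\<^esub> pure_tensor R A H a \<one>\<^bsub>H\<^esub>)" if "a \<in> S" for a
  proof -
    have a: "a \<in> carrier A" using that S by blast
    show ?thesis
      unfolding vanishes_mod_diff_iff[OF mA mH sub coact_closed[OF a] T.pure_closed[OF a oneH]]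
        eq[OF coact_closed[OF a]] coact_counit[OF a]
      using tensor_map_pure[OF pAH p' module_hom_id I.proj_hom a oneH] by simp
  qed
  moreover have "x \<otimes>\<^bsub>H\<^esub> h \<in> I" if x: "x \<in> I" and h: "h \<in> carrier H" for x h
  proof -
    have x: "x \<in> carrier H" "counit x = \<zero>\<^bsub>R\<^esub>" using x unfolding I_def by blast+
    have "\<zero>\<^bsub>R\<^esub> \<otimes>\<^bsub>R\<^esub> counit h = \<zero>\<^bsub>R\<^esub>"
      using counit_closed[OF h] by simp
    then show ?thesis
      using multH[OF x(1) h] counit_mult[OF x(1) h] x(2)
      unfolding I_def by simp
  qed
  ultimately have "I \<in> right_ideals_for S" using sub unfolding right_ideals_for_def by blast
  then show ?thesis unfolding I_def .
qed

end

text \<open>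
  The span \<open>I \<otimes> H + H \<otimes> I\<close> in \<open>H \<otimes> H\<close>.
\<close>

definition coideal_span ::
  "('r, 'c) ring_scheme \<Rightarrow> ('r, 'h, 'd) module_scheme \<Rightarrow> 'h set \<Rightarrow> ('h, 'h) tens set"
  where "coideal_span R H I = generate (tensor_group R H H)
       ({pure_tensor R H H i h | i h. i \<in> I \<and> h \<in> carrier H} \<union>
        {pure_tensor R H H h i | i h. i \<in> I \<and> h \<in> carrier H})"

context comodule_algebra
begin

lemma coideal_span:
  assumes I: "submodule I R H" and J: "\<And>x h. \<lbrakk>x \<in> I; h \<in> carrier H\<rbrakk> \<Longrightarrow> x \<otimes>\<^bsub>H\<^esub> h \<in> I"
  shows coideal_span_submodule: "submodule (coideal_span R H I) R HH"
    and coideal_span_mult: "\<lbrakk>w \<in> coideal_span R H I; y \<in> carrier HH\<rbrakk> \<Longrightarrow> w \<otimes>\<^bsub>HH\<^esub> y \<in> coideal_span R H I"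
    and coideal_span_pure: "\<lbrakk>i \<in> I; h \<in> carrier H\<rbrakk> \<Longrightarrow> pure_tensor R H H i h \<in> coideal_span R H I"
      "\<lbrakk>i \<in> I; h \<in> carrier H\<rbrakk> \<Longrightarrow> pure_tensor R H H h i \<in> coideal_span R H I"
proof -
  interpret T: tensor_pair R H H by (rule pHH)
  interpret TT: abelian_group HH by (rule T.T_abelian)
  let ?X = "{pure_tensor R H H i h | i h. i \<in> I \<and> h \<in> carrier H} \<union>
        {pure_tensor R H H h i | i h. i \<in> I \<and> h \<in> carrier H}"
  let ?W = "coideal_span R H I"
  have IH: "i \<in> carrier H" if "i \<in> I" for i using module.submoduleE(1)[OF mH I] that by blast
  have X: "?X \<subseteq> carrier HH"
    using IH by auto
  have W: "?W = generate (add_monoid HH) ?X"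
    unfolding coideal_span_def by (rule generate_eqI) (simp_all add: tensor_def Let_def)
  have sub: "subgroup ?W (add_monoid HH)"
    unfolding W by (rule group.generate_is_subgroup[OF TT.a_group]) (use X in simp)
  show pure1: "T.pure i h \<in> ?W" if "i \<in> I" "h \<in> carrier H" for i h
    unfolding W by (rule generate.incl) (use that in blast)
  show pure2: "T.pure h i \<in> ?W" if "i \<in> I" "h \<in> carrier H" for i h
    unfolding W by (rule generate.incl) (use that in blast)
  show "submodule ?W R HH"
  proof (intro submodule.intro sub submodule_axioms.intro)
    fix r x assume r: "r \<in> carrier R" and x: "x \<in> ?W"
    show "r \<odot>\<^bsub>HH\<^esub> x \<in> ?W"
    proof (rule add_hom_generate[OF TT.abelian_group_axioms TT.abelian_group_axioms
          module_hom_add_hom[OF module.smult_module_hom[OF mHH r]] X sub _ x[unfolded W]])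
      have rI: "r \<odot>\<^bsub>H\<^esub> i \<in> I" if "i \<in> I" for i by (rule submodule.smult_closed[OF I r that])
      fix x assume "x \<in> ?X"
      then consider i h where "x = T.pure i h" "i \<in> I" "h \<in> carrier H" | i h where "x = T.pure h i" "i \<in> I" "h \<in> carrier H"
        by blast
      then show "r \<odot>\<^bsub>HH\<^esub> x \<in> ?W"
      proof cases
        case (1 i h)
        then show ?thesis
          using pure1[OF rI[OF 1(2)] 1(3)] tensor_smult_pure[OF mH mH r IH[OF 1(2)] 1(3)] by simp
      next
        case (2 i h)
        then show ?thesis
          using pure2[OF 2(2) module.smult_closed[OF mH r 2(3)]] tensor_smult_pure[OF mH mH r 2(3) IH[OF 2(2)]] by simp
      qed
    qed
  qed
  show "w \<otimes>\<^bsub>HH\<^esub> y \<in> ?W" if w: "w \<in> ?W" and y: "y \<in> carrier HH" for w y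
  proof -
    have wH: "w \<in> carrier HH" using subgroup.subset[OF sub] w by auto
    note hom = tensor_mult_hom_right[OF algH algH wH]
    show ?thesis
      using y
    proof (induction y rule: T.T_induct)
      case zero
      show ?case using add_hom_zero[OF T.T_abelian T.T_abelian hom] subgroup.one_closed[OF sub] by simp
    next
      case (add y z)
      then show ?case using add_hom_add[OF hom add(1,2)] subgroup.m_closed[OF sub add(3,4)] by simp
    next
      case (pure g k)
      show ?case
      proof (rule add_hom_generate[OF TT.abelian_group_axioms TT.abelian_group_axioms
          tensor_mult_hom_left[OF algH algH T.pure_closed[OF pure]] X sub _ w[unfolded W]])
        fix x assume "x \<in> ?X"
        then consider i h where "x = T.pure i h" "i \<in> I" "h \<in> carrier H" | i h where "x = T.pure h i" "i \<in> I" "h \<in> carrier H"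
          by blast
        then show "x \<otimes>\<^bsub>HH\<^esub> T.pure g k \<in> ?W"
        proof cases
          case (1 i h)
          have "x \<otimes>\<^bsub>HH\<^esub> T.pure g k = T.pure (i \<otimes>\<^bsub>H\<^esub> g) (h \<otimes>\<^bsub>H\<^esub> k)"
            unfolding 1(1) tensor_mult_pure_left[OF algH algH IH[OF 1(2)] 1(3) T.pure_closed[OF pure]]
            by (rule tensor_map_pure[OF pHH pHH left_mult_hom[OF algH IH[OF 1(2)]] left_mult_hom[OF algH 1(3)] pure])
          then show ?thesis
            using pure1[OF J[OF 1(2) pure(1)] multH[OF 1(3) pure(2)]] by simp
        next
          case (2 i h)
          have "x \<otimes>\<^bsub>HH\<^esub> T.pure g k = T.pure (h \<otimes>\<^bsub>H\<^esub> g) (i \<otimes>\<^bsub>H\<^esub> k)"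
            unfolding 2(1) tensor_mult_pure_left[OF algH algH 2(3) IH[OF 2(2)] T.pure_closed[OF pure]]
            by (rule tensor_map_pure[OF pHH pHH left_mult_hom[OF algH 2(3)] left_mult_hom[OF algH IH[OF 2(2)]] pure])
          then show ?thesis
            using pure2[OF J[OF 2(2) pure(2)] multH[OF 2(3) pure(1)]] by simp
        qed
      qed
    qed
  qed
qed

text \<open>
  Let \<open>W = I \<otimes> H + H \<otimes> I\<close>. Since \<open>a\<^sub>0 \<otimes> a\<^sub>1 \<equiv> a \<otimes> 1\<close> modulo \<open>A \<otimes> I\<close>, modulo \<open>A \<otimes> W\<close> one has
  \<open>a\<^sub>0 \<otimes> \<Delta>(a\<^sub>1) = \<delta>(a\<^sub>0) \<otimes> a\<^sub>1 \<equiv> \<delta>(a) \<otimes> 1 \<equiv> a \<otimes> 1 \<otimes> 1 = a \<otimes> \<Delta>(1)\<close>. So \<open>a\<^sub>0 \<otimes> a\<^sub>1 - a \<otimes> 1\<close> vanishes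
  modulo the preimage of \<open>W\<close> under \<open>\<Delta>\<close>, which is a right ideal because \<open>\<Delta>\<close> is multiplicative.
\<close>

lemma comult_vimage_right_ideals_for:
  assumes flat: "flat_left_module R A" and S: "S \<subseteq> carrier A" and I: "I \<in> right_ideals_for S"
  shows "{h \<in> carrier H. comult h \<in> coideal_span R H I} \<in> right_ideals_for S"
proof -
  have sub: "submodule I R H" and J: "\<And>x h. \<lbrakk>x \<in> I; h \<in> carrier H\<rbrakk> \<Longrightarrow> x \<otimes>\<^bsub>H\<^esub> h \<in> I"
    and van: "\<And>a. a \<in> S \<Longrightarrow> vanishes_mod R A H I (coact a \<ominus>\<^bsub>AH\<^esub> pure_tensor R A H a \<one>\<^bsub>H\<^esub>)"
    using I unfolding right_ideals_for_def by blast+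
  define W where "W = coideal_span R H I"
  have Wsub: "submodule W R HH" unfolding W_def by (rule coideal_span_submodule[OF sub J])
  have IH: "i \<in> carrier H" if "i \<in> I" for i using module.submoduleE(1)[OF mH sub] that by blast
  interpret W: right_submodule R HH W by (rule right_submodule_if_submodule[OF mHH Wsub])
  note mQ = quot_is_module[OF mHH Wsub]
  note pQ = module_tensor_pair[OF mA mQ]
  interpret AH: tensor_pair R A H by (rule pAH)
  interpret AHH: tensor_pair R A HH by (rule pA_HH)
  interpret AH_H: tensor_pair R AH H by (rule pAH_H)
  interpret HHp: tensor_pair R H H by (rule pHH)
  interpret AQ: tensor_pair R A W.Q by (rule pQ)
  note abAH = AH.T_abelian and abAHH = AHH.T_abelian and abQ = AQ.T_abelian and abAH_H = AH_H.T_abelian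
  let ?\<pi> = "tensor_map R A W.Q id W.proj"
  let ?as = "tensor_assoc R A H H"
  have \<pi>: "?\<pi> \<in> add_hom AHH AQ.T" by (rule tensor_map_hom[OF pA_HH pQ module_hom_id W.proj_hom])
  have \<pi>_pure: "?\<pi> (AHH.pure a x) = AQ.pure a (W.proj x)" if "a \<in> carrier A" "x \<in> carrier HH" for a x
    using tensor_map_pure[OF pA_HH pQ module_hom_id W.proj_hom that] by simp
  have as: "?as \<in> add_hom AH_H.T AHH.T" by (rule module_hom_add_hom[OF tensor_assoc_module_hom[OF mA mH mH]])
  note as_pure = tensor_assoc_pure[OF mA mH mH]
  (* U is s |-> s (x) 1, and V is s |-> coact(s_0) (x) s_1, both modulo A (x) W. *)
  define U where "U s = ?\<pi> (?as (AH_H.pure s \<one>\<^bsub>H\<^esub>))" for s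
  have U: "U \<in> add_hom AH AQ.T"
    unfolding U_def by (rule add_hom_compose[OF add_hom_compose[OF AH_H.pure_hom_left[OF oneH] as] \<pi>])
  define V where "V s = ?\<pi> (?as (tensor_map R AH H coact id s))" for s
  note cm = tensor_map_hom[OF pAH pAH_H coact_mhom module_hom_id]
  have V: "V \<in> add_hom AH AQ.T"
    unfolding V_def by (rule add_hom_compose[OF add_hom_compose[OF cm as] \<pi>])
  have zero: "AQ.pure a (W.proj w) = \<zero>\<^bsub>AQ.T\<^esub>" if "a \<in> carrier A" "w \<in> carrier HH" "w \<in> W" for a w
    using that W.proj_zero_iff AQ.pure_zero_right by metis
  have U_I: "U (AH.pure y n) = \<zero>\<^bsub>AQ.T\<^esub>" if y: "y \<in> carrier A" and n: "n \<in> I" for y n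
    unfolding U_def as_pure[OF y IH[OF n] oneH] \<pi>_pure[OF y HHp.pure_closed[OF IH[OF n] oneH]]
    by (rule zero[OF y HHp.pure_closed[OF IH[OF n] oneH]])
      (unfold W_def, rule coideal_span_pure(1)[OF sub J n oneH])
  have V_I: "V (AH.pure y n) = \<zero>\<^bsub>AQ.T\<^esub>" if y: "y \<in> carrier A" and n: "n \<in> I" for y n
  proof -
    have "?\<pi> (?as (AH_H.pure s n)) = \<zero>\<^bsub>AQ.T\<^esub>" if s: "s \<in> carrier AH" for s
    proof (rule AH.T_hom_eqI[OF abQ add_hom_compose[OF add_hom_compose[OF AH_H.pure_hom_left[OF IH[OF n]] as] \<pi>] _ _ s])
      interpret Q: abelian_group AQ.T by (rule abQ)
      show "(\<lambda>_. \<zero>\<^bsub>AQ.T\<^esub>) \<in> add_hom AH AQ.T" by (rule add_homI) auto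
      fix x h assume x: "x \<in> carrier A" and h: "h \<in> carrier H"
      show "?\<pi> (?as (AH_H.pure (AH.pure x h) n)) = \<zero>\<^bsub>AQ.T\<^esub>"
        unfolding as_pure[OF x h IH[OF n]] \<pi>_pure[OF x HHp.pure_closed[OF h IH[OF n]]]
        by (rule zero[OF x HHp.pure_closed[OF h IH[OF n]]])
          (unfold W_def, rule coideal_span_pure(2)[OF sub J n h])
    qed
    then show ?thesis
      unfolding V_def tensor_map_pure[OF pAH pAH_H coact_mhom module_hom_id y IH[OF n]] id_apply
      using coact_closed[OF y] by blast
  qed
  have key: "vanishes_mod R A HH W (tensor_map R A HH id comult (coact a \<ominus>\<^bsub>AH\<^esub> AH.pure a \<one>\<^bsub>H\<^esub>))" if aS: "a \<in> S" for a
  proof -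
    have a: "a \<in> carrier A" using S aS by blast
    let ?t = "coact a \<ominus>\<^bsub>AH\<^esub> AH.pure a \<one>\<^bsub>H\<^esub>"
    note ca = coact_closed[OF a] and p1 = AH.pure_closed[OF a oneH]
    have t: "?t \<in> carrier AH" by (rule abelian_group.minus_closed[OF abAH ca p1])
    have Ut: "U ?t = \<zero>\<^bsub>AQ.T\<^esub>"
      by (rule vanishes_mod_kills[OF flat mA mH sub abQ U U_I t van[OF aS]])
    have Vt: "V ?t = \<zero>\<^bsub>AQ.T\<^esub>"
      by (rule vanishes_mod_kills[OF flat mA mH sub abQ V V_I t van[OF aS]])
    have "V (coact a) = V (AH.pure a \<one>\<^bsub>H\<^esub>)"
      using Vt abelian_group.diff_zero_iff[OF abQ add_hom_closed[OF V ca] add_hom_closed[OF V p1]]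
      unfolding add_hom_diff[OF abAH abQ V ca p1] by blast
    also have "\<dots> = U (coact a)"
      unfolding U_def V_def tensor_map_pure[OF pAH pAH_H coact_mhom module_hom_id a oneH] id_apply ..
    also have "\<dots> = U (AH.pure a \<one>\<^bsub>H\<^esub>)"
      using Ut abelian_group.diff_zero_iff[OF abQ add_hom_closed[OF U ca] add_hom_closed[OF U p1]]
      unfolding add_hom_diff[OF abAH abQ U ca p1] by blast
    also have "\<dots> = ?\<pi> (AHH.pure a (comult \<one>\<^bsub>H\<^esub>))"
      unfolding U_def as_pure[OF a oneH oneH] comult_one ..
    finally have eq: "?\<pi> (tensor_map R A HH id comult (coact a)) = ?\<pi> (AHH.pure a (comult \<one>\<^bsub>H\<^esub>))"
      unfolding V_def coact_coassoc[OF a] .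
    note c = tensor_map_hom[OF pAH pA_HH module_hom_id comult_mhom]
    have "tensor_map R A HH id comult (AH.pure a \<one>\<^bsub>H\<^esub>) = AHH.pure a (comult \<one>\<^bsub>H\<^esub>)"
      using tensor_map_pure[OF pAH pA_HH module_hom_id comult_mhom a oneH] unfolding id_apply .
    with eq have "?\<pi> (tensor_map R A HH id comult (coact a)) = ?\<pi> (tensor_map R A HH id comult (AH.pure a \<one>\<^bsub>H\<^esub>))"
      by metis
    then show ?thesis
      unfolding add_hom_diff[OF abAH abAHH c ca p1]
      by (rule iffD2[OF vanishes_mod_diff_iff[OF mA mHH Wsub add_hom_closed[OF c ca] add_hom_closed[OF c p1]]])
  qed
  have "vanishes_mod R A H {h \<in> carrier H. comult h \<in> W} (coact a \<ominus>\<^bsub>AH\<^esub> AH.pure a \<one>\<^bsub>H\<^esub>)" if aS: "a \<in> S" for a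
  proof -
    have a: "a \<in> carrier A" using S aS by blast
    show ?thesis
      by (rule vanishes_mod_vimage[OF flat mA mH mHH comult_mhom Wsub
            abelian_group.minus_closed[OF abAH coact_closed[OF a] AH.pure_closed[OF a oneH]] key[OF aS]])
  qed
  moreover have "submodule {h \<in> carrier H. comult h \<in> W} R H"
    by (rule submodule_vimage[OF mH mHH comult_mhom Wsub])
  moreover have "x \<otimes>\<^bsub>H\<^esub> h \<in> {h \<in> carrier H. comult h \<in> W}"
    if "x \<in> {h \<in> carrier H. comult h \<in> W}" and h: "h \<in> carrier H" for x h
  proof -
    have x: "x \<in> carrier H" "comult x \<in> W" using that by blast+
    have "comult x \<otimes>\<^bsub>HH\<^esub> comult h \<in> W"
      unfolding W_def by (rule coideal_span_mult[OF sub J x(2)[unfolded W_def] comult_closed[OF h]])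
    then show ?thesis
      using comult_mult[OF x(1) h] multH[OF x(1) h] by simp
  qed
  ultimately show ?thesis unfolding right_ideals_for_def W_def by blast
qed

text \<open>
  By \<open>vanishes_mod_Inter\<close> the intersection \<open>N\<close> of the family belongs to the family. As its least
  element, \<open>N\<close> lies in \<open>ker \<epsilon>\<close> and in the preimage of \<open>N \<otimes> H + H \<otimes> N\<close> under \<open>\<Delta>\<close>, so it is a coideal. It is
  therefore the least among the coideals over which the supremum is taken, and a least ideal is a
  largest quotient.
\<close>

lemma galois_psi_eq:
  assumes flat: "flat_left_module R A" and mittag: "mittag_leffler R A" and S: "S \<subseteq> carrier A"
  shows "galois_psi R H comult counit A coact S = \<Inter>(right_ideals_for S)"
    and "right_ideal_coideal R H comult counit (\<Inter>(right_ideals_for S))"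
    and "S \<subseteq> galois_phi R H A coact (\<Inter>(right_ideals_for S))"
proof -
  let ?N = "\<Inter>(right_ideals_for S)"
  have ne: "right_ideals_for S \<noteq> {}" using counit_kernel_right_ideals_for[OF S] by blast
  have subs: "\<And>W. W \<in> right_ideals_for S \<Longrightarrow> submodule W R H" unfolding right_ideals_for_def by blast
  have van: "\<And>W a. \<lbrakk>W \<in> right_ideals_for S; a \<in> S\<rbrakk> \<Longrightarrow>
      vanishes_mod R A H W (coact a \<ominus>\<^bsub>AH\<^esub> pure_tensor R A H a \<one>\<^bsub>H\<^esub>)"
    unfolding right_ideals_for_def by blast
  have d: "coact a \<ominus>\<^bsub>AH\<^esub> pure_tensor R A H a \<one>\<^bsub>H\<^esub> \<in> carrier AH" if "a \<in> S" for a
    using that S coact_closed tensor_pair.pure_closed[OF pAH _ oneH]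
    by (intro abelian_group.minus_closed[OF tensor_pair.T_abelian[OF pAH]]) auto
  have sub: "submodule ?N R H"
  proof (rule vanishes_mod_Inter(1)[OF flat mittag mH ne subs])
    interpret T: tensor_pair R A H by (rule pAH)
    show "\<zero>\<^bsub>AH\<^esub> \<in> carrier AH" using abelian_monoid.zero_closed[OF abelian_group.axioms(1)[OF T.T_abelian]] .
    fix W assume W: "W \<in> right_ideals_for S"
    interpret W: right_submodule R H W by (rule right_submodule_if_submodule[OF mH subs[OF W]])
    note p' = module_tensor_pair[OF mA quot_is_module[OF mH subs[OF W]]]
    show "vanishes_mod R A H W \<zero>\<^bsub>AH\<^esub>"
      unfolding vanishes_mod_def
      by (rule add_hom_zero[OF T.T_abelian tensor_pair.T_abelian[OF p'] tensor_map_hom[OF pAH p' module_hom_id W.proj_hom]])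
  qed
  have vanN: "vanishes_mod R A H ?N (coact a \<ominus>\<^bsub>AH\<^esub> pure_tensor R A H a \<one>\<^bsub>H\<^esub>)" if "a \<in> S" for a
    by (rule vanishes_mod_Inter(2)[OF flat mittag mH ne subs d[OF that] van[OF _ that]])
  have JN: "x \<otimes>\<^bsub>H\<^esub> h \<in> ?N" if "x \<in> ?N" "h \<in> carrier H" for x h
    using that unfolding right_ideals_for_def by blast
  have N: "?N \<in> right_ideals_for S"
    using sub vanN JN unfolding right_ideals_for_def[of S] by blast
  show coideal: "right_ideal_coideal R H comult counit ?N"
    unfolding right_ideal_coideal_def coideal_span_def[symmetric]
    using sub JN counit_kernel_right_ideals_for[OF S] comult_vimage_right_ideals_for[OF flat S N] by blast
  show phi: "S \<subseteq> galois_phi R H A coact ?N"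
    using S vanN galois_phi_iff[OF sub] by blast
  let ?L = "Quot_gen R H comult counit"
  let ?X = "{I \<in> carrier ?L. S \<subseteq> galois_phi R H A coact I}"
  have mem: "?N \<in> ?X" using coideal phi by (simp add: Quot_gen_def)
  have low: "?N \<subseteq> I" if "I \<in> ?X" for I
  proof -
    have "right_ideal_coideal R H comult counit I" and SI: "S \<subseteq> galois_phi R H A coact I"
      using that by (auto simp: Quot_gen_def)
    then have I: "submodule I R H" "\<forall>x\<in>I. \<forall>h\<in>carrier H. x \<otimes>\<^bsub>H\<^esub> h \<in> I"
      unfolding right_ideal_coideal_def by blast+
    then have "I \<in> right_ideals_for S"
      using SI galois_phi_iff[OF I(1)] unfolding right_ideals_for_def by blast
    then show ?thesis by blast
  qed
  have least: "least ?L N (Upper ?L ?X) \<longleftrightarrow> N = ?N" for N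
  proof
    assume N: "least ?L N (Upper ?L ?X)"
    have "?N \<in> Upper ?L ?X" using mem low by (auto simp: Upper_def Quot_gen_def)
    then have "?N \<subseteq> N" using N by (auto simp: least_def Quot_gen_def)
    moreover have "N \<subseteq> ?N" using N mem by (auto simp: least_def Upper_def Quot_gen_def)
    ultimately show "N = ?N" by blast
  next
    assume "N = ?N"
    then show "least ?L N (Upper ?L ?X)"
      using mem low by (auto simp: least_def Upper_def Quot_gen_def)
  qed
  show "galois_psi R H comult counit A coact S = ?N"
    unfolding galois_psi_def sup_def least by simp
qed

end

section \<open>Consequences of flatness and faithful flatness\<close>

lemma tensor_map_cong:
  assumes T: "tensor_pair B M N" "tensor_pair B M' N'" and f: "f \<in> module_hom B M M'" and g: "g \<in> module_hom B N N'"
    and f': "\<And>m. m \<in> carrier M \<Longrightarrow> f' m = f m" and g': "\<And>n. n \<in> carrier N \<Longrightarrow> g' n = g n"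
    and x: "x \<in> carrier (tensor B M N)"
  shows "tensor_map B M' N' f' g' x = tensor_map B M' N' f g x"
proof -
  have "tensor_map B M' N' f' g' x = tensor_map B M' N' f g (tensor_map B M N id id x)"
    by (rule tensor_map_compose[OF T(1,1,2) module_hom_id f module_hom_id g _ _ x, symmetric]) (simp_all add: f' g')
  also have "tensor_map B M N id id x = x" by (rule tensor_map_id[OF T(1) _ x]) simp
  finally show ?thesis .
qed

lemma tensor_map_add_left:
  assumes T: "tensor_pair B M N" "tensor_pair B M' N'"
    and f: "f \<in> module_hom B M M'" "f' \<in> module_hom B M M'" and g: "g \<in> module_hom B N N'"
    and h: "h \<in> module_hom B M M'" "\<And>m. m \<in> carrier M \<Longrightarrow> h m = f m \<oplus>\<^bsub>M'\<^esub> f' m"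
    and x: "x \<in> carrier (tensor B M N)"
  shows "tensor_map B M' N' h g x = tensor_map B M' N' f g x \<oplus>\<^bsub>tensor B M' N'\<^esub> tensor_map B M' N' f' g x"
proof -
  interpret T: tensor_pair B M N by (rule T)
  interpret T': tensor_pair B M' N' by (rule T)
  note a = tensor_map_hom[OF T f(1) g] and b = tensor_map_hom[OF T f(2) g]
  show ?thesis
    by (rule T.T_hom_eqI[OF T'.T_abelian tensor_map_hom[OF T h(1) g]
          add_hom_plus[OF T'.T_abelian a b] _ x])
      (simp add: tensor_map_pure[OF T f(1) g] tensor_map_pure[OF T f(2) g] tensor_map_pure[OF T h(1) g] h(2)
        T'.pure_add_left module_hom_closed[OF f(1)] module_hom_closed[OF f(2)] module_hom_closed[OF g])
qed

lemma tensor_map_add_right: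
  assumes T: "tensor_pair B M N" "tensor_pair B M' N'"
    and f: "f \<in> module_hom B M M'" and g: "g \<in> module_hom B N N'" "g' \<in> module_hom B N N'"
    and h: "h \<in> module_hom B N N'" "\<And>n. n \<in> carrier N \<Longrightarrow> h n = g n \<oplus>\<^bsub>N'\<^esub> g' n"
    and x: "x \<in> carrier (tensor B M N)"
  shows "tensor_map B M' N' f h x = tensor_map B M' N' f g x \<oplus>\<^bsub>tensor B M' N'\<^esub> tensor_map B M' N' f g' x"
proof -
  interpret T: tensor_pair B M N by (rule T)
  interpret T': tensor_pair B M' N' by (rule T)
  note a = tensor_map_hom[OF T f g(1)] and b = tensor_map_hom[OF T f g(2)]
  show ?thesis
    by (rule T.T_hom_eqI[OF T'.T_abelian tensor_map_hom[OF T f h(1)]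
          add_hom_plus[OF T'.T_abelian a b] _ x])
      (simp add: tensor_map_pure[OF T f g(1)] tensor_map_pure[OF T f g(2)] tensor_map_pure[OF T f h(1)] h(2)
        T'.pure_add_right module_hom_closed[OF g(1)] module_hom_closed[OF g(2)] module_hom_closed[OF f])
qed

text \<open>
  The kernel of \<open>f \<otimes> N\<close> comes from \<open>ker f \<otimes> N\<close>. Unlike in the definition of flatness, the types of
  the elements of \<open>M\<close> and \<open>P\<close> are arbitrary, thanks to the equational criterion.
\<close>

lemma flat_kernel_rep:
  fixes M :: "('b, 'm, 'e) module_scheme" and N :: "('b, 'n, 'd) module_scheme"
  assumes flat: "flat_left_module B N" and M: "right_module B M" and P: "right_module B P"
    and f: "f \<in> module_hom B M P" and z: "z \<in> carrier (tensor B M N)" "tensor_map B P N f id z = \<zero>\<^bsub>tensor B P N\<^esub>"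
  shows "\<exists>(k :: nat) v y. v \<in> {..<k} \<rightarrow> {m \<in> carrier M. f m = \<zero>\<^bsub>P\<^esub>} \<and> y \<in> {..<k} \<rightarrow> carrier N \<and>
    z = (\<Oplus>\<^bsub>tensor B M N\<^esub>j\<in>{..<k}. pure_tensor B M N (v j) (y j))"
proof -
  have N: "left_module B N" using flat by (simp add: flat_left_module_def)
  interpret M: right_module B M by (rule M)
  interpret P: right_module B P by (rule P)
  interpret T: tensor_pair B M N by (intro tensor_pair.intro M N)
  interpret T': tensor_pair B P N by (intro tensor_pair.intro P N)
  obtain n :: nat and m a where m: "m \<in> {..<n} \<rightarrow> carrier M" and a: "a \<in> {..<n} \<rightarrow> carrier N"
    and z_eq: "z = (\<Oplus>\<^bsub>T.T\<^esub>i\<in>{..<n}. T.pure (m i) (a i))"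
    using T.T_finsumE[OF z(1)] by blast
  have fm: "(\<lambda>i. f (m i)) \<in> {..<n} \<rightarrow> carrier P" using m module_hom_closed[OF f] by (auto simp: Pi_iff)
  have "(\<Oplus>\<^bsub>T'.T\<^esub>i\<in>{..<n}. T'.pure (f (m i)) (a i)) = \<zero>\<^bsub>T'.T\<^esub>"
    using tensor_map_finsum[OF T.tensor_pair_axioms T'.tensor_pair_axioms f module_hom_id m a] z(2)
    unfolding z_eq id_apply by metis
  from flat_vanishing[OF flat P finite_lessThan fm a this]
  obtain k :: nat and y c where y: "y \<in> {..<k} \<rightarrow> carrier N" and c: "\<forall>i\<in>{..<n}. \<forall>j<k. c i j \<in> carrier B"
    and a_eq: "\<forall>i\<in>{..<n}. a i = (\<Oplus>\<^bsub>N\<^esub>j\<in>{..<k}. c i j \<odot>\<^bsub>N\<^esub> y j)"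
    and zero: "\<forall>j<k. (\<Oplus>\<^bsub>P\<^esub>i\<in>{..<n}. c i j \<odot>\<^bsub>P\<^esub> f (m i)) = \<zero>\<^bsub>P\<^esub>" by blast
  have "(\<Oplus>\<^bsub>M\<^esub>i\<in>{..<n}. c i j \<odot>\<^bsub>M\<^esub> m i) \<in> {m \<in> carrier M. f m = \<zero>\<^bsub>P\<^esub>}" if j: "j < k" for j
  proof -
    have cm: "(\<lambda>i. c i j \<odot>\<^bsub>M\<^esub> m i) \<in> {..<n} \<rightarrow> carrier M"
      using c j m by (auto simp: Pi_iff intro!: M.smult_closed)
    have "f (\<Oplus>\<^bsub>M\<^esub>i\<in>{..<n}. c i j \<odot>\<^bsub>M\<^esub> m i) = (\<Oplus>\<^bsub>P\<^esub>i\<in>{..<n}. f (c i j \<odot>\<^bsub>M\<^esub> m i))"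
      by (rule add_hom_finsum[OF M.M.abelian_group_axioms P.M.abelian_group_axioms module_hom_add_hom[OF f] cm])
    also have "\<dots> = (\<Oplus>\<^bsub>P\<^esub>i\<in>{..<n}. c i j \<odot>\<^bsub>P\<^esub> f (m i))"
      using c j m fm by (intro P.finsum_cong') (auto simp: module_hom_smult[OF f] Pi_iff intro!: P.smult_closed)
    finally show ?thesis using zero j M.finsum_closed[OF cm] by simp
  qed
  moreover have "z = (\<Oplus>\<^bsub>T.T\<^esub>j\<in>{..<k}. T.pure (\<Oplus>\<^bsub>M\<^esub>i\<in>{..<n}. c i j \<odot>\<^bsub>M\<^esub> m i) (y j))"
    unfolding z_eq by (rule T.finsum_exchange[OF finite_lessThan m y]) (use c a_eq in blast)+
  ultimately show ?thesis
    using y by (intro exI[of _ k] exI[of _ "\<lambda>j. \<Oplus>\<^bsub>M\<^esub>i\<in>{..<n}. c i j \<odot>\<^bsub>M\<^esub> m i"] exI[of _ y]) auto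
qed

lemma flat_tensor_inj:
  fixes M :: "('b, 'm, 'e) module_scheme" and N :: "('b, 'n, 'd) module_scheme"
  assumes flat: "flat_left_module B N" and M: "right_module B M" and P: "right_module B P"
    and f: "f \<in> module_hom B M P" and inj: "inj_on f (carrier M)"
  shows "inj_on (tensor_map B P N f id) (carrier (tensor B M N))"
proof -
  have N: "left_module B N" using flat by (simp add: flat_left_module_def)
  interpret M: right_module B M by (rule M)
  interpret P: right_module B P by (rule P)
  interpret T: tensor_pair B M N by (intro tensor_pair.intro M N)
  interpret T': tensor_pair B P N by (intro tensor_pair.intro P N)
  interpret TT: abelian_group T.T by (rule T.T_abelian)
  interpret TT': abelian_group T'.T by (rule T'.T_abelian)
  note h = tensor_map_hom[OF T.tensor_pair_axioms T'.tensor_pair_axioms f module_hom_id]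
  have ker: "z = \<zero>\<^bsub>T.T\<^esub>" if z: "z \<in> carrier T.T" "tensor_map B P N f id z = \<zero>\<^bsub>T'.T\<^esub>" for z
  proof -
    obtain k :: nat and v y where v: "v \<in> {..<k} \<rightarrow> {m \<in> carrier M. f m = \<zero>\<^bsub>P\<^esub>}" and y: "y \<in> {..<k} \<rightarrow> carrier N"
      and z_eq: "z = (\<Oplus>\<^bsub>T.T\<^esub>j\<in>{..<k}. T.pure (v j) (y j))"
      using flat_kernel_rep[OF flat M P f z] by blast
    have "f \<zero>\<^bsub>M\<^esub> = \<zero>\<^bsub>P\<^esub>"
      by (rule add_hom_zero[OF M.M.abelian_group_axioms P.M.abelian_group_axioms module_hom_add_hom[OF f]])
    then have "v j = \<zero>\<^bsub>M\<^esub>" if "j < k" for j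
      using v that inj_onD[OF inj, of "v j" "\<zero>\<^bsub>M\<^esub>"] by (auto simp: Pi_iff)
    then have "z = (\<Oplus>\<^bsub>T.T\<^esub>j\<in>{..<k}. \<zero>\<^bsub>T.T\<^esub>)"
      unfolding z_eq using y by (intro TT.finsum_cong') (auto simp: T.pure_zero_left Pi_iff)
    then show ?thesis by (simp only: TT.finsum_zero)
  qed
  show ?thesis
  proof (rule inj_onI)
    fix x y assume x: "x \<in> carrier T.T" and y: "y \<in> carrier T.T"
      and eq: "tensor_map B P N f id x = tensor_map B P N f id y"
    have "tensor_map B P N f id (x \<ominus>\<^bsub>T.T\<^esub> y) = \<zero>\<^bsub>T'.T\<^esub>"
      using TT'.diff_zero_iff[OF add_hom_closed[OF h x] add_hom_closed[OF h y]] eq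
      unfolding add_hom_diff[OF T.T_abelian T'.T_abelian h x y] by blast
    from ker[OF TT.minus_closed[OF x y] this] show "x = y" using TT.diff_zero_iff[OF x y] by blast
  qed
qed

lemma faithfully_flat_imp_flat: "faithfully_flat_left_module B N \<Longrightarrow> flat_left_module B N"
  unfolding faithfully_flat_left_module_def flat_left_module_def by blast

text \<open>
  If \<open>J N = N\<close>, then \<open>J \<otimes> N \<rightarrow> B \<otimes> N \<rightarrow> 0\<close> is exact, whence \<open>J \<rightarrow> B \<rightarrow> 0\<close> is exact. The rings and
  modules of this sequence become test modules as lists of length 1 or 0.
\<close>

lemma faithfully_flat_right_ideal:
  fixes N :: "('b, 'n, 'd) module_scheme"
  assumes ff: "faithfully_flat_left_module B N"
    and J: "subgroup J (add_monoid B)" "\<And>x b. \<lbrakk>x \<in> J; b \<in> carrier B\<rbrakk> \<Longrightarrow> x \<otimes>\<^bsub>B\<^esub> b \<in> J"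
    and JN: "\<And>n. n \<in> carrier N \<Longrightarrow> \<exists>(k :: nat) c y. c \<in> {..<k} \<rightarrow> J \<and> y \<in> {..<k} \<rightarrow> carrier N \<and>
      n = (\<Oplus>\<^bsub>N\<^esub>j\<in>{..<k}. c j \<odot>\<^bsub>N\<^esub> y j)"
  shows "\<one>\<^bsub>B\<^esub> \<in> J"
proof -
  have N: "left_module B N" using ff by (simp add: faithfully_flat_left_module_def)
  interpret N: left_module B N by (rule N)
  let ?L = "list_module B (Suc 0)" and ?Z = "list_module B 0"
  interpret L: right_module B ?L by (rule N.R.list_module_right_module)
  interpret Z: right_module B ?Z by (rule N.R.list_module_right_module)
  define J' where "J' = (\<lambda>b. [b]) ` J"
  have JB: "b \<in> carrier B" if "b \<in> J" for b using subgroup.subset[OF J(1)] that by auto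
  have carL: "carrier ?L = (\<lambda>b. [b]) ` carrier B"
    by (auto simp: list_module_def image_iff length_Suc_conv)
  have J'L: "J' \<subseteq> carrier ?L" unfolding J'_def carL using JB by blast
  interpret J': right_submodule B ?L J'
  proof (intro right_submodule.intro right_submodule_axioms.intro L.right_module_axioms)
    show "subgroup J' (add_monoid ?L)"
    proof (rule group.subgroupI[OF L.M.a_group])
      show "J' \<subseteq> carrier (add_monoid ?L)" using J'L by simp
      show "J' \<noteq> {}" using subgroup.one_closed[OF J(1)] by (auto simp: J'_def)
    next
      fix x assume "x \<in> J'"
      then obtain b where b: "x = [b]" "b \<in> J" by (auto simp: J'_def)
      have nb: "\<ominus>\<^bsub>B\<^esub> b \<in> J" using subgroup.m_inv_closed[OF J(1) b(2)] by (simp add: a_inv_def)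
      have "[\<ominus>\<^bsub>B\<^esub> b] \<oplus>\<^bsub>?L\<^esub> x = \<zero>\<^bsub>?L\<^esub>" using JB[OF b(2)] by (simp add: b list_module_def N.R.l_neg)
      then have "\<ominus>\<^bsub>?L\<^esub> x = [\<ominus>\<^bsub>B\<^esub> b]"
        by (rule L.M.minus_equality) (use JB[OF b(2)] in \<open>auto simp: b carL\<close>)
      then show "inv\<^bsub>add_monoid ?L\<^esub> x \<in> J'" using nb by (simp add: a_inv_def J'_def)
    next
      fix x y assume "x \<in> J'" "y \<in> J'"
      then show "x \<otimes>\<^bsub>add_monoid ?L\<^esub> y \<in> J'"
        using subgroup.m_closed[OF J(1)] by (auto simp: J'_def list_module_def)
    qed
    fix b x assume "b \<in> carrier B" "x \<in> J'"
    then show "b \<odot>\<^bsub>?L\<^esub> x \<in> J'" using J(2) by (auto simp: J'_def list_module_def)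
  qed
  let ?J = "?L\<lparr>carrier := J'\<rparr>"
  have rJ: "right_module B ?J" by (rule J'.sub_right_module)
  let ?c1 = "copy ?J" and ?c2 = "copy ?L" and ?c3 = "copy ?Z"
  note c1 = right_module.copy_right_module[OF rJ] and c2 = L.copy_right_module and c3 = Z.copy_right_module
  have car1: "carrier ?c1 = (\<lambda>b. {[b]}) ` J"
    using right_module.copy_carrier[OF rJ] by (simp add: J'_def image_image)
  have car2: "carrier ?c2 = (\<lambda>b. {[b]}) ` carrier B"
    using L.copy_carrier by (simp add: carL image_image)
  have car3: "carrier ?c3 = {\<zero>\<^bsub>?c3\<^esub>}"
  proof -
    have "carrier ?Z = {\<zero>\<^bsub>?Z\<^esub>}" by (auto simp: list_module_def)
    then show ?thesis using Z.copy_carrier by (simp add: quot_module_def)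
  qed
  have idJ: "(\<lambda>x. x) \<in> module_hom B ?J ?L"
    using J'L by (intro module_homI add_homI) auto
  define f where "f = (\<lambda>X :: 'b list set. {the_elem X})"
  have f: "f \<in> module_hom B ?c1 ?c2"
    unfolding f_def by (rule module_hom_compose[OF module_hom_compose[OF right_module.copy_out[OF rJ] idJ] L.copy_in])
  define g where "g = (\<lambda>_ :: 'b list set. \<zero>\<^bsub>?c3\<^esub>)"
  interpret C3: right_module B ?c3 by (rule c3)
  have g: "g \<in> module_hom B ?c2 ?c3"
    using add_hom_zero[OF C3.M.abelian_group_axioms C3.M.abelian_group_axioms C3.smult_hom]
    by (intro module_homI add_homI) (simp_all add: g_def)
  interpret T1: tensor_pair B ?c1 N by (intro tensor_pair.intro c1 N)
  interpret T2: tensor_pair B ?c2 N by (intro tensor_pair.intro c2 N)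
  interpret T3: tensor_pair B ?c3 N by (intro tensor_pair.intro c3 N)
  interpret TT2: abelian_group T2.T by (rule T2.T_abelian)
  interpret TT3: abelian_group T3.T by (rule T3.T_abelian)
  note fh = tensor_map_hom[OF T1.tensor_pair_axioms T2.tensor_pair_axioms f module_hom_id]
  note gh = tensor_map_hom[OF T2.tensor_pair_axioms T3.tensor_pair_axioms g module_hom_id]
  have u: "{[\<one>\<^bsub>B\<^esub>]} \<in> carrier ?c2" by (auto simp: car2)
  have bu: "b \<odot>\<^bsub>?c2\<^esub> {[\<one>\<^bsub>B\<^esub>]} = {[b]}" if b: "b \<in> carrier B" for b
  proof -
    have "[\<one>\<^bsub>B\<^esub>] \<in> carrier ?L" by (auto simp: carL)
    then have "{b \<odot>\<^bsub>?L\<^esub> [\<one>\<^bsub>B\<^esub>]} = b \<odot>\<^bsub>?c2\<^esub> {[\<one>\<^bsub>B\<^esub>]}"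
      using module_hom_smult[OF L.copy_in b] by simp
    then show ?thesis using b by (simp add: list_module_def)
  qed
  have surj: "t \<in> tensor_map B ?c2 N f id ` carrier T1.T" if t: "t \<in> carrier T2.T" for t
    using t
  proof (induction t rule: T2.T_induct)
    case zero
    show ?case
      by (rule image_eqI, rule add_hom_zero[OF T1.T_abelian T2.T_abelian fh, symmetric],
          rule abelian_monoid.zero_closed[OF abelian_group.axioms(1)[OF T1.T_abelian]])
  next
    case (add x y)
    then obtain x' y' where *: "x' \<in> carrier T1.T" "y' \<in> carrier T1.T" "x = tensor_map B ?c2 N f id x'" "y = tensor_map B ?c2 N f id y'"
      by blast
    show ?case
      unfolding *(3,4)
      by (rule image_eqI, rule add_hom_add[OF fh *(1,2), symmetric],
          rule abelian_add_closed[OF T1.T_abelian *(1,2)])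
  next
    case (pure X n)
    then obtain b where b: "X = {[b]}" "b \<in> carrier B" by (auto simp: car2)
    have bn: "b \<odot>\<^bsub>N\<^esub> n \<in> carrier N" by (rule N.smult_closed[OF b(2) pure(2)])
    obtain k :: nat and c y where c: "c \<in> {..<k} \<rightarrow> J" and y: "y \<in> {..<k} \<rightarrow> carrier N"
      and eq: "b \<odot>\<^bsub>N\<^esub> n = (\<Oplus>\<^bsub>N\<^esub>j\<in>{..<k}. c j \<odot>\<^bsub>N\<^esub> y j)"
      using JN[OF bn] by blast
    have cB: "c j \<in> carrier B" "c j \<in> J" if "j < k" for j using c JB that by auto
    have cy: "(\<lambda>j. c j \<odot>\<^bsub>N\<^esub> y j) \<in> {..<k} \<rightarrow> carrier N"
      using cB y by (auto simp: Pi_iff intro!: N.smult_closed)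
    have 1: "(\<lambda>j. {[c j]}) \<in> {..<k} \<rightarrow> carrier ?c1" unfolding car1 using c by auto
    have fin: "(\<Oplus>\<^bsub>T1.T\<^esub>j\<in>{..<k}. T1.pure {[c j]} (y j)) \<in> carrier T1.T"
    proof (rule abelian_monoid.finsum_closed[OF abelian_group.axioms(1)[OF T1.T_abelian]])
      show "(\<lambda>j. T1.pure {[c j]} (y j)) \<in> {..<k} \<rightarrow> carrier T1.T"
        by (intro funcsetI T1.pure_closed funcset_mem[OF 1] funcset_mem[OF y])
    qed
    have "T2.pure X n = T2.pure {[\<one>\<^bsub>B\<^esub>]} (b \<odot>\<^bsub>N\<^esub> n)"
      using T2.pure_smult[OF b(2) u pure(2)] by (simp add: bu[OF b(2)] b(1))
    also have "\<dots> = (\<Oplus>\<^bsub>T2.T\<^esub>j\<in>{..<k}. T2.pure {[\<one>\<^bsub>B\<^esub>]} (c j \<odot>\<^bsub>N\<^esub> y j))"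
      unfolding eq by (rule add_hom_finsum[OF N.M.abelian_group_axioms T2.T_abelian T2.pure_hom_right[OF u] cy])
    also have "\<dots> = (\<Oplus>\<^bsub>T2.T\<^esub>j\<in>{..<k}. T2.pure (f {[c j]}) (id (y j)))"
    proof (rule TT2.finsum_cong'[OF refl])
      show "(\<lambda>j. T2.pure (f {[c j]}) (id (y j))) \<in> {..<k} \<rightarrow> carrier T2.T"
        using module_hom_closed[OF f funcset_mem[OF 1]] by (intro funcsetI T2.pure_closed) (auto simp: funcset_mem[OF y])
      fix j assume "j \<in> {..<k}"
      then have j: "j < k" by simp
      show "T2.pure {[\<one>\<^bsub>B\<^esub>]} (c j \<odot>\<^bsub>N\<^esub> y j) = T2.pure (f {[c j]}) (id (y j))"
        using T2.pure_smult[OF cB(1)[OF j] u, of "y j"] j funcset_mem[OF y, of j]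
        by (simp add: bu[OF cB(1)[OF j]] f_def)
    qed
    also have "\<dots> = tensor_map B ?c2 N f id (\<Oplus>\<^bsub>T1.T\<^esub>j\<in>{..<k}. T1.pure {[c j]} (y j))"
      by (rule tensor_map_finsum[OF T1.tensor_pair_axioms T2.tensor_pair_axioms f module_hom_id 1 y, symmetric])
    finally show ?case using fin by blast
  qed
  have gz: "tensor_map B ?c3 N g id t = \<zero>\<^bsub>T3.T\<^esub>" if t: "t \<in> carrier T2.T" for t
  proof (rule T2.T_hom_eqI[OF T3.T_abelian gh _ _ t])
    show "(\<lambda>_. \<zero>\<^bsub>T3.T\<^esub>) \<in> add_hom T2.T T3.T" by (rule add_homI) auto
    show "tensor_map B ?c3 N g id (T2.pure m n) = \<zero>\<^bsub>T3.T\<^esub>" if "m \<in> carrier ?c2" "n \<in> carrier N" for m n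
      using tensor_map_pure[OF T2.tensor_pair_axioms T3.tensor_pair_axioms g module_hom_id that] that(2)
      by (simp add: g_def T3.pure_zero_left)
  qed
  have "exact_at T1.T T2.T T3.T (tensor_map B ?c2 N f id) (tensor_map B ?c3 N g id)"
  proof -
    have "tensor_map B ?c2 N f id ` carrier T1.T = carrier T2.T"
      using surj add_hom_closed[OF fh] by blast
    also have "carrier T2.T = {t \<in> carrier T2.T. tensor_map B ?c3 N g id t = \<zero>\<^bsub>T3.T\<^esub>}" using gz by blast
    finally show ?thesis by (simp add: exact_at_def a_kernel_def kernel_def)
  qed
  then have "exact_at ?c1 ?c2 ?c3 f g"
    using ff f g c1 c2 c3 unfolding faithfully_flat_left_module_def by blast
  then have "f ` carrier ?c1 = {x \<in> carrier ?c2. g x = \<zero>\<^bsub>?c3\<^esub>}"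
    by (simp add: exact_at_def a_kernel_def kernel_def)
  then have "{[\<one>\<^bsub>B\<^esub>]} \<in> f ` carrier ?c1" using u by (simp add: g_def)
  then show ?thesis unfolding car1 by (auto simp: f_def)
qed

section \<open>The cotensor product\<close>

locale comodule_algebra_quotient = comodule_algebra R H comult counit antipode A coact
  for R :: "('r, 'c) ring_scheme" and H :: "('r, 'h, 'd) module_scheme"
    and comult counit antipode and A :: "('r, 'a, 'e) module_scheme" and coact +
  fixes I :: "'h set"
  assumes I_sub: "submodule I R H"
    and I_right: "\<lbrakk>x \<in> I; h \<in> carrier H\<rbrakk> \<Longrightarrow> x \<otimes>\<^bsub>H\<^esub> h \<in> I"
begin

sublocale I: right_submodule R H I
  by (rule right_submodule_if_submodule[OF mH I_sub])

abbreviation Q where "Q \<equiv> quot_module H I"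
abbreviation proj where "proj h \<equiv> I +>\<^bsub>H\<^esub> h"
abbreviation AQ where "AQ \<equiv> tensor R A Q"
abbreviation QH where "QH \<equiv> tensor R Q H"
abbreviation AQH where "AQH \<equiv> tensor R A QH"

lemma mQ: "module R Q" by (rule quot_is_module[OF mH I_sub])
lemma mAQ: "module R AQ" by (rule tensor_module[OF mA mQ])
lemma mQH: "module R QH" by (rule tensor_module[OF mQ mH])
lemma pAQ: "tensor_pair R A Q" by (rule module_tensor_pair[OF mA mQ])
lemma pQH: "tensor_pair R Q H" by (rule module_tensor_pair[OF mQ mH])
lemma pA_QH: "tensor_pair R A QH" by (rule module_tensor_pair[OF mA mQH])
lemma pAQ_H: "tensor_pair R AQ H" by (rule module_tensor_pair[OF mAQ mH])
lemma pQ_HH: "tensor_pair R Q HH" by (rule module_tensor_pair[OF mQ mHH])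
lemma pH_HH: "tensor_pair R H HH" by (rule module_tensor_pair[OF mH mHH])
lemma pHH_H: "tensor_pair R HH H" by (rule module_tensor_pair[OF mHH mH])

text \<open>
  The right action of \<open>H\<close> on \<open>Q\<close>. Any representative will do because \<open>I\<close> is a right ideal.
\<close>

definition qact :: "'h \<Rightarrow> 'h set \<Rightarrow> 'h set"
  where "qact k X = proj ((SOME g. g \<in> X) \<otimes>\<^bsub>H\<^esub> k)"

lemma qact_proj:
  assumes g: "g \<in> carrier H" and k: "k \<in> carrier H"
  shows "qact k (proj g) = proj (g \<otimes>\<^bsub>H\<^esub> k)"
proof -
  define g' where "g' = (SOME g'. g' \<in> proj g)"
  have "g \<in> proj g" using I.ab.a_rcos_self[OF g] .
  then have g'p: "g' \<in> proj g" unfolding g'_def by (rule someI)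
  then have g': "g' \<in> carrier H" using I.ab.a_elemrcos_carrier[OF g] by blast
  have "g' \<ominus>\<^bsub>H\<^esub> g \<in> I" using I.mem_proj_iff[OF g' g] g'p by blast
  then have "(g' \<ominus>\<^bsub>H\<^esub> g) \<otimes>\<^bsub>H\<^esub> k \<in> I" by (rule I_right[OF _ k])
  also have "(g' \<ominus>\<^bsub>H\<^esub> g) \<otimes>\<^bsub>H\<^esub> k = g' \<otimes>\<^bsub>H\<^esub> k \<ominus>\<^bsub>H\<^esub> g \<otimes>\<^bsub>H\<^esub> k"
    by (rule add_hom_diff[OF abH abH module_hom_add_hom[OF right_mult_hom[OF algH k]] g' g])
  finally show ?thesis
    unfolding qact_def g'_def[symmetric] by (rule I.proj_eq[OF multH[OF g' k] multH[OF g k]])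
qed

lemma Q_cases: "q \<in> carrier Q \<Longrightarrow> (\<And>g. \<lbrakk>g \<in> carrier H; q = proj g\<rbrakk> \<Longrightarrow> P) \<Longrightarrow> P"
  unfolding I.carrier_Q by blast

lemma qact_hom:
  assumes k: "k \<in> carrier H"
  shows "qact k \<in> module_hom R Q Q"
proof (intro module_homI add_homI)
  note f = right_mult_hom[OF algH k]
  fix q assume q: "q \<in> carrier Q"
  then obtain g where g: "g \<in> carrier H" "q = proj g" by (rule Q_cases)
  show "qact k q \<in> carrier Q" unfolding g(2) qact_proj[OF g(1) k] by (rule I.proj_closed[OF multH[OF g(1) k]])
  show "qact k (r \<odot>\<^bsub>Q\<^esub> q) = r \<odot>\<^bsub>Q\<^esub> qact k q" if r: "r \<in> carrier R" for r
    unfolding g(2) I.smult_Q[OF r g(1)] qact_proj[OF g(1) k] qact_proj[OF module.smult_closed[OF mH r g(1)] k]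
      I.smult_Q[OF r multH[OF g(1) k]] module_hom_smult[OF f r g(1)] ..
  fix q' assume "q' \<in> carrier Q"
  then obtain g' where g': "g' \<in> carrier H" "q' = proj g'" by (rule Q_cases)
  show "qact k (q \<oplus>\<^bsub>Q\<^esub> q') = qact k q \<oplus>\<^bsub>Q\<^esub> qact k q'"
    unfolding g(2) g'(2) I.add_Q[OF g(1) g'(1)] qact_proj[OF g(1) k] qact_proj[OF g'(1) k]
      qact_proj[OF abelian_add_closed[OF abH g(1) g'(1)] k]
      I.add_Q[OF multH[OF g(1) k] multH[OF g'(1) k]] add_hom_add[OF module_hom_add_hom[OF f] g(1) g'(1)] ..
qed

lemma qact_hom_right:
  assumes q: "q \<in> carrier Q"
  shows "(\<lambda>k. qact k q) \<in> module_hom R H Q"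
proof -
  obtain g where g: "g \<in> carrier H" "q = proj g" using q by (rule Q_cases)
  have "(\<lambda>k. proj (g \<otimes>\<^bsub>H\<^esub> k)) \<in> module_hom R H Q"
    by (rule module_hom_compose[OF left_mult_hom[OF algH g(1)] I.proj_hom])
  moreover have "qact k q = proj (g \<otimes>\<^bsub>H\<^esub> k)" if "k \<in> carrier H" for k
    unfolding g(2) by (rule qact_proj[OF g(1) that])
  ultimately show ?thesis
    using abelian_add_closed[OF abH] module.smult_closed[OF mH]
    by (auto simp: module_hom_def)
qed

lemma qact_closed: "\<lbrakk>q \<in> carrier Q; k \<in> carrier H\<rbrakk> \<Longrightarrow> qact k q \<in> carrier Q"
  by (rule module_hom_closed[OF qact_hom])

lemma qact_mult: "\<lbrakk>q \<in> carrier Q; k \<in> carrier H; l \<in> carrier H\<rbrakk> \<Longrightarrow> qact l (qact k q) = qact (k \<otimes>\<^bsub>H\<^esub> l) q"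
  by (erule Q_cases) (simp only: qact_proj multH monoid.m_assoc[OF monoidH])

lemma qact_one: "q \<in> carrier Q \<Longrightarrow> qact \<one>\<^bsub>H\<^esub> q = q"
  by (erule Q_cases) (simp only: qact_proj oneH monoid.r_one[OF monoidH])

lemma qact_proj_one: "k \<in> carrier H \<Longrightarrow> qact k (proj \<one>\<^bsub>H\<^esub>) = proj k"
  by (simp only: qact_proj oneH monoid.l_one[OF monoidH])

text \<open>
  \<open>(v \<otimes> q) (c \<otimes> k) = v c \<otimes> q k\<close>, the right action of the algebra \<open>A \<otimes> H\<close> on \<open>A \<otimes> Q\<close>.
\<close>

definition qmult :: "('a, 'h set) tens \<Rightarrow> ('a, 'h) tens \<Rightarrow> ('a, 'h set) tens"
  where "qmult d y = tensor_lift (add_monoid AQ)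
    (\<lambda>v q. tensor_map R A Q (\<lambda>c. v \<otimes>\<^bsub>A\<^esub> c) (\<lambda>k. qact k q) y) d"

lemma qmult_balanced:
  assumes y: "y \<in> carrier AH"
  shows "balanced R A Q AQ (\<lambda>v q. tensor_map R A Q (\<lambda>c. v \<otimes>\<^bsub>A\<^esub> c) (\<lambda>k. qact k q) y)"
proof (rule balancedI)
  interpret T: tensor_pair R A Q by (rule pAQ)
  have clo: "tensor_map R A Q (\<lambda>c. v \<otimes>\<^bsub>A\<^esub> c) (\<lambda>k. qact k q) y \<in> carrier AQ"
    if "v \<in> carrier A" "q \<in> carrier Q" for v q
    by (rule add_hom_closed[OF tensor_map_hom[OF pAH pAQ left_mult_hom[OF algA that(1)] qact_hom_right[OF that(2)]] y])
  show "(\<lambda>v. tensor_map R A Q (\<lambda>c. v \<otimes>\<^bsub>A\<^esub> c) (\<lambda>k. qact k q) y) \<in> add_hom A AQ" if q: "q \<in> carrier Q" for q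
  proof (rule add_homI)
    fix v w assume v: "v \<in> carrier A" and w: "w \<in> carrier A"
    note vw = abelian_add_closed[OF abA v w]
    show "tensor_map R A Q (\<lambda>c. (v \<oplus>\<^bsub>A\<^esub> w) \<otimes>\<^bsub>A\<^esub> c) (\<lambda>k. qact k q) y
      = tensor_map R A Q (\<lambda>c. v \<otimes>\<^bsub>A\<^esub> c) (\<lambda>k. qact k q) y \<oplus>\<^bsub>AQ\<^esub> tensor_map R A Q (\<lambda>c. w \<otimes>\<^bsub>A\<^esub> c) (\<lambda>k. qact k q) y"
      by (rule tensor_map_add_left[OF pAH pAQ left_mult_hom[OF algA v] left_mult_hom[OF algA w] qact_hom_right[OF q]
            left_mult_hom[OF algA vw] _ y])
        (rule add_hom_add[OF module_hom_add_hom[OF right_mult_hom[OF algA]] v w])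
  qed (rule clo[OF _ q])
  show "(\<lambda>q. tensor_map R A Q (\<lambda>c. v \<otimes>\<^bsub>A\<^esub> c) (\<lambda>k. qact k q) y) \<in> add_hom Q AQ" if v: "v \<in> carrier A" for v
  proof (rule add_homI)
    fix q q' assume q: "q \<in> carrier Q" and q': "q' \<in> carrier Q"
    note qq = abelian_add_closed[OF I.Q_abelian q q']
    show "tensor_map R A Q (\<lambda>c. v \<otimes>\<^bsub>A\<^esub> c) (\<lambda>k. qact k (q \<oplus>\<^bsub>Q\<^esub> q')) y
      = tensor_map R A Q (\<lambda>c. v \<otimes>\<^bsub>A\<^esub> c) (\<lambda>k. qact k q) y \<oplus>\<^bsub>AQ\<^esub> tensor_map R A Q (\<lambda>c. v \<otimes>\<^bsub>A\<^esub> c) (\<lambda>k. qact k q') y"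
      by (rule tensor_map_add_right[OF pAH pAQ left_mult_hom[OF algA v] qact_hom_right[OF q] qact_hom_right[OF q']
            qact_hom_right[OF qq] _ y])
        (rule add_hom_add[OF module_hom_add_hom[OF qact_hom] q q'])
  qed (rule clo[OF v])
  fix r v q assume r: "r \<in> carrier R" and v: "v \<in> carrier A" and q: "q \<in> carrier Q"
  note rv = module.smult_closed[OF mA r v] and rq = module.smult_closed[OF mQ r q]
  note f = left_mult_hom[OF algA rv] qact_hom_right[OF q] and g = left_mult_hom[OF algA v] qact_hom_right[OF rq]
  show "tensor_map R A Q (\<lambda>c. (r \<odot>\<^bsub>A\<^esub> v) \<otimes>\<^bsub>A\<^esub> c) (\<lambda>k. qact k q) y
    = tensor_map R A Q (\<lambda>c. v \<otimes>\<^bsub>A\<^esub> c) (\<lambda>k. qact k (r \<odot>\<^bsub>Q\<^esub> q)) y"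
  proof (rule tensor_pair.T_hom_eqI[OF pAH T.T_abelian tensor_map_hom[OF pAH pAQ f] tensor_map_hom[OF pAH pAQ g] _ y])
    fix c k assume c: "c \<in> carrier A" and k: "k \<in> carrier H"
    show "tensor_map R A Q (\<lambda>c. (r \<odot>\<^bsub>A\<^esub> v) \<otimes>\<^bsub>A\<^esub> c) (\<lambda>k. qact k q) (pure_tensor R A H c k)
      = tensor_map R A Q (\<lambda>c. v \<otimes>\<^bsub>A\<^esub> c) (\<lambda>k. qact k (r \<odot>\<^bsub>Q\<^esub> q)) (pure_tensor R A H c k)"
      unfolding tensor_map_pure[OF pAH pAQ f c k] tensor_map_pure[OF pAH pAQ g c k]
        module_hom_smult[OF qact_hom[OF k] r q] assoc_algebra.smult_mult_left[OF algA r v c]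
      by (rule T.pure_smult[OF r multA[OF v c] qact_closed[OF q k]])
  qed
qed

lemma qmult_hom_left: "y \<in> carrier AH \<Longrightarrow> (\<lambda>d. qmult d y) \<in> add_hom AQ AQ"
  unfolding qmult_def by (rule tensor_pair.lift_hom[OF pAQ tensor_pair.T_abelian[OF pAQ] qmult_balanced])

lemma qmult_pure_left: "\<lbrakk>v \<in> carrier A; q \<in> carrier Q; y \<in> carrier AH\<rbrakk> \<Longrightarrow>
    qmult (pure_tensor R A Q v q) y = tensor_map R A Q (\<lambda>c. v \<otimes>\<^bsub>A\<^esub> c) (\<lambda>k. qact k q) y"
  unfolding qmult_def by (rule tensor_pair.lift_pure[OF pAQ tensor_pair.T_abelian[OF pAQ] qmult_balanced])

lemma qmult_hom_right:
  assumes d: "d \<in> carrier AQ"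
  shows "qmult d \<in> module_hom R AH AQ"
proof (intro module_homI add_homI)
  interpret T: tensor_pair R A Q by (rule pAQ)
  note ab = T.T_abelian and abAH = tensor_pair.T_abelian[OF pAH]
  fix y assume y: "y \<in> carrier AH"
  note hy = qmult_hom_left[OF y]
  show "qmult d y \<in> carrier AQ" by (rule add_hom_closed[OF hy d])
  have tm: "tensor_map R A Q (\<lambda>c. v \<otimes>\<^bsub>A\<^esub> c) (\<lambda>k. qact k q) \<in> module_hom R AH AQ"
    if "v \<in> carrier A" "q \<in> carrier Q" for v q
    by (rule tensor_map_module_hom[OF mA mH mA mQ left_mult_hom[OF algA that(1)] qact_hom_right[OF that(2)]])
  show "qmult d (y \<oplus>\<^bsub>AH\<^esub> z) = qmult d y \<oplus>\<^bsub>AQ\<^esub> qmult d z" if z: "z \<in> carrier AH" for z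
  proof -
    note hz = qmult_hom_left[OF z]
    note yz = abelian_add_closed[OF abAH y z]
    show ?thesis
    proof (rule T.T_hom_eqI[OF ab qmult_hom_left[OF yz] add_hom_plus[OF ab hy hz] _ d])
      fix v q assume v: "v \<in> carrier A" and q: "q \<in> carrier Q"
      show "qmult (T.pure v q) (y \<oplus>\<^bsub>AH\<^esub> z) = qmult (T.pure v q) y \<oplus>\<^bsub>AQ\<^esub> qmult (T.pure v q) z"
        unfolding qmult_pure_left[OF v q y] qmult_pure_left[OF v q z] qmult_pure_left[OF v q yz]
        by (rule add_hom_add[OF module_hom_add_hom[OF tm[OF v q]] y z])
    qed
  qed
  show "qmult d (r \<odot>\<^bsub>AH\<^esub> y) = r \<odot>\<^bsub>AQ\<^esub> qmult d y" if r: "r \<in> carrier R" for r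
  proof -
    note ry = module.smult_closed[OF mAH r y]
    show ?thesis
    proof (rule T.T_hom_eqI[OF ab qmult_hom_left[OF ry]
          add_hom_compose[OF hy module_hom_add_hom[OF module.smult_module_hom[OF mAQ r]]] _ d])
      fix v q assume v: "v \<in> carrier A" and q: "q \<in> carrier Q"
      show "qmult (T.pure v q) (r \<odot>\<^bsub>AH\<^esub> y) = r \<odot>\<^bsub>AQ\<^esub> qmult (T.pure v q) y"
        unfolding qmult_pure_left[OF v q y] qmult_pure_left[OF v q ry]
        by (rule module_hom_smult[OF tm[OF v q] r y])
    qed
  qed
qed

definition qcoact :: "'a \<Rightarrow> ('a, 'h set) tens"
  where "qcoact a = tensor_map R A Q id proj (coact a)"

lemma qproj_mhom: "tensor_map R A Q id proj \<in> module_hom R AH AQ"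
  by (rule tensor_map_module_hom[OF mA mH mA mQ module_hom_id I.proj_hom])

lemma qcoact_mhom: "qcoact \<in> module_hom R A AQ"
  unfolding qcoact_def by (rule module_hom_compose[OF coact_mhom qproj_mhom])

lemma qcoact_closed: "a \<in> carrier A \<Longrightarrow> qcoact a \<in> carrier AQ"
  by (rule module_hom_closed[OF qcoact_mhom])

text \<open>
  The coaction of \<open>Q\<close> is not multiplicative, \<open>Q\<close> being no algebra, but it is linear over \<open>\<delta>\<close>.
\<close>

lemma qcoact_mult:
  assumes a: "a \<in> carrier A" and b: "b \<in> carrier A"
  shows "qcoact (a \<otimes>\<^bsub>A\<^esub> b) = qmult (qcoact a) (coact b)"
proof -
  note y = coact_closed[OF b]
  have "tensor_map R A Q id proj (s \<otimes>\<^bsub>AH\<^esub> coact b) = qmult (tensor_map R A Q id proj s) (coact b)"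
    if s: "s \<in> carrier AH" for s
  proof (rule tensor_pair.T_hom_eqI[OF pAH tensor_pair.T_abelian[OF pAQ]
        add_hom_compose[OF tensor_mult_hom_left[OF algA algH y] module_hom_add_hom[OF qproj_mhom]]
        add_hom_compose[OF module_hom_add_hom[OF qproj_mhom] qmult_hom_left[OF y]] _ s])
    fix v g assume v: "v \<in> carrier A" and g: "g \<in> carrier H"
    have "tensor_map R A Q id proj (pure_tensor R A H v g \<otimes>\<^bsub>AH\<^esub> coact b)
      = tensor_map R A Q (\<lambda>c. v \<otimes>\<^bsub>A\<^esub> c) (\<lambda>k. qact k (proj g)) (coact b)"
      unfolding tensor_mult_pure_left[OF algA algH v g y]
      by (rule tensor_map_compose[OF pAH pAH pAQ left_mult_hom[OF algA v] module_hom_id left_mult_hom[OF algH g] I.proj_hom _ _ y])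
        (simp_all only: id_apply qact_proj[OF g])
    also have "\<dots> = qmult (tensor_map R A Q id proj (pure_tensor R A H v g)) (coact b)"
      unfolding tensor_map_pure[OF pAH pAQ module_hom_id I.proj_hom v g] id_apply
      by (rule qmult_pure_left[OF v I.proj_closed[OF g] y, symmetric])
    finally show "tensor_map R A Q id proj (pure_tensor R A H v g \<otimes>\<^bsub>AH\<^esub> coact b)
      = qmult (tensor_map R A Q id proj (pure_tensor R A H v g)) (coact b)" .
  qed
  then show ?thesis
    unfolding qcoact_def coact_mult[OF a b] using coact_closed[OF a] by blast
qed

lemma qmult_pure_right:
  assumes d: "d \<in> carrier AQ" and b: "b \<in> carrier A"
  shows "qmult d (pure_tensor R A H b \<one>\<^bsub>H\<^esub>) = tensor_map R A Q (\<lambda>v. v \<otimes>\<^bsub>A\<^esub> b) id d"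
proof -
  note y = tensor_pair.pure_closed[OF pAH b oneH]
  show ?thesis
  proof (rule tensor_pair.T_hom_eqI[OF pAQ tensor_pair.T_abelian[OF pAQ] qmult_hom_left[OF y]
        tensor_map_hom[OF pAQ pAQ right_mult_hom[OF algA b] module_hom_id] _ d])
    fix v q assume v: "v \<in> carrier A" and q: "q \<in> carrier Q"
    show "qmult (pure_tensor R A Q v q) (pure_tensor R A H b \<one>\<^bsub>H\<^esub>)
      = tensor_map R A Q (\<lambda>v. v \<otimes>\<^bsub>A\<^esub> b) id (pure_tensor R A Q v q)"
      unfolding qmult_pure_left[OF v q y] tensor_map_pure[OF pAH pAQ left_mult_hom[OF algA v] qact_hom_right[OF q] b oneH]
        tensor_map_pure[OF pAQ pAQ right_mult_hom[OF algA b] module_hom_id v q] qact_one[OF q] id_apply ..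
  qed
qed

definition cotensor_left :: "('a, 'h) tens \<Rightarrow> ('a, ('h set, 'h) tens) tens"
  where "cotensor_left x = tensor_assoc R A Q H (tensor_map R AQ H qcoact id x)"

definition cotensor_right :: "('a, 'h) tens \<Rightarrow> ('a, ('h set, 'h) tens) tens"
  where "cotensor_right x = tensor_map R A QH id (\<lambda>h. tensor_map R Q H proj id (comult h)) x"

lemma carrier_cotensor:
  "carrier (cotensor R H comult A coact I) = {x \<in> carrier AH. cotensor_left x = cotensor_right x}"
  by (simp add: cotensor_def Let_def cotensor_left_def cotensor_right_def qcoact_def[abs_def])

lemma qcomult_mhom: "(\<lambda>h. tensor_map R Q H proj id (comult h)) \<in> module_hom R H QH"
  by (rule module_hom_compose[OF comult_mhom tensor_map_module_hom[OF mH mH mQ mH I.proj_hom module_hom_id]])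

lemma cotensor_left_hom: "cotensor_left \<in> add_hom AH AQH"
  unfolding cotensor_left_def
  by (rule add_hom_compose[OF tensor_map_hom[OF pAH pAQ_H qcoact_mhom module_hom_id]
        module_hom_add_hom[OF tensor_assoc_module_hom[OF mA mQ mH]]])

lemma cotensor_right_hom: "cotensor_right \<in> add_hom AH AQH"
  unfolding cotensor_right_def[abs_def] by (rule tensor_map_hom[OF pAH pA_QH module_hom_id qcomult_mhom])

text \<open>
  In Sweedler notation \<open>v \<otimes> q\<close> is sent to \<open>v a\<^sub>0 \<otimes> q a\<^sub>1 \<otimes> a\<^sub>2\<close>. As \<open>a\<close> varies, this extends \<open>can\<close> to a map
  \<open>(A \<otimes> Q) \<otimes>\<^sub>B A \<rightarrow> A \<otimes> Q \<otimes> H\<close>. The two maps that define the cotensor product, applied to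
  \<open>can(u \<otimes> a)\<close>, are its values at \<open>\<delta>\<^sub>Q(u)\<close> and at \<open>u \<otimes> \<pi>(1)\<close>.
\<close>

definition qspread :: "'a \<Rightarrow> ('a, 'h set) tens \<Rightarrow> ('a, ('h set, 'h) tens) tens"
  where "qspread a d = tensor_assoc R A Q H (tensor_map R AQ H (\<lambda>c. qmult d (coact c)) id (coact a))"

lemma qspread_hom:
  assumes a: "a \<in> carrier A"
  shows "qspread a \<in> add_hom AQ AQH"
proof -
  note y = coact_closed[OF a]
  have h: "(\<lambda>c. qmult d (coact c)) \<in> module_hom R A AQ" if "d \<in> carrier AQ" for d
    by (rule module_hom_compose[OF coact_mhom qmult_hom_right[OF that]])
  have "(\<lambda>d. tensor_map R AQ H (\<lambda>c. qmult d (coact c)) id (coact a)) \<in> add_hom AQ (tensor R AQ H)"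
  proof (rule add_homI)
    fix d e assume d: "d \<in> carrier AQ" and e: "e \<in> carrier AQ"
    note de = abelian_add_closed[OF tensor_pair.T_abelian[OF pAQ] d e]
    show "tensor_map R AQ H (\<lambda>c. qmult (d \<oplus>\<^bsub>AQ\<^esub> e) (coact c)) id (coact a)
      = tensor_map R AQ H (\<lambda>c. qmult d (coact c)) id (coact a)
        \<oplus>\<^bsub>tensor R AQ H\<^esub> tensor_map R AQ H (\<lambda>c. qmult e (coact c)) id (coact a)"
      by (rule tensor_map_add_left[OF pAH pAQ_H h[OF d] h[OF e] module_hom_id h[OF de] _ y])
        (rule add_hom_add[OF qmult_hom_left[OF coact_closed] d e])
  qed (rule add_hom_closed[OF tensor_map_hom[OF pAH pAQ_H h module_hom_id] y])
  from add_hom_compose[OF this module_hom_add_hom[OF tensor_assoc_module_hom[OF mA mQ mH]]]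
  show ?thesis unfolding qspread_def[abs_def] .
qed

lemma cotensor_left_coact:
  assumes u: "u \<in> carrier A" and a: "a \<in> carrier A"
  shows "cotensor_left (tensor_map R A H (\<lambda>c. u \<otimes>\<^bsub>A\<^esub> c) id (coact a)) = qspread a (qcoact u)"
  unfolding cotensor_left_def qspread_def
  by (rule arg_cong[of _ _ "tensor_assoc R A Q H"],
      rule tensor_map_compose[OF pAH pAH pAQ_H left_mult_hom[OF algA u] qcoact_mhom module_hom_id module_hom_id _ _ coact_closed[OF a]])
    (simp_all only: id_apply qcoact_mult[OF u])

lemma qtwist_mhom: "q \<in> carrier Q \<Longrightarrow> tensor_map R Q H (\<lambda>k. qact k q) id \<in> module_hom R HH QH"
  by (rule tensor_map_module_hom[OF mH mH mQ mH qact_hom_right module_hom_id])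

text \<open>
  Coassociativity turns \<open>\<delta>(a\<^sub>0) \<otimes> a\<^sub>1\<close>, which occurs in the definition, into \<open>a\<^sub>0 \<otimes> \<Delta>(a\<^sub>1)\<close>.
\<close>

lemma qspread_pure:
  assumes a: "a \<in> carrier A" and v: "v \<in> carrier A" and q: "q \<in> carrier Q"
  shows "qspread a (pure_tensor R A Q v q) =
    tensor_map R A QH (\<lambda>c. v \<otimes>\<^bsub>A\<^esub> c) (\<lambda>h. tensor_map R Q H (\<lambda>k. qact k q) id (comult h)) (coact a)"
proof -
  let ?e = "tensor_map R Q H (\<lambda>k. qact k q) id"
  let ?m = "tensor_map R A Q (\<lambda>c. v \<otimes>\<^bsub>A\<^esub> c) (\<lambda>k. qact k q)"
  note lv = left_mult_hom[OF algA v] and qk = qact_hom_right[OF q] and e = qtwist_mhom[OF q]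
  note m = tensor_map_module_hom[OF mA mH mA mQ lv qk]
  note y = coact_closed[OF a]
  note as = module_hom_add_hom[OF tensor_assoc_module_hom[OF mA mQ mH]]
    and as' = module_hom_add_hom[OF tensor_assoc_module_hom[OF mA mH mH]]
  note ab = tensor_pair.T_abelian[OF pA_QH]
  note mm = tensor_map_hom[OF pAH_H pAQ_H m module_hom_id] and ee = tensor_map_hom[OF pA_HH pA_QH lv e]
  have nat: "tensor_assoc R A Q H (tensor_map R AQ H ?m id x)
      = tensor_map R A QH (\<lambda>c. v \<otimes>\<^bsub>A\<^esub> c) ?e (tensor_assoc R A H H x)"
    if x: "x \<in> carrier (tensor R AH H)" for x
  proof (rule tensor_pair.T_hom_eqI[OF pAH_H ab add_hom_compose[OF mm as] add_hom_compose[OF as' ee] _ x])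
    fix t h assume t: "t \<in> carrier AH" and h: "h \<in> carrier H"
    note l1 = add_hom_compose[OF module_hom_add_hom[OF m] tensor_pair.pure_hom_left[OF pAQ_H h]]
    note l2 = add_hom_compose[OF add_hom_compose[OF tensor_pair.pure_hom_left[OF pAH_H h] as'] ee]
    show "tensor_assoc R A Q H (tensor_map R AQ H ?m id (pure_tensor R AH H t h))
      = tensor_map R A QH (\<lambda>c. v \<otimes>\<^bsub>A\<^esub> c) ?e (tensor_assoc R A H H (pure_tensor R AH H t h))"
      unfolding tensor_map_pure[OF pAH_H pAQ_H m module_hom_id t h] id_apply[of h]
    proof (rule tensor_pair.T_hom_eqI[OF pAH ab add_hom_compose[OF l1 as] l2 _ t])
      fix c k assume c: "c \<in> carrier A" and k: "k \<in> carrier H"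
      show "tensor_assoc R A Q H (pure_tensor R AQ H (?m (pure_tensor R A H c k)) h)
        = tensor_map R A QH (\<lambda>c. v \<otimes>\<^bsub>A\<^esub> c) ?e (tensor_assoc R A H H (pure_tensor R AH H (pure_tensor R A H c k) h))"
        unfolding tensor_map_pure[OF pAH pAQ lv qk c k] tensor_assoc_pure[OF mA mH mH c k h]
          tensor_assoc_pure[OF mA mQ mH multA[OF v c] qact_closed[OF q k] h]
          tensor_map_pure[OF pA_HH pA_QH lv e c tensor_pair.pure_closed[OF pHH k h]]
          tensor_map_pure[OF pHH pQH qk module_hom_id k h] id_apply ..
    qed
  qed
  have "tensor_map R AQ H (\<lambda>c. qmult (pure_tensor R A Q v q) (coact c)) id (coact a)
    = tensor_map R AQ H ?m id (tensor_map R AH H coact id (coact a))"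
    by (rule tensor_map_compose[OF pAH pAH_H pAQ_H coact_mhom m module_hom_id module_hom_id _ _ y, symmetric])
      (simp_all only: id_apply qmult_pure_left[OF v q coact_closed])
  then have "qspread a (pure_tensor R A Q v q)
    = tensor_map R A QH (\<lambda>c. v \<otimes>\<^bsub>A\<^esub> c) ?e (tensor_assoc R A H H (tensor_map R AH H coact id (coact a)))"
    unfolding qspread_def
    using nat[OF add_hom_closed[OF tensor_map_hom[OF pAH pAH_H coact_mhom module_hom_id] y]] by metis
  also have "\<dots> = tensor_map R A QH (\<lambda>c. v \<otimes>\<^bsub>A\<^esub> c) (\<lambda>h. ?e (comult h)) (coact a)"
    unfolding coact_coassoc[OF a]
    by (rule tensor_map_compose[OF pAH pA_HH pA_QH module_hom_id lv comult_mhom e _ _ y]) simp_all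
  finally show ?thesis .
qed

lemma cotensor_right_coact:
  assumes u: "u \<in> carrier A" and a: "a \<in> carrier A"
  shows "cotensor_right (tensor_map R A H (\<lambda>c. u \<otimes>\<^bsub>A\<^esub> c) id (coact a))
    = qspread a (pure_tensor R A Q u (proj \<one>\<^bsub>H\<^esub>))"
proof -
  note y = coact_closed[OF a] and one = I.proj_closed[OF oneH]
  have eq: "tensor_map R Q H proj id (comult h) = tensor_map R Q H (\<lambda>k. qact k (proj \<one>\<^bsub>H\<^esub>)) id (comult h)"
    if h: "h \<in> carrier H" for h
    by (rule tensor_map_cong[OF pHH pQH qact_hom_right[OF one] module_hom_id _ _ comult_closed[OF h]])
      (simp_all only: qact_proj_one)
  show ?thesis
    unfolding cotensor_right_def qspread_pure[OF a u one]
    by (rule tensor_map_compose[OF pAH pAH pA_QH left_mult_hom[OF algA u] module_hom_id module_hom_id qcomult_mhom _ _ y])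
      (simp_all only: id_apply eq)
qed

text \<open>
  \<open>q \<otimes> h \<mapsto> q S(h\<^sub>1) \<otimes> h\<^sub>2\<close>
\<close>

definition qantipode :: "('h set, 'h) tens \<Rightarrow> ('h set, 'h) tens"
  where "qantipode x = tensor_lift (add_monoid QH)
    (\<lambda>q. tensor_map R Q H (\<lambda>k. qact (antipode k) q) id) (tensor_map R Q HH id comult x)"

lemma antipode_mhom: "antipode \<in> module_hom R H H"
  using antipode_hom .

lemma qact_antipode_mhom: "q \<in> carrier Q \<Longrightarrow> (\<lambda>k. qact (antipode k) q) \<in> module_hom R H Q"
  by (rule module_hom_compose[OF antipode_mhom qact_hom_right])

lemma qantipode_lift:
  defines "\<Psi> \<equiv> tensor_lift (add_monoid QH) (\<lambda>q. tensor_map R Q H (\<lambda>k. qact (antipode k) q) id)"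
  shows qantipode_lift_hom: "\<Psi> \<in> module_hom R (tensor R Q HH) QH"
    and qantipode_lift_pure: "\<lbrakk>q \<in> carrier Q; t \<in> carrier HH\<rbrakk> \<Longrightarrow>
      \<Psi> (pure_tensor R Q HH q t) = tensor_map R Q H (\<lambda>k. qact (antipode k) q) id t"
proof -
  let ?f = "\<lambda>q. tensor_map R Q H (\<lambda>k. qact (antipode k) q) id"
  have f: "?f q \<in> module_hom R HH QH" if "q \<in> carrier Q" for q
    by (rule tensor_map_module_hom[OF mH mH mQ mH qact_antipode_mhom[OF that] module_hom_id])
  note ab = tensor_pair.T_abelian[OF pQH]
  have lin: "?f (r \<odot>\<^bsub>Q\<^esub> q) t = r \<odot>\<^bsub>QH\<^esub> ?f q t"
    if r: "r \<in> carrier R" and q: "q \<in> carrier Q" and t: "t \<in> carrier HH" for r q t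
  proof (rule tensor_pair.T_hom_eqI[OF pHH ab module_hom_add_hom[OF f[OF module.smult_closed[OF mQ r q]]]
        add_hom_compose[OF module_hom_add_hom[OF f[OF q]] module_hom_add_hom[OF module.smult_module_hom[OF mQH r]]] _ t])
    fix k l assume k: "k \<in> carrier H" and l: "l \<in> carrier H"
    note sk = module_hom_closed[OF antipode_mhom k]
    show "?f (r \<odot>\<^bsub>Q\<^esub> q) (pure_tensor R H H k l) = r \<odot>\<^bsub>QH\<^esub> ?f q (pure_tensor R H H k l)"
      unfolding tensor_map_pure[OF pHH pQH qact_antipode_mhom[OF q] module_hom_id k l]
        tensor_map_pure[OF pHH pQH qact_antipode_mhom[OF module.smult_closed[OF mQ r q]] module_hom_id k l] id_apply
        tensor_smult_pure[OF mQ mH r qact_closed[OF q sk] l] module_hom_smult[OF qact_hom[OF sk] r q] ..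
  qed
  have bal: "balanced R Q HH QH ?f"
  proof (rule balancedI)
    show "?f q \<in> add_hom HH QH" if "q \<in> carrier Q" for q by (rule module_hom_add_hom[OF f[OF that]])
    show "(\<lambda>q. ?f q t) \<in> add_hom Q QH" if t: "t \<in> carrier HH" for t
    proof (rule add_homI)
      fix q q' assume q: "q \<in> carrier Q" and q': "q' \<in> carrier Q"
      note qq = abelian_add_closed[OF I.Q_abelian q q']
      show "?f (q \<oplus>\<^bsub>Q\<^esub> q') t = ?f q t \<oplus>\<^bsub>QH\<^esub> ?f q' t"
        by (rule tensor_map_add_left[OF pHH pQH qact_antipode_mhom[OF q] qact_antipode_mhom[OF q'] module_hom_id
              qact_antipode_mhom[OF qq] _ t])
          (rule add_hom_add[OF module_hom_add_hom[OF qact_hom[OF module_hom_closed[OF antipode_mhom]]] q q'])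
    qed (rule module_hom_closed[OF f t])
    show "?f (r \<odot>\<^bsub>Q\<^esub> q) t = ?f q (r \<odot>\<^bsub>HH\<^esub> t)"
      if "r \<in> carrier R" "q \<in> carrier Q" "t \<in> carrier HH" for r q t
      unfolding lin[OF that] by (rule module_hom_smult[OF f[OF that(2)] that(1,3), symmetric])
  qed
  show "\<Psi> \<in> module_hom R (tensor R Q HH) QH"
    unfolding \<Psi>_def by (rule lift_module_hom[OF mQ mHH mQH bal lin])
  show "\<Psi> (pure_tensor R Q HH q t) = ?f q t" if "q \<in> carrier Q" "t \<in> carrier HH"
    unfolding \<Psi>_def by (rule tensor_pair.lift_pure[OF pQ_HH ab bal that])
qed

lemma qantipode_mhom: "qantipode \<in> module_hom R QH QH"
  unfolding qantipode_def
  by (rule module_hom_compose[OF tensor_map_module_hom[OF mQ mH mQ mHH module_hom_id comult_mhom] qantipode_lift_hom])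

text \<open>
  \<open>q h\<^sub>1 S(h\<^sub>2) \<otimes> h\<^sub>3 = q \<epsilon>(h\<^sub>1) \<otimes> h\<^sub>2 = q \<otimes> h\<close>, after a use of coassociativity.
\<close>

lemma qantipode_twist:
  assumes q: "q \<in> carrier Q" and h: "h \<in> carrier H"
  shows "qantipode (tensor_map R Q H (\<lambda>k. qact k q) id (comult h)) = pure_tensor R Q H q h"
proof -
  let ?\<Psi> = "tensor_lift (add_monoid QH) (\<lambda>q. tensor_map R Q H (\<lambda>k. qact (antipode k) q) id)"
  note \<Psi> = module_hom_add_hom[OF qantipode_lift_hom] and qk = qact_hom_right[OF q]
  note t = comult_closed[OF h]
  (* k (x) s |-> q k S(s_1) (x) s_2 for s in H (x) H *)
  define \<Gamma> where "\<Gamma> x = ?\<Psi> (tensor_map R Q HH (\<lambda>k. qact k q) id x)" for x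
  have \<Gamma>: "\<Gamma> \<in> add_hom (tensor R H HH) QH"
    unfolding \<Gamma>_def by (rule add_hom_compose[OF tensor_map_hom[OF pH_HH pQ_HH qk module_hom_id] \<Psi>])
  have \<Gamma>_pure: "\<Gamma> (pure_tensor R H HH k s) = tensor_map R Q H (\<lambda>l. qact (antipode l) (qact k q)) id s"
    if k: "k \<in> carrier H" and s: "s \<in> carrier HH" for k s
    unfolding \<Gamma>_def tensor_map_pure[OF pH_HH pQ_HH qk module_hom_id k s] id_apply[of s]
    by (rule qantipode_lift_pure[OF qact_closed[OF q k] s])
  let ?as = "tensor_assoc R H H H"
  note as = module_hom_add_hom[OF tensor_assoc_module_hom[OF mH mH mH]]
  note ab = tensor_pair.T_abelian[OF pQH]
  let ?mul = "tensor_lift (add_monoid H) (\<lambda>x y. x \<otimes>\<^bsub>H\<^esub> antipode y)"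
  have balm: "balanced R H H H (\<lambda>x y. x \<otimes>\<^bsub>H\<^esub> antipode y)"
  proof (rule balancedI)
    show "(\<lambda>x. x \<otimes>\<^bsub>H\<^esub> antipode y) \<in> add_hom H H" if "y \<in> carrier H" for y
      by (rule module_hom_add_hom[OF right_mult_hom[OF algH module_hom_closed[OF antipode_mhom that]]])
    show "(\<lambda>y. x \<otimes>\<^bsub>H\<^esub> antipode y) \<in> add_hom H H" if "x \<in> carrier H" for x
      by (rule add_hom_compose[OF module_hom_add_hom[OF antipode_mhom] module_hom_add_hom[OF left_mult_hom[OF algH that]]])
    show "(r \<odot>\<^bsub>H\<^esub> x) \<otimes>\<^bsub>H\<^esub> antipode y = x \<otimes>\<^bsub>H\<^esub> antipode (r \<odot>\<^bsub>H\<^esub> y)"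
      if r: "r \<in> carrier R" and x: "x \<in> carrier H" and y: "y \<in> carrier H" for r x y
      unfolding module_hom_smult[OF antipode_mhom r y] module_hom_smult[OF left_mult_hom[OF algH x] r module_hom_closed[OF antipode_mhom y]]
      by (rule module_hom_smult[OF right_mult_hom[OF algH module_hom_closed[OF antipode_mhom y]] r x])
  qed
  note mul = tensor_pair.lift_hom[OF pHH abH balm] and mul_pure = tensor_pair.lift_pure[OF pHH abH balm]
  have 1: "\<Gamma> (?as (pure_tensor R HH H s l)) = pure_tensor R Q H (qact (?mul s) q) l"
    if s: "s \<in> carrier HH" and l: "l \<in> carrier H" for s l
  proof (rule tensor_pair.T_hom_eqI[OF pHH ab
        add_hom_compose[OF add_hom_compose[OF tensor_pair.pure_hom_left[OF pHH_H l] as] \<Gamma>]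
        add_hom_compose[OF add_hom_compose[OF mul module_hom_add_hom[OF qk]] tensor_pair.pure_hom_left[OF pQH l]] _ s])
    fix x y assume x: "x \<in> carrier H" and y: "y \<in> carrier H"
    note sy = module_hom_closed[OF antipode_mhom y]
    show "\<Gamma> (?as (pure_tensor R HH H (pure_tensor R H H x y) l)) = pure_tensor R Q H (qact (?mul (pure_tensor R H H x y)) q) l"
      unfolding tensor_assoc_pure[OF mH mH mH x y l] \<Gamma>_pure[OF x tensor_pair.pure_closed[OF pHH y l]] mul_pure[OF x y]
        tensor_map_pure[OF pHH pQH qact_antipode_mhom[OF qact_closed[OF q x]] module_hom_id y l] id_apply
        qact_mult[OF q x sy] ..
  qed
  let ?eps = "tensor_lift (add_monoid H) (\<lambda>x y. counit x \<odot>\<^bsub>H\<^esub> y)"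
  have bale: "balanced R H H H (\<lambda>x y. counit x \<odot>\<^bsub>H\<^esub> y)"
  proof (rule balancedI)
    show "(\<lambda>x. counit x \<odot>\<^bsub>H\<^esub> y) \<in> add_hom H H" if "y \<in> carrier H" for y
      by (rule add_hom_compose[OF counit_add_hom left_module.smult_hom_scalar[OF module.left_module[OF mH] that]])
    show "(\<lambda>y. counit x \<odot>\<^bsub>H\<^esub> y) \<in> add_hom H H" if "x \<in> carrier H" for x
      by (rule module_hom_add_hom[OF module.smult_module_hom[OF mH counit_closed[OF that]]])
    show "counit (r \<odot>\<^bsub>H\<^esub> x) \<odot>\<^bsub>H\<^esub> y = counit x \<odot>\<^bsub>H\<^esub> (r \<odot>\<^bsub>H\<^esub> y)"
      if r: "r \<in> carrier R" and x: "x \<in> carrier H" and y: "y \<in> carrier H" for r x y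
      unfolding counit_smult[OF r x] R_comm[OF r counit_closed[OF x]]
      by (rule module.smult_assoc1[OF mH counit_closed[OF x] r y])
  qed
  note eps = tensor_pair.lift_hom[OF pHH abH bale] and eps_pure = tensor_pair.lift_pure[OF pHH abH bale]
  have 2: "\<Gamma> (?as (tensor_map R HH H comult id x)) = pure_tensor R Q H q (?eps x)" if x: "x \<in> carrier HH" for x
  proof (rule tensor_pair.T_hom_eqI[OF pHH ab
        add_hom_compose[OF add_hom_compose[OF tensor_map_hom[OF pHH pHH_H comult_mhom module_hom_id] as] \<Gamma>]
        add_hom_compose[OF eps tensor_pair.pure_hom_right[OF pQH q]] _ x])
    fix k l assume k: "k \<in> carrier H" and l: "l \<in> carrier H"
    show "\<Gamma> (?as (tensor_map R HH H comult id (pure_tensor R H H k l))) = pure_tensor R Q H q (?eps (pure_tensor R H H k l))"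
      unfolding tensor_map_pure[OF pHH pHH_H comult_mhom module_hom_id k l] id_apply 1[OF comult_closed[OF k] l]
        antipode_right[OF k] module_hom_smult[OF qk counit_closed[OF k] oneH] qact_one[OF q] eps_pure[OF k l]
      by (rule tensor_pair.pure_smult[OF pQH counit_closed[OF k] q l])
  qed
  have "tensor_map R Q HH id comult (tensor_map R Q H (\<lambda>k. qact k q) id (comult h))
    = tensor_map R Q HH (\<lambda>k. qact k q) comult (comult h)"
    by (rule tensor_map_compose[OF pHH pQH pQ_HH qk module_hom_id module_hom_id comult_mhom _ _ t]) simp_all
  also have "\<dots> = tensor_map R Q HH (\<lambda>k. qact k q) id (tensor_map R H HH id comult (comult h))"
    by (rule tensor_map_compose[OF pHH pH_HH pQ_HH module_hom_id qk comult_mhom module_hom_id _ _ t, symmetric]) simp_all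
  finally have "qantipode (tensor_map R Q H (\<lambda>k. qact k q) id (comult h)) = \<Gamma> (tensor_map R H HH id comult (comult h))"
    unfolding qantipode_def \<Gamma>_def by metis
  also have "\<dots> = pure_tensor R Q H q (?eps (comult h))"
    unfolding comult_coassoc[OF h, symmetric] by (rule 2[OF t])
  also have "\<dots> = pure_tensor R Q H q h" unfolding counit_left[OF h] ..
  finally show ?thesis .
qed

end

section \<open>The canonical map\<close>

context comodule_algebra
begin

abbreviation coinv where "coinv \<equiv> coinvariants R H A coact"
abbreviation Bring where "Bring \<equiv> A\<lparr>carrier := coinv\<rparr>"
abbreviation rA where "rA \<equiv> right_regular A (carrier A)"
abbreviation lA where "lA \<equiv> left_regular A (carrier A)"
abbreviation AA where "AA \<equiv> tensor Bring rA lA"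
abbreviation can where "can \<equiv> canonical_map R H A coact"

lemma coinv: "b \<in> coinv \<Longrightarrow> b \<in> carrier A" "b \<in> coinv \<Longrightarrow> coact b = pure_tensor R A H b \<one>\<^bsub>H\<^esub>"
  by (auto simp: coinvariants_def)

lemma coinvI: "\<lbrakk>b \<in> carrier A; coact b = pure_tensor R A H b \<one>\<^bsub>H\<^esub>\<rbrakk> \<Longrightarrow> b \<in> coinv"
  by (auto simp: coinvariants_def)

lemma coinv_subring: "subring coinv A"
proof (rule ring.subringI[OF ringA])
  interpret T: tensor_pair R A H by (rule pAH)
  note ab = T.T_abelian and ca = module_hom_add_hom[OF coact_mhom] and pl = T.pure_hom_left[OF oneH]
  show "coinv \<subseteq> carrier A" using coinv(1) by blast
  show "\<one>\<^bsub>A\<^esub> \<in> coinv"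
    using coact_hom by (intro coinvI oneA) (simp add: alg_hom_def ring_hom_def tensor_def Let_def)
  fix b assume b: "b \<in> coinv"
  note b' = coinv[OF b]
  show "\<ominus>\<^bsub>A\<^esub> b \<in> coinv"
    by (rule coinvI[OF abelian_group.a_inv_closed[OF abA b'(1)]])
      (simp only: add_hom_minus[OF abA ab ca b'(1)] add_hom_minus[OF abA ab pl b'(1)] b'(2))
  fix c assume c: "c \<in> coinv"
  note c' = coinv[OF c]
  show "b \<oplus>\<^bsub>A\<^esub> c \<in> coinv"
    by (rule coinvI[OF abelian_add_closed[OF abA b'(1) c'(1)]])
      (simp only: add_hom_add[OF ca b'(1) c'(1)] add_hom_add[OF pl b'(1) c'(1)] b'(2) c'(2))
  show "b \<otimes>\<^bsub>A\<^esub> c \<in> coinv"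
  proof (rule coinvI[OF multA[OF b'(1) c'(1)]])
    have "coact (b \<otimes>\<^bsub>A\<^esub> c) = tensor_map R A H (\<lambda>x. b \<otimes>\<^bsub>A\<^esub> x) (\<lambda>k. \<one>\<^bsub>H\<^esub> \<otimes>\<^bsub>H\<^esub> k) (T.pure c \<one>\<^bsub>H\<^esub>)"
      unfolding coact_mult[OF b'(1) c'(1)] b'(2) c'(2)
      by (rule tensor_mult_pure_left[OF algA algH b'(1) oneH T.pure_closed[OF c'(1) oneH]])
    also have "\<dots> = T.pure (b \<otimes>\<^bsub>A\<^esub> c) (\<one>\<^bsub>H\<^esub> \<otimes>\<^bsub>H\<^esub> \<one>\<^bsub>H\<^esub>)"
      by (rule tensor_map_pure[OF pAH pAH left_mult_hom[OF algA b'(1)] left_mult_hom[OF algH oneH] c'(1) oneH])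
    finally show "coact (b \<otimes>\<^bsub>A\<^esub> c) = T.pure (b \<otimes>\<^bsub>A\<^esub> c) \<one>\<^bsub>H\<^esub>"
      unfolding monoid.l_one[OF monoidH oneH] .
  qed
qed

lemma ringB: "ring Bring"
  by (rule ring.subring_is_ring[OF ringA coinv_subring])

lemma rA_simps: "carrier (right_regular A X) = X" "x \<oplus>\<^bsub>right_regular A X\<^esub> y = x \<oplus>\<^bsub>A\<^esub> y"
  "\<zero>\<^bsub>right_regular A X\<^esub> = \<zero>\<^bsub>A\<^esub>" "b \<odot>\<^bsub>right_regular A X\<^esub> x = x \<otimes>\<^bsub>A\<^esub> b" "add (right_regular A X) = add A"
  by (simp_all add: right_regular_def)

lemma lA_simps: "carrier lA = carrier A" "x \<oplus>\<^bsub>lA\<^esub> y = x \<oplus>\<^bsub>A\<^esub> y"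
  "\<zero>\<^bsub>lA\<^esub> = \<zero>\<^bsub>A\<^esub>" "b \<odot>\<^bsub>lA\<^esub> x = b \<otimes>\<^bsub>A\<^esub> x"
  by (simp_all add: left_regular_def)

lemma Bring_simps: "carrier Bring = coinv" "x \<oplus>\<^bsub>Bring\<^esub> y = x \<oplus>\<^bsub>A\<^esub> y" "x \<otimes>\<^bsub>Bring\<^esub> y = x \<otimes>\<^bsub>A\<^esub> y"
  "\<one>\<^bsub>Bring\<^esub> = \<one>\<^bsub>A\<^esub>"
  by simp_all

lemma rA_right_module: "right_module Bring rA"
proof -
  have "comm_group (add_monoid rA)"
    by (rule comm_group_eqI[OF abelian_group.a_comm_group[OF abA]]) (simp_all add: right_regular_def)
  then have "abelian_group rA"
    by (intro abelian_group.intro abelian_monoid.intro abelian_group_axioms.intro) (auto simp: comm_group_def)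
  then show ?thesis
  proof (intro right_module.intro right_module_axioms.intro ringB)
  qed (simp_all only: rA_simps Bring_simps coinv(1) multA ring.ring_simprules(13,23)[OF ringA]
      monoid.m_assoc[OF monoidA] monoid.r_one[OF monoidA])
qed

end

locale galois_algebra = comodule_algebra_quotient R H comult counit antipode A coact I
  for R :: "('r, 'c) ring_scheme" and H :: "('r, 'h, 'd) module_scheme"
    and comult counit antipode and A :: "('r, 'a, 'e) module_scheme" and coact I +
  assumes ff: "faithfully_flat_left_module Bring lA"
    and galois: "hopf_galois R H A coact"
begin

lemma flat: "flat_left_module Bring lA"
  by (rule faithfully_flat_imp_flat[OF ff])

lemma lA_left_module: "left_module Bring lA"
  using ff by (simp add: faithfully_flat_left_module_def)

definition right_submod :: "'a set \<Rightarrow> bool"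
  where "right_submod X \<longleftrightarrow> subgroup X (add_monoid A) \<and> (\<forall>x\<in>X. \<forall>b\<in>coinv. x \<otimes>\<^bsub>A\<^esub> b \<in> X)"

lemma right_submod_carrier: "right_submod X \<Longrightarrow> x \<in> X \<Longrightarrow> x \<in> carrier A"
  using subgroup.subset[of X "add_monoid A"] by (auto simp: right_submod_def)

lemma right_submod_A: "right_submod (carrier A)"
  using group.subgroup_self[OF abelian_group.a_group[OF abA]] coinv(1) multA
  by (auto simp: right_submod_def)

lemma right_submod_sub: "right_submod X \<Longrightarrow> right_submodule Bring rA X"
  using subgroup_eqI[of "add_monoid rA" "add_monoid A" X]
  by (intro right_submodule.intro right_submodule_axioms.intro rA_right_module)
    (auto simp: right_submod_def rA_simps)

lemma right_submod_module: "right_submod X \<Longrightarrow> right_module Bring (right_regular A X)"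
  using right_submodule.sub_right_module[OF right_submod_sub, of X] by (simp add: right_regular_def)

lemma right_submod_pair: "right_submod X \<Longrightarrow> tensor_pair Bring (right_regular A X) lA"
  by (intro tensor_pair.intro right_submod_module lA_left_module)

lemmas pAA = right_submod_pair[OF right_submod_A]
lemmas abAA = tensor_pair.T_abelian[OF pAA]

lemma right_submod_incl: "right_submod X \<Longrightarrow> id \<in> module_hom Bring (right_regular A X) rA"
  by (intro module_homI add_homI) (simp_all add: rA_simps right_submod_carrier)

lemma carrier_AH_mult: "u \<in> carrier A \<Longrightarrow> y \<in> carrier AH \<Longrightarrow> tensor_map R A H (\<lambda>c. u \<otimes>\<^bsub>A\<^esub> c) id y \<in> carrier AH"
  by (rule add_hom_closed[OF tensor_map_hom[OF pAH pAH left_mult_hom[OF algA] module_hom_id]])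

lemma can_balanced:
  assumes X: "right_submod X"
  shows "balanced Bring (right_regular A X) lA AH (\<lambda>a b. tensor_map R A H (\<lambda>c. a \<otimes>\<^bsub>A\<^esub> c) id (coact b))"
proof (rule balancedI)
  note XA = right_submod_carrier[OF X]
  show "(\<lambda>a. tensor_map R A H (\<lambda>c. a \<otimes>\<^bsub>A\<^esub> c) id (coact b)) \<in> add_hom (right_regular A X) AH" if b: "b \<in> carrier lA" for b
  proof (rule add_homI, unfold rA_simps(1,2))
    have b: "b \<in> carrier A" using b unfolding lA_simps .
    fix u v assume u: "u \<in> X" and v: "v \<in> X"
    note uv = abelian_add_closed[OF abA XA[OF u] XA[OF v]]
    show "tensor_map R A H (\<lambda>c. (u \<oplus>\<^bsub>A\<^esub> v) \<otimes>\<^bsub>A\<^esub> c) id (coact b)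
      = tensor_map R A H (\<lambda>c. u \<otimes>\<^bsub>A\<^esub> c) id (coact b) \<oplus>\<^bsub>AH\<^esub> tensor_map R A H (\<lambda>c. v \<otimes>\<^bsub>A\<^esub> c) id (coact b)"
      by (rule tensor_map_add_left[OF pAH pAH left_mult_hom[OF algA XA[OF u]] left_mult_hom[OF algA XA[OF v]] module_hom_id
            left_mult_hom[OF algA uv] _ coact_closed[OF b]])
        (rule add_hom_add[OF module_hom_add_hom[OF right_mult_hom[OF algA]] XA[OF u] XA[OF v]])
  qed (rule carrier_AH_mult[OF XA coact_closed[OF b[unfolded lA_simps]]])
  show "(\<lambda>b. tensor_map R A H (\<lambda>c. a \<otimes>\<^bsub>A\<^esub> c) id (coact b)) \<in> add_hom lA AH" if aX: "a \<in> carrier (right_regular A X)" for a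
  proof (rule add_homI, unfold lA_simps(1,2))
    note a = aX[unfolded rA_simps]
    note f = tensor_map_hom[OF pAH pAH left_mult_hom[OF algA XA[OF a]] module_hom_id]
    fix b c assume b: "b \<in> carrier A" and c: "c \<in> carrier A"
    show "tensor_map R A H (\<lambda>c. a \<otimes>\<^bsub>A\<^esub> c) id (coact (b \<oplus>\<^bsub>A\<^esub> c))
      = tensor_map R A H (\<lambda>c. a \<otimes>\<^bsub>A\<^esub> c) id (coact b) \<oplus>\<^bsub>AH\<^esub> tensor_map R A H (\<lambda>c. a \<otimes>\<^bsub>A\<^esub> c) id (coact c)"
      unfolding add_hom_add[OF module_hom_add_hom[OF coact_mhom] b c]
      by (rule add_hom_add[OF f coact_closed[OF b] coact_closed[OF c]])
  qed (rule carrier_AH_mult[OF XA[OF aX[unfolded rA_simps]] coact_closed])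
  fix b m n assume "b \<in> carrier Bring" and "m \<in> carrier (right_regular A X)" and "n \<in> carrier lA"
  then have b: "b \<in> coinv" and m: "m \<in> X" and n: "n \<in> carrier A" by (simp_all only: rA_simps lA_simps Bring_simps)
  note b' = coinv[OF b] and m' = XA[OF m]
  show "tensor_map R A H (\<lambda>c. (b \<odot>\<^bsub>right_regular A X\<^esub> m) \<otimes>\<^bsub>A\<^esub> c) id (coact n)
    = tensor_map R A H (\<lambda>c. m \<otimes>\<^bsub>A\<^esub> c) id (coact (b \<odot>\<^bsub>lA\<^esub> n))"
    unfolding rA_simps lA_simps coact_mult[OF b'(1) n] b'(2) tensor_mult_pure_left[OF algA algH b'(1) oneH coact_closed[OF n]]
    by (rule tensor_map_compose[OF pAH pAH pAH left_mult_hom[OF algA b'(1)] left_mult_hom[OF algA m']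
          left_mult_hom[OF algH oneH] module_hom_id _ _ coact_closed[OF n], symmetric])
      (simp_all only: id_apply monoid.m_assoc[OF monoidA m' b'(1)] monoid.l_one[OF monoidH])
qed

lemma can_eq: "can = tensor_lift (add_monoid AH) (\<lambda>a b. tensor_map R A H (\<lambda>c. a \<otimes>\<^bsub>A\<^esub> c) id (coact b))"
  by (simp only: canonical_map_def tensor_lift_group)

lemma can_hom: "right_submod X \<Longrightarrow> can \<in> add_hom (tensor_over_sub A coinv X) AH"
  unfolding can_eq tensor_over_sub_def
  by (rule tensor_pair.lift_hom[OF right_submod_pair tensor_pair.T_abelian[OF pAH] can_balanced])

lemma can_pure:
  assumes X: "right_submod X" and a: "a \<in> X" and b: "b \<in> carrier A"
  shows "can (pure_tensor Bring (right_regular A X) lA a b) = tensor_map R A H (\<lambda>c. a \<otimes>\<^bsub>A\<^esub> c) id (coact b)"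
  unfolding can_eq
  by (rule tensor_pair.lift_pure[OF right_submod_pair[OF X] tensor_pair.T_abelian[OF pAH] can_balanced[OF X]])
    (simp_all only: rA_simps lA_simps a b)

lemma AA_eq: "tensor_over_sub A coinv (carrier A) = AA"
  by (simp add: tensor_over_sub_def)

lemmas can_hom_A = can_hom[OF right_submod_A, unfolded AA_eq]
lemmas can_pure_A = can_pure[OF right_submod_A]

lemma can_incl:
  assumes X: "right_submod X" and z: "z \<in> carrier (tensor_over_sub A coinv X)"
  shows "can (tensor_map Bring rA lA id id z) = can z"
proof -
  note p = right_submod_pair[OF X] and XA = right_submod_carrier[OF X]
  note i = right_submod_incl[OF X]
  show ?thesis
  proof (rule tensor_pair.T_hom_eqI[OF p tensor_pair.T_abelian[OF pAH]
        add_hom_compose[OF tensor_map_hom[OF p pAA i module_hom_id] can_hom_A] can_hom[OF X, unfolded tensor_over_sub_def] _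
        z[unfolded tensor_over_sub_def]])
    fix m n assume m: "m \<in> carrier (right_regular A X)" and n: "n \<in> carrier lA"
    then have m': "m \<in> X" and n': "n \<in> carrier A" by (simp_all add: rA_simps lA_simps)
    show "can (tensor_map Bring rA lA id id (pure_tensor Bring (right_regular A X) lA m n))
      = can (pure_tensor Bring (right_regular A X) lA m n)"
      unfolding tensor_map_pure[OF p pAA i module_hom_id m n] can_pure[OF X m' n']
      using can_pure_A[OF XA[OF m'] n'] by simp
  qed
qed

lemma can_bij: "bij_betw can (carrier AA) (carrier AH)"
  using galois by (simp add: hopf_galois_def AA_eq)

definition caninv :: "('a, 'h) tens \<Rightarrow> ('a, 'a) tens"
  where "caninv = the_inv_into (carrier AA) can"

lemma caninv_can: "z \<in> carrier AA \<Longrightarrow> caninv (can z) = z"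
  unfolding caninv_def by (rule the_inv_into_f_f[OF bij_betw_imp_inj_on[OF can_bij]])

lemma can_caninv: "y \<in> carrier AH \<Longrightarrow> can (caninv y) = y"
  unfolding caninv_def by (rule f_the_inv_into_f_bij_betw[OF can_bij])

lemma caninv_closed: "y \<in> carrier AH \<Longrightarrow> caninv y \<in> carrier AA"
  unfolding caninv_def using the_inv_into_into[OF bij_betw_imp_inj_on[OF can_bij]] can_bij
  by (auto simp: bij_betw_def)

lemma caninv_hom: "caninv \<in> add_hom AH AA"
proof (rule add_homI)
  fix x y assume x: "x \<in> carrier AH" and y: "y \<in> carrier AH"
  note c = caninv_closed[OF x] caninv_closed[OF y]
  have "can (caninv x \<oplus>\<^bsub>AA\<^esub> caninv y) = x \<oplus>\<^bsub>AH\<^esub> y"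
    unfolding add_hom_add[OF can_hom_A c] can_caninv[OF x] can_caninv[OF y] ..
  then show "caninv (x \<oplus>\<^bsub>AH\<^esub> y) = caninv x \<oplus>\<^bsub>AA\<^esub> caninv y"
    using caninv_can[OF abelian_add_closed[OF abAA c]] by simp
qed (rule caninv_closed)

text \<open>
  Scalars of \<open>R\<close> act on \<open>A \<otimes>\<^sub>B A\<close> through the left factor; \<open>can\<close> is linear for this action.
\<close>

lemma caninv_smult:
  assumes r: "r \<in> carrier R" and y: "y \<in> carrier AH"
  shows "caninv (r \<odot>\<^bsub>AH\<^esub> y) = tensor_map Bring rA lA (\<lambda>u. r \<odot>\<^bsub>A\<^esub> u) id (caninv y)"
    and "(\<lambda>u. r \<odot>\<^bsub>A\<^esub> u) \<in> module_hom Bring rA rA"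
proof -
  note rs = module.smult_module_hom[OF mA r]
  show h: "(\<lambda>u. r \<odot>\<^bsub>A\<^esub> u) \<in> module_hom Bring rA rA"
  proof (intro module_homI add_homI, unfold rA_simps Bring_simps(1))
    show "r \<odot>\<^bsub>A\<^esub> (x \<otimes>\<^bsub>A\<^esub> b) = (r \<odot>\<^bsub>A\<^esub> x) \<otimes>\<^bsub>A\<^esub> b" if "b \<in> coinv" "x \<in> carrier A" for b x
      by (rule assoc_algebra.smult_mult_left[OF algA r that(2) coinv(1)[OF that(1)], symmetric])
  qed (rule module_hom_closed[OF rs] add_hom_add[OF module_hom_add_hom[OF rs]], assumption+)+
  note sm = tensor_map_hom[OF pAA pAA h module_hom_id]
  have "can (tensor_map Bring rA lA (\<lambda>u. r \<odot>\<^bsub>A\<^esub> u) id z) = r \<odot>\<^bsub>AH\<^esub> can z" if z: "z \<in> carrier AA" for z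
  proof (rule tensor_pair.T_hom_eqI[OF pAA tensor_pair.T_abelian[OF pAH] add_hom_compose[OF sm can_hom_A]
        add_hom_compose[OF can_hom_A module_hom_add_hom[OF module.smult_module_hom[OF mAH r]]] _ z])
    fix u a assume u: "u \<in> carrier rA" and a: "a \<in> carrier lA"
    then have u': "u \<in> carrier A" and a': "a \<in> carrier A" by (simp_all add: rA_simps lA_simps)
    note ru = module.smult_closed[OF mA r u']
    have "r \<odot>\<^bsub>AH\<^esub> tensor_map R A H (\<lambda>c. u \<otimes>\<^bsub>A\<^esub> c) id (coact a)
      = tensor_map R A H (\<lambda>c. (r \<odot>\<^bsub>A\<^esub> u) \<otimes>\<^bsub>A\<^esub> c) id (coact a)"
      unfolding tensor_smult
      by (rule tensor_map_compose[OF pAH pAH pAH left_mult_hom[OF algA u'] rs module_hom_id module_hom_id _ _ coact_closed[OF a']])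
        (simp_all only: id_apply assoc_algebra.smult_mult_left[OF algA r u'])
    then show "can (tensor_map Bring rA lA (\<lambda>u. r \<odot>\<^bsub>A\<^esub> u) id (pure_tensor Bring rA lA u a)) = r \<odot>\<^bsub>AH\<^esub> can (pure_tensor Bring rA lA u a)"
      unfolding tensor_map_pure[OF pAA pAA h module_hom_id u a] can_pure_A[OF u' a'] id_apply[of a] can_pure_A[OF ru a'] by simp
  qed
  from this[OF caninv_closed[OF y]] show "caninv (r \<odot>\<^bsub>AH\<^esub> y) = tensor_map Bring rA lA (\<lambda>u. r \<odot>\<^bsub>A\<^esub> u) id (caninv y)"
    using caninv_can[OF add_hom_closed[OF sm caninv_closed[OF y]]] can_caninv[OF y] by simp
qed

section \<open>The cotensor product inside the Galois extension\<close>

text \<open>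
  \<open>A \<otimes> Q\<close> as a right \<open>B\<close>-module, through the factor \<open>A\<close>
\<close>

definition rAQ :: "('a, ('a, 'h set) tens) module"
  where "rAQ = \<lparr>carrier = carrier AQ, monoid.mult = undefined, one = undefined,
    ring.zero = \<zero>\<^bsub>AQ\<^esub>, add = add AQ, smult = (\<lambda>b. tensor_map R A Q (\<lambda>v. v \<otimes>\<^bsub>A\<^esub> b) id)\<rparr>"

lemma rAQ_simps: "carrier rAQ = carrier AQ" "x \<oplus>\<^bsub>rAQ\<^esub> y = x \<oplus>\<^bsub>AQ\<^esub> y"
  "b \<odot>\<^bsub>rAQ\<^esub> d = tensor_map R A Q (\<lambda>v. v \<otimes>\<^bsub>A\<^esub> b) id d" "add rAQ = add AQ" "\<zero>\<^bsub>rAQ\<^esub> = \<zero>\<^bsub>AQ\<^esub>"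
  by (simp_all add: rAQ_def)

lemma rAQ_right_module: "right_module Bring rAQ"
proof (rule tensor_right_module[OF pAQ rA_right_module])
  show "(\<lambda>m. s \<odot>\<^bsub>rA\<^esub> m) \<in> module_hom R A A" if "s \<in> carrier Bring" for s
    using right_mult_hom[OF algA, of s] that coinv(1) by (simp add: rA_simps)
qed (simp_all add: rA_simps rAQ_simps)

abbreviation G where "G \<equiv> tensor Bring rAQ lA"

lemma pG: "tensor_pair Bring rAQ lA"
  by (intro tensor_pair.intro rAQ_right_module lA_left_module)

lemmas abG = tensor_pair.T_abelian[OF pG]

lemma insert_mhom:
  assumes q: "q \<in> carrier Q"
  shows "(\<lambda>v. pure_tensor R A Q v q) \<in> module_hom Bring rA rAQ"
proof (intro module_homI add_homI, unfold rA_simps rAQ_simps Bring_simps(1))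
  note h = tensor_pair.pure_hom_left[OF pAQ q]
  show "pure_tensor R A Q v q \<in> carrier AQ" if "v \<in> carrier A" for v by (rule add_hom_closed[OF h that])
  show "pure_tensor R A Q (v \<oplus>\<^bsub>A\<^esub> w) q = pure_tensor R A Q v q \<oplus>\<^bsub>AQ\<^esub> pure_tensor R A Q w q"
    if "v \<in> carrier A" "w \<in> carrier A" for v w by (rule add_hom_add[OF h that])
  show "pure_tensor R A Q (v \<otimes>\<^bsub>A\<^esub> b) q = tensor_map R A Q (\<lambda>v. v \<otimes>\<^bsub>A\<^esub> b) id (pure_tensor R A Q v q)"
    if "b \<in> coinv" "v \<in> carrier A" for b v
    unfolding tensor_map_pure[OF pAQ pAQ right_mult_hom[OF algA coinv(1)[OF that(1)]] module_hom_id that(2) q] id_apply ..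
qed

text \<open>
  \<open>\<delta>(b) = b \<otimes> 1\<close> for \<open>b \<in> B\<close>, so \<open>\<delta>\<^sub>Q(u b) = \<delta>\<^sub>Q(u) (b \<otimes> 1)\<close>.
\<close>

lemma qcoact_B_mhom: "qcoact \<in> module_hom Bring rA rAQ"
proof (intro module_homI add_homI, unfold rA_simps rAQ_simps Bring_simps(1))
  note h = module_hom_add_hom[OF qcoact_mhom]
  show "qcoact v \<in> carrier AQ" if "v \<in> carrier A" for v by (rule add_hom_closed[OF h that])
  show "qcoact (v \<oplus>\<^bsub>A\<^esub> w) = qcoact v \<oplus>\<^bsub>AQ\<^esub> qcoact w"
    if "v \<in> carrier A" "w \<in> carrier A" for v w by (rule add_hom_add[OF h that])
  show "qcoact (v \<otimes>\<^bsub>A\<^esub> b) = tensor_map R A Q (\<lambda>v. v \<otimes>\<^bsub>A\<^esub> b) id (qcoact v)"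
    if "b \<in> coinv" "v \<in> carrier A" for b v
    unfolding qcoact_mult[OF that(2) coinv(1)[OF that(1)]] coinv(2)[OF that(1)]
    by (rule qmult_pure_right[OF qcoact_closed[OF that(2)] coinv(1)[OF that(1)]])
qed

text \<open>
  \<open>u \<otimes> a \<mapsto> (u \<otimes> q) \<otimes> a\<close>
\<close>

definition ins :: "'h set \<Rightarrow> ('a, 'a) tens \<Rightarrow> (('a, 'h set) tens, 'a) tens"
  where "ins q = tensor_map Bring rAQ lA (\<lambda>v. pure_tensor R A Q v q) id"

lemma ins_hom: "q \<in> carrier Q \<Longrightarrow> ins q \<in> add_hom AA G"
  unfolding ins_def by (rule tensor_map_hom[OF pAA pG insert_mhom module_hom_id])

lemma ins_pure: "\<lbrakk>q \<in> carrier Q; u \<in> carrier A; a \<in> carrier A\<rbrakk> \<Longrightarrow>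
    ins q (pure_tensor Bring rA lA u a) = pure_tensor Bring rAQ lA (pure_tensor R A Q u q) a"
  unfolding ins_def using tensor_map_pure[OF pAA pG insert_mhom module_hom_id, of q u a] by (simp add: rA_simps lA_simps)

lemma ins_add:
  assumes "q \<in> carrier Q" "q' \<in> carrier Q" "z \<in> carrier AA"
  shows "ins (q \<oplus>\<^bsub>Q\<^esub> q') z = ins q z \<oplus>\<^bsub>G\<^esub> ins q' z"
  unfolding ins_def
proof (rule tensor_map_add_left[OF pAA pG insert_mhom[OF assms(1)] insert_mhom[OF assms(2)] module_hom_id insert_mhom _ assms(3)])
  show "q \<oplus>\<^bsub>Q\<^esub> q' \<in> carrier Q" by (rule abelian_add_closed[OF I.Q_abelian assms(1,2)])
  show "pure_tensor R A Q m (q \<oplus>\<^bsub>Q\<^esub> q') = pure_tensor R A Q m q \<oplus>\<^bsub>rAQ\<^esub> pure_tensor R A Q m q'" if "m \<in> carrier rA" for m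
    using tensor_pair.pure_add_right[OF pAQ _ assms(1,2), of m] that by (simp add: rA_simps rAQ_simps)
qed

lemma ins_smult:
  assumes r: "r \<in> carrier R" and q: "q \<in> carrier Q" and y: "y \<in> carrier AH"
  shows "ins (r \<odot>\<^bsub>Q\<^esub> q) (caninv y) = ins q (caninv (r \<odot>\<^bsub>AH\<^esub> y))"
  unfolding ins_def caninv_smult(1)[OF r y]
proof (rule tensor_map_compose[OF pAA pAA pG caninv_smult(2)[OF r y] insert_mhom[OF q] module_hom_id module_hom_id _ _ caninv_closed[OF y], symmetric])
  show "pure_tensor R A Q m (r \<odot>\<^bsub>Q\<^esub> q) = pure_tensor R A Q (r \<odot>\<^bsub>A\<^esub> m) q" if "m \<in> carrier rA" for m
    using tensor_pair.pure_smult[OF pAQ r _ q, of m] that by (simp add: rA_simps)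
qed simp

text \<open>
  \<open>q \<otimes> h \<mapsto> \<Sum>\<^sub>i (u\<^sub>i \<otimes> q) \<otimes> a\<^sub>i\<close>, where \<open>can (\<Sum>\<^sub>i u\<^sub>i \<otimes> a\<^sub>i) = x \<otimes> h\<close>
\<close>

definition unfold_at :: "'a \<Rightarrow> ('h set, 'h) tens \<Rightarrow> (('a, 'h set) tens, 'a) tens"
  where "unfold_at x = tensor_lift (add_monoid G) (\<lambda>q h. ins q (caninv (pure_tensor R A H x h)))"

lemma pure_AH: "\<lbrakk>x \<in> carrier A; h \<in> carrier H\<rbrakk> \<Longrightarrow> pure_tensor R A H x h \<in> carrier AH"
  by (rule tensor_pair.pure_closed[OF pAH])

lemma unfold_at_balanced:
  assumes x: "x \<in> carrier A"
  shows "balanced R Q H G (\<lambda>q h. ins q (caninv (pure_tensor R A H x h)))"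
proof (rule balancedI)
  show "(\<lambda>q. ins q (caninv (pure_tensor R A H x h))) \<in> add_hom Q G" if h: "h \<in> carrier H" for h
    by (rule add_homI) (simp_all only: add_hom_closed[OF ins_hom] caninv_closed pure_AH x h ins_add)
  show "(\<lambda>h. ins q (caninv (pure_tensor R A H x h))) \<in> add_hom H G" if q: "q \<in> carrier Q" for q
    by (rule add_hom_compose[OF add_hom_compose[OF tensor_pair.pure_hom_right[OF pAH x] caninv_hom] ins_hom[OF q]])
  show "ins (r \<odot>\<^bsub>Q\<^esub> q) (caninv (pure_tensor R A H x h)) = ins q (caninv (pure_tensor R A H x (r \<odot>\<^bsub>H\<^esub> h)))"
    if "r \<in> carrier R" "q \<in> carrier Q" "h \<in> carrier H" for r q h
    unfolding ins_smult[OF that(1,2) pure_AH[OF x that(3)]] tensor_smult_pure[OF mA mH that(1) x that(3)]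
      tensor_pair.pure_smult[OF pAH that(1) x that(3)] ..
qed

lemma unfold_at_hom: "x \<in> carrier A \<Longrightarrow> unfold_at x \<in> add_hom QH G"
  unfolding unfold_at_def by (rule tensor_pair.lift_hom[OF pQH abG unfold_at_balanced])

lemma unfold_at_pure: "\<lbrakk>x \<in> carrier A; q \<in> carrier Q; h \<in> carrier H\<rbrakk> \<Longrightarrow>
    unfold_at x (pure_tensor R Q H q h) = ins q (caninv (pure_tensor R A H x h))"
  unfolding unfold_at_def by (rule tensor_pair.lift_pure[OF pQH abG unfold_at_balanced])

text \<open>
  A left inverse of \<open>d \<otimes> a \<mapsto> qspread a d\<close>: the antipode cancels the middle component of \<open>\<delta>\<close>, and the
  inverse of \<open>can\<close> absorbs the other two.
\<close>

definition unfold_cotensor :: "('a, ('h set, 'h) tens) tens \<Rightarrow> (('a, 'h set) tens, 'a) tens"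
  where "unfold_cotensor y = tensor_lift (add_monoid G) unfold_at (tensor_map R A QH id qantipode y)"

lemma unfold_at_balanced':
  "balanced R A QH G unfold_at"
proof (rule balancedI)
  note T_eq = tensor_pair.T_hom_eqI[OF pQH abG]
  show "unfold_at x \<in> add_hom QH G" if "x \<in> carrier A" for x by (rule unfold_at_hom[OF that])
  show "(\<lambda>x. unfold_at x t) \<in> add_hom A G" if t: "t \<in> carrier QH" for t
  proof (rule add_homI)
    fix x y assume x: "x \<in> carrier A" and y: "y \<in> carrier A"
    note xy = abelian_add_closed[OF abA x y]
    show "unfold_at (x \<oplus>\<^bsub>A\<^esub> y) t = unfold_at x t \<oplus>\<^bsub>G\<^esub> unfold_at y t"
    proof (rule T_eq[OF unfold_at_hom[OF xy] add_hom_plus[OF abG unfold_at_hom[OF x] unfold_at_hom[OF y]] _ t])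
      fix q h assume q: "q \<in> carrier Q" and h: "h \<in> carrier H"
      show "unfold_at (x \<oplus>\<^bsub>A\<^esub> y) (pure_tensor R Q H q h)
        = unfold_at x (pure_tensor R Q H q h) \<oplus>\<^bsub>G\<^esub> unfold_at y (pure_tensor R Q H q h)"
        unfolding unfold_at_pure[OF xy q h] unfold_at_pure[OF x q h] unfold_at_pure[OF y q h]
        by (rule add_hom_add[OF add_hom_compose[OF add_hom_compose[OF tensor_pair.pure_hom_left[OF pAH h] caninv_hom] ins_hom[OF q]] x y])
    qed
  qed (rule add_hom_closed[OF unfold_at_hom t])
  show "unfold_at (r \<odot>\<^bsub>A\<^esub> x) t = unfold_at x (r \<odot>\<^bsub>QH\<^esub> t)"
    if r: "r \<in> carrier R" and x: "x \<in> carrier A" and t: "t \<in> carrier QH" for r x t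
  proof (rule T_eq[OF unfold_at_hom[OF module.smult_closed[OF mA r x]]
        add_hom_compose[OF module_hom_add_hom[OF module.smult_module_hom[OF mQH r]] unfold_at_hom[OF x]] _ t])
    fix q h assume q: "q \<in> carrier Q" and h: "h \<in> carrier H"
    show "unfold_at (r \<odot>\<^bsub>A\<^esub> x) (pure_tensor R Q H q h) = unfold_at x (r \<odot>\<^bsub>QH\<^esub> pure_tensor R Q H q h)"
      unfolding unfold_at_pure[OF module.smult_closed[OF mA r x] q h] tensor_smult_pure[OF mQ mH r q h]
        unfold_at_pure[OF x module.smult_closed[OF mQ r q] h] ins_smult[OF r q pure_AH[OF x h]]
        tensor_smult_pure[OF mA mH r x h] ..
  qed
qed

lemma unfold_cotensor_hom: "unfold_cotensor \<in> add_hom AQH G"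
  unfolding unfold_cotensor_def[abs_def]
  by (rule add_hom_compose[OF tensor_map_hom[OF pA_QH pA_QH module_hom_id qantipode_mhom]
        tensor_pair.lift_hom[OF pA_QH abG unfold_at_balanced']])

text \<open>
  The antipode takes \<open>v a\<^sub>0 \<otimes> q a\<^sub>1 \<otimes> a\<^sub>2\<close> to \<open>v a\<^sub>0 \<otimes> q \<otimes> a\<^sub>1\<close>, that is, to \<open>can(v \<otimes> a)\<close> with \<open>q\<close> inserted.
\<close>

lemma unfold_qspread:
  assumes a: "a \<in> carrier A" and d: "d \<in> carrier AQ"
  shows "unfold_cotensor (qspread a d) = pure_tensor Bring rAQ lA d a"
proof -
  have a': "a \<in> carrier lA" by (simp only: lA_simps a)
  have r: "(\<lambda>d. pure_tensor Bring rAQ lA d a) \<in> add_hom AQ G"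
    using tensor_pair.pure_hom_left[OF pG a'] by (simp add: hom_def rAQ_simps)
  show ?thesis
  proof (rule tensor_pair.T_hom_eqI[OF pAQ abG add_hom_compose[OF qspread_hom[OF a] unfold_cotensor_hom] r _ d])
    fix v q assume v: "v \<in> carrier A" and q: "q \<in> carrier Q"
    let ?p = "\<lambda>h. pure_tensor R Q H q h"
    let ?U = "tensor_lift (add_monoid G) unfold_at"
    note y = coact_closed[OF a] and lv = left_mult_hom[OF algA v]
    note U = tensor_pair.lift_hom[OF pA_QH abG unfold_at_balanced'] and U_pure = tensor_pair.lift_pure[OF pA_QH abG unfold_at_balanced']
    have p: "?p \<in> module_hom R H QH"
    proof (rule module_homI[OF tensor_pair.pure_hom_right[OF pQH q]])
      show "?p (r \<odot>\<^bsub>H\<^esub> h) = r \<odot>\<^bsub>QH\<^esub> ?p h" if "r \<in> carrier R" "h \<in> carrier H" for r h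
        unfolding tensor_smult_pure[OF mQ mH that(1) q that(2)] by (rule tensor_pair.pure_smult[OF pQH that(1) q that(2), symmetric])
    qed
    note tw = module_hom_compose[OF comult_mhom qtwist_mhom[OF q]]
    have 1: "tensor_map R A QH id qantipode (qspread a (pure_tensor R A Q v q)) = tensor_map R A QH (\<lambda>c. v \<otimes>\<^bsub>A\<^esub> c) ?p (coact a)"
      unfolding qspread_pure[OF a v q]
      by (rule tensor_map_compose[OF pAH pA_QH pA_QH lv module_hom_id tw qantipode_mhom _ _ y])
        (simp_all only: id_apply qantipode_twist[OF q])
    have "?U (tensor_map R A QH (\<lambda>c. v \<otimes>\<^bsub>A\<^esub> c) ?p s) = ins q (caninv (tensor_map R A H (\<lambda>c. v \<otimes>\<^bsub>A\<^esub> c) id s))"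
      if s: "s \<in> carrier AH" for s
    proof (rule tensor_pair.T_hom_eqI[OF pAH abG add_hom_compose[OF tensor_map_hom[OF pAH pA_QH lv p] U]
          add_hom_compose[OF add_hom_compose[OF tensor_map_hom[OF pAH pAH lv module_hom_id] caninv_hom] ins_hom[OF q]] _ s])
      fix c h assume c: "c \<in> carrier A" and h: "h \<in> carrier H"
      show "?U (tensor_map R A QH (\<lambda>c. v \<otimes>\<^bsub>A\<^esub> c) ?p (pure_tensor R A H c h))
        = ins q (caninv (tensor_map R A H (\<lambda>c. v \<otimes>\<^bsub>A\<^esub> c) id (pure_tensor R A H c h)))"
        unfolding tensor_map_pure[OF pAH pA_QH lv p c h] tensor_map_pure[OF pAH pAH lv module_hom_id c h] id_apply[of h]
          U_pure[OF multA[OF v c] module_hom_closed[OF p h]] unfold_at_pure[OF multA[OF v c] q h] ..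
    qed
    from this[OF y] have "unfold_cotensor (qspread a (pure_tensor R A Q v q)) = ins q (caninv (can (pure_tensor Bring rA lA v a)))"
      unfolding unfold_cotensor_def 1 can_pure_A[OF v a] .
    also have "\<dots> = ins q (pure_tensor Bring rA lA v a)"
      using caninv_can[OF tensor_pair.pure_closed[OF pAA, of v a]] v a by (simp add: rA_simps lA_simps)
    also have "\<dots> = pure_tensor Bring rAQ lA (pure_tensor R A Q v q) a"
      by (rule ins_pure[OF q v a])
    finally show "unfold_cotensor (qspread a (pure_tensor R A Q v q)) = pure_tensor Bring rAQ lA (pure_tensor R A Q v q) a" .
  qed
qed

lemma unfold_cotensor_left:
  assumes z: "z \<in> carrier AA"
  shows "unfold_cotensor (cotensor_left (can z)) = tensor_map Bring rAQ lA qcoact id z"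
proof (rule tensor_pair.T_hom_eqI[OF pAA abG
      add_hom_compose[OF add_hom_compose[OF can_hom_A cotensor_left_hom] unfold_cotensor_hom]
      tensor_map_hom[OF pAA pG qcoact_B_mhom module_hom_id] _ z])
  fix u a assume ua: "u \<in> carrier rA" "a \<in> carrier lA"
  then have u: "u \<in> carrier A" and a: "a \<in> carrier A" by (simp_all add: rA_simps lA_simps)
  show "unfold_cotensor (cotensor_left (can (pure_tensor Bring rA lA u a))) = tensor_map Bring rAQ lA qcoact id (pure_tensor Bring rA lA u a)"
    unfolding can_pure_A[OF u a] cotensor_left_coact[OF u a] unfold_qspread[OF a qcoact_closed[OF u]]
      tensor_map_pure[OF pAA pG qcoact_B_mhom module_hom_id ua] id_apply ..
qed

lemma unfold_cotensor_right:
  assumes z: "z \<in> carrier AA"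
  shows "unfold_cotensor (cotensor_right (can z)) = ins (proj \<one>\<^bsub>H\<^esub>) z"
proof (rule tensor_pair.T_hom_eqI[OF pAA abG
      add_hom_compose[OF add_hom_compose[OF can_hom_A cotensor_right_hom] unfold_cotensor_hom]
      ins_hom[OF I.proj_closed[OF oneH]] _ z])
  fix u a assume ua: "u \<in> carrier rA" "a \<in> carrier lA"
  then have u: "u \<in> carrier A" and a: "a \<in> carrier A" by (simp_all add: rA_simps lA_simps)
  note one = I.proj_closed[OF oneH]
  show "unfold_cotensor (cotensor_right (can (pure_tensor Bring rA lA u a))) = ins (proj \<one>\<^bsub>H\<^esub>) (pure_tensor Bring rA lA u a)"
    unfolding can_pure_A[OF u a] cotensor_right_coact[OF u a]
      unfold_qspread[OF a tensor_pair.pure_closed[OF pAQ u one]] ins_pure[OF one u a] ..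
qed

lemma galois_phi_qcoact: "u \<in> galois_phi R H A coact I \<longleftrightarrow> u \<in> carrier A \<and> qcoact u = pure_tensor R A Q u (proj \<one>\<^bsub>H\<^esub>)"
  by (auto simp: galois_phi_def qcoact_def)

text \<open>
  By \<open>unfold_cotensor_left\<close> and \<open>unfold_cotensor_right\<close> the equation says that \<open>z\<close> is in the
  kernel of \<open>D \<otimes> A\<close>, where \<open>D u = \<delta>\<^sub>Q(u) - u \<otimes> \<pi>(1)\<close> is \<open>B\<close>-linear with kernel \<open>A\<^bsup>co Q\<^esup>\<close>. Now \<open>A\<close> is
  flat over \<open>B\<close>.
\<close>

lemma cotensor_rep:
  assumes z: "z \<in> carrier AA" and eq: "cotensor_left (can z) = cotensor_right (can z)"
  shows "\<exists>(k :: nat) v y. v \<in> {..<k} \<rightarrow> galois_phi R H A coact I \<and> y \<in> {..<k} \<rightarrow> carrier A \<and>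
    z = (\<Oplus>\<^bsub>AA\<^esub>j\<in>{..<k}. pure_tensor Bring rA lA (v j) (y j))"
proof -
  interpret P: right_module Bring rAQ by (rule rAQ_right_module)
  interpret GG: abelian_group G by (rule abG)
  let ?e = "\<lambda>v. pure_tensor R A Q v (proj \<one>\<^bsub>H\<^esub>)"
  define D where "D u = qcoact u \<ominus>\<^bsub>rAQ\<^esub> ?e u" for u
  note e = insert_mhom[OF I.proj_closed[OF oneH]] and c = qcoact_B_mhom
  note ec = module_hom_closed[OF e] and cc = module_hom_closed[OF c]
  note eh = module_hom_add_hom[OF e] and ch = module_hom_add_hom[OF c]
  have D: "D \<in> module_hom Bring rA rAQ"
  proof (intro module_homI add_homI)
    fix u assume u: "u \<in> carrier rA"
    show "D u \<in> carrier rAQ" unfolding D_def by (rule P.M.minus_closed[OF cc[OF u] ec[OF u]])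
    show "D (u \<oplus>\<^bsub>rA\<^esub> v) = D u \<oplus>\<^bsub>rAQ\<^esub> D v" if v: "v \<in> carrier rA" for v
      unfolding D_def a_minus_def add_hom_add[OF eh u v] add_hom_add[OF ch u v]
      using cc[OF u] cc[OF v] ec[OF u] ec[OF v] by (simp add: P.M.minus_add P.M.a_ac)
    show "D (b \<odot>\<^bsub>rA\<^esub> u) = b \<odot>\<^bsub>rAQ\<^esub> D u" if b: "b \<in> carrier Bring" for b
      unfolding D_def module_hom_smult[OF e b u] module_hom_smult[OF c b u]
      by (rule add_hom_diff[OF P.M.abelian_group_axioms P.M.abelian_group_axioms P.smult_hom[OF b] cc[OF u] ec[OF u], symmetric])
  qed
  have D0: "D u = \<zero>\<^bsub>rAQ\<^esub> \<longleftrightarrow> qcoact u = ?e u" if u: "u \<in> carrier rA" for u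
    unfolding D_def by (rule P.M.diff_zero_iff[OF cc[OF u] ec[OF u]])
  have "tensor_map Bring rAQ lA qcoact id z = tensor_map Bring rAQ lA D id z \<oplus>\<^bsub>G\<^esub> tensor_map Bring rAQ lA ?e id z"
    by (rule tensor_map_add_left[OF pAA pG D e module_hom_id c _ z])
      (unfold D_def, rule P.M.diff_add_cancel[symmetric], rule cc, assumption, rule ec, assumption)
  moreover have "tensor_map Bring rAQ lA qcoact id z = tensor_map Bring rAQ lA ?e id z"
    using unfold_cotensor_left[OF z] unfold_cotensor_right[OF z] eq by (simp add: ins_def)
  ultimately have "tensor_map Bring rAQ lA D id z \<oplus>\<^bsub>G\<^esub> tensor_map Bring rAQ lA ?e id z = tensor_map Bring rAQ lA ?e id z"
    by (rule trans[OF sym])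
  then have "tensor_map Bring rAQ lA D id z = \<zero>\<^bsub>G\<^esub>"
    using GG.add.r_cancel_one[OF add_hom_closed[OF tensor_map_hom[OF pAA pG e module_hom_id] z]]
      add_hom_closed[OF tensor_map_hom[OF pAA pG D module_hom_id] z] by blast
  from flat_kernel_rep[OF flat rA_right_module rAQ_right_module D z this]
  obtain k :: nat and v y where v: "v \<in> {..<k} \<rightarrow> {m \<in> carrier rA. D m = \<zero>\<^bsub>rAQ\<^esub>}" and y: "y \<in> {..<k} \<rightarrow> carrier lA"
    and z_eq: "z = (\<Oplus>\<^bsub>AA\<^esub>j\<in>{..<k}. pure_tensor Bring rA lA (v j) (y j))" by blast
  have "v \<in> {..<k} \<rightarrow> galois_phi R H A coact I"
  proof (rule funcsetI)
    fix j assume "j \<in> {..<k}"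
    then have j: "v j \<in> carrier rA" "D (v j) = \<zero>\<^bsub>rAQ\<^esub>" using funcset_mem[OF v] by blast+
    then show "v j \<in> galois_phi R H A coact I"
      using D0[OF j(1)] unfolding galois_phi_qcoact rA_simps by blast
  qed
  then show ?thesis using y z_eq by (auto simp: lA_simps)
qed

end

context galois_algebra
begin

lemma can_phi_cotensor:
  assumes u: "u \<in> galois_phi R H A coact I" and a: "a \<in> carrier A"
  shows "cotensor_left (can (pure_tensor Bring rA lA u a)) = cotensor_right (can (pure_tensor Bring rA lA u a))"
proof -
  have u': "u \<in> carrier A" "qcoact u = pure_tensor R A Q u (proj \<one>\<^bsub>H\<^esub>)" using u galois_phi_qcoact by blast+
  show ?thesis
    unfolding can_pure_A[OF u'(1) a] cotensor_left_coact[OF u'(1) a] cotensor_right_coact[OF u'(1) a] u'(2) ..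
qed

section \<open>Closed subalgebras\<close>

text \<open>
  The element \<open>t \<otimes> 1\<close> vanishes in \<open>A / S \<otimes>\<^sub>B A\<close>. By the equational criterion \<open>1 = \<Sum>\<^sub>j c\<^sub>j y\<^sub>j\<close> with
  \<open>t c\<^sub>j\<close> zero in \<open>A / S\<close>.
\<close>

lemma right_ideal_generating_one:
  assumes S: "right_submod S" and t: "t \<in> carrier A"
    and w: "w \<in> carrier (tensor_over_sub A coinv S)"
    and eq: "tensor_map Bring rA lA id id w = pure_tensor Bring rA lA t \<one>\<^bsub>A\<^esub>"
  shows "\<exists>(k :: nat) c y. c \<in> {..<k} \<rightarrow> {b \<in> coinv. t \<otimes>\<^bsub>A\<^esub> b \<in> S} \<and> y \<in> {..<k} \<rightarrow> carrier A \<and>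
    \<one>\<^bsub>A\<^esub> = (\<Oplus>\<^bsub>lA\<^esub>j\<in>{..<k}. c j \<otimes>\<^bsub>A\<^esub> y j)"
proof -
  interpret S: right_submodule Bring rA S by (rule right_submod_sub[OF S])
  note M = S.Q_right_module and pS = right_submod_pair[OF S] and inc = right_submod_incl[OF S]
  have pM: "tensor_pair Bring S.Q lA" by (intro tensor_pair.intro M lA_left_module)
  interpret M: right_module Bring S.Q by (rule M)
  interpret MA: tensor_pair Bring S.Q lA by (rule pM)
  interpret MAg: abelian_group MA.T by (rule MA.T_abelian)
  have t': "t \<in> carrier rA" and one: "\<one>\<^bsub>A\<^esub> \<in> carrier lA" by (simp_all only: rA_simps lA_simps t oneA)
  note f = tensor_map_hom[OF pAA pM S.proj_hom module_hom_id]
  have "tensor_map Bring S.Q lA S.proj id (tensor_map Bring rA lA id id w) = \<zero>\<^bsub>MA.T\<^esub>"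
  proof (rule tensor_pair.T_hom_eqI[OF pS MA.T_abelian add_hom_compose[OF tensor_map_hom[OF pS pAA inc module_hom_id] f] _ _
        w[unfolded tensor_over_sub_def]])
    show "(\<lambda>_. \<zero>\<^bsub>MA.T\<^esub>) \<in> add_hom (tensor Bring (right_regular A S) lA) MA.T" by (rule add_homI) auto
    fix s a assume s: "s \<in> carrier (right_regular A S)" and a: "a \<in> carrier lA"
    then have s': "s \<in> S" "s \<in> carrier rA" using right_submod_carrier[OF S] by (simp_all add: rA_simps)
    have "S.proj s = \<zero>\<^bsub>S.Q\<^esub>" using S.proj_zero_iff[OF s'(2)] s'(1) by blast
    then show "tensor_map Bring S.Q lA S.proj id (tensor_map Bring rA lA id id (pure_tensor Bring (right_regular A S) lA s a)) = \<zero>\<^bsub>MA.T\<^esub>"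
      unfolding tensor_map_pure[OF pS pAA inc module_hom_id s a] id_apply[of s] id_apply[of a]
        tensor_map_pure[OF pAA pM S.proj_hom module_hom_id s'(2) a]
      using MA.pure_zero_left[OF a] by simp
  qed
  then have pt0: "MA.pure (S.proj t) \<one>\<^bsub>A\<^esub> = \<zero>\<^bsub>MA.T\<^esub>"
    unfolding eq tensor_map_pure[OF pAA pM S.proj_hom module_hom_id t' one] id_apply .
  note pt = S.proj_closed[OF t']
  (* The equational criterion is applied to a sum with one term, indexed by the element of the unit type. *)
  have sum0: "(\<Oplus>\<^bsub>MA.T\<^esub>i\<in>{()}. MA.pure (S.proj t) \<one>\<^bsub>A\<^esub>) = \<zero>\<^bsub>MA.T\<^esub>"
    using pt0 by (simp add: MAg.finsum_insert)
  have "\<exists>(k :: nat) y c. y \<in> {..<k} \<rightarrow> carrier lA \<and> (\<forall>i\<in>{()}. \<forall>j<k. c i j \<in> carrier Bring) \<and>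
      (\<forall>i\<in>{()}. \<one>\<^bsub>A\<^esub> = (\<Oplus>\<^bsub>lA\<^esub>j\<in>{..<k}. c i j \<odot>\<^bsub>lA\<^esub> y j)) \<and>
      (\<forall>j<k. (\<Oplus>\<^bsub>S.Q\<^esub>i\<in>{()}. c i j \<odot>\<^bsub>S.Q\<^esub> S.proj t) = \<zero>\<^bsub>S.Q\<^esub>)"
    by (rule flat_vanishing[OF flat M _ _ _ sum0]) (use pt one in auto)
  then obtain k :: nat and y c where y: "y \<in> {..<k} \<rightarrow> carrier lA" and c: "\<forall>j<k. c () j \<in> carrier Bring"
    and sum1: "\<one>\<^bsub>A\<^esub> = (\<Oplus>\<^bsub>lA\<^esub>j\<in>{..<k}. c () j \<odot>\<^bsub>lA\<^esub> y j)"
    and z: "\<forall>j<k. (\<Oplus>\<^bsub>S.Q\<^esub>i\<in>{()}. c i j \<odot>\<^bsub>S.Q\<^esub> S.proj t) = \<zero>\<^bsub>S.Q\<^esub>" by auto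
  have "c () \<in> {..<k} \<rightarrow> {b \<in> coinv. t \<otimes>\<^bsub>A\<^esub> b \<in> S}"
  proof (rule funcsetI)
    fix j assume "j \<in> {..<k}"
    then have j: "j < k" by simp
    have cj: "c () j \<in> carrier Bring" using c j by blast
    have ct: "c () j \<odot>\<^bsub>S.Q\<^esub> S.proj t \<in> carrier S.Q" by (rule M.smult_closed[OF cj pt])
    have "c () j \<odot>\<^bsub>S.Q\<^esub> S.proj t = \<zero>\<^bsub>S.Q\<^esub>"
    proof -
      have "(\<Oplus>\<^bsub>S.Q\<^esub>i\<in>{()}. c i j \<odot>\<^bsub>S.Q\<^esub> S.proj t)
        = c () j \<odot>\<^bsub>S.Q\<^esub> S.proj t \<oplus>\<^bsub>S.Q\<^esub> (\<Oplus>\<^bsub>S.Q\<^esub>i\<in>{}. c i j \<odot>\<^bsub>S.Q\<^esub> S.proj t)"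
        by (rule M.finsum_insert) (use ct in auto)
      also have "\<dots> = c () j \<odot>\<^bsub>S.Q\<^esub> S.proj t"
        unfolding M.finsum_empty by (rule M.r_zero[OF ct])
      finally show ?thesis using z j by simp
    qed
    then have "S.proj (c () j \<odot>\<^bsub>rA\<^esub> t) = \<zero>\<^bsub>S.Q\<^esub>" unfolding S.smult_Q[OF cj t'] .
    then have "c () j \<odot>\<^bsub>rA\<^esub> t \<in> S"
      using S.proj_zero_iff right_module.smult_closed[OF rA_right_module cj t'] by blast
    then show "c () j \<in> {b \<in> coinv. t \<otimes>\<^bsub>A\<^esub> b \<in> S}"
      using cj unfolding rA_simps Bring_simps by blast
  qed
  then show ?thesis using y sum1 unfolding lA_simps by blast
qed

text \<open>
  The right ideal \<open>J = {b \<in> B. t b \<in> S}\<close> satisfies \<open>J A = A\<close> by \<open>right_ideal_generating_one\<close>, so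
  \<open>1 \<in> J\<close> by faithful flatness.
\<close>

lemma mem_if_tensor_one_in_image:
  assumes S: "right_submod S" and t: "t \<in> carrier A"
    and w: "w \<in> carrier (tensor_over_sub A coinv S)"
    and eq: "tensor_map Bring rA lA id id w = pure_tensor Bring rA lA t \<one>\<^bsub>A\<^esub>"
  shows "t \<in> S"
proof -
  let ?J = "{b \<in> coinv. t \<otimes>\<^bsub>A\<^esub> b \<in> S}"
  note rmA = monoid.m_assoc[OF monoidA]
  have Ssub: "subgroup S (add_monoid A)" and Sr: "\<And>x b. \<lbrakk>x \<in> S; b \<in> coinv\<rbrakk> \<Longrightarrow> x \<otimes>\<^bsub>A\<^esub> b \<in> S"
    using S by (auto simp: right_submod_def)
  note lt = module_hom_add_hom[OF left_mult_hom[OF algA t]]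
  interpret lAm: left_module Bring lA by (rule lA_left_module)
  have Jsub: "subgroup ?J (add_monoid A)"
  proof (rule group.subgroupI[OF abelian_group.a_group[OF abA]])
    note Bsub = subring.axioms(1)[OF coinv_subring]
    show "?J \<subseteq> carrier (add_monoid A)" using coinv(1) by auto
    have "t \<otimes>\<^bsub>A\<^esub> \<zero>\<^bsub>A\<^esub> = \<zero>\<^bsub>A\<^esub>" by (rule add_hom_zero[OF abA abA lt])
    then show "?J \<noteq> {}" using subgroup.one_closed[OF Ssub] subgroup.one_closed[OF Bsub] by force
    fix b assume b: "b \<in> ?J"
    have "t \<otimes>\<^bsub>A\<^esub> (\<ominus>\<^bsub>A\<^esub> b) = \<ominus>\<^bsub>A\<^esub> (t \<otimes>\<^bsub>A\<^esub> b)"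
      by (rule add_hom_minus[OF abA abA lt]) (use b coinv(1) in blast)
    then show "inv\<^bsub>add_monoid A\<^esub> b \<in> ?J"
      using subgroup.m_inv_closed[OF Ssub, of "t \<otimes>\<^bsub>A\<^esub> b"] subgroup.m_inv_closed[OF Bsub, of b] b
      unfolding a_inv_def by simp
    fix c assume c: "c \<in> ?J"
    have "t \<otimes>\<^bsub>A\<^esub> (b \<oplus>\<^bsub>A\<^esub> c) = t \<otimes>\<^bsub>A\<^esub> b \<oplus>\<^bsub>A\<^esub> t \<otimes>\<^bsub>A\<^esub> c"
      by (rule add_hom_add[OF lt]) (use b c coinv(1) in blast)+
    then show "b \<otimes>\<^bsub>add_monoid A\<^esub> c \<in> ?J"
      using subgroup.m_closed[OF Ssub, of "t \<otimes>\<^bsub>A\<^esub> b" "t \<otimes>\<^bsub>A\<^esub> c"] subgroup.m_closed[OF Bsub, of b c] b c by simp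
  qed
  obtain k :: nat and c y where c: "c \<in> {..<k} \<rightarrow> ?J" and y: "y \<in> {..<k} \<rightarrow> carrier A"
    and one: "\<one>\<^bsub>A\<^esub> = (\<Oplus>\<^bsub>lA\<^esub>j\<in>{..<k}. c j \<otimes>\<^bsub>A\<^esub> y j)"
    using right_ideal_generating_one[OF S t w eq] by blast
  have cA: "c j \<in> carrier A" if "j < k" for j using c that coinv(1) by (auto simp: Pi_iff)
  have "\<one>\<^bsub>Bring\<^esub> \<in> ?J"
  proof (rule faithfully_flat_right_ideal[OF ff])
    show "subgroup ?J (add_monoid Bring)"
    proof -
      have "subgroup ?J (add_monoid A\<lparr>carrier := coinv\<rparr>)"
        by (rule group.subgroup_incl[OF abelian_group.a_group[OF abA] Jsub subring.axioms(1)[OF coinv_subring]]) blast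
      then show ?thesis
        by (subst subgroup_eqI[of _ "add_monoid A\<lparr>carrier := coinv\<rparr>"]) simp_all
    qed
    fix x b assume x: "x \<in> ?J" and b: "b \<in> carrier Bring"
    then have b': "b \<in> coinv" by simp
    have "x \<otimes>\<^bsub>A\<^esub> b \<in> coinv" using subringE(6)[OF coinv_subring] x b' by blast
    moreover have "t \<otimes>\<^bsub>A\<^esub> (x \<otimes>\<^bsub>A\<^esub> b) \<in> S"
      using Sr[of "t \<otimes>\<^bsub>A\<^esub> x" b] rmA[OF t, of x b] coinv(1) x b' by auto
    ultimately show "x \<otimes>\<^bsub>Bring\<^esub> b \<in> ?J" by simp
  next
    fix n assume "n \<in> carrier lA"
    then have n: "n \<in> carrier A" by (simp only: lA_simps)
    have r: "(\<lambda>x. x \<otimes>\<^bsub>A\<^esub> n) \<in> add_hom lA lA"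
      using module_hom_add_hom[OF right_mult_hom[OF algA n]] by (simp add: hom_def lA_simps)
    have cy: "(\<lambda>j. c j \<otimes>\<^bsub>A\<^esub> y j) \<in> {..<k} \<rightarrow> carrier lA"
      using cA y multA by (auto simp: lA_simps Pi_iff)
    have "n = \<one>\<^bsub>A\<^esub> \<otimes>\<^bsub>A\<^esub> n" by (rule monoid.l_one[OF monoidA n, symmetric])
    also have "\<dots> = (\<Oplus>\<^bsub>lA\<^esub>j\<in>{..<k}. (c j \<otimes>\<^bsub>A\<^esub> y j) \<otimes>\<^bsub>A\<^esub> n)"
      unfolding one by (rule add_hom_finsum[OF lAm.M.abelian_group_axioms lAm.M.abelian_group_axioms r cy])
    also have "\<dots> = (\<Oplus>\<^bsub>lA\<^esub>j\<in>{..<k}. c j \<odot>\<^bsub>lA\<^esub> (y j \<otimes>\<^bsub>A\<^esub> n))"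
    proof (rule lAm.finsum_cong'[OF refl])
      show "(\<lambda>j. c j \<odot>\<^bsub>lA\<^esub> (y j \<otimes>\<^bsub>A\<^esub> n)) \<in> {..<k} \<rightarrow> carrier lA"
        using cA y n multA by (auto simp: lA_simps Pi_iff)
    qed (use cA y n in \<open>auto simp: lA_simps Pi_iff intro!: rmA\<close>)
    finally show "\<exists>(k :: nat) c y. c \<in> {..<k} \<rightarrow> ?J \<and> y \<in> {..<k} \<rightarrow> carrier lA \<and> n = (\<Oplus>\<^bsub>lA\<^esub>j\<in>{..<k}. c j \<odot>\<^bsub>lA\<^esub> y j)"
      using c y n multA by (intro exI[of _ k] exI[of _ c] exI[of _ "\<lambda>j. y j \<otimes>\<^bsub>A\<^esub> n"]) (auto simp: lA_simps Pi_iff)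
  qed
  then have "t \<otimes>\<^bsub>A\<^esub> \<one>\<^bsub>A\<^esub> \<in> S" by simp
  then show ?thesis using monoid.r_one[OF monoidA t] by simp
qed

text \<open>
  The map \<open>can\<close> is bijective on \<open>A \<otimes>\<^sub>B A\<close>, into which \<open>S \<otimes>\<^sub>B A\<close> embeds, and it sends \<open>S \<otimes>\<^sub>B A\<close> into
  \<open>A \<box>\<^sub>Q H\<close>. So the question is whether it is onto. If \<open>S = A\<^bsup>co Q\<^esup>\<close>, this is \<open>cotensor_rep\<close>. Conversely,
  for \<open>t \<in> A\<^bsup>co Q\<^esup>\<close> the element \<open>can(t \<otimes> 1)\<close> of \<open>A \<box>\<^sub>Q H\<close> has a preimage in \<open>S \<otimes>\<^sub>B A\<close>.
\<close>

lemma galois_phi_eq_iff_iso: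
  assumes S: "right_submod S" and le: "S \<subseteq> galois_phi R H A coact I"
  shows "galois_phi R H A coact I = S \<longleftrightarrow>
    can \<in> iso (add_monoid (tensor_over_sub A coinv S)) (add_monoid (cotensor R H comult A coact I))"
proof -
  note pS = right_submod_pair[OF S] and SA = right_submod_carrier[OF S] and inc = right_submod_incl[OF S]
  let ?SA = "tensor_over_sub A coinv S" and ?C = "cotensor R H comult A coact I"
  let ?i = "tensor_map Bring rA lA id id"
  have i_hom: "?i \<in> add_hom ?SA AA"
    unfolding tensor_over_sub_def by (rule tensor_map_hom[OF pS pAA inc module_hom_id])
  have inj: "inj_on can (carrier ?SA)"
  proof (rule inj_onI)
    fix x y assume x: "x \<in> carrier ?SA" and y: "y \<in> carrier ?SA" and eq: "can x = can y"
    have "can (?i x) = can (?i y)" unfolding can_incl[OF S x] can_incl[OF S y] by (rule eq)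
    then have i: "?i x = ?i y"
      by (rule inj_onD[OF bij_betw_imp_inj_on[OF can_bij] _ add_hom_closed[OF i_hom x] add_hom_closed[OF i_hom y]])
    have "inj_on ?i (carrier ?SA)"
      unfolding tensor_over_sub_def
      by (rule flat_tensor_inj[OF flat right_submod_module[OF S] rA_right_module inc]) simp
    from inj_onD[OF this i x y] show "x = y" .
  qed
  have into: "can x \<in> carrier ?C" if x: "x \<in> carrier ?SA" for x
  proof -
    have "cotensor_left (can x) = cotensor_right (can x)"
    proof (rule tensor_pair.T_hom_eqI[OF pS tensor_pair.T_abelian[OF pA_QH]
          add_hom_compose[OF can_hom[OF S, unfolded tensor_over_sub_def] cotensor_left_hom]
          add_hom_compose[OF can_hom[OF S, unfolded tensor_over_sub_def] cotensor_right_hom] _ x[unfolded tensor_over_sub_def]])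
      fix s a assume "s \<in> carrier (right_regular A S)" "a \<in> carrier lA"
      then have s: "s \<in> S" and a: "a \<in> carrier A" by (simp_all add: rA_simps lA_simps)
      show "cotensor_left (can (pure_tensor Bring (right_regular A S) lA s a))
        = cotensor_right (can (pure_tensor Bring (right_regular A S) lA s a))"
        using can_phi_cotensor[OF subsetD[OF le s] a] unfolding can_pure[OF S s a] can_pure_A[OF SA[OF s] a] .
    qed
    then show ?thesis using add_hom_closed[OF can_hom[OF S] x] unfolding carrier_cotensor by blast
  qed
  have hom: "can \<in> add_hom ?SA ?C"
  proof (rule add_homI)
    fix x y assume "x \<in> carrier ?SA" "y \<in> carrier ?SA"
    then show "can (x \<oplus>\<^bsub>?SA\<^esub> y) = can x \<oplus>\<^bsub>?C\<^esub> can y"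
      using add_hom_add[OF can_hom[OF S]] by (simp add: cotensor_def Let_def)
  qed (rule into)
  have iso: "can \<in> iso (add_monoid ?SA) (add_monoid ?C) \<longleftrightarrow> carrier ?C \<subseteq> can ` carrier ?SA"
    using hom inj into by (auto simp: iso_def bij_betw_def)
  show ?thesis
    unfolding iso
  proof
    assume eq: "galois_phi R H A coact I = S"
    show "carrier ?C \<subseteq> can ` carrier ?SA"
    proof
      fix y assume "y \<in> carrier ?C"
      then have y: "y \<in> carrier AH" "cotensor_left y = cotensor_right y" unfolding carrier_cotensor by blast+
      have "cotensor_left (can (caninv y)) = cotensor_right (can (caninv y))" unfolding can_caninv[OF y(1)] by (rule y(2))
      from cotensor_rep[OF caninv_closed[OF y(1)] this]
      obtain k :: nat and v a where v: "v \<in> {..<k} \<rightarrow> S" and a: "a \<in> {..<k} \<rightarrow> carrier A"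
        and z: "caninv y = (\<Oplus>\<^bsub>AA\<^esub>j\<in>{..<k}. pure_tensor Bring rA lA (v j) (a j))"
        unfolding eq by blast
      have v': "v \<in> {..<k} \<rightarrow> carrier (right_regular A S)" and a': "a \<in> {..<k} \<rightarrow> carrier lA"
        using v a by (simp_all only: rA_simps lA_simps)
      define w where "w = (\<Oplus>\<^bsub>tensor Bring (right_regular A S) lA\<^esub>j\<in>{..<k}. pure_tensor Bring (right_regular A S) lA (v j) (a j))"
      have w: "w \<in> carrier ?SA"
        unfolding w_def tensor_over_sub_def
      proof (rule abelian_monoid.finsum_closed[OF abelian_group.axioms(1)[OF tensor_pair.T_abelian[OF pS]]])
        show "(\<lambda>j. pure_tensor Bring (right_regular A S) lA (v j) (a j)) \<in> {..<k} \<rightarrow> carrier (tensor Bring (right_regular A S) lA)"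
          by (intro funcsetI tensor_pair.pure_closed[OF pS] funcset_mem[OF v'] funcset_mem[OF a'])
      qed
      have "?i w = caninv y"
        unfolding w_def z using tensor_map_finsum[OF pS pAA inc module_hom_id v' a'] by (simp only: id_apply)
      then have "can w = y" using can_incl[OF S w] can_caninv[OF y(1)] by simp
      then show "y \<in> can ` carrier ?SA" using w by blast
    qed
  next
    assume surj: "carrier ?C \<subseteq> can ` carrier ?SA"
    have "t \<in> S" if t: "t \<in> galois_phi R H A coact I" for t
    proof -
      have tA: "t \<in> carrier A" using t galois_phi_qcoact by blast
      let ?p = "pure_tensor Bring rA lA t \<one>\<^bsub>A\<^esub>"
      have p: "?p \<in> carrier AA"
        by (rule tensor_pair.pure_closed[OF pAA]) (simp_all only: rA_simps lA_simps tA oneA)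
      have "can ?p \<in> carrier ?C"
        using add_hom_closed[OF can_hom_A p] can_phi_cotensor[OF t oneA] unfolding carrier_cotensor by blast
      then obtain w where w: "w \<in> carrier ?SA" "can ?p = can w" using surj by blast
      then have "can (?i w) = can ?p" using can_incl[OF S w(1)] by simp
      then have "?i w = ?p"
        by (rule inj_onD[OF bij_betw_imp_inj_on[OF can_bij] _ add_hom_closed[OF i_hom w(1)] p])
      from mem_if_tensor_one_in_image[OF S tA w(1) this] show "t \<in> S" .
    qed
    then show "galois_phi R H A coact I = S" using le by blast
  qed
qed

end

theorem theorem4p3p1:
  fixes R :: "'r ring" and H :: "('r, 'h) module" and A :: "('r, 'a) module"
    and comult :: "'h \<Rightarrow> ('h, 'h) tens" and counit :: "'h \<Rightarrow> 'r" and antipode :: "'h \<Rightarrow> 'h"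
    and coact :: "'a \<Rightarrow> ('a, 'h) tens" and B S :: "'a set"
  assumes "hopf_algebra R H comult counit antipode"
    and "comodule_algebra R H comult counit antipode A coact"
    and "B = coinvariants R H A coact"
    and "hopf_galois R H A coact"
    and "flat_left_module R A" and "mittag_leffler R A"
    and "flat_left_module R H" and "mittag_leffler R H"
    and "faithfully_flat_left_module (A\<lparr>carrier := B\<rparr>) (left_regular A (carrier A))"
    and "S \<in> Sub_Alg R A B"
  shows "galois_closed R H comult counit A coact S \<longleftrightarrow>
    canonical_map R H A coact \<in>
      iso (add_monoid (tensor_over_sub A B S))
          (add_monoid (cotensor R H comult A coact (galois_psi R H comult counit A coact S)))"
proof -
  interpret C: comodule_algebra R H comult counit antipode A coact by (rule assms(2))
  let ?I = "galois_psi R H comult counit A coact S"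
  have S: "subring S A" "coinvariants R H A coact \<subseteq> S"
    using assms(10) unfolding Sub_Alg_def assms(3) by blast+
  have SA: "S \<subseteq> carrier A" using subringE(1)[OF S(1)] .
  have I: "right_ideal_coideal R H comult counit ?I" and le: "S \<subseteq> galois_phi R H A coact ?I"
    using C.galois_psi_eq[OF assms(5,6) SA] by simp_all
  interpret G: galois_algebra R H comult counit antipode A coact ?I
  proof (intro galois_algebra.intro galois_algebra_axioms.intro comodule_algebra_quotient.intro
        comodule_algebra_quotient_axioms.intro assms(2) assms(4) assms(9)[unfolded assms(3)])
    show "submodule ?I R H" using I unfolding right_ideal_coideal_def by (rule conjunct1)
    show "x \<otimes>\<^bsub>H\<^esub> h \<in> ?I" if "x \<in> ?I" "h \<in> carrier H" for x h
      using I that unfolding right_ideal_coideal_def by blast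
  qed
  have "G.right_submod S"
    unfolding G.right_submod_def using subring.axioms(1)[OF S(1)] subringE(6)[OF S(1)] S(2) by blast
  from G.galois_phi_eq_iff_iso[OF this le] show ?thesis
    unfolding galois_closed_def assms(3) .
qed

end
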